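(* Let $s>3/2$, $C_q>0$, $k>0$, $0<\epsilon<\frac{s}{s+3}$, $\hat s:=\frac{s}{s+3}-\epsilon$. In the three-dimensional inverse medium scattering setting of the context, let $\nu$ be the prior measure with compact support $\mathcal Q_{\mathrm{pr}}=\operatorname{supp}\nu\subset\mathcal Q_{\mathrm{ad}}$, $\mu=\Psi_\#\nu$, and assume the uniform analytic bound $\sup_{q\in\mathcal Q_{\mathrm{pr}}}\|\Psi(q)\|_{\mathcal X}\le M_{\mathcal X}^{\mathrm{pr}}<\infty$. Fix $L,n\in\mathbb N$ and set $r_p:=\dim_{\mathbb C}\mathbb P_n(B_1)$, $m:=m_L$, $p:=2r_p$. Let $\mathcal E_L$ be the spectral coefficient encoder, $\mathcal D_L^{\mathrm{ad}}:K_L\to D_G$ the prior-induced admissible decoder, and $\mathcal P:L^2(B_1)\to\mathbb R^p$, $\mathcal R=\mathcal R_{\mathrm{SH}}:\mathbb R^p\to L^2(B_1)$ the spectral projector and reconstructor of the context. Assume $m$ is sufficiently large that $$\varepsilon_m^{\mathrm{ad}}:=\operatorname*{ess\,sup}_{f\in\Psi(\mathcal Q_{\mathrm{pr}})}\|\mathcal D_L^{\mathrm{ad}}\mathcal E_L(f)-f\|_{L^2(\mathbb S^2\times\mathbb S^2)}$$ (with respect to $\mu$) lies in the small-data regime of the logarithmic stability estimate, i.e. $\varepsilon_m^{\mathrm{ad}}\le e^{-1}$. Then there exist constants $C_1,C_2,C_3>0$, independent of $m$, $p$ and $N$, and constants $c_0,c_1>0$, which may depend on $L,p$ and the fixed data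 but not on $N$, such that for every $N\in\mathbb N$ with $N>N_{0,L}:=c_0(p+1)\exp(c_1m_L)$ there is a ReLU network $\mathcal A_N:\mathbb R^m\to\mathbb R^p$ with $\mathrm{size}(\mathcal A_N)\le N$ for which the DeepONet $\mathscr N:=\mathcal R\circ\mathcal A_N\circ\mathcal E_L$ satisfies $$\left(\int_X\|\mathscr G(f)-\mathscr N(f)\|_{L^2(B_1)}^2\,d\mu(f)\right)^{1/2}\le C_1\operatorname{Lip}(\mathcal R)\left[\frac1{c_1m}\log\left(\frac N{c_0(p+1)}\right)\right]^{-\hat s}+C_2\bigl(\operatorname{Lip}(\mathcal R)+\operatorname{Lip}(\mathcal R\circ\mathcal P)\bigr)m^{-\hat s/4}+C_3\,p^{-s/3},$$ where $X=L^2(\mathbb S^2\times\mathbb S^2)$.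
   Context: All scalar function spaces are over $\mathbb C$. $B_1=\{x\in\mathbb R^3:|x|<1\}$. Scattering: for a contrast $q$ and $\omega\in\mathbb S^2$, the total field $u_q=e^{ikx\cdot\omega}+u_q^{\mathrm{sca}}$ solves $\Delta u_q+k^2(1+q)u_q=0$ in $\mathbb R^3$ with the Sommerfeld radiation condition $\lim_{|x|\to\infty}|x|(\partial_{|x|}u_q^{\mathrm{sca}}-iku_q^{\mathrm{sca}})=0$, and the far-field pattern $u_q^\infty$ is defined by $u_q^{\mathrm{sca}}(x,\omega)=\frac{e^{ik|x|}}{|x|}u_q^\infty(\hat x,\omega)+O(|x|^{-2})$, $\hat x=x/|x|$. Admissible class: $\mathcal Q_{\mathrm{ad}}:=\{q\in H^s(\mathbb R^3):\operatorname{supp}q\subset B_1,\ \|q\|_{H^s}\le C_q,\ \operatorname{Im}q\ge0\text{ a.e.}\}$. Forward map $\Psi:\mathcal Q_{\mathrm{ad}}\to L^2(\mathbb S^2\times\mathbb S^2)$, $\Psi(q)=u_q^\infty$; data set $D_G:=\Psi(\mathcal Q_{\mathrm{ad}})$; inverse map $G:D_G\to L^2(B_1)$, $G(u_q^\infty)=q$. Known stability estimate (Hähner–Hohage; may be used): there is $C>0$ depending only on $s,\epsilon,k,C_q$ with $\|q-\widetilde q\|_{L^2(B_1)}\le C[-\ln^-(\|u_q^\infty-u_{\widetilde q}^\infty\|_{L^2(\mathbb S^2\times\mathbb S^2)})]^{-\hat s}$ for all $q,\widetilde q\in\mathcal Q_{\mathrm{ad}}$, where $\ln^-(t)=\ln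 t$ for $0<t\le e^{-1}$, $\ln^-(t)=-1$ for $t>e^{-1}$, $\ln^-(0)=-\infty$ and $[-\ln^-(0)]^{-\alpha}:=0$ for $\alpha>0$. Prior: $\mathcal Q_{\mathrm{ad}}$ carries a fixed separable metric topology for which the inclusion into $L^2(B_1)$ and $\Psi$ are continuous; $\nu$ is a Borel probability measure on it with compact support $\mathcal Q_{\mathrm{pr}}$. $\mathscr G:L^2(\mathbb S^2\times\mathbb S^2)\to L^2(B_1)$ is a Borel measurable map agreeing with $G$ on $\Psi(\mathcal Q_{\mathrm{pr}})$. Analytic class $\mathcal X$: a fixed normed class continuously embedded in $L^2(\mathbb S^2\times\mathbb S^2)$ for which there are constants $C,\sigma>0$ such that the tensor spherical-harmonic coefficients of every $f\in\mathcal X$ satisfy $|\hat f_{l_1,m_1;l_2,m_2}|\le C\|f\|_{\mathcal X}e^{-\sigma(l_1+l_2)}$ for all $l_1,l_2\ge0$. Here $\{Y_{l,j}\}_{1\le j\le d_l}$, $d_l=2l+1$, is an orthonormal basis of the spherical harmonics of degree $l$ on $\mathbb S^2$ and $\hat f_{l_1,m_1;l_2,m_2}=\langle f,Y_{l_1,m_1}(\hat x)Y_{l_2,m_2}(\omega)\rangle_{L^2}$. Encoder: $\mathcal E_L(f):=(\hat f_{l_1,m_1;l_2,m_2})_{\max(l_1,l_2)\le L}\in\mathbb C^{r_L}\simeq\mathbb R^{m_L}$ (real and imaginary parts separated), $r_L=(\sum_{l=0}^Ld_l)^2$, $m_L=2r_L$. Admissible decoder: $F_L:=\mathcal E_L\circ\Psi$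 on $\mathcal Q_{\mathrm{pr}}$, $K_L:=F_L(\mathcal Q_{\mathrm{pr}})$ (compact, equal to $\operatorname{supp}((\mathcal E_L)_\#\mu)$); $s_L:K_L\to\mathcal Q_{\mathrm{pr}}$ is a fixed Borel measurable selector with $F_L(s_L(z))=z$ for all $z\in K_L$ (it exists by measurable selection); $\mathcal D_L^{\mathrm{ad}}(z):=\Psi(s_L(z))$. Reconstruction: $\mathbb P_n(B_1)$ is the space of complex polynomials of total degree $\le n$ on $B_1$. $\{\phi_k\}_{k\ge1}$ is a real-valued $L^2(B_1)$-orthonormal polynomial basis (spherical-harmonic–Jacobi basis), ordered so that $\operatorname{span}_{\mathbb C}\{\phi_1,\dots,\phi_{r_p}\}=\mathbb P_n(B_1)$. $\mathcal P(q):=(\operatorname{Re}\langle q,\phi_1\rangle,\dots,\operatorname{Re}\langle q,\phi_{r_p}\rangle,\operatorname{Im}\langle q,\phi_1\rangle,\dots,\operatorname{Im}\langle q,\phi_{r_p}\rangle)$ and $\mathcal R_{\mathrm{SH}}(a,b):=\sum_{k=1}^{r_p}(a_k+ib_k)\phi_k$ for $(a,b)\in\mathbb R^{r_p}\times\mathbb R^{r_p}$. Thus $\mathcal R\circ\mathcal P$ is the orthogonal projection onto $\mathbb P_n(B_1)$, $\operatorname{Lip}(\mathcal R)=1$ and $\operatorname{Lip}(\mathcal R\circ\mathcal P)\le1$. $\operatorname{Lip}$ denotes the Lipschitz constant. ReLU network: a map $\Phi=C_\Lambda\circ\sigma\circ\cdots\circ\sigma\circ C_1$, $\Lambda\ge1$,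 with $\sigma(x)=\max\{x,0\}$ componentwise and affine maps $C_\ell(z)=W_\ell z+b_\ell$; $\mathrm{size}(\Phi):=\sum_\ell(\|W_\ell\|_0+\|b_\ell\|_0)$, where $\|\cdot\|_0$ counts nonzero entries (for a chosen representation). *)

theory Defs
  imports
    "HOL-Probability.Probability"
    "HOL-Library.Function_Algebras"
    "HOL-Library.Landau_Symbols"
    "Jordan_Normal_Form.Matrix"
begin

text \<open>Vectors of variable dimension are those of \<^theory>\<open>Jordan_Normal_Form.Matrix\<close>; points of
  three-dimensional space have type \<open>real^3\<close>.  The clashing notation is resolved so that
  \<open>\<bullet>\<close> is the inner product of Euclidean spaces and \<open>$\<close> is the component of a
  variable-dimension vector.\<close>

no_notation scalar_prod (infix \<open>\<bullet>\<close> 70)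
no_notation vec_nth (infixl \<open>$\<close> 90)


type_synonym R3 = "real^3"


section \<open>Borel sets of a topology, support of a measure, Lipschitz constants\<close>

definition borel_of :: "'a topology \<Rightarrow> 'a measure" where
  "borel_of T = sigma (topspace T) {U. openin T U}"

definition measure_support :: "'a topology \<Rightarrow> 'a measure \<Rightarrow> 'a set" where
  "measure_support T M = {x \<in> topspace T. \<forall>U. openin T U \<and> x \<in> U \<longrightarrow> emeasure M U > 0}"

definition Lip_const ::
  "'a set \<Rightarrow> ('a \<Rightarrow> 'a \<Rightarrow> real) \<Rightarrow> ('b \<Rightarrow> 'b \<Rightarrow> real) \<Rightarrow> ('a \<Rightarrow> 'b) \<Rightarrow> real" where
  "Lip_const X dX dY f = Inf {C. 0 \<le> C \<and> (\<forall>x\<in>X. \<forall>y\<in>X. dY (f x) (f y) \<le> C * dX x y)}"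


section \<open>Complex L2 spaces of a measure\<close>

text \<open>An element of \<open>L2 M\<close> is an equivalence class of measurable square-integrable functions
  modulo equality almost everywhere.\<close>

type_synonym 'a l2 = "('a \<Rightarrow> complex) set"

definition square_integrable :: "'a measure \<Rightarrow> ('a \<Rightarrow> complex) set" where
  "square_integrable M =
     {f \<in> borel_measurable M. integrable M (\<lambda>x. (cmod (f x))\<^sup>2)}"

definition ae_equal :: "'a measure \<Rightarrow> (('a \<Rightarrow> complex) \<times> ('a \<Rightarrow> complex)) set" where
  "ae_equal M = {(f, g). f \<in> square_integrable M \<and> g \<in> square_integrable M \<and>
                         (AE x in M. f x = g x)}"

definition L2 :: "'a measure \<Rightarrow> 'a l2 set" where
  "L2 M = square_integrable M // ae_equal M"

definition L2_class :: "'a measure \<Rightarrow> ('a \<Rightarrow> complex) \<Rightarrow> 'a l2" where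
  "L2_class M f = ae_equal M `` {f}"

definition L2_rep :: "'a l2 \<Rightarrow> 'a \<Rightarrow> complex" where
  "L2_rep F = (SOME f. f \<in> F)"

definition L2_add :: "'a measure \<Rightarrow> 'a l2 \<Rightarrow> 'a l2 \<Rightarrow> 'a l2" where
  "L2_add M F G = L2_class M (\<lambda>x. L2_rep F x + L2_rep G x)"

definition L2_scale :: "'a measure \<Rightarrow> complex \<Rightarrow> 'a l2 \<Rightarrow> 'a l2" where
  "L2_scale M c F = L2_class M (\<lambda>x. c * L2_rep F x)"

definition L2_inner :: "'a measure \<Rightarrow> 'a l2 \<Rightarrow> 'a l2 \<Rightarrow> complex" where
  "L2_inner M F G = (LINT x|M. L2_rep F x * cnj (L2_rep G x))"

definition L2_norm :: "'a measure \<Rightarrow> 'a l2 \<Rightarrow> real" where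
  "L2_norm M F = sqrt (LINT x|M. (cmod (L2_rep F x))\<^sup>2)"

definition L2_dist :: "'a measure \<Rightarrow> 'a l2 \<Rightarrow> 'a l2 \<Rightarrow> real" where
  "L2_dist M F G = sqrt (LINT x|M. (cmod (L2_rep F x - L2_rep G x))\<^sup>2)"

definition L2_topology :: "'a measure \<Rightarrow> 'a l2 topology" where
  "L2_topology M = Metric_space.mtopology (L2 M) (L2_dist M)"


section \<open>The ball, the sphere, and the data space\<close>

definition ball_measure :: "(R3) measure" where
  "ball_measure = restrict_space lborel (ball 0 1)"

text \<open>Surface measure on the unit sphere: the measure of \<open>A\<close> is three times the volume of the
  cone \<open>{x. 0 < norm x \<le> 1, x / norm x \<in> A}\<close>.\<close>

definition sphere_measure :: "(R3) measure" where
  "sphere_measure =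
     scale_measure 3 (distr (restrict_space lborel (cball 0 1 - {0}))
                            (restrict_space borel (sphere 0 1)) sgn)"

abbreviation sphere2_measure :: "(R3 \<times> R3) measure" where
  "sphere2_measure \<equiv> sphere_measure \<Otimes>\<^sub>M sphere_measure"

text \<open>Restriction to the ball, i.e. the inclusion of the admissible class into
  \<open>L2(B_1)\<close>.\<close>

definition to_ball :: "(R3) l2 \<Rightarrow> (R3) l2" where
  "to_ball q = L2_class ball_measure (L2_rep q)"


section \<open>Sobolev spaces and the admissible class\<close>

definition fourier_truncated :: "real \<Rightarrow> (R3 \<Rightarrow> complex) \<Rightarrow> R3 \<Rightarrow> complex" where
  "fourier_truncated R f \<xi> =
     complex_of_real ((2 * pi) powr (- 3 / 2)) *
     (LINT x:cball 0 R|lborel. exp (- (\<i> * complex_of_real (x \<bullet> \<xi>))) * f x)"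

text \<open>The unitary Fourier--Plancherel transform on \<open>L2(R^3)\<close>, as the \<open>L2\<close>-limit of
  Fourier integrals over growing balls.\<close>

definition L2_fourier :: "(R3) l2 \<Rightarrow> (R3) l2" where
  "L2_fourier F =
     (THE G. G \<in> L2 lborel \<and>
        ((\<lambda>R. \<integral>\<^sup>+ \<xi>. ennreal ((cmod (fourier_truncated R (L2_rep F) \<xi> - L2_rep G \<xi>))\<^sup>2) \<partial>lborel)
           \<longlongrightarrow> 0) at_top)"

definition sobolev :: "real \<Rightarrow> (R3) l2 set" where
  "sobolev s = {F \<in> L2 lborel.
     integrable lborel (\<lambda>\<xi>. (1 + (norm \<xi>)\<^sup>2) powr s * (cmod (L2_rep (L2_fourier F) \<xi>))\<^sup>2)}"

definition sobolev_norm :: "real \<Rightarrow> (R3) l2 \<Rightarrow> real" where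
  "sobolev_norm s F =
     sqrt (LINT \<xi>|lborel. (1 + (norm \<xi>)\<^sup>2) powr s * (cmod (L2_rep (L2_fourier F) \<xi>))\<^sup>2)"

definition ess_support :: "(R3) l2 \<Rightarrow> (R3) set" where
  "ess_support F =
     {x. \<forall>U. open U \<and> x \<in> U \<longrightarrow> \<not> (AE y in lborel. y \<in> U \<longrightarrow> L2_rep F y = 0)}"

definition admissible :: "real \<Rightarrow> real \<Rightarrow> (R3) l2 set" where
  "admissible s Cq =
     {q \<in> sobolev s. ess_support q \<subseteq> ball 0 1 \<and> sobolev_norm s q \<le> Cq \<and>
                     (AE x in lborel. Im (L2_rep q x) \<ge> 0)}"


section \<open>The scattering problem\<close>

definition dir_deriv :: "R3 \<Rightarrow> (R3 \<Rightarrow> complex) \<Rightarrow> R3 \<Rightarrow> complex" where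
  "dir_deriv v f x = vector_derivative (\<lambda>t. f (x + t *\<^sub>R v)) (at 0)"

definition C1_fun :: "(R3 \<Rightarrow> complex) \<Rightarrow> bool" where
  "C1_fun f \<longleftrightarrow> (\<forall>b\<in>Basis. (\<forall>x. (\<lambda>t. f (x + t *\<^sub>R b)) differentiable (at (0::real))) \<and>
                             continuous_on UNIV (dir_deriv b f))"

definition C2_fun :: "(R3 \<Rightarrow> complex) \<Rightarrow> bool" where
  "C2_fun f \<longleftrightarrow> C1_fun f \<and> (\<forall>b\<in>Basis. C1_fun (dir_deriv b f))"

definition laplacian :: "(R3 \<Rightarrow> complex) \<Rightarrow> R3 \<Rightarrow> complex" where
  "laplacian f x = (\<Sum>b\<in>Basis. dir_deriv b (dir_deriv b f) x)"

definition plane_wave :: "real \<Rightarrow> R3 \<Rightarrow> R3 \<Rightarrow> complex" where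
  "plane_wave k \<omega> x = exp (\<i> * complex_of_real (k * (x \<bullet> \<omega>)))"

definition sommerfeld :: "real \<Rightarrow> (R3 \<Rightarrow> complex) \<Rightarrow> bool" where
  "sommerfeld k u \<longleftrightarrow>
     ((\<lambda>x. complex_of_real (norm x) * (dir_deriv (sgn x) u x - \<i> * complex_of_real k * u x))
        \<longlongrightarrow> 0) at_infinity"

text \<open>The equation is imposed almost everywhere because \<open>q\<close> is only given as an \<open>L2\<close> class.
  For \<open>s > 3/2\<close> an admissible \<open>q\<close> has a Hoelder continuous representative, the total field is
  twice continuously differentiable, and the equation holds everywhere for that
  representative.\<close>

definition is_scattered_field ::
  "real \<Rightarrow> (R3) l2 \<Rightarrow> R3 \<Rightarrow> (R3 \<Rightarrow> complex) \<Rightarrow> bool" where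
  "is_scattered_field k q \<omega> us \<longleftrightarrow>
     C2_fun us \<and>
     (let u = (\<lambda>x. plane_wave k \<omega> x + us x) in
        AE x in lborel. laplacian u x + (complex_of_real k)\<^sup>2 * (1 + L2_rep q x) * u x = 0) \<and>
     sommerfeld k us"

definition is_far_field ::
  "real \<Rightarrow> (R3) l2 \<Rightarrow> (R3 \<Rightarrow> R3 \<Rightarrow> complex) \<Rightarrow> bool" where
  "is_far_field k q v \<longleftrightarrow>
     (\<forall>\<omega>\<in>sphere 0 1. \<exists>us. is_scattered_field k q \<omega> us \<and>
        (\<lambda>x. us x - exp (\<i> * complex_of_real (k * norm x)) / complex_of_real (norm x) * v (sgn x) \<omega>)
          \<in> O[at_infinity](\<lambda>x. complex_of_real (1 / (norm x)\<^sup>2)))"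

text \<open>The forward map \<open>\<Psi>\<close> sends \<open>q\<close> to the class of its far-field pattern.\<close>

definition forward_map :: "real \<Rightarrow> (R3) l2 \<Rightarrow> (R3 \<times> R3) l2" where
  "forward_map k q =
     (THE F. \<exists>v. is_far_field k q v \<and> F = L2_class sphere2_measure (\<lambda>(x, \<omega>). v x \<omega>))"

text \<open>The inverse map \<open>G\<close> on the data set \<open>\<Psi>(Q)\<close>, where \<open>Q\<close> is the admissible class.\<close>

definition inverse_map ::
  "real \<Rightarrow> (R3) l2 set \<Rightarrow> (R3 \<times> R3) l2 \<Rightarrow> (R3) l2" where
  "inverse_map k Q f = to_ball (inv_into Q (forward_map k) f)"

definition ln_minus :: "real \<Rightarrow> real" where
  "ln_minus t = (if t \<le> exp (- 1) then ln t else - 1)"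

text \<open>\<open>log_modulus \<alpha> t\<close> is the power \<open>- \<alpha>\<close> of \<open>- ln_minus t\<close>, with its conventional value
  \<open>0\<close> at \<open>t = 0\<close>.\<close>

definition log_modulus :: "real \<Rightarrow> real \<Rightarrow> real" where
  "log_modulus \<alpha> t = (if t = 0 then 0 else (- ln_minus t) powr (- \<alpha>))"

definition log_stability :: "real \<Rightarrow> (R3) l2 set \<Rightarrow> real \<Rightarrow> bool" where
  "log_stability k Q \<alpha> \<longleftrightarrow>
     (\<exists>C>0. \<forall>q\<in>Q. \<forall>q'\<in>Q.
        L2_dist ball_measure (to_ball q) (to_ball q')
          \<le> C * log_modulus \<alpha> (L2_dist sphere2_measure (forward_map k q) (forward_map k q')))"


section \<open>Polynomials and spherical harmonics\<close>

global_interpretation cfun: vector_space "\<lambda>(c::complex) (f :: 'a \<Rightarrow> complex) x. c * f x"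
  by unfold_locales (auto simp: fun_eq_iff algebra_simps)

definition monomial3 :: "nat \<times> nat \<times> nat \<Rightarrow> R3 \<Rightarrow> complex" where
  "monomial3 = (\<lambda>(a, b, c) x. complex_of_real (vec_nth x 1 ^ a * vec_nth x 2 ^ b * vec_nth x 3 ^ c))"

text \<open>Polynomials are represented by the functions they induce on all of space; since the ball
  has interior points, restriction to the ball loses nothing.\<close>

definition poly_space :: "nat \<Rightarrow> (R3 \<Rightarrow> complex) set" where
  "poly_space n = cfun.span (monomial3 ` {(a, b, c). a + b + c \<le> n})"

definition homogeneous_space :: "nat \<Rightarrow> (R3 \<Rightarrow> complex) set" where
  "homogeneous_space l = cfun.span (monomial3 ` {(a, b, c). a + b + c = l})"

definition poly_dim :: "nat \<Rightarrow> nat" where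
  "poly_dim n = cfun.dim (poly_space n)"

definition spherical_harmonics :: "nat \<Rightarrow> (R3 \<Rightarrow> complex) set" where
  "spherical_harmonics l =
     {Y. \<exists>h\<in>homogeneous_space l. (\<forall>x. laplacian h x = 0) \<and> (\<forall>x\<in>sphere 0 1. Y x = h x)}"

definition spherical_harmonic_basis :: "(nat \<Rightarrow> nat \<Rightarrow> R3 \<Rightarrow> complex) \<Rightarrow> bool" where
  "spherical_harmonic_basis Y \<longleftrightarrow>
     (\<forall>l. (\<forall>j\<in>{1..2*l+1}. Y l j \<in> spherical_harmonics l) \<and>
          (\<forall>i\<in>{1..2*l+1}. \<forall>j\<in>{1..2*l+1}.
              (LINT x|sphere_measure. Y l i x * cnj (Y l j x)) = of_bool (i = j)) \<and>
          (\<forall>h\<in>spherical_harmonics l. \<exists>c. \<forall>x\<in>sphere 0 1. h x = (\<Sum>j=1..2*l+1. c j * Y l j x)))"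

text \<open>A real-valued orthonormal polynomial basis of \<open>L2(B_1)\<close>, indexed from \<open>1\<close> and ordered by
  degree.\<close>

definition polynomial_basis :: "(nat \<Rightarrow> R3 \<Rightarrow> real) \<Rightarrow> bool" where
  "polynomial_basis \<phi> \<longleftrightarrow>
     (\<forall>i\<ge>1. \<forall>j\<ge>1. (LINT x|ball_measure. \<phi> i x * \<phi> j x) = of_bool (i = j)) \<and>
     (\<forall>n. cfun.span ((\<lambda>k x. complex_of_real (\<phi> k x)) ` {1..poly_dim n}) = poly_space n)"


section \<open>Encoder, projector and reconstructor\<close>

definition vec_dist :: "real vec \<Rightarrow> real vec \<Rightarrow> real" where
  "vec_dist v w = sqrt (\<Sum>i<dim_vec v. (v $ i - w $ i)\<^sup>2)"

definition vec_topology :: "nat \<Rightarrow> real vec topology" where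
  "vec_topology d = Metric_space.mtopology (carrier_vec d) vec_dist"

definition tensor_coeff ::
  "(nat \<Rightarrow> nat \<Rightarrow> R3 \<Rightarrow> complex) \<Rightarrow> (R3 \<times> R3) l2
     \<Rightarrow> nat \<times> nat \<Rightarrow> nat \<times> nat \<Rightarrow> complex" where
  "tensor_coeff Y f = (\<lambda>(l1, m1) (l2, m2).
     L2_inner sphere2_measure f
       (L2_class sphere2_measure (\<lambda>(x, \<omega>). Y l1 m1 x * Y l2 m2 \<omega>)))"

definition r_L :: "nat \<Rightarrow> nat" where
  "r_L L = (\<Sum>l=0..L. 2 * l + 1)\<^sup>2"

definition m_L :: "nat \<Rightarrow> nat" where
  "m_L L = 2 * r_L L"

definition harmonic_indices :: "nat \<Rightarrow> (nat \<times> nat) list" where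
  "harmonic_indices L = [(l, j). l \<leftarrow> [0..<L+1], j \<leftarrow> [1..<2*l+2]]"

text \<open>All real parts, followed by all imaginary parts; the length is \<open>m_L L\<close>.\<close>

definition encoder ::
  "(nat \<Rightarrow> nat \<Rightarrow> R3 \<Rightarrow> complex) \<Rightarrow> nat \<Rightarrow> (R3 \<times> R3) l2 \<Rightarrow> real vec" where
  "encoder Y L f =
     (let cs = map (\<lambda>(a, b). tensor_coeff Y f a b)
                   (List.product (harmonic_indices L) (harmonic_indices L))
      in vec_of_list (map Re cs @ map Im cs))"

definition projector :: "(nat \<Rightarrow> R3 \<Rightarrow> real) \<Rightarrow> nat \<Rightarrow> (R3) l2 \<Rightarrow> real vec" where
  "projector \<phi> n q =
     (let r = poly_dim n;
          c = (\<lambda>k. L2_inner ball_measure q (L2_class ball_measure (\<lambda>x. complex_of_real (\<phi> k x))))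
      in vec (2 * r) (\<lambda>i. if i < r then Re (c (i + 1)) else Im (c (i - r + 1))))"

definition reconstructor :: "(nat \<Rightarrow> R3 \<Rightarrow> real) \<Rightarrow> nat \<Rightarrow> real vec \<Rightarrow> (R3) l2" where
  "reconstructor \<phi> n v =
     (let r = poly_dim n
      in L2_class ball_measure
           (\<lambda>x. \<Sum>k=1..r. Complex (v $ (k - 1)) (v $ (r + k - 1)) * complex_of_real (\<phi> k x)))"


section \<open>The analytic class\<close>

definition normed_space_in_L2 :: "'a measure \<Rightarrow> 'a l2 set \<Rightarrow> ('a l2 \<Rightarrow> real) \<Rightarrow> bool" where
  "normed_space_in_L2 M X nrm \<longleftrightarrow>
     X \<subseteq> L2 M \<and>
     L2_class M (\<lambda>_. 0) \<in> X \<and>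
     (\<forall>f\<in>X. \<forall>g\<in>X. L2_add M f g \<in> X) \<and>
     (\<forall>c. \<forall>f\<in>X. L2_scale M c f \<in> X) \<and>
     (\<forall>f\<in>X. 0 \<le> nrm f \<and> (nrm f = 0 \<longleftrightarrow> f = L2_class M (\<lambda>_. 0))) \<and>
     (\<forall>c. \<forall>f\<in>X. nrm (L2_scale M c f) = cmod c * nrm f) \<and>
     (\<forall>f\<in>X. \<forall>g\<in>X. nrm (L2_add M f g) \<le> nrm f + nrm g) \<and>
     (\<exists>C>0. \<forall>f\<in>X. L2_norm M f \<le> C * nrm f)"

definition analytic_class ::
  "(nat \<Rightarrow> nat \<Rightarrow> R3 \<Rightarrow> complex) \<Rightarrow> (R3 \<times> R3) l2 set
     \<Rightarrow> ((R3 \<times> R3) l2 \<Rightarrow> real) \<Rightarrow> bool" where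
  "analytic_class Y X nrm \<longleftrightarrow>
     normed_space_in_L2 sphere2_measure X nrm \<and>
     (\<exists>C>0. \<exists>\<sigma>>0. \<forall>f\<in>X. \<forall>l1 l2. \<forall>m1\<in>{1..2*l1+1}. \<forall>m2\<in>{1..2*l2+1}.
        cmod (tensor_coeff Y f (l1, m1) (l2, m2)) \<le> C * nrm f * exp (- \<sigma> * real (l1 + l2)))"


section \<open>ReLU networks\<close>

text \<open>A network is represented by the nonempty list of its affine layers, input layer first;
  there is no activation after the last layer.\<close>

type_synonym network = "(real mat \<times> real vec) list"

fun is_network :: "nat \<Rightarrow> nat \<Rightarrow> network \<Rightarrow> bool" where
  "is_network m p [] \<longleftrightarrow> False"
| "is_network m p [(W, b)] \<longleftrightarrow> W \<in> carrier_mat p m \<and> b \<in> carrier_vec p"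
| "is_network m p ((W, b) # ls) \<longleftrightarrow>
     dim_col W = m \<and> dim_vec b = dim_row W \<and> is_network (dim_row W) p ls"

fun realize :: "network \<Rightarrow> real vec \<Rightarrow> real vec" where
  "realize [] z = z"
| "realize [(W, b)] z = W *\<^sub>v z + b"
| "realize ((W, b) # ls) z = realize ls (map_vec (\<lambda>t. max t 0) (W *\<^sub>v z + b))"

definition nnz_mat :: "real mat \<Rightarrow> nat" where
  "nnz_mat W = card {(i, j). i < dim_row W \<and> j < dim_col W \<and> W $$ (i, j) \<noteq> 0}"

definition nnz_vec :: "real vec \<Rightarrow> nat" where
  "nnz_vec b = card {i. i < dim_vec b \<and> b $ i \<noteq> 0}"

definition network_size :: "network \<Rightarrow> nat" where
  "network_size ls = (\<Sum>(W, b)\<leftarrow>ls. nnz_mat W + nnz_vec b)"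

end

theory Submission
  imports Defs "HOL-Real_Asymp.Real_Asymp"
begin

text \<open>The network interpolates the finite-dimensional inverse map.  On the bounded set \<open>K L\<close> of encoded
  data take a \<open>\<delta>\<close>-net of points \<open>Enc (\<Psi> (q j))\<close> and a ReLU partition of unity subordinate to it; the
  network is the corresponding combination of the vectors \<open>P (q j)\<close>, and \<open>log (1 / \<delta>)\<close> is of order
  \<open>log N / m\<close>.  If \<open>Enc (\<Psi> q)\<close> is close to \<open>Enc (\<Psi> (q j))\<close>, then \<open>\<Psi> q\<close> is \<open>O(\<delta> + exp (- \<sigma> L / 2))\<close>-close
  to \<open>\<Psi> (q j)\<close>, by completeness of the spherical harmonics and the decay of the coefficients, and the
  logarithmic stability estimate bounds the distance of \<open>q\<close> and \<open>q j\<close> by the first two terms; here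
  \<open>m = 2 (L + 1)^4\<close> turns \<open>(L + 1) powr (- s_hat)\<close> into \<open>m powr (- s_hat / 4)\<close>.

  The third term is a Jackson estimate without extension operators: the residual \<open>r\<close> of the orthogonal
  projection of \<open>q\<close> to \<open>P_n\<close> has \<open>norm r ^ 2 = \<langle>q, r\<rangle>\<close>, which by Parseval is an integral of Fourier
  transforms; that of \<open>r\<close> is tiny on frequencies below \<open>c n\<close>, since \<open>r\<close> is orthogonal to polynomials,
  and the Sobolev weight of \<open>q\<close> gains \<open>n powr (- s)\<close> above.\<close>

section \<open>Square-integrable functions\<close>

text \<open>The encoder forgets coefficients, so a point of \<open>K L\<close> may come from many
  contrasts, and the inverse is only logarithmically continuous. Both obstacles disappear because
  stability is used for pairs of contrasts of the prior: any preimage of a node can supply its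
  value, and the forgotten coefficients become an additive error inside the logarithm, where
  \<open>log_modulus_add\<close> separates it from the mesh size. This keeps the three outer
  constants independent of \<open>L\<close>, \<open>n\<close> and \<open>N\<close>. Interpolation is
  by convex combination, so the error at a point is that of the worst active node: convexity of
  balls replaces a Lipschitz bound for the inverse. The factor \<open>3\<close> in the exponent has
  this origin: a net of mesh \<open>d\<close> in dimension \<open>m\<close> has about
  \<open>(1 / d) ^ m\<close> nodes, and a network that evaluates the partition of unity node by node
  has size cubic in their number. Surface measure is given through cones. Orthogonality of harmonics
  is therefore derived from volume integrals with a weight vanishing on the sphere, which leaves no
  boundary term; completeness is a dimension count combined with Stone-Weierstrass.\<close>

definition l2n :: "'a measure \<Rightarrow> ('a \<Rightarrow> complex) \<Rightarrow> real" where
  "l2n M f = sqrt (LINT x|M. (cmod (f x))\<^sup>2)"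

text \<open>Norm and inner product act on functions, not on classes, so that algebra needs no choice
  of representatives; \<open>L2_dist_eq\<close> and \<open>L2_inner_eq\<close> make the link to the
  \<open>L2\<close> spaces.\<close>

definition l2i :: "'a measure \<Rightarrow> ('a \<Rightarrow> complex) \<Rightarrow> ('a \<Rightarrow> complex) \<Rightarrow> complex" where
  "l2i M f g = (LINT x|M. f x * cnj (g x))"

lemma sqi_measurable [measurable_dest]: "f \<in> square_integrable M \<Longrightarrow> f \<in> borel_measurable M"
  by (simp add: square_integrable_def)

lemma sqi_integrable: "f \<in> square_integrable M \<Longrightarrow> integrable M (\<lambda>x. (cmod (f x))\<^sup>2)"
  by (simp add: square_integrable_def)

lemma sqi_cmod_mult:
  assumes f: "f \<in> square_integrable M" and g: "g \<in> square_integrable M"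
  shows "integrable M (\<lambda>x. cmod (f x) * cmod (g x))"
proof (rule Bochner_Integration.integrable_bound)
  show "integrable M (\<lambda>x. (cmod (f x))\<^sup>2 + (cmod (g x))\<^sup>2)"
    using sqi_integrable[OF f] sqi_integrable[OF g] by simp
  show "(\<lambda>x. cmod (f x) * cmod (g x)) \<in> borel_measurable M"
    using sqi_measurable[OF f] sqi_measurable[OF g] by measurable
  have "a * b \<le> a\<^sup>2 + b\<^sup>2" if "0 \<le> a" "0 \<le> b" for a b :: real
    using sum_squares_bound[of a b] mult_nonneg_nonneg[OF that] by linarith
  then show "AE x in M. norm (cmod (f x) * cmod (g x)) \<le> norm ((cmod (f x))\<^sup>2 + (cmod (g x))\<^sup>2)"
    by (intro AE_I2) (simp add: abs_mult)
qed

lemma sqi_mult_cnj: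
  assumes f: "f \<in> square_integrable M" and g: "g \<in> square_integrable M"
  shows "integrable M (\<lambda>x. f x * cnj (g x))"
proof (rule Bochner_Integration.integrable_bound[OF sqi_cmod_mult[OF f g]])
  show "(\<lambda>x. f x * cnj (g x)) \<in> borel_measurable M"
    using sqi_measurable[OF f] sqi_measurable[OF g]
    by (intro borel_measurable_times borel_measurable_continuous_on[of cnj])
       (auto intro!: continuous_intros)
qed (simp add: norm_mult)

lemma sqi_add:
  assumes f: "f \<in> square_integrable M" and g: "g \<in> square_integrable M"
  shows "(\<lambda>x. f x + g x) \<in> square_integrable M"
proof -
  have "integrable M (\<lambda>x. (cmod (f x + g x))\<^sup>2)"
  proof (rule Bochner_Integration.integrable_bound)
    show "integrable M (\<lambda>x. 2 * (cmod (f x))\<^sup>2 + 2 * (cmod (g x))\<^sup>2)"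
      using sqi_integrable[OF f] sqi_integrable[OF g] by simp
    show "(\<lambda>x. (cmod (f x + g x))\<^sup>2) \<in> borel_measurable M"
      using sqi_measurable[OF f] sqi_measurable[OF g] by measurable
    have "(cmod (a + b))\<^sup>2 \<le> 2 * (cmod a)\<^sup>2 + 2 * (cmod b)\<^sup>2" for a b
    proof -
      have "(cmod (a + b))\<^sup>2 \<le> (cmod a + cmod b)\<^sup>2"
        by (intro power_mono norm_triangle_ineq) auto
      also have "\<dots> \<le> 2 * (cmod a)\<^sup>2 + 2 * (cmod b)\<^sup>2"
        using sum_squares_bound[of "cmod a" "cmod b"] by (simp add: power2_sum)
      finally show ?thesis .
    qed
    then show "AE x in M. norm ((cmod (f x + g x))\<^sup>2) \<le> norm (2 * (cmod (f x))\<^sup>2 + 2 * (cmod (g x))\<^sup>2)"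
      by (intro AE_I2) simp
  qed
  then show ?thesis
    using sqi_measurable[OF f] sqi_measurable[OF g] by (simp add: square_integrable_def)
qed

lemma sqi_cmult:
  assumes f: "f \<in> square_integrable M"
  shows "(\<lambda>x. c * f x) \<in> square_integrable M"
  using sqi_measurable[OF f] sqi_integrable[OF f]
  by (simp add: square_integrable_def norm_mult power_mult_distrib)

lemma sqi_diff:
  assumes f: "f \<in> square_integrable M" and g: "g \<in> square_integrable M"
  shows "(\<lambda>x. f x - g x) \<in> square_integrable M"
  using sqi_add[OF f sqi_cmult[OF g, of "-1"]] by simp

lemma sqi_zero: "(\<lambda>_. 0) \<in> square_integrable M"
  by (simp add: square_integrable_def)

lemma sqi_sum:
  assumes "\<And>i. i \<in> I \<Longrightarrow> f i \<in> square_integrable M"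
  shows "(\<lambda>x. \<Sum>i\<in>I. f i x) \<in> square_integrable M"
  using assms by (induction I rule: infinite_finite_induct) (auto intro: sqi_zero sqi_add)

lemma sqi_bounded:
  assumes "finite_measure M" "f \<in> borel_measurable M" "\<And>x. x \<in> space M \<Longrightarrow> cmod (f x) \<le> B"
  shows "f \<in> square_integrable M"
proof -
  interpret finite_measure M by fact
  have "integrable M (\<lambda>x. (cmod (f x))\<^sup>2)"
    by (rule integrable_const_bound[where B = "B\<^sup>2"])
       (use assms in \<open>auto intro!: AE_I2 power_mono\<close>)
  then show ?thesis using assms by (simp add: square_integrable_def)
qed

lemma sqi_cong_AE:
  assumes "f \<in> square_integrable M" "g \<in> borel_measurable M" "AE x in M. f x = g x"
  shows "g \<in> square_integrable M"
proof -
  have "integrable M (\<lambda>x. (cmod (g x))\<^sup>2)"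
    using sqi_integrable[OF assms(1)] sqi_measurable[OF assms(1)] assms(2,3)
    by (subst integrable_cong_AE[where g = "\<lambda>x. (cmod (f x))\<^sup>2"]) auto
  then show ?thesis using assms(2) by (simp add: square_integrable_def)
qed

lemma l2n_nonneg [simp]: "0 \<le> l2n M f"
  by (simp add: l2n_def)

lemma l2n_sq: "(l2n M f)\<^sup>2 = (LINT x|M. (cmod (f x))\<^sup>2)"
  by (simp add: l2n_def)

lemma l2n_cong_AE:
  assumes "f \<in> borel_measurable M" "g \<in> borel_measurable M" "AE x in M. f x = g x"
  shows "l2n M f = l2n M g"
  unfolding l2n_def using assms by (intro arg_cong[where f = sqrt] integral_cong_AE) auto

lemma l2i_cong_AE:
  assumes [measurable]: "f \<in> borel_measurable M" "f' \<in> borel_measurable M"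
      "g \<in> borel_measurable M" "g' \<in> borel_measurable M"
    and "AE x in M. f x = f' x" "AE x in M. g x = g' x"
  shows "l2i M f g = l2i M f' g'"
proof -
  have [measurable]: "cnj \<in> borel_measurable borel"
    by (intro borel_measurable_continuous_onI continuous_intros)
  have "(\<lambda>x. f x * cnj (g x)) \<in> borel_measurable M" "(\<lambda>x. f' x * cnj (g' x)) \<in> borel_measurable M"
    by measurable
  then show ?thesis
    unfolding l2i_def using assms by (intro integral_cong_AE) auto
qed

lemma l2i_self: "l2i M f f = complex_of_real ((l2n M f)\<^sup>2)"
proof -
  have "l2i M f f = (LINT x|M. complex_of_real ((cmod (f x))\<^sup>2))"
    unfolding l2i_def complex_norm_square by simp
  then show ?thesis by (simp only: integral_complex_of_real l2n_sq)
qed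

lemma l2i_commute: "l2i M g f = cnj (l2i M f g)"
proof -
  have "cnj (l2i M f g) = (LINT x|M. cnj (f x * cnj (g x)))"
    unfolding l2i_def by (rule Bochner_Integration.integral_cnj[symmetric])
  also have "\<dots> = l2i M g f"
    unfolding l2i_def by (simp add: mult.commute)
  finally show ?thesis by simp
qed

lemma l2i_add_left:
  assumes "f \<in> square_integrable M" "g \<in> square_integrable M" "h \<in> square_integrable M"
  shows "l2i M (\<lambda>x. f x + g x) h = l2i M f h + l2i M g h"
  unfolding l2i_def using sqi_mult_cnj[of _ M h] assms by (simp add: distrib_right)

lemma l2i_diff_left:
  assumes "f \<in> square_integrable M" "g \<in> square_integrable M" "h \<in> square_integrable M"
  shows "l2i M (\<lambda>x. f x - g x) h = l2i M f h - l2i M g h"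
  unfolding l2i_def using sqi_mult_cnj[of _ M h] assms by (simp add: left_diff_distrib)

lemma l2i_cmult_left: "l2i M (\<lambda>x. c * f x) h = c * l2i M f h"
  unfolding l2i_def by (simp add: mult.assoc)

lemma l2i_add_right:
  assumes "f \<in> square_integrable M" "g \<in> square_integrable M" "h \<in> square_integrable M"
  shows "l2i M h (\<lambda>x. f x + g x) = l2i M h f + l2i M h g"
  using l2i_add_left[OF assms] by (metis complex_cnj_add l2i_commute)

lemma l2i_diff_right:
  assumes "f \<in> square_integrable M" "g \<in> square_integrable M" "h \<in> square_integrable M"
  shows "l2i M h (\<lambda>x. f x - g x) = l2i M h f - l2i M h g"
  using l2i_diff_left[OF assms] by (metis complex_cnj_diff l2i_commute)

lemma l2i_cmult_right: "l2i M h (\<lambda>x. c * f x) = cnj c * l2i M h f"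
  by (metis complex_cnj_mult l2i_commute l2i_cmult_left)

lemma l2i_zero_left [simp]: "l2i M (\<lambda>_. 0) h = 0"
  by (simp add: l2i_def)

lemma l2i_zero_right [simp]: "l2i M h (\<lambda>_. 0) = 0"
  by (simp add: l2i_def)

lemma l2i_sum_left:
  assumes "\<And>i. i \<in> I \<Longrightarrow> f i \<in> square_integrable M" "h \<in> square_integrable M"
  shows "l2i M (\<lambda>x. \<Sum>i\<in>I. f i x) h = (\<Sum>i\<in>I. l2i M (f i) h)"
  using assms(1)
proof (induction I rule: infinite_finite_induct)
  case (insert i I)
  then have "l2i M (\<lambda>x. f i x + (\<Sum>i\<in>I. f i x)) h = l2i M (f i) h + l2i M (\<lambda>x. \<Sum>i\<in>I. f i x) h"
    by (intro l2i_add_left sqi_sum assms(2) insert.prems) auto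
  with insert show ?case by simp
qed auto

lemma l2i_sum_right:
  assumes "\<And>i. i \<in> I \<Longrightarrow> f i \<in> square_integrable M" "h \<in> square_integrable M"
  shows "l2i M h (\<lambda>x. \<Sum>i\<in>I. f i x) = (\<Sum>i\<in>I. l2i M h (f i))"
  by (subst l2i_commute, subst l2i_sum_left[OF assms]) (auto simp: cnj_sum l2i_commute[of M h])

lemma l2n_diff_sq:
  assumes "f \<in> square_integrable M" "g \<in> square_integrable M"
  shows "(l2n M (\<lambda>x. f x - g x))\<^sup>2 = (l2n M f)\<^sup>2 - 2 * Re (l2i M f g) + (l2n M g)\<^sup>2"
proof -
  have "complex_of_real ((l2n M (\<lambda>x. f x - g x))\<^sup>2)
      = l2i M f f - l2i M g f - (l2i M f g - l2i M g g)"
    using assms by (simp add: l2i_self[symmetric] l2i_diff_left l2i_diff_right sqi_diff del: of_real_power)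
  then have "(l2n M (\<lambda>x. f x - g x))\<^sup>2 = Re (l2i M f f - l2i M g f - (l2i M f g - l2i M g g))"
    by (metis Re_complex_of_real)
  moreover have "Re (l2i M g f) = Re (l2i M f g)"
    by (subst l2i_commute) simp
  ultimately show ?thesis
    by (simp add: l2i_self del: of_real_power)
qed

lemma l2n_cmult: "l2n M (\<lambda>x. c * f x) = cmod c * l2n M f"
  unfolding l2n_def by (simp add: norm_mult power_mult_distrib real_sqrt_mult)

text \<open>Cauchy-Schwarz, from the nonnegative quadratic polynomial in \<open>t\<close> that is
  the integral of \<open>(cmod (f x) - t * cmod (g x))\<^sup>2\<close>.\<close>

lemma integral_cmod_mult_le:
  assumes f: "f \<in> square_integrable M" and g: "g \<in> square_integrable M"
  shows "(LINT x|M. cmod (f x) * cmod (g x)) \<le> l2n M f * l2n M g"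
proof -
  let ?A = "(l2n M f)\<^sup>2" and ?C = "(l2n M g)\<^sup>2" and ?B = "LINT x|M. cmod (f x) * cmod (g x)"
  have B0: "0 \<le> ?B" by simp
  have q: "0 \<le> ?A - 2 * t * ?B + t\<^sup>2 * ?C" for t
  proof -
    have "0 \<le> (LINT x|M. (cmod (f x) - t * cmod (g x))\<^sup>2)" by simp
    also have "\<dots> = (LINT x|M. (cmod (f x))\<^sup>2 - 2 * t * (cmod (f x) * cmod (g x)) + t\<^sup>2 * (cmod (g x))\<^sup>2)"
      by (simp add: power2_diff power_mult_distrib algebra_simps)
    also have "\<dots> = ?A - 2 * t * ?B + t\<^sup>2 * ?C"
      using sqi_integrable[OF f] sqi_integrable[OF g] sqi_cmod_mult[OF f g] by (simp add: l2n_sq)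
    finally show ?thesis .
  qed
  have "?B\<^sup>2 \<le> ?A * ?C"
  proof (cases "?C = 0")
    case True
    have "?B = 0"
    proof (rule ccontr)
      assume "?B \<noteq> 0"
      with B0 have "?B > 0" by linarith
      \<comment> \<open>With vanishing leading coefficient the polynomial is affine in
        \<open>t\<close>, and at this \<open>t\<close> its value is \<open>- 1\<close>.\<close>
      then show False
        using q[of "(?A + 1) / (2 * ?B)"] True by (simp add: field_simps)
    qed
    then show ?thesis by simp
  next
    case False
    then have "?C > 0" by (simp add: less_le)
    moreover from this have "(?B / ?C)\<^sup>2 * ?C = ?B\<^sup>2 / ?C" by (simp add: power2_eq_square)
    ultimately have "?B\<^sup>2 / ?C \<le> ?A"
      using q[of "?B / ?C"] by (simp only:) (simp add: power2_eq_square)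
    with \<open>?C > 0\<close> show ?thesis by (simp only: pos_divide_le_eq)
  qed
  then have "?B\<^sup>2 \<le> (l2n M f * l2n M g)\<^sup>2" by (simp add: power_mult_distrib)
  then show ?thesis by (rule power2_le_imp_le) simp
qed

lemma cmod_l2i_le:
  assumes "f \<in> square_integrable M" "g \<in> square_integrable M"
  shows "cmod (l2i M f g) \<le> l2n M f * l2n M g"
proof -
  have "cmod (l2i M f g) \<le> (LINT x|M. cmod (f x * cnj (g x)))"
    unfolding l2i_def by (rule integral_norm_bound)
  also have "\<dots> \<le> l2n M f * l2n M g"
    using integral_cmod_mult_le[OF assms] by (simp add: norm_mult)
  finally show ?thesis .
qed

lemma l2n_triangle:
  assumes f: "f \<in> square_integrable M" and g: "g \<in> square_integrable M"
  shows "l2n M (\<lambda>x. f x + g x) \<le> l2n M f + l2n M g"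
proof -
  have "(l2n M (\<lambda>x. f x - (- 1) * g x))\<^sup>2
      = (l2n M f)\<^sup>2 - 2 * Re (l2i M f (\<lambda>x. (- 1) * g x)) + (l2n M (\<lambda>x. (- 1) * g x))\<^sup>2"
    by (intro l2n_diff_sq sqi_cmult f g)
  then have "(l2n M (\<lambda>x. f x + g x))\<^sup>2 = (l2n M f)\<^sup>2 + 2 * Re (l2i M f g) + (l2n M g)\<^sup>2"
    unfolding l2i_cmult_right l2n_cmult by simp
  also have "\<dots> \<le> (l2n M f + l2n M g)\<^sup>2"
    using complex_Re_le_cmod[of "l2i M f g"] cmod_l2i_le[OF f g] by (simp add: power2_sum)
  finally show ?thesis by (rule power2_le_imp_le) simp
qed

lemma l2n_triangle_diff:
  assumes "f \<in> square_integrable M" "g \<in> square_integrable M" "h \<in> square_integrable M"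
  shows "l2n M (\<lambda>x. f x - h x) \<le> l2n M (\<lambda>x. f x - g x) + l2n M (\<lambda>x. g x - h x)"
  using l2n_triangle[of "\<lambda>x. f x - g x" M "\<lambda>x. g x - h x"] assms by (simp add: sqi_diff)

lemma l2n_minus_commute: "l2n M (\<lambda>x. f x - g x) = l2n M (\<lambda>x. g x - f x)"
  unfolding l2n_def by (simp add: norm_minus_commute)

lemma l2n_eq_0_iff:
  assumes "f \<in> square_integrable M"
  shows "l2n M f = 0 \<longleftrightarrow> (AE x in M. f x = 0)"
  unfolding l2n_def using integral_nonneg_eq_0_iff_AE[OF sqi_integrable[OF assms]] by simp

section \<open>The L2 spaces as metric spaces\<close>

lemma equiv_ae_equal: "equiv (square_integrable M) (ae_equal M)"
proof (rule equivI)
  show "trans (ae_equal M)"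
  proof (rule transI)
    fix f g h assume *: "(f, g) \<in> ae_equal M" "(g, h) \<in> ae_equal M"
    then have "AE x in M. f x = g x" "AE x in M. g x = h x" by (auto simp: ae_equal_def)
    then have "AE x in M. f x = h x" by eventually_elim simp
    then show "(f, h) \<in> ae_equal M" using * by (simp add: ae_equal_def)
  qed
  show "sym (ae_equal M)"
  proof (rule symI)
    fix f g assume *: "(f, g) \<in> ae_equal M"
    then have "AE x in M. f x = g x" by (simp add: ae_equal_def)
    then have "AE x in M. g x = f x" by eventually_elim simp
    then show "(g, f) \<in> ae_equal M" using * by (simp add: ae_equal_def)
  qed
qed (auto simp: refl_on_def ae_equal_def)

lemma L2_class_in [simp]: "f \<in> square_integrable M \<Longrightarrow> L2_class M f \<in> L2 M"
  unfolding L2_def L2_class_def by (rule quotientI)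

lemma
  assumes "F \<in> L2 M"
  shows L2_rep_sqi [simp]: "L2_rep F \<in> square_integrable M"
    and L2_class_rep [simp]: "L2_class M (L2_rep F) = F"
proof -
  obtain f where f: "f \<in> square_integrable M" "F = ae_equal M `` {f}"
    using assms by (auto simp: L2_def elim: quotientE)
  have "f \<in> F" using f by (auto simp: ae_equal_def)
  then have *: "L2_rep F \<in> F" unfolding L2_rep_def by (rule someI[where P = "\<lambda>f. f \<in> F"])
  then show "L2_rep F \<in> square_integrable M" using f by (auto simp: ae_equal_def)
  have "(f, L2_rep F) \<in> ae_equal M" using * f by auto
  then show "L2_class M (L2_rep F) = F"
    unfolding L2_class_def f(2) using equiv_class_eq[OF equiv_ae_equal] by metis
qed

lemma L2_rep_class:
  assumes "f \<in> square_integrable M"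
  shows "AE x in M. L2_rep (L2_class M f) x = f x"
proof -
  have "f \<in> L2_class M f" using assms by (auto simp: L2_class_def ae_equal_def)
  then have "L2_rep (L2_class M f) \<in> L2_class M f" unfolding L2_rep_def by (rule someI[where P = "\<lambda>g. g \<in> L2_class M f"])
  moreover have "\<forall>g\<in>L2_class M f. AE x in M. f x = g x" by (simp add: L2_class_def ae_equal_def)
  ultimately have "AE x in M. f x = L2_rep (L2_class M f) x" by blast
  then show ?thesis by eventually_elim simp
qed

lemma L2_class_eq_iff:
  assumes "f \<in> square_integrable M" "g \<in> square_integrable M"
  shows "L2_class M f = L2_class M g \<longleftrightarrow> (AE x in M. f x = g x)"
  unfolding L2_class_def using eq_equiv_class_iff[OF equiv_ae_equal assms] assms
  by (simp add: ae_equal_def)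

lemma L2_dist_eq: "L2_dist M F G = l2n M (\<lambda>x. L2_rep F x - L2_rep G x)"
  by (simp add: L2_dist_def l2n_def)

lemma L2_inner_eq: "L2_inner M F G = l2i M (L2_rep F) (L2_rep G)"
  by (simp add: L2_inner_def l2i_def)

lemma L2_dist_class_left:
  assumes "f \<in> square_integrable M" "G \<in> L2 M"
  shows "L2_dist M (L2_class M f) G = l2n M (\<lambda>x. f x - L2_rep G x)"
  unfolding L2_dist_eq
  using assms sqi_measurable[OF assms(1)] sqi_measurable[OF L2_rep_sqi[OF assms(2)]]
    sqi_measurable[OF L2_rep_sqi[OF L2_class_in[OF assms(1)]]] L2_rep_class[OF assms(1)]
  by (intro l2n_cong_AE) auto

lemma L2_dist_class:
  assumes "f \<in> square_integrable M" "g \<in> square_integrable M"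
  shows "L2_dist M (L2_class M f) (L2_class M g) = l2n M (\<lambda>x. f x - g x)"
proof -
  have "L2_dist M (L2_class M f) (L2_class M g) = l2n M (\<lambda>x. f x - L2_rep (L2_class M g) x)"
    using assms by (simp add: L2_dist_class_left)
  also have "\<dots> = l2n M (\<lambda>x. f x - g x)"
    using assms sqi_measurable[OF assms(1)] sqi_measurable[OF assms(2)]
      sqi_measurable[OF L2_rep_sqi[OF L2_class_in[OF assms(2)]]] L2_rep_class[OF assms(2)]
    by (intro l2n_cong_AE) auto
  finally show ?thesis .
qed

lemma L2_inner_class_right:
  assumes "F \<in> L2 M" "g \<in> square_integrable M"
  shows "L2_inner M F (L2_class M g) = l2i M (L2_rep F) g"
  unfolding L2_inner_eq
  using assms sqi_measurable[OF L2_rep_sqi[OF assms(1)]] sqi_measurable[OF assms(2)]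
    sqi_measurable[OF L2_rep_sqi[OF L2_class_in[OF assms(2)]]] L2_rep_class[OF assms(2)]
  by (intro l2i_cong_AE) auto

text \<open>Separation is the one axiom that needs classes; on functions \<open>l2n\<close> only
  gives a pseudometric.\<close>

lemma Metric_space_L2: "Metric_space (L2 M) (L2_dist M)"
proof
  fix F G H :: "'a l2"
  show "0 \<le> L2_dist M F G" by (simp add: L2_dist_eq)
  show "L2_dist M F G = L2_dist M G F" unfolding L2_dist_eq by (rule l2n_minus_commute)
  assume F: "F \<in> L2 M" and G: "G \<in> L2 M"
  show "L2_dist M F G = 0 \<longleftrightarrow> F = G"
  proof -
    have "L2_dist M F G = 0 \<longleftrightarrow> (AE x in M. L2_rep F x = L2_rep G x)"
      unfolding L2_dist_eq using F G by (simp add: l2n_eq_0_iff sqi_diff)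
    also have "\<dots> \<longleftrightarrow> F = G"
      using L2_class_eq_iff[of "L2_rep F" M "L2_rep G"] F G by simp
    finally show ?thesis .
  qed
  assume H: "H \<in> L2 M"
  show "L2_dist M F H \<le> L2_dist M F G + L2_dist M G H"
    unfolding L2_dist_eq using F G H by (intro l2n_triangle_diff) auto
qed

lemma L2_dist_triangle:
  assumes "F \<in> L2 M" "G \<in> L2 M" "H \<in> L2 M"
  shows "L2_dist M F H \<le> L2_dist M F G + L2_dist M G H"
  using Metric_space.triangle[OF Metric_space_L2 assms] .

lemma L2_dist_commute: "L2_dist M F G = L2_dist M G F"
  unfolding L2_dist_eq by (rule l2n_minus_commute)

lemma L2_dist_nonneg [simp]: "0 \<le> L2_dist M F G"
  by (simp add: L2_dist_eq)

lemma topspace_L2 [simp]: "topspace (L2_topology M) = L2 M"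
  unfolding L2_topology_def using Metric_space.topspace_mtopology[OF Metric_space_L2] .

section \<open>Density of the continuous functions\<close>

lemma l2n_dominated_convergence:
  assumes "\<And>n. f n \<in> borel_measurable M" "g \<in> borel_measurable M" "integrable M (\<lambda>x. (w x)\<^sup>2)"
    and lim: "\<And>x. x \<in> space M \<Longrightarrow> (\<lambda>n. f n x) \<longlonglongrightarrow> g x"
    and bound: "\<And>n x. x \<in> space M \<Longrightarrow> cmod (f n x - g x) \<le> w x"
  shows "(\<lambda>n. l2n M (\<lambda>x. f n x - g x)) \<longlonglongrightarrow> 0"
proof -
  have "(\<lambda>n. LINT x|M. (cmod (f n x - g x))\<^sup>2) \<longlonglongrightarrow> (LINT x|M. 0)"
  proof (rule integral_dominated_convergence[where w = "\<lambda>x. (w x)\<^sup>2"])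
    show "AE x in M. (\<lambda>n. (cmod (f n x - g x))\<^sup>2) \<longlonglongrightarrow> 0"
    proof (rule AE_I2)
      fix x assume "x \<in> space M"
      from tendsto_diff[OF lim[OF this] tendsto_const[of "g x"]]
      have "(\<lambda>n. f n x - g x) \<longlonglongrightarrow> 0" by simp
      from tendsto_power[OF tendsto_norm[OF this], of 2]
      show "(\<lambda>n. (cmod (f n x - g x))\<^sup>2) \<longlonglongrightarrow> 0" by simp
    qed
    show "AE x in M. norm ((cmod (f n x - g x))\<^sup>2) \<le> (w x)\<^sup>2" for n
      using bound by (intro AE_I2) (auto intro: power_mono)
  qed (use assms in \<open>auto intro!: borel_measurable_power borel_measurable_norm borel_measurable_diff\<close>)
  then have "(\<lambda>n. sqrt (LINT x|M. (cmod (f n x - g x))\<^sup>2)) \<longlonglongrightarrow> sqrt (LINT x|M. 0)"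
    by (intro tendsto_real_sqrt)
  then show ?thesis by (simp add: l2n_def)
qed

text \<open>The \<open>L2\<close> closure of the bounded continuous functions. Its stability under
  sums, multiples and limits makes Dynkin's theorem applicable, which replaces an appeal to
  regularity of the measure.\<close>

definition L2_closure_cont :: "('a::metric_space) measure \<Rightarrow> ('a \<Rightarrow> complex) set" where
  "L2_closure_cont M = {f \<in> square_integrable M. \<forall>\<eta>>0. \<exists>\<phi>. continuous_on UNIV \<phi> \<and>
     bounded (range \<phi>) \<and> l2n M (\<lambda>x. f x - \<phi> x) < \<eta>}"

context
  fixes M :: "('a::metric_space) measure" and S :: "'a set"
  assumes fin: "finite_measure M" and S: "S \<in> sets borel"
    and sets_M: "sets M = sets (restrict_space borel S)"
begin

lemma sqi_continuous:
  assumes "continuous_on UNIV \<phi>" "bounded (range \<phi>)"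
  shows "\<phi> \<in> square_integrable M"
proof -
  obtain B where "\<And>x. cmod (\<phi> x) \<le> B" using assms(2) by (auto simp: bounded_iff)
  moreover have "\<phi> \<in> borel_measurable M"
    unfolding measurable_cong_sets[OF sets_M refl]
    by (intro measurable_restrict_space1 borel_measurable_continuous_onI assms)
  ultimately show ?thesis using sqi_bounded[OF fin] by blast
qed

lemma closure_cont_continuous:
  assumes "continuous_on UNIV \<phi>" "bounded (range \<phi>)"
  shows "\<phi> \<in> L2_closure_cont M"
  unfolding L2_closure_cont_def using sqi_continuous[OF assms] assms
  by (auto intro!: exI[of _ \<phi>] simp: l2n_def)

lemma closure_cont_add:
  assumes f: "f \<in> L2_closure_cont M" and g: "g \<in> L2_closure_cont M"
  shows "(\<lambda>x. f x + g x) \<in> L2_closure_cont M"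
proof -
  have "\<exists>\<phi>. continuous_on UNIV \<phi> \<and> bounded (range \<phi>) \<and> l2n M (\<lambda>x. f x + g x - \<phi> x) < \<eta>"
    if "\<eta> > 0" for \<eta>
  proof -
    from that have h: "\<eta> / 2 > 0" by simp
    obtain a where a: "continuous_on UNIV a" "bounded (range a)" "l2n M (\<lambda>x. f x - a x) < \<eta> / 2"
      using f h unfolding L2_closure_cont_def by blast
    obtain b where b: "continuous_on UNIV b" "bounded (range b)" "l2n M (\<lambda>x. g x - b x) < \<eta> / 2"
      using g h unfolding L2_closure_cont_def by blast
    have "l2n M (\<lambda>x. (f x - a x) + (g x - b x)) \<le> l2n M (\<lambda>x. f x - a x) + l2n M (\<lambda>x. g x - b x)"
      using f g sqi_continuous[OF a(1,2)] sqi_continuous[OF b(1,2)]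
      by (intro l2n_triangle sqi_diff) (auto simp: L2_closure_cont_def)
    then have "l2n M (\<lambda>x. f x + g x - (a x + b x)) < \<eta>"
      using a b by (simp add: algebra_simps)
    then show ?thesis using a b
      by (intro exI[of _ "\<lambda>x. a x + b x"] conjI continuous_intros bounded_plus_comp) auto
  qed
  then show ?thesis using f g by (auto simp: L2_closure_cont_def intro: sqi_add)
qed

lemma closure_cont_limit:
  assumes f: "\<And>n. f n \<in> L2_closure_cont M" and g: "g \<in> square_integrable M"
    and lim: "(\<lambda>n. l2n M (\<lambda>x. f n x - g x)) \<longlonglongrightarrow> 0"
  shows "g \<in> L2_closure_cont M"
proof -
  have "\<exists>\<phi>. continuous_on UNIV \<phi> \<and> bounded (range \<phi>) \<and> l2n M (\<lambda>x. g x - \<phi> x) < \<eta>"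
    if "\<eta> > 0" for \<eta>
  proof -
    from that have h: "\<eta> / 2 > 0" by simp
    have "\<forall>\<^sub>F n in sequentially. l2n M (\<lambda>x. f n x - g x) < \<eta> / 2"
      using order_tendstoD(2)[OF lim h] .
    then obtain n where n: "l2n M (\<lambda>x. f n x - g x) < \<eta> / 2"
      by (meson eventually_sequentially order_refl)
    obtain a where a: "continuous_on UNIV a" "bounded (range a)" "l2n M (\<lambda>x. f n x - a x) < \<eta> / 2"
      using f[of n] h unfolding L2_closure_cont_def by blast
    have "l2n M (\<lambda>x. g x - a x) \<le> l2n M (\<lambda>x. g x - f n x) + l2n M (\<lambda>x. f n x - a x)"
      using f[of n] g sqi_continuous[OF a(1,2)]
      by (intro l2n_triangle_diff) (auto simp: L2_closure_cont_def)
    then show ?thesis using a n l2n_minus_commute[of M g "f n"] by (intro exI[of _ a]) auto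
  qed
  then show ?thesis using g by (auto simp: L2_closure_cont_def)
qed

lemma closure_cont_cmult:
  assumes f: "f \<in> L2_closure_cont M"
  shows "(\<lambda>x. c * f x) \<in> L2_closure_cont M"
proof -
  have "\<exists>\<phi>. continuous_on UNIV \<phi> \<and> bounded (range \<phi>) \<and> l2n M (\<lambda>x. c * f x - \<phi> x) < \<eta>"
    if "\<eta> > 0" for \<eta>
  proof -
    from that have h: "\<eta> / (cmod c + 1) > 0" by (simp add: add_nonneg_pos)
    obtain a where a: "continuous_on UNIV a" "bounded (range a)"
        "l2n M (\<lambda>x. f x - a x) < \<eta> / (cmod c + 1)"
      using f h unfolding L2_closure_cont_def by blast
    have "l2n M (\<lambda>x. c * f x - c * a x) = cmod c * l2n M (\<lambda>x. f x - a x)"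
      by (simp add: l2n_cmult[symmetric] algebra_simps)
    also have "\<dots> \<le> cmod c * (\<eta> / (cmod c + 1))"
      using a by (intro mult_left_mono) auto
    also have "\<dots> < \<eta>" using that by (simp add: pos_divide_less_eq add_nonneg_pos distrib_left)
    finally have "l2n M (\<lambda>x. c * f x - c * a x) < \<eta>" .
    moreover have "bounded (range (\<lambda>x. c * a x))"
      using bounded_linear_image[OF a(2) bounded_linear_mult_right[of c]] by (simp add: image_image)
    ultimately show ?thesis using a
      by (intro exI[of _ "\<lambda>x. c * a x"] conjI continuous_intros) auto
  qed
  then show ?thesis using f by (auto simp: L2_closure_cont_def intro: sqi_cmult)
qed

lemma closure_cont_sum:
  "(\<And>i. i \<in> I \<Longrightarrow> f i \<in> L2_closure_cont M) \<Longrightarrow> (\<lambda>x. \<Sum>i\<in>I. f i x) \<in> L2_closure_cont M"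
proof (induction I rule: infinite_finite_induct)
  case (insert i I)
  then show ?case using closure_cont_add[of "f i" "\<lambda>x. \<Sum>i\<in>I. f i x"] by simp
qed (auto intro!: closure_cont_continuous)

lemma closure_cont_cong:
  assumes f: "f \<in> L2_closure_cont M" and eq: "\<And>x. x \<in> space M \<Longrightarrow> f x = g x"
  shows "g \<in> L2_closure_cont M"
proof -
  have "f \<in> square_integrable M" using f by (simp add: L2_closure_cont_def)
  moreover have "g \<in> borel_measurable M"
    using sqi_measurable[OF calculation] eq by (simp cong: measurable_cong)
  ultimately have "g \<in> square_integrable M" using eq by (intro sqi_cong_AE[of f M g] AE_I2)
  moreover have "l2n M (\<lambda>x. g x - \<phi> x) = l2n M (\<lambda>x. f x - \<phi> x)" for \<phi>
    unfolding l2n_def using eq by (intro arg_cong[where f = sqrt] Bochner_Integration.integral_cong) auto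
  ultimately show ?thesis using f by (auto simp: L2_closure_cont_def)
qed

lemma sqi_indicator: "A \<in> sets M \<Longrightarrow> (indicator A :: 'a \<Rightarrow> complex) \<in> square_integrable M"
  by (rule sqi_bounded[OF fin, where B = 1]) (auto simp: indicator_def)

lemma finite_integrable_const: "integrable M (\<lambda>x. c::real)"
  using finite_measure.integrable_const[OF fin] .

lemma closure_cont_open:
  assumes U: "open U"
  shows "(indicator (U \<inter> S) :: 'a \<Rightarrow> complex) \<in> L2_closure_cont M"
proof -
  have sp: "space M = S" using sets_eq_imp_space_eq[OF sets_M] by (simp add: space_restrict_space)
  have mU: "U \<inter> S \<in> sets M"
    unfolding sets_M sets_restrict_space using U by auto
  show ?thesis
  \<comment> \<open>The distance to the empty set is \<open>0\<close> by convention, so the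
    approximants below would all vanish for \<open>U = UNIV\<close>.\<close>
  proof (cases "U = UNIV")
    case True
    have "(\<lambda>_. 1) \<in> L2_closure_cont M" by (rule closure_cont_continuous) (auto intro: continuous_intros)
    then show ?thesis by (rule closure_cont_cong) (simp add: True sp)
  next
    case False
    \<comment> \<open>Continuous functions that increase to the indicator of \<open>U\<close>: at a
      point of \<open>U\<close> the distance to the complement is positive, and the value is
      \<open>1\<close> for large \<open>n\<close>.\<close>
    define \<phi> where "\<phi> n x = complex_of_real (min 1 (real n * infdist x (- U)))" for n x
    have bd: "cmod (\<phi> n x) \<le> 1" for n x by (simp add: \<phi>_def infdist_nonneg)
    have c: "continuous_on UNIV (\<phi> n)" for n
      unfolding \<phi>_def by (intro continuous_intros continuous_on_infdist)
    have b: "bounded (range (\<phi> n))" for n using bd by (auto simp: bounded_iff)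
    show ?thesis
    proof (rule closure_cont_limit[OF closure_cont_continuous[OF c b] sqi_indicator[OF mU]])
      show "(\<lambda>n. l2n M (\<lambda>x. \<phi> n x - indicator (U \<inter> S) x)) \<longlonglongrightarrow> 0"
      proof (rule l2n_dominated_convergence[where w = "\<lambda>_. 2"])
        show "\<phi> n \<in> borel_measurable M" for n by (intro sqi_measurable sqi_continuous c b)
        show "(indicator (U \<inter> S) :: 'a \<Rightarrow> complex) \<in> borel_measurable M" using mU by simp
        show "integrable M (\<lambda>x. 2\<^sup>2::real)" by (rule finite_integrable_const)
        show "(\<lambda>n. \<phi> n x) \<longlonglongrightarrow> indicator (U \<inter> S) x" if x: "x \<in> space M" for x
        proof (cases "x \<in> U")
          case True
          then have "infdist x (- U) \<noteq> 0"
            using in_closed_iff_infdist_zero[of "- U" x] U False by auto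
          then have pos: "infdist x (- U) > 0" using infdist_nonneg[of x "- U"] by linarith
          obtain N :: nat where N: "1 / infdist x (- U) \<le> real N" using real_arch_simple by blast
          have "\<phi> n x = 1" if "n \<ge> N" for n
          proof -
            have "1 / infdist x (- U) \<le> real n" using N that by linarith
            then have "1 \<le> real n * infdist x (- U)" using pos by (simp add: field_simps)
            then show ?thesis by (simp add: \<phi>_def)
          qed
          then have "\<forall>\<^sub>F n in sequentially. \<phi> n x = 1"
            by (auto simp: eventually_sequentially)
          then show ?thesis using True x sp by (simp add: tendsto_eventually)
        next
          case False
          then have "\<phi> n x = 0" for n by (simp add: \<phi>_def infdist_zero)
          then show ?thesis using False by simp
        qed
        show "cmod (\<phi> n x - indicator (U \<inter> S) x) \<le> 2" for n x
          using norm_triangle_ineq4[of "\<phi> n x" "indicator (U \<inter> S) x"] bd[of n x]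
          by (auto simp: indicator_def split: if_splits)
      qed
    qed
  qed
qed

text \<open>Dynkin's theorem: the traces of open sets on \<open>S\<close> are stable under
  intersection and generate the sigma-algebra, complements are handled by linearity and disjoint
  unions by dominated convergence.\<close>

lemma closure_cont_sets:
  assumes A: "A \<in> sets M"
  shows "(indicator A :: 'a \<Rightarrow> complex) \<in> L2_closure_cont M"
proof -
  have sp: "space M = S" using sets_eq_imp_space_eq[OF sets_M] by (simp add: space_restrict_space)
  let ?G = "{U \<inter> S | U. open U}"
  have gen: "sets M = sigma_sets S ?G"
  proof -
    have "sets M = (\<inter>) S ` sigma_sets UNIV (Collect open)"
      unfolding sets_M sets_restrict_space by (simp add: borel_def)
    also have "\<dots> = sigma_sets S ((\<inter>) S ` Collect open)"
      using S by (intro sigma_sets_Int) (auto simp: borel_def)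
    also have "(\<inter>) S ` Collect open = ?G" by auto
    finally show ?thesis .
  qed
  show ?thesis
  proof (rule sigma_sets_induct_disjoint[of ?G S A])
    show "Int_stable ?G"
    proof (rule Int_stableI)
      fix a b assume "a \<in> ?G" "b \<in> ?G"
      then obtain U V where "open U" "a = U \<inter> S" "open V" "b = V \<inter> S" by blast
      then have "open (U \<inter> V)" "a \<inter> b = (U \<inter> V) \<inter> S" by auto
      then show "a \<inter> b \<in> ?G" by blast
    qed
    show "A \<in> sigma_sets S ?G" using A gen by simp
    show "(indicator A :: 'a \<Rightarrow> complex) \<in> L2_closure_cont M" if "A \<in> ?G" for A
      using that closure_cont_open by auto
    show "(indicator {} :: 'a \<Rightarrow> complex) \<in> L2_closure_cont M"
      using closure_cont_continuous[of "\<lambda>_. 0"] by (simp add: indicator_def[abs_def])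
    show "(indicator (S - A) :: 'a \<Rightarrow> complex) \<in> L2_closure_cont M"
      if "A \<in> sigma_sets S ?G" "(indicator A :: 'a \<Rightarrow> complex) \<in> L2_closure_cont M" for A
    proof -
      have "(\<lambda>x. 1 + (- 1) * indicator A x) \<in> L2_closure_cont M"
        by (intro closure_cont_add closure_cont_cmult that(2)) (auto intro!: closure_cont_continuous)
      then show ?thesis by (rule closure_cont_cong) (simp add: sp indicator_def)
    qed
    show "(indicator (\<Union>(range A)) :: 'a \<Rightarrow> complex) \<in> L2_closure_cont M"
      if dis: "disjoint_family A" and r: "range A \<subseteq> sigma_sets S ?G"
        and ind: "\<And>i. (indicator (A i) :: 'a \<Rightarrow> complex) \<in> L2_closure_cont M" for A :: "nat \<Rightarrow> 'a set"
    proof (rule closure_cont_limit)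
      have mA: "A i \<in> sets M" for i using r gen by auto
      then have mU: "\<Union>(range A) \<in> sets M" by blast
      show "(indicator (\<Union>(range A)) :: 'a \<Rightarrow> complex) \<in> square_integrable M" by (rule sqi_indicator[OF mU])
      show "(\<lambda>x. \<Sum>i<n. indicator (A i) x) \<in> L2_closure_cont M" for n
        by (intro closure_cont_sum ind)
      have sum: "(\<Sum>i<n. indicator (A i) x) = (indicator (\<Union>i<n. A i) x :: complex)" for n x
        using dis by (subst indicator_UN_disjoint) (auto simp: disjoint_family_on_def)
      show "(\<lambda>n. l2n M (\<lambda>x. (\<Sum>i<n. indicator (A i) x) - indicator (\<Union>(range A)) x)) \<longlonglongrightarrow> 0"
        unfolding sum
      proof (rule l2n_dominated_convergence[where w = "\<lambda>_. 1"])
        show "(\<lambda>n. indicator (\<Union>i<n. A i) x) \<longlonglongrightarrow> (indicator (\<Union>(range A)) x :: complex)" for x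
          by (rule LIMSEQ_indicator_UN)
      qed (use mA mU in \<open>auto simp: indicator_def finite_integrable_const\<close>)
    qed
  qed auto
qed

text \<open>Simple functions dominated by \<open>2 * cmod (f x)\<close> converge to \<open>f\<close>
  in \<open>L2\<close>. The set \<open>S\<close> is left general because this is needed on the ball,
  for Parseval, and on the product of two spheres, for completeness of the harmonics.\<close>

lemma L2_approx_continuous:
  assumes f: "f \<in> square_integrable M" and "\<eta> > 0"
  obtains \<phi> where "continuous_on UNIV \<phi>" "bounded (range \<phi>)" "l2n M (\<lambda>x. f x - \<phi> x) < \<eta>"
proof -
  obtain F where F: "\<And>i. simple_function M (F i)" "\<And>x. x \<in> space M \<Longrightarrow> (\<lambda>i. F i x) \<longlonglongrightarrow> f x"
      "\<And>i x. x \<in> space M \<Longrightarrow> cmod (F i x) \<le> 2 * cmod (f x)"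
    using borel_measurable_implies_sequence_metric[OF sqi_measurable[OF f], of 0] by fastforce
  have "f \<in> L2_closure_cont M"
  proof (rule closure_cont_limit[OF _ f])
    show "F i \<in> L2_closure_cont M" for i
    proof (rule closure_cont_cong)
      show "(\<lambda>x. \<Sum>y\<in>F i ` space M. y * indicator (F i -` {y} \<inter> space M) x) \<in> L2_closure_cont M"
        using simple_functionD(2)[OF F(1)]
        by (intro closure_cont_sum closure_cont_cmult closure_cont_sets) auto
      show "(\<Sum>y\<in>F i ` space M. y * indicator (F i -` {y} \<inter> space M) x) = F i x" if x: "x \<in> space M" for x
      proof -
        have "(\<Sum>y\<in>F i ` space M. y * indicator (F i -` {y} \<inter> space M) x)
            = (\<Sum>y\<in>F i ` space M. if y = F i x then F i x else 0)"
          using x by (intro sum.cong) (auto simp: indicator_def)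
        also have "\<dots> = F i x" using simple_functionD(1)[OF F(1)] x by simp
        finally show ?thesis .
      qed
    qed
    show "(\<lambda>n. l2n M (\<lambda>x. F n x - f x)) \<longlonglongrightarrow> 0"
    proof (rule l2n_dominated_convergence[where w = "\<lambda>x. 3 * cmod (f x)"])
      show "integrable M (\<lambda>x. (3 * cmod (f x))\<^sup>2)"
        using sqi_integrable[OF f] by (simp add: power_mult_distrib)
      show "F n \<in> borel_measurable M" for n using F(1) by (rule borel_measurable_simple_function)
      show "cmod (F n x - f x) \<le> 3 * cmod (f x)" if "x \<in> space M" for n x
        using F(3)[OF that, of n] norm_triangle_ineq4[of "F n x" "f x"] by linarith
    qed (use F sqi_measurable[OF f] in auto)
  qed
  then show ?thesis using that \<open>\<eta> > 0\<close> unfolding L2_closure_cont_def by blast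
qed

end

section \<open>The Fourier transform of square-integrable functions on the ball\<close>

text \<open>Written as a product over the coordinates, so that its Fourier transform factorises into
  characteristic functions of the standard normal distribution.\<close>

definition gauss :: "R3 \<Rightarrow> real" where
  "gauss u = (\<Prod>b\<in>Basis. std_normal_density (u \<bullet> b))"

text \<open>At once the normalisation of the unitary Fourier transform and the value of
  \<open>gauss\<close> at \<open>0\<close>; this is the source of \<open>fconst\<^sup>2\<close> in
  \<open>gauss_kernel\<close>.\<close>

definition fconst :: real where "fconst = (2 * pi) powr (- 3 / 2)"

lemma fconst_pos [simp]: "fconst > 0"
  by (simp add: fconst_def)

lemma fconst_nonzero [simp]: "fconst \<noteq> 0"
  using fconst_pos by linarith

lemma gauss_eq: "gauss u = fconst * exp (- (norm u)\<^sup>2 / 2)"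
proof -
  have "gauss u = (1 / sqrt (2 * pi)) ^ 3 * (\<Prod>b\<in>Basis. exp (- (u \<bullet> b)\<^sup>2 / 2))"
    unfolding gauss_def std_normal_density_def by (subst prod.distrib) simp
  also have "(\<Prod>b\<in>Basis. exp (- (u \<bullet> b)\<^sup>2 / 2)) = exp (\<Sum>b\<in>Basis. - (u \<bullet> b)\<^sup>2 / 2)"
    by (simp add: exp_sum)
  also have "(\<Sum>b\<in>Basis. - (u \<bullet> b)\<^sup>2 / 2) = - (norm u)\<^sup>2 / 2"
    unfolding power2_norm_eq_inner euclidean_inner[of u u]
    by (simp add: sum_divide_distrib sum_negf power2_eq_square)
  also have "(1 / sqrt (2 * pi)) ^ 3 = fconst"
  proof -
    have "1 / sqrt (2 * pi) = (2 * pi) powr (- 1 / 2)"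
      by (simp add: powr_half_sqrt powr_minus_divide)
    then have "(1 / sqrt (2 * pi)) ^ 3 = ((2 * pi) powr (- 1 / 2)) powr (real 3)"
      by (simp add: powr_realpow)
    then show ?thesis by (simp add: fconst_def powr_powr)
  qed
  finally show ?thesis .
qed

lemma gauss_nonneg [simp]: "0 \<le> gauss u"
  by (simp add: gauss_eq less_imp_le)

text \<open>Lebesgue measure is the image of the product measure over the basis, so that the
  integral of a product of functions of one coordinate each is the product of the integrals.\<close>

lemma
  fixes t :: R3
  shows gauss_fourier_integrable:
      "integrable lborel (\<lambda>u. complex_of_real (gauss u) * exp (\<i> * complex_of_real (t \<bullet> u)))"
    and gauss_fourier: "(LINT u|lborel. complex_of_real (gauss u) * exp (\<i> * complex_of_real (t \<bullet> u)))
      = complex_of_real (exp (- (norm t)\<^sup>2 / 2))"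
proof -
  let ?PM = "Pi\<^sub>M (Basis::R3 set) (\<lambda>_. lborel :: real measure)"
  interpret P: product_sigma_finite "\<lambda>_::R3. lborel :: real measure" by standard
  define g where "g b s = complex_of_real (std_normal_density s) * exp (\<i> * complex_of_real ((t \<bullet> b) * s))"
    for b :: R3 and s :: real
  have int_g: "integrable lborel (g b)" for b
  proof (rule Bochner_Integration.integrable_bound[OF integrable_normal_density[of 1 0]])
    show "g b \<in> borel_measurable lborel"
      unfolding g_def by measurable
  qed (auto simp: g_def norm_mult)
  have val_g: "integral\<^sup>L lborel (g b) = complex_of_real (exp (- (t \<bullet> b)\<^sup>2 / 2))" for b
  proof -
    have "char std_normal_distribution (t \<bullet> b) = integral\<^sup>L lborel (g b)"
      unfolding char_def g_def
      by (subst integral_density) (auto simp: scaleR_conv_of_real)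
    then show ?thesis by (simp add: char_std_normal_distribution)
  qed
  have eq: "complex_of_real (gauss u) * exp (\<i> * complex_of_real (t \<bullet> u)) = (\<Prod>b\<in>Basis. g b (u \<bullet> b))" for u
  proof -
    have "exp (\<i> * complex_of_real (t \<bullet> u)) = (\<Prod>b\<in>Basis. exp (\<i> * complex_of_real ((t \<bullet> b) * (u \<bullet> b))))"
      by (simp add: euclidean_inner[of t u] exp_sum[symmetric] sum_distrib_left)
    then show ?thesis by (simp add: g_def gauss_def prod.distrib)
  qed
  have comp: "(\<Sum>b\<in>Basis. f b *\<^sub>R b) \<bullet> c = f c" if "c \<in> Basis" for f :: "R3 \<Rightarrow> real" and c
    using that by (simp add: inner_sum_left inner_Basis if_distrib cong: if_cong)
  have meas: "(\<lambda>u::R3. \<Prod>b\<in>Basis. g b (u \<bullet> b)) \<in> borel_measurable borel"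
    unfolding g_def by measurable
  have meas2: "(\<lambda>f. \<Sum>b\<in>Basis. f b *\<^sub>R b) \<in> measurable ?PM borel"
    by measurable
  have "integrable ?PM (\<lambda>f. \<Prod>b\<in>Basis. g b (f b))"
    by (rule P.product_integrable_prod) (auto intro: int_g)
  then have "integrable ?PM (\<lambda>f. \<Prod>b\<in>Basis. g b ((\<Sum>b\<in>Basis. f b *\<^sub>R b) \<bullet> b))"
    by (simp add: comp)
  then show "integrable lborel (\<lambda>u. complex_of_real (gauss u) * exp (\<i> * complex_of_real (t \<bullet> u)))"
    unfolding eq by (subst lborel_eq, subst integrable_distr_eq[OF meas2 meas])
  have "integral\<^sup>L lborel (\<lambda>u. \<Prod>b\<in>Basis. g b (u \<bullet> b))
      = integral\<^sup>L ?PM (\<lambda>f. \<Prod>b\<in>Basis. g b ((\<Sum>b\<in>Basis. f b *\<^sub>R b) \<bullet> b))"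
    by (subst lborel_eq, subst integral_distr[OF meas2 meas]) simp
  also have "\<dots> = integral\<^sup>L ?PM (\<lambda>f. \<Prod>b\<in>Basis. g b (f b))"
    by (simp add: comp)
  also have "\<dots> = (\<Prod>b\<in>Basis. integral\<^sup>L lborel (g b))"
    by (rule P.product_integral_prod) (auto intro: int_g)
  also have "\<dots> = complex_of_real (\<Prod>b\<in>Basis. exp (- (t \<bullet> b)\<^sup>2 / 2))"
    by (simp add: val_g)
  also have "(\<Prod>b\<in>Basis. exp (- (t \<bullet> b)\<^sup>2 / 2)) = exp (\<Sum>b\<in>Basis. - (t \<bullet> b)\<^sup>2 / 2)"
    by (simp add: exp_sum)
  also have "(\<Sum>b\<in>Basis. - (t \<bullet> b)\<^sup>2 / 2) = - (norm t)\<^sup>2 / 2"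
    unfolding power2_norm_eq_inner euclidean_inner[of t t]
    by (simp add: sum_divide_distrib sum_negf power2_eq_square)
  finally show "(LINT u|lborel. complex_of_real (gauss u) * exp (\<i> * complex_of_real (t \<bullet> u)))
      = complex_of_real (exp (- (norm t)\<^sup>2 / 2))"
    unfolding eq .
qed

lemma gauss_measurable [measurable]: "gauss \<in> borel_measurable borel"
  unfolding gauss_def by measurable

lemma gauss_integrable: "integrable lborel gauss"
  using gauss_fourier_integrable[of 0] by (simp add: complex_of_real_integrable_eq)

lemma gauss_integral: "integral\<^sup>L lborel gauss = 1"
proof -
  have "complex_of_real (integral\<^sup>L lborel gauss) = 1"
    using gauss_fourier[of 0] by simp
  then show ?thesis by simp
qed

lemma lborel_integral_affine:
  fixes f :: "R3 \<Rightarrow> 'b::{banach, second_countable_topology}"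
  assumes [measurable]: "f \<in> borel_measurable borel" and "c > 0"
  shows "integral\<^sup>L lborel f = c ^ 3 *\<^sub>R (LINT u|lborel. f (t + c *\<^sub>R u))"
proof -
  have "integral\<^sup>L lborel f = integral\<^sup>L (density (distr lborel borel (\<lambda>u. t + c *\<^sub>R u)) (\<lambda>_. ennreal (c ^ 3))) f"
    using lborel_affine[of c t] assms by simp
  also have "\<dots> = (LINT u|distr lborel borel (\<lambda>u. t + c *\<^sub>R u). c ^ 3 *\<^sub>R f u)"
    by (rule integral_density) (use assms in auto)
  also have "\<dots> = (LINT u|lborel. c ^ 3 *\<^sub>R f (t + c *\<^sub>R u))"
    by (rule integral_distr) auto
  finally show ?thesis by simp
qed

text \<open>The kernel whose positivity and unit mass drive both Plancherel and Parseval.\<close>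

lemma gauss_kernel:
  fixes w :: R3
  assumes "e > 0"
  shows "(LINT \<xi>|lborel. exp (\<i> * complex_of_real (w \<bullet> \<xi>)) * complex_of_real (exp (- (e * norm \<xi>)\<^sup>2 / 2)))
     = complex_of_real (gauss ((1 / e) *\<^sub>R w) / (e ^ 3 * fconst\<^sup>2))"
proof -
  let ?f = "\<lambda>u::R3. complex_of_real (gauss u) * exp (\<i> * complex_of_real (((1 / e) *\<^sub>R w) \<bullet> u))"
  have "complex_of_real (exp (- (norm ((1 / e) *\<^sub>R w))\<^sup>2 / 2)) = integral\<^sup>L lborel ?f"
    by (rule gauss_fourier[symmetric])
  also have "\<dots> = e ^ 3 *\<^sub>R (LINT u|lborel. ?f (0 + e *\<^sub>R u))"
    by (intro lborel_integral_affine assms) measurable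
  also have "(\<lambda>u. ?f (0 + e *\<^sub>R u)) = (\<lambda>u. complex_of_real fconst * (exp (\<i> * complex_of_real (w \<bullet> u)) * complex_of_real (exp (- (e * norm u)\<^sup>2 / 2))))"
    using assms by (intro ext) (simp add: gauss_eq)
  finally have "complex_of_real (exp (- (norm ((1 / e) *\<^sub>R w))\<^sup>2 / 2)) = complex_of_real (e ^ 3 * fconst) *
      (LINT \<xi>|lborel. exp (\<i> * complex_of_real (w \<bullet> \<xi>)) * complex_of_real (exp (- (e * norm \<xi>)\<^sup>2 / 2)))"
    by (simp add: scaleR_conv_of_real)
  then have "complex_of_real (gauss ((1 / e) *\<^sub>R w)) = complex_of_real fconst * (complex_of_real (e ^ 3 * fconst) *
      (LINT \<xi>|lborel. exp (\<i> * complex_of_real (w \<bullet> \<xi>)) * complex_of_real (exp (- (e * norm \<xi>)\<^sup>2 / 2))))"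
    unfolding gauss_eq of_real_mult by (rule arg_cong)
  moreover have "complex_of_real (e ^ 3 * fconst) \<noteq> 0" using assms fconst_pos by auto
  ultimately show ?thesis
    using assms by (simp add: field_simps power2_eq_square del: mult_minus_left)
qed

lemma gauss_weight_integrable:
  assumes "e > 0"
  shows "integrable lborel (\<lambda>\<xi>::R3. exp (- (e * norm \<xi>)\<^sup>2 / 2))"
proof -
  have "integrable (density (distr lborel borel (\<lambda>u::R3. 0 + e *\<^sub>R u)) (\<lambda>_. ennreal (\<bar>e\<bar> ^ DIM(R3)))) gauss"
    using gauss_integrable lborel_affine[of e "0::R3"] assms by (simp del: add_0)
  then have "integrable lborel (\<lambda>u. e ^ 3 *\<^sub>R gauss (0 + e *\<^sub>R u))"
    using assms by (subst (asm) integrable_density) (auto simp: integrable_distr_eq)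
  then have "integrable lborel (\<lambda>u. (1 / (e ^ 3 * fconst)) * (e ^ 3 * gauss (0 + e *\<^sub>R u)))"
    by (intro integrable_mult_right) simp
  moreover have "(1 / (e ^ 3 * fconst)) * (e ^ 3 * gauss (0 + e *\<^sub>R u)) = exp (- (e * norm u)\<^sup>2 / 2)" for u
    using assms fconst_pos by (simp add: gauss_eq)
  ultimately show ?thesis by simp
qed

text \<open>A kernel bounded by \<open>1\<close> keeps the double integral absolutely convergent. It
  is applied to the exponential kernel and to its conjugate.\<close>

lemma Fubini_kernel:
  fixes f v :: "R3 \<Rightarrow> complex" and k :: "R3 \<Rightarrow> R3 \<Rightarrow> complex"
  assumes f: "integrable lborel f" and v: "integrable lborel v"
    and k: "(\<lambda>(x, y). k x y) \<in> borel_measurable borel" and kb: "\<And>x y. cmod (k x y) \<le> 1"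
  shows "(LINT x|lborel. f x * (LINT y|lborel. k x y * v y)) = (LINT y|lborel. (LINT x|lborel. f x * k x y) * v y)"
proof -
  have [measurable]: "f \<in> borel_measurable borel" "v \<in> borel_measurable borel"
    using borel_measurable_integrable[OF f] borel_measurable_integrable[OF v] by auto
  have k'[measurable]: "(\<lambda>p. k (fst p) (snd p)) \<in> borel_measurable (borel \<Otimes>\<^sub>M borel)"
    using k by (simp add: borel_prod case_prod_beta')
  have k1: "(\<lambda>y. k x y) \<in> borel_measurable borel" for x
    using measurable_compose[OF measurable_Pair1' k', of x] by simp
  have int: "integrable (lborel \<Otimes>\<^sub>M lborel) (\<lambda>(x, y). f x * k x y * v y)"
  proof (rule lborel_pair.Fubini_integrable)
    show "(\<lambda>(x, y). f x * k x y * v y) \<in> borel_measurable (lborel \<Otimes>\<^sub>M lborel)"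
      by (simp add: case_prod_beta') measurable
    have kv: "integrable lborel (\<lambda>y. k x y * v y)" for x
      by (rule Bochner_Integration.integrable_bound[OF v])
         (use k1[of x] kb in \<open>auto simp: norm_mult intro!: AE_I2 mult_left_le_one_le\<close>)
    then show "AE x in lborel. integrable lborel (\<lambda>y. case (x, y) of (x, y) \<Rightarrow> f x * k x y * v y)"
      by (simp add: mult.assoc)
    show "integrable lborel (\<lambda>x. LINT y|lborel. norm (case (x, y) of (x, y) \<Rightarrow> f x * k x y * v y))"
    proof (rule Bochner_Integration.integrable_bound)
      show "integrable lborel (\<lambda>x. cmod (f x) * (LINT y|lborel. cmod (v y)))"
        using f by simp
      show "(\<lambda>x. LINT y|lborel. norm (case (x, y) of (x, y) \<Rightarrow> f x * k x y * v y)) \<in> borel_measurable lborel"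
        by simp measurable
      have "(LINT y|lborel. cmod (f x * k x y * v y)) \<le> cmod (f x) * (LINT y|lborel. cmod (v y))" for x
      proof -
        have "(LINT y|lborel. cmod (f x * k x y * v y)) = (LINT y|lborel. cmod (f x) * cmod (k x y * v y))"
          by (simp add: norm_mult mult.assoc)
        also have "\<dots> = cmod (f x) * (LINT y|lborel. cmod (k x y * v y))" by simp
        also have "\<dots> \<le> cmod (f x) * (LINT y|lborel. cmod (v y))"
          using kv[of x] v kb
          by (intro mult_left_mono integral_mono integrable_norm) (auto simp: norm_mult intro!: mult_left_le_one_le)
        finally show ?thesis .
      qed
      then show "AE x in lborel. norm (LINT y|lborel. norm (case (x, y) of (x, y) \<Rightarrow> f x * k x y * v y))
          \<le> norm (cmod (f x) * (LINT y|lborel. cmod (v y)))"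
        by (intro AE_I2) simp
    qed
  qed
  have "(LINT y|lborel. (LINT x|lborel. f x * k x y * v y)) = (LINT x|lborel. (LINT y|lborel. f x * k x y * v y))"
    by (rule lborel_pair.Fubini_integral[OF int])
  moreover have "(LINT y|lborel. f x * k x y * v y) = f x * (LINT y|lborel. k x y * v y)" for x
    by (simp add: mult.assoc)
  ultimately show ?thesis by simp
qed

text \<open>The transform as an absolutely convergent integral, with the normalisation of
  \<open>fourier_truncated\<close>. On functions supported in the ball it is the concrete function
  behind \<open>L2_fourier\<close>.\<close>

definition ftr :: "(R3 \<Rightarrow> complex) \<Rightarrow> R3 \<Rightarrow> complex" where
  "ftr f \<xi> = complex_of_real fconst * (LINT x|lborel. exp (- (\<i> * complex_of_real (x \<bullet> \<xi>))) * f x)"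

text \<open>Vanishing outside the ball is demanded at every point, not almost everywhere; since the
  ball has finite volume, these functions are also integrable.\<close>

definition ball_fun :: "(R3 \<Rightarrow> complex) \<Rightarrow> bool" where
  "ball_fun f \<longleftrightarrow> f \<in> square_integrable lborel \<and> (\<forall>x. x \<notin> ball 0 1 \<longrightarrow> f x = 0)"

lemma ball_fun_sqi: "ball_fun f \<Longrightarrow> f \<in> square_integrable lborel"
  by (simp add: ball_fun_def)

lemma ball_fun_measurable: "ball_fun f \<Longrightarrow> f \<in> borel_measurable borel"
  using sqi_measurable[of f lborel] by (simp add: ball_fun_def)

lemma ball_fun_diff: "ball_fun f \<Longrightarrow> ball_fun g \<Longrightarrow> ball_fun (\<lambda>x. f x - g x)"
  by (simp add: ball_fun_def sqi_diff)

lemma integrable_ball_const: "integrable lborel (\<lambda>x::R3. c * indicator (ball 0 1) x :: real)"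
  using emeasure_lborel_ball_finite[of "0::R3" 1] by (intro integrable_mult_right integrable_real_indicator) auto

lemma ball_fun_integrable:
  assumes f: "ball_fun f"
  shows "integrable lborel f"
proof (rule Bochner_Integration.integrable_bound)
  show "integrable lborel (\<lambda>x. 1 * indicator (ball 0 1) x + (cmod (f x))\<^sup>2)"
    using integrable_ball_const[of 1] sqi_integrable[OF ball_fun_sqi[OF f]] by (intro Bochner_Integration.integrable_add)
  have "a \<le> 1 + a\<^sup>2" for a :: real
  proof -
    have "0 \<le> (a - 1/2) * (a - 1/2)" by simp
    then have "0 \<le> a\<^sup>2 - a + 1/4" by (simp add: power2_eq_square algebra_simps)
    then show ?thesis by linarith
  qed
  then have "cmod (f x) \<le> indicator (ball 0 1) x + (cmod (f x))\<^sup>2" for x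
    using f by (cases "x \<in> ball 0 1") (auto simp: ball_fun_def)
  then show "AE x in lborel. norm (f x) \<le> norm (1 * indicator (ball 0 1) x + (cmod (f x))\<^sup>2)"
    by (intro AE_I2) (simp add: abs_of_nonneg)
qed (use ball_fun_measurable[OF f] in simp)

section \<open>The Fourier integral and its Gaussian regularisation\<close>

lemma fourier_integrand:
  assumes "integrable lborel f"
  shows "integrable lborel (\<lambda>x::R3. exp (- (\<i> * complex_of_real (x \<bullet> \<xi>))) * f x)"
proof (rule Bochner_Integration.integrable_bound[OF assms])
  have [measurable]: "f \<in> borel_measurable borel" using borel_measurable_integrable[OF assms] by simp
  show "(\<lambda>x. exp (- (\<i> * complex_of_real (x \<bullet> \<xi>))) * f x) \<in> borel_measurable lborel" by measurable
qed (simp add: norm_mult)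

lemma ftr_bound:
  shows "cmod (ftr f \<xi>) \<le> fconst * (LINT x|lborel. cmod (f x))"
proof -
  have "cmod (LINT x|lborel. exp (- (\<i> * complex_of_real (x \<bullet> \<xi>))) * f x)
      \<le> (LINT x|lborel. cmod (exp (- (\<i> * complex_of_real (x \<bullet> \<xi>))) * f x))"
    by (rule integral_norm_bound)
  then show ?thesis
    unfolding ftr_def norm_mult using fconst_pos by (simp add: mult_left_mono abs_of_pos)
qed

lemma ftr_measurable:
  assumes [measurable]: "f \<in> borel_measurable borel"
  shows "ftr f \<in> borel_measurable borel"
proof -
  have [measurable]: "(\<lambda>p::R3 \<times> R3. snd p \<bullet> fst p) \<in> borel_measurable (borel \<Otimes>\<^sub>M borel)"
    unfolding borel_prod by (intro borel_measurable_continuous_onI continuous_intros)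
  have "(\<lambda>(\<xi>, x::R3). exp (- (\<i> * complex_of_real (x \<bullet> \<xi>))) * f x) \<in> borel_measurable (borel \<Otimes>\<^sub>M lborel)"
    by (simp add: case_prod_beta') measurable
  from lborel.borel_measurable_lebesgue_integral[OF this]
  show ?thesis unfolding ftr_def[abs_def] by measurable
qed

lemma ftr_diff:
  assumes "integrable lborel f" "integrable lborel g"
  shows "ftr (\<lambda>x. f x - g x) \<xi> = ftr f \<xi> - ftr g \<xi>"
  unfolding ftr_def using fourier_integrand[OF assms(1)] fourier_integrand[OF assms(2)]
  by (simp add: right_diff_distrib)

lemma cnj_ftr:
  "cnj (ftr f \<xi>) = complex_of_real fconst * (LINT x|lborel. cnj (f x) * exp (\<i> * complex_of_real (x \<bullet> \<xi>)))"
proof -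
  have "cnj (LINT x|lborel. exp (- (\<i> * complex_of_real (x \<bullet> \<xi>))) * f x)
     = (LINT x|lborel. cnj (exp (- (\<i> * complex_of_real (x \<bullet> \<xi>))) * f x))"
    by (rule Bochner_Integration.integral_cnj[symmetric])
  then show ?thesis by (simp add: ftr_def exp_cnj mult.commute)
qed

lemma cnj_measurable [measurable]: "cnj \<in> borel_measurable borel"
  by (intro borel_measurable_continuous_onI continuous_intros)

lemma inner_pair_measurable [measurable]:
  "(\<lambda>p::R3 \<times> R3. fst p \<bullet> snd p) \<in> borel_measurable borel"
  by (intro borel_measurable_continuous_onI continuous_intros)

text \<open>The product of two transforms need not be known to be integrable yet; the Gaussian
  factor makes Fubini applicable. Carrying out the frequency integral produces
  \<open>gauss_kernel\<close>, an approximate identity at scale \<open>e\<close>, so the right-hand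
  side pairs \<open>f\<close> with a mollified \<open>r\<close>.\<close>

lemma regularized_parseval:
  assumes f: "integrable lborel f" and r: "integrable lborel r" and e: "e > 0"
  shows "(LINT \<xi>|lborel. ftr f \<xi> * (cnj (ftr r \<xi>) * complex_of_real (exp (- (e * norm \<xi>)\<^sup>2 / 2))))
    = (LINT x|lborel. f x * (LINT u|lborel. cnj (r (x + e *\<^sub>R u)) * complex_of_real (gauss u)))"
proof -
  have [measurable]: "f \<in> borel_measurable borel" "r \<in> borel_measurable borel"
    using borel_measurable_integrable[OF f] borel_measurable_integrable[OF r] by auto
  note ftr_measurable[of r, measurable]
  define w where "w \<xi> = complex_of_real (exp (- (e * norm \<xi>)\<^sup>2 / 2))" for \<xi> :: R3
  have w: "integrable lborel w"
    unfolding w_def using gauss_weight_integrable[OF e] by (simp only: complex_of_real_integrable_eq)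
  have [measurable]: "w \<in> borel_measurable borel" using borel_measurable_integrable[OF w] by simp
  define v where "v \<xi> = cnj (ftr r \<xi>) * w \<xi>" for \<xi>
  have v: "integrable lborel v"
  proof (rule Bochner_Integration.integrable_bound)
    show "integrable lborel (\<lambda>\<xi>. complex_of_real (fconst * (LINT x|lborel. cmod (r x))) * w \<xi>)"
      using w by (rule integrable_mult_right)
    show "v \<in> borel_measurable lborel" unfolding v_def by measurable
    show "AE \<xi> in lborel. norm (v \<xi>) \<le> norm (complex_of_real (fconst * (LINT x|lborel. cmod (r x))) * w \<xi>)"
      unfolding v_def norm_mult complex_mod_cnj norm_of_real
      using ftr_bound[of r] by (intro AE_I2 mult_right_mono order_trans[OF _ abs_ge_self]) auto
  qed
  define k where "k x \<xi> = exp (- (\<i> * complex_of_real (x \<bullet> \<xi>)))" for x \<xi> :: R3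
  have ck: "cnj (k y \<xi>) = exp (\<i> * complex_of_real (y \<bullet> \<xi>))" for y \<xi>
    by (simp add: k_def exp_cnj)
  have k: "(\<lambda>(x, y). k x y) \<in> borel_measurable borel"
    unfolding k_def case_prod_beta' by measurable
  have k2: "(\<lambda>(x, y). cnj (k x y)) \<in> borel_measurable borel"
    unfolding k_def case_prod_beta' by measurable
  have kw: "integrable lborel (\<lambda>\<xi>. k x \<xi> * w \<xi>)" for x
    using fourier_integrand[OF w, of x] by (simp add: k_def inner_commute)
  have inner: "(LINT \<xi>|lborel. k x \<xi> * v \<xi>)
      = (LINT u|lborel. cnj (r (x + e *\<^sub>R u)) * complex_of_real (gauss u)) / complex_of_real fconst" for x
  proof -
    have "(LINT \<xi>|lborel. k x \<xi> * v \<xi>)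
        = complex_of_real fconst * (LINT \<xi>|lborel. (LINT y|lborel. cnj (r y) * cnj (k y \<xi>)) * (k x \<xi> * w \<xi>))"
      unfolding v_def cnj_ftr ck[symmetric]
      by (subst integral_mult_right_zero[symmetric]) (simp only: mult_ac)
    also have "(LINT \<xi>|lborel. (LINT y|lborel. cnj (r y) * cnj (k y \<xi>)) * (k x \<xi> * w \<xi>))
        = (LINT y|lborel. cnj (r y) * (LINT \<xi>|lborel. cnj (k y \<xi>) * (k x \<xi> * w \<xi>)))"
      by (rule Fubini_kernel[symmetric, OF _ kw k2]) (use r in \<open>auto simp: k_def\<close>)
    also have "(\<lambda>y. (LINT \<xi>|lborel. cnj (k y \<xi>) * (k x \<xi> * w \<xi>)))
        = (\<lambda>y. complex_of_real (gauss ((1 / e) *\<^sub>R (y - x)) / (e ^ 3 * fconst\<^sup>2)))"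
    proof
      fix y
      have "cnj (k y \<xi>) * (k x \<xi> * w \<xi>) = exp (\<i> * complex_of_real ((y - x) \<bullet> \<xi>)) * w \<xi>" for \<xi>
        unfolding ck unfolding k_def mult.assoc[symmetric] exp_add[symmetric]
        by (simp add: inner_diff_left right_diff_distrib)
      then show "(LINT \<xi>|lborel. cnj (k y \<xi>) * (k x \<xi> * w \<xi>))
          = complex_of_real (gauss ((1 / e) *\<^sub>R (y - x)) / (e ^ 3 * fconst\<^sup>2))"
        unfolding w_def by (simp only: gauss_kernel[OF e])
    qed
    \<comment> \<open>The substitution \<open>y = x + e *\<^sub>R u\<close> produces the factor
      \<open>e ^ 3\<close> that cancels the one in the kernel.\<close>
    also have "(LINT y|lborel. cnj (r y) * complex_of_real (gauss ((1 / e) *\<^sub>R (y - x)) / (e ^ 3 * fconst\<^sup>2)))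
        = e ^ 3 *\<^sub>R (LINT u|lborel. cnj (r (x + e *\<^sub>R u)) * complex_of_real (gauss ((1 / e) *\<^sub>R (x + e *\<^sub>R u - x)) / (e ^ 3 * fconst\<^sup>2)))"
      by (rule lborel_integral_affine[OF _ e]) measurable
    also have "\<dots> = (LINT u|lborel. cnj (r (x + e *\<^sub>R u)) * complex_of_real (gauss u)) / complex_of_real (fconst\<^sup>2)"
      using e by (simp add: scaleR_conv_of_real[where 'a = complex])
    finally show ?thesis by (simp add: power2_eq_square)
  qed
  have "(LINT \<xi>|lborel. ftr f \<xi> * v \<xi>) = complex_of_real fconst * (LINT \<xi>|lborel. (LINT x|lborel. f x * k x \<xi>) * v \<xi>)"
    unfolding ftr_def k_def by (subst integral_mult_right_zero[symmetric]) (simp only: mult_ac)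
  also have "(LINT \<xi>|lborel. (LINT x|lborel. f x * k x \<xi>) * v \<xi>) = (LINT x|lborel. f x * (LINT \<xi>|lborel. k x \<xi> * v \<xi>))"
    by (rule Fubini_kernel[symmetric, OF f v k]) (simp add: k_def)
  also have "\<dots> = (LINT x|lborel. f x * (LINT u|lborel. cnj (r (x + e *\<^sub>R u)) * complex_of_real (gauss u))) / complex_of_real fconst"
    unfolding inner by simp
  finally show ?thesis unfolding v_def w_def by simp
qed

lemma norm_integral_le_nn:
  fixes f :: "'a \<Rightarrow> 'b::{banach, second_countable_topology}"
  shows "ennreal (norm (integral\<^sup>L M f)) \<le> (\<integral>\<^sup>+x. ennreal (norm (f x)) \<partial>M)"
  by (cases "integrable M f") (auto intro: integral_norm_bound_ennreal simp: not_integrable_integral_eq)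

text \<open>Bound the product of \<open>cmod (f x)\<close> and
  \<open>cmod (f (x + e *\<^sub>R u))\<close> by half the sum of squares. By translation invariance
  and the unit mass of \<open>gauss\<close>, each half contributes \<open>?R / 2\<close>.
  Nonnegative integrals spare all integrability conditions.\<close>

lemma regularized_plancherel:
  assumes f: "ball_fun f" and e: "e > 0"
  shows "(\<integral>\<^sup>+\<xi>. ennreal ((cmod (ftr f \<xi>))\<^sup>2 * exp (- (e * norm \<xi>)\<^sup>2 / 2)) \<partial>lborel)
    \<le> (\<integral>\<^sup>+x. ennreal ((cmod (f x))\<^sup>2) \<partial>lborel)" (is "?L \<le> ?R")
proof -
  note int = ball_fun_integrable[OF f]
  define h :: ennreal where "h = ennreal (1/2)"
  have h_h: "h + h = 1" unfolding h_def by (subst ennreal_plus[symmetric]) auto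
  have fm [measurable]: "f \<in> borel_measurable borel" by (rule ball_fun_measurable[OF f])
  note ftr_measurable[OF fm, measurable]
  let ?w = "\<lambda>\<xi>::R3. exp (- (e * norm \<xi>)\<^sup>2 / 2)"
  have int2: "integrable lborel (\<lambda>\<xi>. (cmod (ftr f \<xi>))\<^sup>2 * ?w \<xi>)"
  proof (rule Bochner_Integration.integrable_bound)
    show "integrable lborel (\<lambda>\<xi>. (fconst * (LINT x|lborel. cmod (f x)))\<^sup>2 * ?w \<xi>)"
      using gauss_weight_integrable[OF e] by (rule integrable_mult_right)
    have "(cmod (ftr f \<xi>))\<^sup>2 \<le> (fconst * (LINT x|lborel. cmod (f x)))\<^sup>2" for \<xi>
      using ftr_bound[of f \<xi>] by (intro power_mono) auto
    then show "AE \<xi> in lborel. norm ((cmod (ftr f \<xi>))\<^sup>2 * ?w \<xi>) \<le> norm ((fconst * (LINT x|lborel. cmod (f x)))\<^sup>2 * ?w \<xi>)"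
      by (intro AE_I2) (simp add: mult_right_mono)
  qed simp
  have trans: "(\<integral>\<^sup>+x. ennreal ((cmod (f (x + c)))\<^sup>2) \<partial>lborel) = ?R" for c
  proof -
    have "?R = (\<integral>\<^sup>+x. ennreal ((cmod (f x))\<^sup>2) \<partial>distr lborel borel ((+) c))"
      by (simp only: lborel_distr_plus)
    also have "\<dots> = (\<integral>\<^sup>+x. ennreal ((cmod (f (c + x)))\<^sup>2) \<partial>lborel)"
      by (rule nn_integral_distr) auto
    finally show ?thesis by (simp add: add.commute)
  qed
  have g1: "(\<integral>\<^sup>+u. ennreal (gauss u) \<partial>lborel) = 1"
    by (subst nn_integral_eq_integral[OF gauss_integrable]) (auto simp: gauss_integral)
  have m1 [measurable]: "(\<lambda>p::R3\<times>R3. f (fst p + e *\<^sub>R snd p)) \<in> borel_measurable (borel \<Otimes>\<^sub>M borel)"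
    by measurable
  have "?L = ennreal (LINT \<xi>|lborel. (cmod (ftr f \<xi>))\<^sup>2 * ?w \<xi>)"
    by (rule nn_integral_eq_integral[OF int2]) simp
  also have "\<dots> = ennreal (cmod (complex_of_real (LINT \<xi>|lborel. (cmod (ftr f \<xi>))\<^sup>2 * ?w \<xi>)))"
    by (simp add: abs_of_nonneg)
  also have "complex_of_real (LINT \<xi>|lborel. (cmod (ftr f \<xi>))\<^sup>2 * ?w \<xi>)
      = (LINT \<xi>|lborel. ftr f \<xi> * (cnj (ftr f \<xi>) * complex_of_real (?w \<xi>)))"
    by (subst integral_complex_of_real[symmetric], intro Bochner_Integration.integral_cong refl)
       (simp only: of_real_mult complex_norm_square mult.assoc)
  also have "\<dots> = (LINT x|lborel. f x * (LINT u|lborel. cnj (f (x + e *\<^sub>R u)) * complex_of_real (gauss u)))"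
    by (rule regularized_parseval[OF int int e])
  also have "ennreal (cmod \<dots>) \<le> (\<integral>\<^sup>+x. ennreal (cmod (f x * (LINT u|lborel. cnj (f (x + e *\<^sub>R u)) * complex_of_real (gauss u)))) \<partial>lborel)"
    by (rule norm_integral_le_nn)
  also have "\<dots> \<le> (\<integral>\<^sup>+x. (\<integral>\<^sup>+u. h * (ennreal ((cmod (f x))\<^sup>2) * ennreal (gauss u)) + h * (ennreal ((cmod (f (x + e *\<^sub>R u)))\<^sup>2) * ennreal (gauss u)) \<partial>lborel) \<partial>lborel)"
  proof (rule nn_integral_mono)
    fix x :: R3
    have "ennreal (cmod (f x * (LINT u|lborel. cnj (f (x + e *\<^sub>R u)) * complex_of_real (gauss u))))
        \<le> ennreal (cmod (f x)) * (\<integral>\<^sup>+u. ennreal (cmod (cnj (f (x + e *\<^sub>R u)) * complex_of_real (gauss u))) \<partial>lborel)"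
      unfolding norm_mult[of "f x"] ennreal_mult[OF norm_ge_zero norm_ge_zero]
      using norm_integral_le_nn[of lborel "\<lambda>u. cnj (f (x + e *\<^sub>R u)) * complex_of_real (gauss u)"]
      by (intro mult_left_mono) simp_all
    also have "\<dots> = (\<integral>\<^sup>+u. ennreal (cmod (f x)) * ennreal (cmod (cnj (f (x + e *\<^sub>R u)) * complex_of_real (gauss u))) \<partial>lborel)"
      by (rule nn_integral_cmult[symmetric]) measurable
    also have "\<dots> \<le> (\<integral>\<^sup>+u. h * (ennreal ((cmod (f x))\<^sup>2) * ennreal (gauss u)) + h * (ennreal ((cmod (f (x + e *\<^sub>R u)))\<^sup>2) * ennreal (gauss u)) \<partial>lborel)"
    proof (rule nn_integral_mono)
      fix u :: R3
      have base: "a * (b * g) \<le> 1/2 * (a\<^sup>2 * g) + 1/2 * (b\<^sup>2 * g)" if "0 \<le> g" for a b g :: real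
        using mult_right_mono[OF sum_squares_bound[of a b] that] by (simp add: algebra_simps)
      have half: "ennreal (1/2) * (ennreal a * ennreal b) = ennreal (1/2 * (a * b))" if "0 \<le> a" "0 \<le> b" for a b :: real
        using that by (simp add: ennreal_mult[symmetric] del: ennreal_half)
      from base have "cmod (f x) * (cmod (f (x + e *\<^sub>R u)) * gauss u)
          \<le> 1/2 * ((cmod (f x))\<^sup>2 * gauss u) + 1/2 * ((cmod (f (x + e *\<^sub>R u)))\<^sup>2 * gauss u)"
        by simp
      from ennreal_leI[OF this] have "ennreal (cmod (f x) * (cmod (f (x + e *\<^sub>R u)) * gauss u))
          \<le> ennreal (1/2) * (ennreal ((cmod (f x))\<^sup>2) * ennreal (gauss u)) + ennreal (1/2) * (ennreal ((cmod (f (x + e *\<^sub>R u)))\<^sup>2) * ennreal (gauss u))"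
        unfolding half[OF zero_le_power2 gauss_nonneg] by (subst (asm) ennreal_plus) (auto intro!: mult_nonneg_nonneg)
      then show "ennreal (cmod (f x)) * ennreal (cmod (cnj (f (x + e *\<^sub>R u)) * complex_of_real (gauss u)))
         \<le> h * (ennreal ((cmod (f x))\<^sup>2) * ennreal (gauss u)) + h * (ennreal ((cmod (f (x + e *\<^sub>R u)))\<^sup>2) * ennreal (gauss u))"
        by (simp add: norm_mult ennreal_mult h_def)
    qed
    finally show "ennreal (cmod (f x * (LINT u|lborel. cnj (f (x + e *\<^sub>R u)) * complex_of_real (gauss u)))) \<le> \<dots>" .
  qed
  also have "\<dots> = (\<integral>\<^sup>+x. h * ennreal ((cmod (f x))\<^sup>2) + (\<integral>\<^sup>+u. h * (ennreal ((cmod (f (x + e *\<^sub>R u)))\<^sup>2) * ennreal (gauss u)) \<partial>lborel) \<partial>lborel)"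
    by (subst nn_integral_add) (auto simp: nn_integral_cmult g1)
  also have "\<dots> = h * ?R + (\<integral>\<^sup>+x. (\<integral>\<^sup>+u. h * (ennreal ((cmod (f (x + e *\<^sub>R u)))\<^sup>2) * ennreal (gauss u)) \<partial>lborel) \<partial>lborel)"
    by (subst nn_integral_add) (auto simp: nn_integral_cmult)
  also have "(\<integral>\<^sup>+x. (\<integral>\<^sup>+u. h * (ennreal ((cmod (f (x + e *\<^sub>R u)))\<^sup>2) * ennreal (gauss u)) \<partial>lborel) \<partial>lborel)
      = (\<integral>\<^sup>+u. (\<integral>\<^sup>+x. h * (ennreal ((cmod (f (x + e *\<^sub>R u)))\<^sup>2) * ennreal (gauss u)) \<partial>lborel) \<partial>lborel)"
    by (rule lborel_pair.Fubini'[symmetric]) measurable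
  also have "\<dots> = (\<integral>\<^sup>+u. h * ?R * ennreal (gauss u) \<partial>lborel)"
    by (simp add: nn_integral_cmult nn_integral_multc trans mult.assoc)
  also have "\<dots> = h * ?R"
    by (simp add: nn_integral_cmult g1)
  also have "h * ?R + h * ?R = ?R"
    by (simp add: distrib_right[symmetric] h_h)
  finally show ?thesis .
qed

text \<open>The Gaussian weights increase to \<open>1\<close> as \<open>e\<close> decreases to
  \<open>0\<close>, so monotone convergence yields the inequality and with it square-integrability.
  Equality follows later from \<open>parseval\<close>.\<close>

lemma
  assumes f: "ball_fun f"
  shows ftr_sqi: "ftr f \<in> square_integrable lborel"
    and plancherel_le: "l2n lborel (ftr f) \<le> l2n lborel f"
proof -
  have fm [measurable]: "f \<in> borel_measurable borel" by (rule ball_fun_measurable[OF f])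
  note ftr_measurable[OF fm, measurable]
  let ?R = "\<integral>\<^sup>+x. ennreal ((cmod (f x))\<^sup>2) \<partial>lborel"
  let ?w = "\<lambda>n \<xi>. exp (- (1 / real (Suc n) * norm \<xi>)\<^sup>2 / 2) :: real"
  have "(\<lambda>n. \<integral>\<^sup>+\<xi>. ennreal ((cmod (ftr f \<xi>))\<^sup>2 * ?w n \<xi>) \<partial>lborel) \<longlonglongrightarrow> (\<integral>\<^sup>+\<xi>. ennreal ((cmod (ftr f \<xi>))\<^sup>2) \<partial>lborel)"
  proof (rule nn_integral_LIMSEQ)
    show "incseq (\<lambda>n \<xi>. ennreal ((cmod (ftr f \<xi>))\<^sup>2 * ?w n \<xi>))"
    proof (intro incseq_SucI le_funI ennreal_leI mult_left_mono)
      fix n and \<xi> :: R3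
      have "(1 / real (Suc (Suc n)) * norm \<xi>)\<^sup>2 \<le> (1 / real (Suc n) * norm \<xi>)\<^sup>2"
        by (intro power_mono mult_right_mono) (auto simp: field_simps)
      then show "?w n \<xi> \<le> ?w (Suc n) \<xi>" by simp
    qed auto
    have "(\<lambda>n. (1 / real (Suc n) * norm \<xi>)\<^sup>2) \<longlonglongrightarrow> (0 * norm \<xi>)\<^sup>2" for \<xi> :: R3
      by (intro tendsto_power tendsto_mult tendsto_const LIMSEQ_Suc[OF lim_1_over_n])
    then have "(\<lambda>n. ?w n \<xi>) \<longlonglongrightarrow> exp (- 0 / 2)" for \<xi> :: R3
      by (intro tendsto_intros) auto
    from tendsto_mult[OF tendsto_const this]
    show "(\<lambda>n. ennreal ((cmod (ftr f \<xi>))\<^sup>2 * ?w n \<xi>)) \<longlonglongrightarrow> ennreal ((cmod (ftr f \<xi>))\<^sup>2)" for \<xi>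
      by (intro tendsto_ennrealI) simp
  qed simp
  then have le: "(\<integral>\<^sup>+\<xi>. ennreal ((cmod (ftr f \<xi>))\<^sup>2) \<partial>lborel) \<le> ?R"
    by (rule LIMSEQ_le_const2) (intro exI[of _ 0] allI impI regularized_plancherel[OF f], simp)
  have R: "?R = ennreal ((l2n lborel f)\<^sup>2)"
    unfolding l2n_sq by (rule nn_integral_eq_integral[OF sqi_integrable[OF ball_fun_sqi[OF f]]]) simp
  have int: "integrable lborel (\<lambda>\<xi>. (cmod (ftr f \<xi>))\<^sup>2)"
    using le_less_trans[OF le] R by (intro integrableI_nonneg) auto
  then show "ftr f \<in> square_integrable lborel" by (simp add: square_integrable_def)
  have "ennreal ((l2n lborel (ftr f))\<^sup>2) \<le> ennreal ((l2n lborel f)\<^sup>2)"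
    using le unfolding R l2n_sq[of _ "ftr f"] by (simp add: nn_integral_eq_integral[OF int])
  then show "l2n lborel (ftr f) \<le> l2n lborel f"
    using power2_le_imp_le[of "l2n lborel (ftr f)" "l2n lborel f"] by simp
qed

section \<open>Restriction to the ball and extension by zero\<close>

lemma sets_ball_measure: "sets ball_measure = sets (restrict_space borel (ball 0 1))"
  unfolding ball_measure_def by (rule sets_restrict_space_cong) simp

lemma space_ball_measure [simp]: "space ball_measure = ball 0 1"
  unfolding ball_measure_def by (simp add: space_restrict_space)

lemma finite_ball_measure: "finite_measure ball_measure"
  unfolding ball_measure_def
  by (intro finite_measure_restrict_space finite_measureI)
     (use emeasure_lborel_ball_finite[of "0::R3" 1] in \<open>auto simp: emeasure_restrict_space space_restrict_space\<close>)

lemma ball_integral: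
  fixes f :: "R3 \<Rightarrow> 'b::{banach, second_countable_topology}"
  shows "integral\<^sup>L ball_measure f = (LINT x|lborel. indicator (ball 0 1) x *\<^sub>R f x)"
  unfolding ball_measure_def by (rule integral_restrict_space) simp

lemma ball_integrable:
  fixes f :: "R3 \<Rightarrow> 'b::{banach, second_countable_topology}"
  shows "integrable ball_measure f \<longleftrightarrow> integrable lborel (\<lambda>x. indicator (ball 0 1) x *\<^sub>R f x)"
  unfolding ball_measure_def by (rule integrable_restrict_space) simp

text \<open>The indicator acts by \<open>scaleR\<close> because integrals over a restricted space
  are expressed in that form.\<close>

definition extend0 :: "(R3 \<Rightarrow> complex) \<Rightarrow> R3 \<Rightarrow> complex" where
  "extend0 f x = indicator (ball 0 1) x *\<^sub>R f x"

lemma ball_fun_extend0: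
  assumes "f \<in> square_integrable ball_measure"
  shows "ball_fun (extend0 f)"
proof -
  have m: "extend0 f \<in> borel_measurable lborel"
    using sqi_measurable[OF assms] unfolding ball_measure_def extend0_def[abs_def]
    by (subst (asm) borel_measurable_restrict_space_iff) auto
  have "integrable lborel (\<lambda>x. (cmod (extend0 f x))\<^sup>2)"
  proof -
    have "(\<lambda>x. (cmod (extend0 f x))\<^sup>2) = (\<lambda>x. indicator (ball 0 1) x *\<^sub>R (cmod (f x))\<^sup>2)"
      by (auto simp: extend0_def indicator_def)
    then show ?thesis using sqi_integrable[OF assms] unfolding ball_integrable by simp
  qed
  then show ?thesis using m by (auto simp: ball_fun_def square_integrable_def extend0_def)
qed

lemma l2i_extend0: "l2i lborel (extend0 f) (extend0 g) = l2i ball_measure f g"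
  unfolding l2i_def ball_integral extend0_def
  by (intro Bochner_Integration.integral_cong) (auto simp: indicator_def)

lemma l2n_extend0: "l2n lborel (extend0 f) = l2n ball_measure f"
  unfolding l2n_def ball_integral extend0_def
  by (intro arg_cong[where f = sqrt] Bochner_Integration.integral_cong) (auto simp: indicator_def)

lemma ball_fun_extend0_eq: "ball_fun f \<Longrightarrow> extend0 f = f"
  by (auto simp: ball_fun_def extend0_def indicator_def)

lemma ball_fun_sqi_ball:
  assumes "ball_fun f"
  shows "f \<in> square_integrable ball_measure"
proof -
  have "f \<in> borel_measurable ball_measure"
    unfolding ball_measure_def using ball_fun_measurable[OF assms] by (intro measurable_restrict_space1) simp
  moreover have "(\<lambda>x. indicator (ball 0 1) x *\<^sub>R (cmod (f x))\<^sup>2) = (\<lambda>x. (cmod (f x))\<^sup>2)"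
    using assms by (intro ext) (auto simp: ball_fun_def indicator_def)
  then have "integrable ball_measure (\<lambda>x. (cmod (f x))\<^sup>2)"
    unfolding ball_integrable using sqi_integrable[OF ball_fun_sqi[OF assms]] by simp
  ultimately show ?thesis by (simp add: square_integrable_def)
qed

text \<open>The zero extension of a continuous function may jump across the sphere and nowhere else;
  mollifications therefore converge to it almost everywhere.\<close>

lemma AE_lborel_not_sphere: "AE x in lborel. (x::R3) \<notin> sphere 0 1"
proof (rule AE_not_in)
  show "sphere (0::R3) 1 \<in> null_sets lborel"
    using negligible_sphere[of "0::R3" 1]
    by (auto simp: null_sets_completion_iff negligible_iff_null_sets negligible_convex_frontier)
qed

text \<open>Let \<open>e\<close> tend to \<open>0\<close> in \<open>regularized_parseval\<close>.
  For bounded \<open>\<phi>\<close>, continuous on the ball, the mollified function is bounded by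
  \<open>B\<close> and converges off the sphere, so dominated convergence applies on both
  sides.\<close>

lemma parseval_continuous:
  assumes f: "ball_fun f" and c: "continuous_on UNIV \<phi>" and b: "bounded (range \<phi>)"
  shows "l2i lborel (ftr f) (ftr (extend0 \<phi>)) = l2i lborel f (extend0 \<phi>)"
proof -
  let ?r = "extend0 \<phi>"
  obtain B where B: "\<And>x. cmod (\<phi> x) \<le> B" using b by (auto simp: bounded_iff)
  have B0: "0 \<le> B" using B[of 0] norm_ge_zero order_trans by blast
  have "\<phi> \<in> borel_measurable ball_measure"
    unfolding ball_measure_def using borel_measurable_continuous_onI[OF c] by (intro measurable_restrict_space1) simp
  then have "\<phi> \<in> square_integrable ball_measure"
    using B by (intro sqi_bounded[OF finite_ball_measure]) auto
  then have r: "ball_fun ?r" by (rule ball_fun_extend0)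
  have rB: "cmod (?r x) \<le> B" for x using B[of x] B0 by (simp add: extend0_def indicator_def)
  have fm [measurable]: "f \<in> borel_measurable borel" by (rule ball_fun_measurable[OF f])
  have rm [measurable]: "?r \<in> borel_measurable borel" by (rule ball_fun_measurable[OF r])
  note ftr_measurable[OF fm, measurable] ftr_measurable[OF rm, measurable]
  have e0: "(\<lambda>n. 1 / real (Suc n)) \<longlonglongrightarrow> 0" by (rule LIMSEQ_Suc[OF lim_1_over_n])
  let ?L = "\<lambda>n. LINT \<xi>|lborel. ftr f \<xi> * (cnj (ftr ?r \<xi>) * complex_of_real (exp (- (1 / real (Suc n) * norm \<xi>)\<^sup>2 / 2)))"
  let ?I = "\<lambda>n x. LINT u|lborel. cnj (?r (x + (1 / real (Suc n)) *\<^sub>R u)) * complex_of_real (gauss u)"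
  have L: "?L \<longlonglongrightarrow> (LINT \<xi>|lborel. ftr f \<xi> * cnj (ftr ?r \<xi>))"
  proof (rule integral_dominated_convergence)
    \<comment> \<open>This majorant is where the Plancherel inequality enters: it puts both
      transforms into \<open>L2\<close>.\<close>
    show "integrable lborel (\<lambda>\<xi>. cmod (ftr f \<xi>) * cmod (ftr ?r \<xi>))"
      by (intro sqi_cmod_mult ftr_sqi f r)
    have w: "(\<lambda>n. exp (- (1 / real (Suc n) * norm \<xi>)\<^sup>2 / 2)) \<longlonglongrightarrow> 1" for \<xi> :: R3
    proof -
      have "(\<lambda>n. exp (- (1 / real (Suc n) * norm \<xi>)\<^sup>2 / 2)) \<longlonglongrightarrow> exp (- (0 * norm \<xi>)\<^sup>2 / 2)"
        by (intro tendsto_exp tendsto_divide tendsto_minus tendsto_power tendsto_mult tendsto_const e0) auto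
      then show ?thesis by simp
    qed
    show "AE \<xi> in lborel. (\<lambda>n. ftr f \<xi> * (cnj (ftr ?r \<xi>) * complex_of_real (exp (- (1 / real (Suc n) * norm \<xi>)\<^sup>2 / 2))))
        \<longlonglongrightarrow> ftr f \<xi> * cnj (ftr ?r \<xi>)"
    proof (rule AE_I2)
      fix \<xi> :: R3
      have "(\<lambda>n. ftr f \<xi> * (cnj (ftr ?r \<xi>) * complex_of_real (exp (- (1 / real (Suc n) * norm \<xi>)\<^sup>2 / 2))))
        \<longlonglongrightarrow> ftr f \<xi> * (cnj (ftr ?r \<xi>) * complex_of_real 1)"
        by (intro tendsto_mult tendsto_const tendsto_of_real w)
      then show "(\<lambda>n. ftr f \<xi> * (cnj (ftr ?r \<xi>) * complex_of_real (exp (- (1 / real (Suc n) * norm \<xi>)\<^sup>2 / 2))))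
        \<longlonglongrightarrow> ftr f \<xi> * cnj (ftr ?r \<xi>)" by simp
    qed
    show "AE \<xi> in lborel. norm (ftr f \<xi> * (cnj (ftr ?r \<xi>) * complex_of_real (exp (- (1 / real (Suc n) * norm \<xi>)\<^sup>2 / 2))))
        \<le> cmod (ftr f \<xi>) * cmod (ftr ?r \<xi>)" for n
      unfolding norm_mult complex_mod_cnj norm_of_real
      by (intro AE_I2 mult_left_mono mult_left_le) auto
  qed measurable
  have I: "(\<lambda>n. ?I n x) \<longlonglongrightarrow> cnj (?r x)" if x: "x \<notin> sphere 0 1" for x
  proof -
    have "isCont ?r x"
    proof (cases "x \<in> ball 0 1")
      case True
      have "\<forall>\<^sub>F y in nhds x. ?r y = \<phi> y"
        using True by (auto simp: eventually_nhds extend0_def intro!: exI[of _ "ball 0 1"])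
      moreover have "isCont \<phi> x" using c by (simp add: continuous_on_eq_continuous_at)
      ultimately show ?thesis by (simp add: isCont_cong)
    next
      case False
      with x have "x \<in> - cball 0 1" by auto
      then have "\<forall>\<^sub>F y in nhds x. ?r y = 0"
        by (auto simp: eventually_nhds extend0_def indicator_def intro!: exI[of _ "- cball 0 1"])
      then show ?thesis by (simp add: isCont_cong)
    qed
    then have rlim: "(\<lambda>n. ?r (s n)) \<longlonglongrightarrow> ?r x" if "s \<longlonglongrightarrow> x" for s
      using isCont_tendsto_compose that by blast
    have "(\<lambda>n. ?I n x) \<longlonglongrightarrow> (LINT u|lborel. cnj (?r x) * complex_of_real (gauss u))"
    proof (rule integral_dominated_convergence)
      show "integrable lborel (\<lambda>u. B * gauss u)" using gauss_integrable by simp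
      show "AE u in lborel. (\<lambda>n. cnj (?r (x + (1 / real (Suc n)) *\<^sub>R u)) * complex_of_real (gauss u))
          \<longlonglongrightarrow> cnj (?r x) * complex_of_real (gauss u)"
      proof (rule AE_I2)
        fix u :: R3
        have "(\<lambda>n. x + (1 / real (Suc n)) *\<^sub>R u) \<longlonglongrightarrow> x + 0 *\<^sub>R u"
          by (intro tendsto_add tendsto_const tendsto_scaleR e0)
        then show "(\<lambda>n. cnj (?r (x + (1 / real (Suc n)) *\<^sub>R u)) * complex_of_real (gauss u))
          \<longlonglongrightarrow> cnj (?r x) * complex_of_real (gauss u)"
          by (intro tendsto_mult tendsto_cnj tendsto_const rlim) simp
      qed
      show "AE u in lborel. norm (cnj (?r (x + (1 / real (Suc n)) *\<^sub>R u)) * complex_of_real (gauss u)) \<le> B * gauss u" for n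
        using rB by (intro AE_I2) (simp add: norm_mult mult_right_mono)
    qed measurable
    moreover have "(LINT u|lborel. cnj (?r x) * complex_of_real (gauss u)) = cnj (?r x)"
      by (simp add: gauss_integral)
    ultimately show ?thesis by (simp only:)
  qed
  have Ib: "cmod (?I n x) \<le> B" for n x
  proof -
    have "cmod (?I n x) \<le> (LINT u|lborel. cmod (cnj (?r (x + (1 / real (Suc n)) *\<^sub>R u)) * complex_of_real (gauss u)))"
      by (rule integral_norm_bound)
    also have "\<dots> \<le> (LINT u|lborel. B * gauss u)"
    proof (rule integral_mono)
      show i: "integrable lborel (\<lambda>u. B * gauss u)" using gauss_integrable by simp
      show "cmod (cnj (?r (x + (1 / real (Suc n)) *\<^sub>R u)) * complex_of_real (gauss u)) \<le> B * gauss u" for u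
        using rB by (simp add: norm_mult mult_right_mono)
      then show "integrable lborel (\<lambda>u. cmod (cnj (?r (x + (1 / real (Suc n)) *\<^sub>R u)) * complex_of_real (gauss u)))"
        by (intro Bochner_Integration.integrable_bound[OF i] AE_I2) (auto simp: B0)
    qed
    also have "\<dots> = B" by (simp add: gauss_integral)
    finally show ?thesis .
  qed
  have m2: "(\<lambda>p::R3\<times>R3. ?r (fst p + c *\<^sub>R snd p)) \<in> borel_measurable (borel \<Otimes>\<^sub>M borel)" for c
    by measurable
  have Im: "?I n \<in> borel_measurable borel" for n
  proof (rule lborel.borel_measurable_lebesgue_integral)
    note m2[measurable]
    show "(\<lambda>(x, u). cnj (?r (x + (1 / real (Suc n)) *\<^sub>R u)) * complex_of_real (gauss u)) \<in> borel_measurable (borel \<Otimes>\<^sub>M lborel)"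
      by (simp add: case_prod_beta') measurable
  qed
  have R: "(\<lambda>n. LINT x|lborel. f x * ?I n x) \<longlonglongrightarrow> (LINT x|lborel. f x * cnj (?r x))"
  proof (rule integral_dominated_convergence)
    show "integrable lborel (\<lambda>x. cmod (f x) * B)" using ball_fun_integrable[OF f] by simp
    show "AE x in lborel. (\<lambda>n. f x * ?I n x) \<longlonglongrightarrow> f x * cnj (?r x)"
      using AE_lborel_not_sphere by eventually_elim (intro tendsto_mult tendsto_const I)
    show "AE x in lborel. norm (f x * ?I n x) \<le> cmod (f x) * B" for n
      using Ib by (intro AE_I2) (simp add: norm_mult mult_left_mono)
    show "(\<lambda>x. f x * ?I n x) \<in> borel_measurable lborel" for n
      using Im[of n] fm by (intro borel_measurable_times) auto
  qed measurable
  have "?L = (\<lambda>n. LINT x|lborel. f x * ?I n x)"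
    by (intro ext regularized_parseval ball_fun_integrable f r) simp
  then show ?thesis unfolding l2i_def using LIMSEQ_unique[OF L] R by simp
qed

text \<open>Both sides are continuous in \<open>r\<close> for the \<open>L2\<close> norm, the left
  one by the Plancherel inequality, and continuous functions are dense.\<close>

theorem parseval:
  assumes f: "ball_fun f" and r: "ball_fun r"
  shows "l2i lborel (ftr f) (ftr r) = l2i lborel f r"
proof -
  have "cmod (l2i lborel (ftr f) (ftr r) - l2i lborel f r) \<le> \<eta>" if \<eta>: "\<eta> > 0" for \<eta>
  proof -
    \<comment> \<open>Each of the two pairings with the difference \<open>?d\<close> costs at most
      \<open>l2n lborel f * \<delta>\<close>; the added \<open>1\<close> keeps the denominator
      positive.\<close>
    define \<delta> where "\<delta> = \<eta> / (2 * l2n lborel f + 1)"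
    have pos: "2 * l2n lborel f + 1 > 0" using l2n_nonneg[of lborel f] by linarith
    have "\<delta> > 0" using \<eta> pos by (simp add: \<delta>_def)
    then obtain \<phi> where \<phi>: "continuous_on UNIV \<phi>" "bounded (range \<phi>)" "l2n ball_measure (\<lambda>x. r x - \<phi> x) < \<delta>"
      using L2_approx_continuous[OF finite_ball_measure _ sets_ball_measure ball_fun_sqi_ball[OF r], of \<delta>]
      by (metis borel_open open_ball)
    have \<phi>s: "\<phi> \<in> square_integrable ball_measure"
      using sqi_continuous[OF finite_ball_measure _ sets_ball_measure \<phi>(1,2)] by simp
    then have bp: "ball_fun (extend0 \<phi>)" by (rule ball_fun_extend0)
    let ?d = "\<lambda>x. r x - extend0 \<phi> x"
    have d: "ball_fun ?d" by (rule ball_fun_diff[OF r bp])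
    have "?d = extend0 (\<lambda>x. r x - \<phi> x)"
      using ball_fun_extend0_eq[OF r] by (auto simp: extend0_def fun_eq_iff scaleR_diff_right)
    then have nd: "l2n lborel ?d < \<delta>" using \<phi>(3) l2n_extend0 by metis
    have fd: "ftr ?d = (\<lambda>\<xi>. ftr r \<xi> - ftr (extend0 \<phi>) \<xi>)"
      by (intro ext ftr_diff ball_fun_integrable r bp)
    have "l2i lborel (ftr f) (ftr r) - l2i lborel f r
        = l2i lborel (ftr f) (ftr ?d) - l2i lborel f ?d"
      unfolding fd using parseval_continuous[OF f \<phi>(1,2)]
      by (subst l2i_diff_right, use ftr_sqi f r bp in blast, use ftr_sqi f r bp in blast, use ftr_sqi f r bp in blast,
          subst l2i_diff_right, use ball_fun_sqi f r bp in blast, use ball_fun_sqi f r bp in blast,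
          use ball_fun_sqi f r bp in blast) simp
    also have "cmod \<dots> \<le> l2n lborel (ftr f) * l2n lborel (ftr ?d) + l2n lborel f * l2n lborel ?d"
      using cmod_l2i_le[OF ftr_sqi[OF f] ftr_sqi[OF d]] cmod_l2i_le[OF ball_fun_sqi[OF f] ball_fun_sqi[OF d]]
        norm_triangle_ineq4[of "l2i lborel (ftr f) (ftr ?d)" "l2i lborel f ?d"] by linarith
    also have "\<dots> \<le> l2n lborel f * l2n lborel ?d + l2n lborel f * l2n lborel ?d"
      by (intro add_mono mult_mono plancherel_le f d) auto
    also have "\<dots> \<le> (2 * l2n lborel f + 1) * \<delta>"
      using nd mult_left_mono[OF less_imp_le[OF nd], of "l2n lborel f"] \<open>\<delta> > 0\<close> by (simp add: algebra_simps)
    also have "\<dots> = \<eta>" using pos by (simp add: \<delta>_def)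
    finally show ?thesis .
  qed
  then have "cmod (l2i lborel (ftr f) (ftr r) - l2i lborel f r) \<le> 0"
    by (rule field_le_epsilon[of _ 0, simplified]) simp
  then show ?thesis by simp
qed

section \<open>Polynomials in three variables\<close>

lemma monomial3_mult: "monomial3 (a, b, c) x * monomial3 (a', b', c') x = monomial3 (a + a', b + b', c + c') x"
  by (simp add: monomial3_def power_add)

lemma monomial3_in_poly: "a + b + c \<le> n \<Longrightarrow> monomial3 (a, b, c) \<in> poly_space n"
  unfolding poly_space_def by (rule cfun.span_base) auto

lemma monomial3_in_homogeneous: "a + b + c = l \<Longrightarrow> monomial3 (a, b, c) \<in> homogeneous_space l"
  unfolding homogeneous_space_def by (rule cfun.span_base) auto

lemma poly_space_mono: "m \<le> n \<Longrightarrow> poly_space m \<subseteq> poly_space n"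
  unfolding poly_space_def by (rule cfun.span_mono) auto

lemma homogeneous_subset_poly: "homogeneous_space l \<subseteq> poly_space l"
  unfolding poly_space_def homogeneous_space_def by (rule cfun.span_mono) auto

lemma poly_add: "p \<in> poly_space n \<Longrightarrow> q \<in> poly_space n \<Longrightarrow> (\<lambda>x. p x + q x) \<in> poly_space n"
  unfolding poly_space_def using cfun.span_add[of p _ q] by (simp add: plus_fun_def)

lemma poly_cmult: "p \<in> poly_space n \<Longrightarrow> (\<lambda>x. c * p x) \<in> poly_space n"
  unfolding poly_space_def by (rule cfun.span_scale)

lemma poly_zero: "(\<lambda>x. 0) \<in> poly_space n"
  unfolding poly_space_def using cfun.span_zero by (simp add: zero_fun_def)

lemma poly_sum: "(\<And>i. i \<in> I \<Longrightarrow> f i \<in> poly_space n) \<Longrightarrow> (\<lambda>x. \<Sum>i\<in>I. f i x) \<in> poly_space n"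
  by (induction I rule: infinite_finite_induct) (auto intro: poly_zero poly_add)

lemma poly_induct [consumes 1, case_names monomial zero add]:
  assumes "p \<in> poly_space n"
    and mon: "\<And>a b c. a + b + c \<le> n \<Longrightarrow> P (monomial3 (a, b, c))"
    and zero: "P (\<lambda>_. 0)"
    and add: "\<And>c p q. P p \<Longrightarrow> P q \<Longrightarrow> P (\<lambda>x. c * p x + q x)"
  shows "P p"
proof -
  from assms(1)[unfolded poly_space_def]
  have "P p"
  proof (induction rule: cfun.span_induct_alt)
    case base
    then show ?case using zero by (simp add: zero_fun_def)
  next
    case (step c p q)
    then have "P p" using mon by auto
    with step add[of p q c] show ?case by (simp add: plus_fun_def)
  qed
  then show ?thesis .
qed

lemma homogeneous_induct [consumes 1, case_names monomial zero add]:
  assumes "p \<in> homogeneous_space n"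
    and mon: "\<And>a b c. a + b + c = n \<Longrightarrow> P (monomial3 (a, b, c))"
    and zero: "P (\<lambda>_. 0)"
    and add: "\<And>c p q. P p \<Longrightarrow> P q \<Longrightarrow> P (\<lambda>x. c * p x + q x)"
  shows "P p"
proof -
  from assms(1)[unfolded homogeneous_space_def]
  have "P p"
  proof (induction rule: cfun.span_induct_alt)
    case base
    then show ?case using zero by (simp add: zero_fun_def)
  next
    case (step c p q)
    then have "P p" using mon by auto
    with step add[of p q c] show ?case by (simp add: plus_fun_def)
  qed
  then show ?thesis .
qed

lemma poly_mult:
  assumes p: "p \<in> poly_space m" and q: "q \<in> poly_space n"
  shows "(\<lambda>x. p x * q x) \<in> poly_space (m + n)"
  using p
proof (induction rule: poly_induct)
  case (monomial a b c)
  from q show ?case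
  proof (induction rule: poly_induct)
    case (monomial a' b' c')
    then show ?case using \<open>a + b + c \<le> m\<close> unfolding monomial3_mult
      using monomial3_in_poly[of "a + a'" "b + b'" "c + c'" "m + n"] by simp
  next
    case (add k p q)
    have "(\<lambda>x. k * (monomial3 (a, b, c) x * p x) + monomial3 (a, b, c) x * q x) \<in> poly_space (m + n)"
      by (intro poly_add poly_cmult add)
    then show ?case by (simp add: algebra_simps)
  qed (simp add: poly_zero)
next
  case (add k p' q')
  have "(\<lambda>x. k * (p' x * q x) + q' x * q x) \<in> poly_space (m + n)"
    by (intro poly_add poly_cmult add)
  then show ?case by (simp add: algebra_simps)
qed (simp add: poly_zero)

lemma poly_const: "(\<lambda>_. c) \<in> poly_space n"
  using poly_cmult[OF monomial3_in_poly[of 0 0 0 n], of c] by (simp add: monomial3_def)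

lemma poly_coord: "(\<lambda>x. complex_of_real (vec_nth x i)) \<in> poly_space 1"
proof -
  have "(\<lambda>x. complex_of_real (vec_nth x 1)) \<in> poly_space 1"
    "(\<lambda>x. complex_of_real (vec_nth x 2)) \<in> poly_space 1"
    "(\<lambda>x. complex_of_real (vec_nth x 3)) \<in> poly_space 1"
    using monomial3_in_poly[of 1 0 0 1] monomial3_in_poly[of 0 1 0 1] monomial3_in_poly[of 0 0 1 1]
    by (simp_all add: monomial3_def)
  then show ?thesis using exhaust_3[of i] by auto
qed

lemma inner_R3: "x \<bullet> y = (\<Sum>i\<in>UNIV. vec_nth x i * vec_nth y i)" for x y :: R3
  by (simp add: inner_vec_def)

lemma poly_inner: "(\<lambda>x. complex_of_real (x \<bullet> \<xi>)) \<in> poly_space 1"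
proof -
  have "(\<lambda>x. \<Sum>i\<in>UNIV. complex_of_real (vec_nth \<xi> i) * complex_of_real (vec_nth x i)) \<in> poly_space 1"
    by (intro poly_sum poly_cmult poly_coord)
  then show ?thesis by (simp add: inner_R3 mult.commute)
qed

lemma poly_power: "p \<in> poly_space m \<Longrightarrow> (\<lambda>x. p x ^ j) \<in> poly_space (j * m)"
proof (induction j)
  case (Suc j)
  then show ?case using poly_mult[of p m "\<lambda>x. p x ^ j" "j * m"] by simp
qed (simp add: poly_const)

lemma continuous_poly:
  assumes "p \<in> poly_space n"
  shows "continuous_on UNIV p"
  using assms
proof (induction rule: poly_induct)
  case (monomial a b c)
  show ?case unfolding monomial3_def by (simp, intro continuous_intros)
qed (intro continuous_intros; assumption)+

lemma poly_space_bounded_on: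
  assumes "p \<in> poly_space n" and "bounded S"
  obtains B where "\<And>x. x \<in> S \<Longrightarrow> cmod (p x) \<le> B"
proof -
  have "compact (p ` closure S)"
    using assms continuous_poly[OF assms(1)]
    by (intro compact_continuous_image) (auto intro: continuous_on_subset simp: compact_closure)
  then have "bounded (p ` closure S)" by (rule compact_imp_bounded)
  then show ?thesis using that closure_subset[of S] unfolding bounded_iff by (metis imageI subsetD)
qed

section \<open>Homogeneity, derivatives and dimension of polynomial spaces\<close>

lemma homogeneous_scale:
  assumes "p \<in> homogeneous_space l"
  shows "p (t *\<^sub>R x) = complex_of_real t ^ l * p x"
  using assms
proof (induction rule: homogeneous_induct)
  case (monomial a b c)
  then show ?case
    by (auto simp: monomial3_def power_mult_distrib power_add)
qed (auto simp: algebra_simps)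

text \<open>For exponent \<open>0\<close> the truncated difference \<open>a - 1\<close> is again
  \<open>0\<close>, but the factor \<open>of_nat a\<close> makes the term vanish.\<close>

definition monomial_deriv :: "nat \<times> nat \<times> nat \<Rightarrow> 3 \<Rightarrow> R3 \<Rightarrow> complex" where
  "monomial_deriv = (\<lambda>(a, b, c) i x.
     if i = 1 then of_nat a * monomial3 (a - 1, b, c) x
     else if i = 2 then of_nat b * monomial3 (a, b - 1, c) x
     else of_nat c * monomial3 (a, b, c - 1) x)"

lemma monomial_has_deriv:
  "((\<lambda>t. monomial3 (a, b, c) (x + t *\<^sub>R axis i 1)) has_vector_derivative monomial_deriv (a, b, c) i x) (at 0)"
proof -
  have pw: "((\<lambda>t. complex_of_real (k * (y + t) ^ n)) has_vector_derivative
      complex_of_real (k * (real n * y ^ (n - 1)))) (at 0)" for k y :: real and n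
  proof (rule has_vector_derivative_of_real)
    have "((\<lambda>t. (y + t) ^ n) has_field_derivative (real n * y ^ (n - 1))) (at 0)"
      by (rule derivative_eq_intros refl | simp)+
    then show "((\<lambda>t. k * (y + t) ^ n) has_field_derivative (k * (real n * y ^ (n - 1)))) (at 0)"
      by (rule DERIV_cmult)
  qed
  have m1: "monomial3 (a, b, c) x = complex_of_real ((vec_nth x 2 ^ b * vec_nth x 3 ^ c) * vec_nth x 1 ^ a)" for a b c x
    by (simp only: monomial3_def prod.case mult_ac)
  have m2: "monomial3 (a, b, c) x = complex_of_real ((vec_nth x 1 ^ a * vec_nth x 3 ^ c) * vec_nth x 2 ^ b)" for a b c x
    by (simp only: monomial3_def prod.case mult_ac)
  have m3: "monomial3 (a, b, c) x = complex_of_real ((vec_nth x 1 ^ a * vec_nth x 2 ^ b) * vec_nth x 3 ^ c)" for a b c x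
    by (simp only: monomial3_def prod.case)
  consider "i = 1" | "i = 2" | "i = 3" using exhaust_3[of i] by auto
  then show ?thesis
  proof cases
    case 1
    have "of_nat a * monomial3 (a - 1, b, c) x
        = complex_of_real ((vec_nth x 2 ^ b * vec_nth x 3 ^ c) * (real a * vec_nth x 1 ^ (a - 1)))"
      unfolding m1 by (simp add: mult.left_commute[of "of_nat a"])
    with pw[of "vec_nth x 2 ^ b * vec_nth x 3 ^ c" "vec_nth x 1" a] 1
    show ?thesis by (simp add: m1 monomial_deriv_def axis_def mult.left_commute[of "of_nat a"])
  next
    case 2
    have "of_nat b * monomial3 (a, b - 1, c) x
        = complex_of_real ((vec_nth x 1 ^ a * vec_nth x 3 ^ c) * (real b * vec_nth x 2 ^ (b - 1)))"
      unfolding m2 by (simp add: mult.left_commute[of "of_nat b"])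
    with pw[of "vec_nth x 1 ^ a * vec_nth x 3 ^ c" "vec_nth x 2" b] 2
    show ?thesis by (simp add: m2 monomial_deriv_def axis_def mult.left_commute[of "of_nat b"])
  next
    case 3
    have "of_nat c * monomial3 (a, b, c - 1) x
        = complex_of_real ((vec_nth x 1 ^ a * vec_nth x 2 ^ b) * (real c * vec_nth x 3 ^ (c - 1)))"
      unfolding m3 by (simp add: mult.left_commute[of "of_nat c"])
    with pw[of "vec_nth x 1 ^ a * vec_nth x 2 ^ b" "vec_nth x 3" c] 3
    show ?thesis by (simp add: m3 monomial_deriv_def axis_def mult.left_commute[of "of_nat c"])
  qed
qed

lemma dir_deriv_eqI:
  "((\<lambda>t. f (x + t *\<^sub>R v)) has_vector_derivative d) (at 0) \<Longrightarrow> dir_deriv v f x = d"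
  unfolding dir_deriv_def by (rule vector_derivative_at)

lemma monomial_deriv_poly:
  "a + b + c \<le> n \<Longrightarrow> monomial_deriv (a, b, c) i \<in> poly_space n"
  by (cases "i = 1"; cases "i = 2")
     (auto simp: monomial_deriv_def[abs_def] intro!: poly_cmult monomial3_in_poly)

text \<open>The degree bound is not lowered: all that is used is that derivatives remain
  polynomials, hence are continuous and differentiable again.\<close>

lemma
  assumes "p \<in> poly_space n"
  shows poly_has_deriv: "((\<lambda>t. p (x + t *\<^sub>R axis i 1)) has_vector_derivative dir_deriv (axis i 1) p x) (at 0)"
    and poly_deriv_poly: "dir_deriv (axis i 1) p \<in> poly_space n"
proof -
  from assms have "\<exists>q\<in>poly_space n. \<forall>x. ((\<lambda>t. p (x + t *\<^sub>R axis i 1)) has_vector_derivative q x) (at 0)"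
  proof (induction rule: poly_induct)
    case (monomial a b c)
    then show ?case using monomial_has_deriv monomial_deriv_poly by blast
  next
    case zero
    then show ?case by (intro bexI[of _ "\<lambda>_. 0"]) (auto simp: poly_zero)
  next
    case (add c p q)
    then obtain p' q' where *: "p' \<in> poly_space n" "q' \<in> poly_space n"
      "\<And>x. ((\<lambda>t. p (x + t *\<^sub>R axis i 1)) has_vector_derivative p' x) (at 0)"
      "\<And>x. ((\<lambda>t. q (x + t *\<^sub>R axis i 1)) has_vector_derivative q' x) (at 0)" by blast
    then show ?case
      by (intro bexI[of _ "\<lambda>x. c * p' x + q' x"] allI has_vector_derivative_add has_vector_derivative_mult_right
          poly_add poly_cmult)
  qed
  then obtain q where q: "q \<in> poly_space n" "\<And>x. ((\<lambda>t. p (x + t *\<^sub>R axis i 1)) has_vector_derivative q x) (at 0)"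
    by blast
  then have "dir_deriv (axis i 1) p = q" by (intro ext dir_deriv_eqI) auto
  then show "((\<lambda>t. p (x + t *\<^sub>R axis i 1)) has_vector_derivative dir_deriv (axis i 1) p x) (at 0)"
    "dir_deriv (axis i 1) p \<in> poly_space n" using q by auto
qed

text \<open>Euler's identity: by linearity it suffices to count exponents on monomials.\<close>

lemma euler_homogeneous:
  assumes "p \<in> homogeneous_space l"
  shows "(\<Sum>i\<in>UNIV. complex_of_real (vec_nth x i) * dir_deriv (axis i 1) p x) = of_nat l * p x"
proof -
  \<comment> \<open>Membership in \<open>poly_space\<close> is carried through the induction because
    linearity of \<open>dir_deriv\<close> needs differentiability of both summands.\<close>
  from assms have "p \<in> poly_space l \<and> (\<Sum>i\<in>UNIV. complex_of_real (vec_nth x i) * dir_deriv (axis i 1) p x) = of_nat l * p x"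
  proof (induction rule: homogeneous_induct)
    case (monomial a b c)
    have d: "dir_deriv (axis i 1) (monomial3 (a, b, c)) x = monomial_deriv (a, b, c) i x" for i
      by (rule dir_deriv_eqI[OF monomial_has_deriv])
    have 1: "complex_of_real (vec_nth x 1) * (of_nat a * monomial3 (a - 1, b, c) x) = of_nat a * monomial3 (a, b, c) x"
      by (cases a) (simp_all add: monomial3_def mult_ac)
    have 2: "complex_of_real (vec_nth x 2) * (of_nat b * monomial3 (a, b - 1, c) x) = of_nat b * monomial3 (a, b, c) x"
      by (cases b) (simp_all add: monomial3_def mult_ac)
    have 3: "complex_of_real (vec_nth x 3) * (of_nat c * monomial3 (a, b, c - 1) x) = of_nat c * monomial3 (a, b, c) x"
      by (cases c) (simp_all add: monomial3_def mult_ac)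
    have "(\<Sum>i\<in>UNIV. complex_of_real (vec_nth x i) * monomial_deriv (a, b, c) i x)
        = (of_nat a + of_nat b + of_nat c) * monomial3 (a, b, c) x"
      unfolding distrib_right 1[symmetric] 2[symmetric] 3[symmetric] by (simp add: sum_3 monomial_deriv_def)
    then show ?case using monomial unfolding d by (auto simp: monomial3_in_poly)
  next
    case zero
    have "dir_deriv v (\<lambda>_. 0) x = 0" for v by (rule dir_deriv_eqI) auto
    then show ?case by (simp add: poly_zero)
  next
    case (add c p q)
    have "dir_deriv (axis i 1) (\<lambda>x. c * p x + q x) x = c * dir_deriv (axis i 1) p x + dir_deriv (axis i 1) q x" for i
      using add poly_has_deriv[of p l x i] poly_has_deriv[of q l x i]
      by (intro dir_deriv_eqI has_vector_derivative_add has_vector_derivative_mult_right) auto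
    then have "(\<Sum>i\<in>UNIV. complex_of_real (vec_nth x i) * dir_deriv (axis i 1) (\<lambda>x. c * p x + q x) x)
        = c * (\<Sum>i\<in>UNIV. complex_of_real (vec_nth x i) * dir_deriv (axis i 1) p x)
          + (\<Sum>i\<in>UNIV. complex_of_real (vec_nth x i) * dir_deriv (axis i 1) q x)"
      by (simp add: distrib_left sum.distrib sum_distrib_left mult.left_commute)
    then show ?case using add by (auto intro!: poly_add poly_cmult simp: algebra_simps)
  qed
  then show ?thesis by blast
qed

lemma sum_Basis_R3: "(\<Sum>b\<in>(Basis :: R3 set). f b) = (\<Sum>i\<in>UNIV. f (axis i 1))"
proof -
  have "(Basis :: R3 set) = (\<lambda>i. axis i 1) ` UNIV" by (auto simp: Basis_vec_def)
  then have "sum f Basis = sum f ((\<lambda>i. axis i 1) ` UNIV)" by (rule arg_cong)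
  also have "\<dots> = (\<Sum>i\<in>UNIV. f (axis i 1))"
    by (subst sum.reindex) (auto simp: inj_on_def axis_eq_axis)
  finally show ?thesis .
qed

lemma finite_deg: "finite {(a, b, c). a + b + c \<le> (n::nat)}"
proof (rule finite_subset)
  show "{(a, b, c). a + b + c \<le> n} \<subseteq> {..n} \<times> {..n} \<times> {..n}" by auto
qed auto

text \<open>The cube has the right order of growth, and this is what turns a rate
  \<open>n powr (- s)\<close> into the rate \<open>p powr (- s / 3)\<close>.\<close>

lemma poly_dim_le: "poly_dim n \<le> (n + 1) ^ 3"
proof -
  have sub: "{(a, b, c). a + b + c \<le> n} \<subseteq> {..n} \<times> {..n} \<times> {..n}" by auto
  have "poly_dim n \<le> card (monomial3 ` {(a, b, c). a + b + c \<le> n})"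
    unfolding poly_dim_def poly_space_def cfun.dim_span
    by (intro cfun.dim_le_card') (auto intro: finite_deg)
  also have "\<dots> \<le> card {(a, b, c). a + b + c \<le> n}" by (rule card_image_le[OF finite_deg])
  also have "\<dots> \<le> card ({..n} \<times> {..n} \<times> {..n})" by (rule card_mono[OF _ sub]) auto
  also have "\<dots> = (n + 1) ^ 3" by (simp add: card_cartesian_product power3_eq_cube)
  finally show ?thesis .
qed

section \<open>Polynomial approximation of admissible contrasts\<close>

text \<open>Each point outside the essential support has an open neighbourhood on which
  \<open>q\<close> vanishes almost everywhere; Lindeloef's theorem selects countably many of them,
  so the exceptional sets add up to a null set.\<close>

lemma admissible_zero_outside:
  assumes "ess_support q \<subseteq> ball 0 1"
  shows "AE y in lborel. y \<notin> ball 0 1 \<longrightarrow> L2_rep q y = 0"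
proof -
  let ?U = "{U. open U \<and> (AE y in lborel. y \<in> U \<longrightarrow> L2_rep q y = 0)}"
  obtain \<U> where \<U>: "\<U> \<subseteq> ?U" "countable \<U>" "\<Union>\<U> = \<Union>?U"
    using Lindelof[of ?U] by blast
  have "AE y in lborel. \<forall>U\<in>\<U>. y \<in> U \<longrightarrow> L2_rep q y = 0"
    using \<U> by (subst AE_ball_countable) auto
  moreover have "y \<in> \<Union>\<U>" if "y \<notin> ball 0 1" for y
  proof -
    have "y \<notin> ess_support q" using that assms by blast
    then show ?thesis unfolding \<U>(3) ess_support_def by blast
  qed
  ultimately show ?thesis by (auto elim!: eventually_mono)
qed

lemma sqi_lborel_ball:
  assumes "g \<in> square_integrable lborel"
  shows "g \<in> square_integrable ball_measure"
proof -
  have "g \<in> borel_measurable ball_measure"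
    unfolding ball_measure_def using sqi_measurable[OF assms] by (intro measurable_restrict_space1)
  moreover have "integrable ball_measure (\<lambda>x. (cmod (g x))\<^sup>2)"
    unfolding ball_integrable by (rule integrable_mult_indicator[OF _ sqi_integrable[OF assms]]) simp
  ultimately show ?thesis by (simp add: square_integrable_def)
qed

context
  fixes s Cq :: real and q :: "R3 l2"
  assumes q: "q \<in> admissible s Cq"
begin

lemma admissible_L2: "q \<in> L2 lborel"
  using q by (simp add: admissible_def sobolev_def)

lemma admissible_rep_sqi: "L2_rep q \<in> square_integrable lborel"
  using admissible_L2 by simp

lemma admissible_ball_fun: "ball_fun (extend0 (L2_rep q))"
  by (intro ball_fun_extend0 sqi_lborel_ball admissible_rep_sqi)

lemma admissible_extend0: "AE x in lborel. extend0 (L2_rep q) x = L2_rep q x"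
  using admissible_zero_outside[of q] q by (auto simp: admissible_def extend0_def elim!: eventually_mono)

text \<open>A ball of radius at least \<open>1\<close> contains the support, so truncation has no
  effect and the limit in \<open>L2_fourier\<close> is that of an eventually constant
  family.\<close>

lemma fourier_truncated_eq:
  assumes "R \<ge> 1"
  shows "fourier_truncated R (L2_rep q) = ftr (extend0 (L2_rep q))"
proof
  fix \<xi>
  have [measurable]: "L2_rep q \<in> borel_measurable borel"
    using sqi_measurable[OF admissible_rep_sqi] by simp
  have [measurable]: "cball (0::R3) R \<in> sets borel" by simp
  have [measurable]: "extend0 (L2_rep q) \<in> borel_measurable borel"
    by (rule ball_fun_measurable[OF admissible_ball_fun])
  have "(LINT x:cball 0 R|lborel. exp (- (\<i> * complex_of_real (x \<bullet> \<xi>))) * L2_rep q x)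
      = (LINT x|lborel. exp (- (\<i> * complex_of_real (x \<bullet> \<xi>))) * extend0 (L2_rep q) x)"
    unfolding set_lebesgue_integral_def
  proof (rule integral_cong_AE)
    show "AE x in lborel. indicat_real (cball 0 R) x *\<^sub>R (exp (- (\<i> * complex_of_real (x \<bullet> \<xi>))) * L2_rep q x)
        = exp (- (\<i> * complex_of_real (x \<bullet> \<xi>))) * extend0 (L2_rep q) x"
      using admissible_extend0
    proof eventually_elim
      case (elim x)
      show ?case
      proof (cases "x \<in> ball 0 1")
        case True
        with assms have "x \<in> cball 0 R" by auto
        with elim show ?thesis by simp
      next
        case False
        with elim have "L2_rep q x = 0" "extend0 (L2_rep q) x = 0" by (auto simp: extend0_def)
        then show ?thesis by simp
      qed
    qed
  qed measurable
  then show "fourier_truncated R (L2_rep q) \<xi> = ftr (extend0 (L2_rep q)) \<xi>"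
    by (simp add: fourier_truncated_def ftr_def fconst_def)
qed

text \<open>The description is resolved in both directions: the eventually constant integral tends
  to \<open>0\<close> exactly if it is \<open>0\<close>, that is, if \<open>G\<close> is the class
  of the transform.\<close>

lemma L2_fourier_eq: "L2_fourier q = L2_class lborel (ftr (extend0 (L2_rep q)))"
  unfolding L2_fourier_def
proof (rule the_equality)
  let ?F = "ftr (extend0 (L2_rep q))"
  have F: "?F \<in> square_integrable lborel" by (rule ftr_sqi[OF admissible_ball_fun])
  let ?I = "\<lambda>G R. \<integral>\<^sup>+ \<xi>. ennreal ((cmod (fourier_truncated R (L2_rep q) \<xi> - L2_rep G \<xi>))\<^sup>2) \<partial>lborel"
  let ?c = "\<lambda>G. \<integral>\<^sup>+ \<xi>. ennreal ((cmod (?F \<xi> - L2_rep G \<xi>))\<^sup>2) \<partial>lborel"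
  have ev: "\<forall>\<^sub>F R in at_top. ?I G R = ?c G" for G
    using eventually_ge_at_top[of 1] by eventually_elim (simp add: fourier_truncated_eq)
  have c0: "?c G = 0 \<longleftrightarrow> (AE \<xi> in lborel. ?F \<xi> = L2_rep G \<xi>)" if "G \<in> L2 lborel" for G
    using sqi_measurable[OF F] sqi_measurable[OF L2_rep_sqi[OF that]]
    by (subst nn_integral_0_iff_AE) auto
  show "L2_class lborel ?F \<in> L2 lborel \<and> ((?I (L2_class lborel ?F)) \<longlongrightarrow> 0) at_top"
  proof
    show in_L2: "L2_class lborel ?F \<in> L2 lborel" using F by simp
    have "AE \<xi> in lborel. ?F \<xi> = L2_rep (L2_class lborel ?F) \<xi>"
      using L2_rep_class[OF F] by (auto elim!: eventually_mono)
    then have "?c (L2_class lborel ?F) = 0" using c0[OF in_L2] by simp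
    then show "((?I (L2_class lborel ?F)) \<longlongrightarrow> 0) at_top"
      using tendsto_eventually[OF ev[of "L2_class lborel ?F"]] by simp
  qed
  fix G assume G: "G \<in> L2 lborel \<and> ((?I G) \<longlongrightarrow> 0) at_top"
  have "?c G = 0"
    using tendsto_unique[OF _ tendsto_eventually[OF ev[of G]], of 0] G by simp
  then have ae: "AE \<xi> in lborel. ?F \<xi> = L2_rep G \<xi>" using c0 G by simp
  have "L2_class lborel ?F = L2_class lborel (L2_rep G)"
    using ae G by (subst L2_class_eq_iff[OF F]) auto
  then show "G = L2_class lborel ?F" using G by simp
qed

text \<open>Transfers the Sobolev bound from the arbitrary representative of the transformed class
  to the concrete function \<open>ftr\<close>, to which Parseval and pointwise estimates
  apply.\<close>

lemma
  shows sobolev_integrable: "integrable lborel (\<lambda>\<xi>. (1 + (norm \<xi>)\<^sup>2) powr s * (cmod (ftr (extend0 (L2_rep q)) \<xi>))\<^sup>2)"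
    and sobolev_le: "(LINT \<xi>|lborel. (1 + (norm \<xi>)\<^sup>2) powr s * (cmod (ftr (extend0 (L2_rep q)) \<xi>))\<^sup>2) \<le> Cq\<^sup>2"
proof -
  let ?F = "ftr (extend0 (L2_rep q))"
  have F: "?F \<in> square_integrable lborel" by (rule ftr_sqi[OF admissible_ball_fun])
  have [measurable]: "?F \<in> borel_measurable borel" using sqi_measurable[OF F] by simp
  have [measurable]: "L2_rep (L2_class lborel ?F) \<in> borel_measurable borel"
    using sqi_measurable[OF L2_rep_sqi[OF L2_class_in[OF F]]] by simp
  have eq: "AE \<xi> in lborel. (1 + (norm \<xi>)\<^sup>2) powr s * (cmod (L2_rep (L2_class lborel ?F) \<xi>))\<^sup>2
      = (1 + (norm \<xi>)\<^sup>2) powr s * (cmod (?F \<xi>))\<^sup>2"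
    using L2_rep_class[OF F] by eventually_elim simp
  have "integrable lborel (\<lambda>\<xi>. (1 + (norm \<xi>)\<^sup>2) powr s * (cmod (L2_rep (L2_class lborel ?F) \<xi>))\<^sup>2)"
    using q by (simp add: admissible_def sobolev_def L2_fourier_eq)
  then show int: "integrable lborel (\<lambda>\<xi>. (1 + (norm \<xi>)\<^sup>2) powr s * (cmod (?F \<xi>))\<^sup>2)"
    by (subst (asm) integrable_cong_AE[OF _ _ eq]) auto
  have "sqrt (LINT \<xi>|lborel. (1 + (norm \<xi>)\<^sup>2) powr s * (cmod (L2_rep (L2_class lborel ?F) \<xi>))\<^sup>2) \<le> Cq"
    using q by (simp add: admissible_def sobolev_norm_def L2_fourier_eq)
  also have "(LINT \<xi>|lborel. (1 + (norm \<xi>)\<^sup>2) powr s * (cmod (L2_rep (L2_class lborel ?F) \<xi>))\<^sup>2)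
      = (LINT \<xi>|lborel. (1 + (norm \<xi>)\<^sup>2) powr s * (cmod (?F \<xi>))\<^sup>2)"
    by (rule integral_cong_AE[OF _ _ eq]) auto
  finally show "(LINT \<xi>|lborel. (1 + (norm \<xi>)\<^sup>2) powr s * (cmod (?F \<xi>))\<^sup>2) \<le> Cq\<^sup>2"
    by (rule sqrt_le_D)
qed

end

section \<open>A Jackson estimate by duality\<close>

lemma l2n_le_const:
  assumes "finite_measure M" "f \<in> borel_measurable M" "\<And>x. x \<in> space M \<Longrightarrow> cmod (f x) \<le> c" "0 \<le> c"
  shows "l2n M f \<le> c * l2n M (\<lambda>_. 1)"
proof -
  have f: "f \<in> square_integrable M" by (rule sqi_bounded[OF assms(1,2,3)])
  have 1: "(\<lambda>_. 1) \<in> square_integrable M" by (rule sqi_bounded[OF assms(1), of _ 1]) auto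
  have "(l2n M f)\<^sup>2 \<le> (LINT x|M. c\<^sup>2 * (cmod 1)\<^sup>2)"
    unfolding l2n_sq using sqi_integrable[OF f] integrable_mult_right[OF sqi_integrable[OF 1], of "c\<^sup>2"] assms
    by (intro integral_mono) (auto intro: power_mono)
  also have "\<dots> = (c * l2n M (\<lambda>_. 1))\<^sup>2"
    by (simp only: integral_mult_right_zero power_mult_distrib l2n_sq)
  finally show ?thesis by (rule power2_le_imp_le) (simp add: assms)
qed

lemma sqi_poly_ball:
  assumes "p \<in> poly_space n"
  shows "p \<in> square_integrable ball_measure"
proof -
  obtain B where "\<And>x. x \<in> ball 0 1 \<Longrightarrow> cmod (p x) \<le> B"
    using poly_space_bounded_on[OF assms bounded_ball] by blast
  moreover have "p \<in> borel_measurable ball_measure"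
    unfolding ball_measure_def using borel_measurable_continuous_onI[OF continuous_poly[OF assms]]
    by (intro measurable_restrict_space1) simp
  ultimately show ?thesis by (intro sqi_bounded[OF finite_ball_measure]) auto
qed

text \<open>Orthogonality to polynomials of degree \<open>n\<close> means that the Fourier transform vanishes to order
  \<open>n + 1\<close> at the origin.\<close>

lemma ftr_moment_bound:
  assumes r: "r \<in> square_integrable ball_measure"
    and orth: "\<And>p. p \<in> poly_space n \<Longrightarrow> l2i ball_measure r p = 0"
  shows "cmod (ftr (extend0 r) \<xi>)
    \<le> fconst * l2n ball_measure (\<lambda>_. 1) * l2n ball_measure r * (norm \<xi> ^ Suc n / fact (Suc n))"
proof -
  define E where "E x = exp (\<i> * complex_of_real (x \<bullet> \<xi>))" for x
  \<comment> \<open>The Taylor polynomial of \<open>E\<close> of degree \<open>n\<close>;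
    orthogonality allows it to be subtracted from \<open>E\<close>, and only the remainder of order
    \<open>n + 1\<close> is left.\<close>
  define P where "P x = (\<Sum>k\<le>n. (\<i> * complex_of_real (x \<bullet> \<xi>)) ^ k / fact k)" for x
  have P: "P \<in> poly_space n"
  proof -
    have "(\<lambda>x. \<Sum>k\<le>n. (\<i> ^ k / fact k) * complex_of_real (x \<bullet> \<xi>) ^ k) \<in> poly_space n"
    proof (intro poly_sum poly_cmult)
      fix k assume "k \<in> {..n}"
      then show "(\<lambda>x. complex_of_real (x \<bullet> \<xi>) ^ k) \<in> poly_space n"
        using poly_power[OF poly_inner, of \<xi> k] poly_space_mono[of "k * 1" n] by auto
    qed
    moreover have "P = (\<lambda>x. \<Sum>k\<le>n. (\<i> ^ k / fact k) * complex_of_real (x \<bullet> \<xi>) ^ k)"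
      unfolding P_def by (simp add: power_mult_distrib)
    ultimately show ?thesis by simp
  qed
  have cE: "continuous_on UNIV E" unfolding E_def by (intro continuous_intros)
  have bE: "bounded (range E)" by (auto simp: bounded_iff E_def intro!: exI[of _ 1])
  have E: "E \<in> square_integrable ball_measure"
    using sqi_continuous[OF finite_ball_measure _ sets_ball_measure cE bE] by simp
  have "l2i ball_measure r E = (LINT x|lborel. exp (- (\<i> * complex_of_real (x \<bullet> \<xi>))) * extend0 r x)"
    unfolding l2i_def ball_integral E_def extend0_def
    by (intro Bochner_Integration.integral_cong) (auto simp: exp_cnj mult.commute)
  then have "ftr (extend0 r) \<xi> = complex_of_real fconst * l2i ball_measure r E"
    by (simp add: ftr_def)
  also have "l2i ball_measure r E = l2i ball_measure r (\<lambda>x. E x - P x)"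
    using l2i_diff_right[OF E sqi_poly_ball[OF P] r] orth[OF P] by simp
  finally have "cmod (ftr (extend0 r) \<xi>) = fconst * cmod (l2i ball_measure r (\<lambda>x. E x - P x))"
    by (simp add: norm_mult abs_of_pos)
  also have "\<dots> \<le> fconst * (l2n ball_measure r * l2n ball_measure (\<lambda>x. E x - P x))"
    using cmod_l2i_le[OF r sqi_diff[OF E sqi_poly_ball[OF P]]] less_imp_le[OF fconst_pos]
    by (rule mult_left_mono)
  also have "\<dots> \<le> fconst * (l2n ball_measure r * (norm \<xi> ^ Suc n / fact (Suc n) * l2n ball_measure (\<lambda>_. 1)))"
  proof (intro mult_left_mono l2n_le_const[OF finite_ball_measure])
    show "(\<lambda>x. E x - P x) \<in> borel_measurable ball_measure"
      by (rule sqi_measurable[OF sqi_diff[OF E sqi_poly_ball[OF P]]])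
    show "cmod (E x - P x) \<le> norm \<xi> ^ Suc n / fact (Suc n)" if "x \<in> space ball_measure" for x
    proof -
      have "\<bar>x \<bullet> \<xi>\<bar> \<le> norm x * norm \<xi>" by (rule Cauchy_Schwarz_ineq2)
      also have "\<dots> \<le> 1 * norm \<xi>" using that by (intro mult_right_mono) auto
      finally have "\<bar>x \<bullet> \<xi>\<bar> ^ Suc n \<le> norm \<xi> ^ Suc n" by (intro power_mono) auto
      then have "\<bar>x \<bullet> \<xi>\<bar> ^ Suc n / fact (Suc n) \<le> norm \<xi> ^ Suc n / fact (Suc n)"
        by (rule divide_right_mono) simp
      with iexp_approx1[of "x \<bullet> \<xi>" n] show ?thesis unfolding E_def P_def by linarith
    qed
  qed (auto simp: less_imp_le)
  finally show ?thesis by (simp add: mult_ac)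
qed

text \<open>A single term of the exponential series. For \<open>x = real k\<close> it gives
  \<open>k ^ k / fact k \<le> exp k\<close>, the part of Stirling's formula used below.\<close>

lemma power_div_fact_le_exp:
  assumes "0 \<le> (x::real)"
  shows "x ^ k / fact k \<le> exp x"
proof -
  have s: "(\<lambda>n. x ^ n /\<^sub>R fact n) sums exp x" by (rule exp_converges)
  have "(\<Sum>n\<in>{k}. x ^ n /\<^sub>R fact n) \<le> (\<Sum>n. x ^ n /\<^sub>R fact n)"
    using s assms by (intro sum_le_suminf) (auto simp: sums_iff)
  then show ?thesis using s by (simp add: sums_iff divide_inverse mult.commute)
qed

text \<open>Smoothness is asked of \<open>q\<close> and vanishing moments of \<open>r\<close>, so
  \<open>r\<close> itself needs no regularity. Low frequencies are controlled by the moments of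
  \<open>r\<close> and high ones by the Sobolev weight of \<open>q\<close>; the constant is uniform
  in \<open>n\<close>, \<open>q\<close> and \<open>r\<close>.\<close>

lemma jackson_pairing:
  assumes s: "s > 0" and Cq: "Cq > 0"
  obtains C where "C > 0"
    "\<And>n q r. q \<in> admissible s Cq \<Longrightarrow> r \<in> square_integrable ball_measure \<Longrightarrow>
       (\<And>p. p \<in> poly_space n \<Longrightarrow> l2i ball_measure r p = 0) \<Longrightarrow>
       cmod (l2i ball_measure (L2_rep q) r) \<le> C * real (n + 1) powr (- s) * l2n ball_measure r"
proof -
  \<comment> \<open>The factor \<open>2 powr (- N)\<close> gained at low frequencies has to absorb
    the square root of the volume of the frequency ball, of order \<open>N powr (3/2)\<close>, and
    still leave \<open>N powr (- s)\<close>.\<close>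
  have "(\<lambda>N. real N powr (3/2 + s) * (1/2) ^ N) \<longlonglongrightarrow> 0" by real_asymp
  then have "Bseq (\<lambda>N. real N powr (3/2 + s) * (1/2) ^ N)" by (rule convergent_imp_Bseq[OF convergentI])
  then obtain K where K: "K > 0" "\<And>N. norm (real N powr (3/2 + s) * (1/2) ^ N) \<le> K"
    by (rule BseqE) auto
  let ?V = "l2n ball_measure (\<lambda>_. 1)" and ?ub = "unit_ball_vol (real DIM(R3))"
  \<comment> \<open>The first summand comes from the frequencies in the ball of radius
    \<open>R\<close>, the second from those outside.\<close>
  define C where "C = Cq * (fconst * ?V * sqrt ?ub * K) + Cq * (2 * exp 1) powr s"
  have C: "C > 0"
    unfolding C_def using Cq K(1) unit_ball_vol_nonneg[of "real DIM(R3)"] less_imp_le[OF fconst_pos]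
    by (intro add_nonneg_pos mult_nonneg_nonneg mult_pos_pos) auto
  have "cmod (l2i ball_measure (L2_rep q) r) \<le> C * real (n + 1) powr (- s) * l2n ball_measure r"
    if q: "q \<in> admissible s Cq" and r: "r \<in> square_integrable ball_measure"
      and orth: "\<And>p. p \<in> poly_space n \<Longrightarrow> l2i ball_measure r p = 0" for n q r
  proof -
    \<comment> \<open>Orthogonality up to degree \<open>n\<close> makes the transform vanish to
      order \<open>n + 1\<close>, which is the exponent that counts.\<close>
    define N where "N = n + 1"
    \<comment> \<open>The largest radius proportional to \<open>N\<close> for which
      \<open>N ^ N / fact N \<le> exp N\<close> still gives
      \<open>R ^ N / fact N \<le> (1/2) ^ N\<close>.\<close>
    define R where "R = real N / (2 * exp 1)"
    have N: "real N \<ge> 1" by (simp add: N_def)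
    have R0: "R > 0" using N by (simp add: R_def)
    have RN: "R \<le> real N"
    proof -
      have "1 \<le> 2 * exp (1::real)" using exp_ge_add_one_self[of "1::real"] by linarith
      then show ?thesis unfolding R_def using N by (simp add: divide_le_eq mult_le_cancel_left1)
    qed
    let ?F = "ftr (extend0 (L2_rep q))" and ?H = "ftr (extend0 r)"
    have rb: "ball_fun (extend0 r)" by (rule ball_fun_extend0[OF r])
    have F: "?F \<in> square_integrable lborel" by (rule ftr_sqi[OF admissible_ball_fun[OF q]])
    have H: "?H \<in> square_integrable lborel" by (rule ftr_sqi[OF rb])
    have [measurable]: "?F \<in> borel_measurable borel" "?H \<in> borel_measurable borel"
      using sqi_measurable[OF F] sqi_measurable[OF H] by auto
    have cut: "(\<lambda>\<xi>. indicator A \<xi> * f \<xi>) \<in> square_integrable lborel"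
      if "A \<in> sets borel" "f \<in> square_integrable lborel" for A and f :: "R3 \<Rightarrow> complex"
    proof -
      have "(\<lambda>\<xi>. indicator A \<xi> * f \<xi>) \<in> borel_measurable lborel"
        using that sqi_measurable[OF that(2)] by (intro borel_measurable_times borel_measurable_indicator) auto
      moreover have "(\<lambda>\<xi>. (cmod (indicator A \<xi> * f \<xi>))\<^sup>2) = (\<lambda>\<xi>. indicat_real A \<xi> *\<^sub>R (cmod (f \<xi>))\<^sup>2)"
        by (auto simp: indicator_def)
      then have "integrable lborel (\<lambda>\<xi>. (cmod (indicator A \<xi> * f \<xi>))\<^sup>2)"
        using that integrable_mult_indicator[OF _ sqi_integrable[OF that(2)], of A] by simp
      ultimately show ?thesis by (simp add: square_integrable_def)
    qed
    let ?B = "cball (0::R3) R"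
    let ?F2 = "\<lambda>\<xi>. indicator (- ?B) \<xi> * ?F \<xi>" and ?H1 = "\<lambda>\<xi>. indicator ?B \<xi> * ?H \<xi>"
    let ?F1 = "\<lambda>\<xi>. indicator ?B \<xi> * ?F \<xi>"
    have F2: "?F2 \<in> square_integrable lborel" and H1: "?H1 \<in> square_integrable lborel"
      and F1: "?F1 \<in> square_integrable lborel"
      using cut[OF _ F] cut[OF _ H] by auto
    let ?W = "\<lambda>\<xi>::R3. (1 + (norm \<xi>)\<^sup>2) powr s"
    have W1: "1 \<le> ?W \<xi>" for \<xi> using s by (intro ge_one_powr_ge_zero) auto
    have nF: "l2n lborel ?F \<le> Cq"
    proof -
      have "(l2n lborel ?F)\<^sup>2 \<le> (LINT \<xi>|lborel. ?W \<xi> * (cmod (?F \<xi>))\<^sup>2)"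
        unfolding l2n_sq using sqi_integrable[OF F] sobolev_integrable[OF q] W1
        by (intro integral_mono) (auto intro: order_trans[OF _ mult_right_mono[of 1]])
      also have "\<dots> \<le> Cq\<^sup>2" by (rule sobolev_le[OF q])
      finally show ?thesis by (rule power2_le_imp_le) (use Cq in simp)
    qed
    have nF2: "l2n lborel ?F2 \<le> R powr (- s) * Cq"
    proof -
      have "(l2n lborel ?F2)\<^sup>2 \<le> (LINT \<xi>|lborel. (R powr (- s))\<^sup>2 * (?W \<xi> * (cmod (?F \<xi>))\<^sup>2))"
        unfolding l2n_sq
      proof (rule integral_mono[OF sqi_integrable[OF F2] integrable_mult_right[OF sobolev_integrable[OF q]]])
        fix \<xi> :: R3
        show "(cmod (?F2 \<xi>))\<^sup>2 \<le> (R powr (- s))\<^sup>2 * (?W \<xi> * (cmod (?F \<xi>))\<^sup>2)"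
        proof (cases "\<xi> \<in> ?B")
          case False
          then have "R \<le> norm \<xi>" by simp
          then have "R\<^sup>2 \<le> (norm \<xi>)\<^sup>2" using R0 by (intro power_mono) auto
          then have "R\<^sup>2 \<le> 1 + (norm \<xi>)\<^sup>2" by linarith
          then have "(R\<^sup>2) powr s \<le> ?W \<xi>" using s R0 by (intro powr_mono2) auto
          moreover have "(R powr (- s))\<^sup>2 * (R\<^sup>2) powr s = 1"
            using R0 by (simp add: powr_powr powr_add[symmetric] powr_numeral[symmetric] del: powr_numeral)
          ultimately have "1 \<le> (R powr (- s))\<^sup>2 * ?W \<xi>"
            by (metis mult_left_mono zero_le_power2)
          from mult_right_mono[OF this, of "(cmod (?F \<xi>))\<^sup>2"] False show ?thesis
            by (simp add: mult.assoc)
        qed simp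
      qed
      also have "\<dots> \<le> (R powr (- s))\<^sup>2 * Cq\<^sup>2"
        using sobolev_le[OF q] by (simp add: mult_left_mono)
      also have "\<dots> = (R powr (- s) * Cq)\<^sup>2" by (simp add: power_mult_distrib)
      finally show ?thesis by (rule power2_le_imp_le) (use Cq in simp)
    qed
    have nH: "l2n lborel ?H \<le> l2n ball_measure r"
      using plancherel_le[OF rb] by (simp add: l2n_extend0)
    let ?c = "fconst * ?V * l2n ball_measure r * (1/2) ^ N"
    have c0: "0 \<le> ?c" using less_imp_le[OF fconst_pos] by simp
    have RNf: "R ^ N / fact N \<le> (1/2) ^ N"
    proof -
      have "R ^ N / fact N = (real N ^ N / fact N) / (2 * exp 1) ^ N"
        by (simp add: R_def power_divide)
      also have "\<dots> \<le> exp (real N) / (2 * exp 1) ^ N"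
        using power_div_fact_le_exp[of "real N" N] by (intro divide_right_mono) auto
      also have "exp (real N) = exp 1 ^ N" by (simp add: exp_of_nat_mult[symmetric])
      also have "exp 1 ^ N / (2 * exp (1::real)) ^ N = (1/2) ^ N"
        by (simp add: power_mult_distrib power_divide)
      finally show ?thesis .
    qed
    have Hb: "cmod (?H \<xi>) \<le> ?c" if "\<xi> \<in> ?B" for \<xi>
    proof -
      have "norm \<xi> ^ N / fact N \<le> R ^ N / fact N"
        using that by (intro divide_right_mono power_mono) auto
      also have "\<dots> \<le> (1/2) ^ N" by (rule RNf)
      finally have le: "norm \<xi> ^ N / fact N \<le> (1/2) ^ N" .
      have "cmod (?H \<xi>) \<le> fconst * ?V * l2n ball_measure r * (norm \<xi> ^ N / fact N)"
        using ftr_moment_bound[OF r orth] by (simp add: N_def)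
      also have "\<dots> \<le> ?c" using le less_imp_le[OF fconst_pos] by (intro mult_left_mono) auto
      finally show ?thesis .
    qed
    have nH1: "l2n lborel ?H1 \<le> ?c * sqrt (?ub * R ^ 3)"
    proof -
      have fin: "emeasure lborel ?B < \<infinity>" using emeasure_lborel_cball_finite[of "0::R3" R] by simp
      have "(l2n lborel ?H1)\<^sup>2 \<le> (LINT \<xi>|lborel. ?c\<^sup>2 * indicat_real ?B \<xi>)"
        unfolding l2n_sq
      proof (rule integral_mono[OF sqi_integrable[OF H1]])
        show "integrable lborel (\<lambda>\<xi>. ?c\<^sup>2 * indicat_real ?B \<xi>)"
          using fin by (intro integrable_mult_right integrable_real_indicator) auto
        show "(cmod (?H1 \<xi>))\<^sup>2 \<le> ?c\<^sup>2 * indicat_real ?B \<xi>" for \<xi>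
          using power_mono[OF Hb, of \<xi> 2] by (auto simp: indicator_def)
      qed
      also have "\<dots> = ?c\<^sup>2 * measure lborel ?B" by simp
      also have "measure lborel ?B = ?ub * R ^ 3"
        using emeasure_cball[of R "0::R3"] R0 unit_ball_vol_nonneg[of "real DIM(R3)"] by (simp add: measure_def)
      also have "?c\<^sup>2 * (?ub * R ^ 3) = (?c * sqrt (?ub * R ^ 3))\<^sup>2"
        using R0 unit_ball_vol_nonneg[of "real DIM(R3)"] by (simp add: power_mult_distrib)
      finally show ?thesis
        by (rule power2_le_imp_le) (use c0 R0 unit_ball_vol_nonneg[of "real DIM(R3)"] in \<open>intro mult_nonneg_nonneg[OF c0], auto\<close>)
    qed
    have "l2i ball_measure (L2_rep q) r = l2i lborel ?F ?H"
      unfolding parseval[OF admissible_ball_fun[OF q] rb] by (rule l2i_extend0[symmetric])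
    also have "?F = (\<lambda>\<xi>. ?F1 \<xi> + ?F2 \<xi>)" by (auto simp: indicator_def)
    also have "l2i lborel \<dots> ?H = l2i lborel ?F1 ?H + l2i lborel ?F2 ?H"
      by (rule l2i_add_left[OF F1 F2 H])
    \<comment> \<open>The cut-off is real, so it may be moved to the factor that is small on low
      frequencies.\<close>
    also have "l2i lborel ?F1 ?H = l2i lborel ?F ?H1"
      unfolding l2i_def by (intro Bochner_Integration.integral_cong) (auto simp: indicator_def)
    finally have "cmod (l2i ball_measure (L2_rep q) r) \<le> cmod (l2i lborel ?F ?H1) + cmod (l2i lborel ?F2 ?H)"
      by (simp add: norm_triangle_ineq)
    also have "\<dots> \<le> l2n lborel ?F * l2n lborel ?H1 + l2n lborel ?F2 * l2n lborel ?H"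
      by (intro add_mono cmod_l2i_le F H H1 F2)
    also have "\<dots> \<le> Cq * (?c * sqrt (?ub * R ^ 3)) + (R powr (- s) * Cq) * l2n ball_measure r"
      by (intro add_mono mult_mono nF nH1 nF2 nH) (use Cq in auto)
    also have "\<dots> \<le> C * real N powr (- s) * l2n ball_measure r"
    proof -
      have "sqrt (R ^ 3) \<le> sqrt (real N ^ 3)" using R0 RN by (intro real_sqrt_le_mono power_mono) auto
      also have "sqrt (real N ^ 3) = real N powr (3/2)"
        using N by (simp add: powr_half_sqrt[symmetric] powr_powr powr_numeral[symmetric] del: powr_numeral)
      finally have "(1/2) ^ N * sqrt (R ^ 3) \<le> (1/2) ^ N * real N powr (3/2)"
        by (intro mult_left_mono) auto
      also have "\<dots> = (real N powr (3/2 + s) * (1/2) ^ N) * real N powr (- s)"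
        using N by (simp add: mult.assoc mult.left_commute powr_add[symmetric])
      also have "\<dots> \<le> K * real N powr (- s)"
        using K(2)[of N] by (intro mult_right_mono) auto
      finally have a: "(1/2) ^ N * sqrt (R ^ 3) \<le> K * real N powr (- s)" .
      have "?c * sqrt (?ub * R ^ 3) = (fconst * ?V * sqrt ?ub * l2n ball_measure r) * ((1/2) ^ N * sqrt (R ^ 3))"
        by (simp only: real_sqrt_mult mult_ac)
      also have "\<dots> \<le> (fconst * ?V * sqrt ?ub * l2n ball_measure r) * (K * real N powr (- s))"
        using a less_imp_le[OF fconst_pos] unit_ball_vol_nonneg[of "real DIM(R3)"]
        by (intro mult_left_mono mult_nonneg_nonneg) auto
      finally have b: "?c * sqrt (?ub * R ^ 3) \<le> (fconst * ?V * sqrt ?ub * l2n ball_measure r) * (K * real N powr (- s))" .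
      have "R powr (- s) = real N powr (- s) * (2 * exp 1) powr s"
        using N by (simp add: R_def powr_divide powr_minus divide_simps)
      then have "Cq * (?c * sqrt (?ub * R ^ 3)) + (R powr (- s) * Cq) * l2n ball_measure r
        \<le> Cq * ((fconst * ?V * sqrt ?ub * l2n ball_measure r) * (K * real N powr (- s)))
          + (real N powr (- s) * (2 * exp 1) powr s * Cq) * l2n ball_measure r"
        using mult_left_mono[OF b, of Cq] Cq by simp
      also have "\<dots> = C * real N powr (- s) * l2n ball_measure r"
        unfolding C_def by (simp only: distrib_right distrib_left mult_ac)
      finally show ?thesis .
    qed
    finally show ?thesis by (simp add: N_def)
  qed
  with C that show ?thesis by blast
qed

section \<open>The sphere\<close>

abbreviation "punctured \<equiv> cball (0::R3) 1 - {0}"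

lemma sets_sphere_measure: "sets sphere_measure = sets (restrict_space borel (sphere 0 1))"
  by (simp add: sphere_measure_def)

lemma space_sphere_measure [simp]: "space sphere_measure = sphere 0 1"
  using sets_eq_imp_space_eq[OF sets_sphere_measure] by (simp add: space_restrict_space)

lemma norm_sgn_R3: "x \<noteq> 0 \<Longrightarrow> norm (sgn (x::R3)) = 1"
  by (simp add: norm_sgn)

lemma sgn_measurable_sphere:
  "sgn \<in> measurable (restrict_space lborel punctured) (restrict_space borel (sphere (0::R3) 1))"
proof (rule measurable_restrict_space2)
  show "sgn \<in> space (restrict_space lborel punctured) \<rightarrow> sphere (0::R3) 1"
    by (auto simp: space_restrict_space norm_sgn_R3)
  show "(sgn :: R3 \<Rightarrow> R3) \<in> borel_measurable (restrict_space lborel punctured)"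
    by (intro measurable_restrict_space1) simp
qed

text \<open>Scaling is rewritten as a constant density, for which integrals can be computed.\<close>

lemma sphere_measure_density:
  "sphere_measure = density (distr (restrict_space lborel punctured) (restrict_space borel (sphere 0 1)) sgn) (\<lambda>_. ennreal 3)"
  unfolding sphere_measure_def by (rule measure_eqI) (simp_all add: emeasure_density_const)

lemma sphere_integral:
  fixes f :: "R3 \<Rightarrow> complex"
  assumes f: "f \<in> borel_measurable (restrict_space borel (sphere 0 1))"
  shows "integral\<^sup>L sphere_measure f = 3 * (LINT x|lborel. indicator punctured x *\<^sub>R f (sgn x))"
proof -
  let ?N = "distr (restrict_space lborel punctured) (restrict_space borel (sphere 0 1)) sgn"
  have "integral\<^sup>L sphere_measure f = (LINT x|?N. 3 *\<^sub>R f x)"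
    unfolding sphere_measure_density using f by (intro integral_density) auto
  also have "\<dots> = 3 *\<^sub>R (LINT x|?N. f x)" by simp
  also have "(LINT x|?N. f x) = (LINT x|restrict_space lborel punctured. f (sgn x))"
    by (rule integral_distr[OF sgn_measurable_sphere f])
  also have "\<dots> = (LINT x|lborel. indicator punctured x *\<^sub>R f (sgn x))"
    by (rule integral_restrict_space) auto
  finally show ?thesis by (simp add: scaleR_conv_of_real)
qed

lemma finite_sphere_measure: "finite_measure sphere_measure"
proof (rule finite_measureI)
  have "emeasure sphere_measure (space sphere_measure)
      = 3 * emeasure (distr (restrict_space lborel punctured) (restrict_space borel (sphere 0 1)) sgn) (sphere 0 1)"
    unfolding space_sphere_measure by (simp add: sphere_measure_def)
  also have "emeasure (distr (restrict_space lborel punctured) (restrict_space borel (sphere 0 1)) sgn) (sphere 0 1)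
      = emeasure (restrict_space lborel punctured) (sgn -` sphere 0 1 \<inter> space (restrict_space lborel punctured))"
    by (rule emeasure_distr[OF sgn_measurable_sphere]) (simp add: sets_restrict_space_iff)
  also have "sgn -` sphere 0 1 \<inter> space (restrict_space lborel punctured) = punctured"
    by (auto simp: space_restrict_space norm_sgn_R3)
  also have "emeasure (restrict_space lborel punctured) punctured = emeasure lborel punctured"
    by (rule emeasure_restrict_space) auto
  also have "emeasure lborel punctured \<le> emeasure lborel (cball (0::R3) 1)"
    by (rule emeasure_mono) auto
  finally have "emeasure sphere_measure (space sphere_measure) \<le> 3 * emeasure lborel (cball (0::R3) 1)"
    by (simp add: mult_left_mono)
  also have "\<dots> < \<infinity>" using emeasure_lborel_cball_finite[of "0::R3" 1] by (simp add: ennreal_mult_less_top)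
  finally show "emeasure sphere_measure (space sphere_measure) \<noteq> \<infinity>" by simp
qed

lemma indicator_punctured_integrable:
  fixes g :: "R3 \<Rightarrow> complex"
  assumes [measurable]: "g \<in> borel_measurable borel" and "\<And>x. x \<in> punctured \<Longrightarrow> cmod (g x) \<le> B"
  shows "integrable lborel (\<lambda>x. indicator punctured x *\<^sub>R g x)"
proof (rule Bochner_Integration.integrable_bound)
  have "emeasure lborel punctured \<le> emeasure lborel (cball (0::R3) 1)"
    by (rule emeasure_mono) auto
  also have "\<dots> < \<infinity>" using emeasure_lborel_cball_finite[of "0::R3" 1] by simp
  finally show "integrable lborel (\<lambda>x. B * indicator punctured x)"
    by (intro integrable_mult_right integrable_real_indicator) auto
qed (use assms in \<open>auto simp: indicator_def intro!: AE_I2 order_trans[OF _ abs_ge_self]\<close>)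

text \<open>\<open>F (sgn x)\<close> is invariant under positive dilations, so only the Jacobian
  \<open>t ^ 3\<close> remains.\<close>

lemma radial_scaling:
  fixes F :: "R3 \<Rightarrow> complex"
  assumes [measurable]: "F \<in> borel_measurable borel" and t: "t > 0"
  shows "(LINT x|lborel. indicator (cball 0 t - {0}) x *\<^sub>R F (sgn x))
    = t ^ 3 *\<^sub>R (LINT x|lborel. indicator punctured x *\<^sub>R F (sgn x))"
proof -
  have [measurable]: "cball (0::R3) t \<in> sets borel" "{0::R3} \<in> sets borel" by auto
  have "(LINT x|lborel. indicator (cball 0 t - {0}) x *\<^sub>R F (sgn x))
    = t ^ 3 *\<^sub>R (LINT x|lborel. indicator (cball 0 t - {0}) (0 + t *\<^sub>R x) *\<^sub>R F (sgn (0 + t *\<^sub>R x)))"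
    by (rule lborel_integral_affine[OF _ t]) measurable
  also have "(\<lambda>x. indicator (cball 0 t - {0}) (0 + t *\<^sub>R x) *\<^sub>R F (sgn (0 + t *\<^sub>R x)))
      = (\<lambda>x. indicator punctured x *\<^sub>R F (sgn x))"
    using t by (intro ext) (auto simp: indicator_def sgn_scaleR)
  finally show ?thesis .
qed

text \<open>Integration in polar coordinates of a radial power, by the layer-cake formula
  \<open>1 - norm x ^ d = \<integral>_{norm x}^1 d t^(d-1) dt\<close>.\<close>

lemma radial_integral:
  fixes F :: "R3 \<Rightarrow> complex"
  assumes Fm [measurable]: "F \<in> borel_measurable borel" and FB: "\<And>x. cmod (F x) \<le> B"
  shows "(LINT x|lborel. indicator punctured x *\<^sub>R (complex_of_real (norm x ^ d) * F (sgn x)))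
    = complex_of_real (3 / (real d + 3)) * (LINT x|lborel. indicator punctured x *\<^sub>R F (sgn x))"
proof (cases d)
  case 0
  then show ?thesis by simp
next
  case (Suc k)
  let ?I = "LINT x|lborel. indicator punctured x *\<^sub>R F (sgn x)"
  have [measurable]: "cball (0::R3) 1 \<in> sets borel" "{0::R3} \<in> sets borel" by auto
  have B0: "0 \<le> B" using FB[of 0] norm_ge_zero order_trans by blast
  \<comment> \<open>With \<open>k = d - 1\<close>, integration over \<open>t\<close> from
    \<open>norm x\<close> to \<open>1\<close> gives \<open>1 - norm x ^ d\<close>, while integration
    over \<open>x\<close> meets the dilated ball of \<open>radial_scaling\<close>.\<close>
  define K where "K x t = (indicator punctured x * (indicator {0..1} t * (if norm x \<le> t then real d * t ^ k else 0))) *\<^sub>R F (sgn x)"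
    for x :: R3 and t :: real
  have Km: "(\<lambda>(x, t). K x t) \<in> borel_measurable (lborel \<Otimes>\<^sub>M lborel)"
    unfolding K_def case_prod_beta' by measurable
  have Kint: "integrable (lborel \<Otimes>\<^sub>M lborel) (\<lambda>(x, t). K x t)"
  proof (rule Bochner_Integration.integrable_bound[OF _ Km])
    have "emeasure lborel punctured \<le> emeasure lborel (cball (0::R3) 1)"
      by (rule emeasure_mono) auto
    also have "\<dots> < \<infinity>" using emeasure_lborel_cball_finite[of "0::R3" 1] by simp
    finally have "emeasure (lborel \<Otimes>\<^sub>M lborel) (punctured \<times> {0..1::real}) < \<infinity>"
      by (subst lborel.emeasure_pair_measure_Times) (auto simp: ennreal_mult_less_top)
    then show "integrable (lborel \<Otimes>\<^sub>M lborel) (\<lambda>p. (real d * B) * indicator (punctured \<times> {0..1::real}) p)"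
      by (intro integrable_mult_right integrable_real_indicator) auto
    have "cmod (K x t) \<le> (real d * B) * indicator (punctured \<times> {0..1::real}) (x, t)" for x t
    proof (cases "x \<in> punctured \<and> t \<in> {0..1} \<and> norm x \<le> t")
      case True
      have "real d * t ^ k \<le> real d * 1" using True by (intro mult_left_mono power_le_one) auto
      then have "real d * t ^ k * cmod (F (sgn x)) \<le> real d * B"
        using FB True by (intro mult_mono) auto
      then show ?thesis using True by (simp add: K_def abs_mult)
    qed (use B0 in \<open>auto simp: K_def indicator_def\<close>)
    then show "AE p in lborel \<Otimes>\<^sub>M lborel. norm (case p of (x, t) \<Rightarrow> K x t)
        \<le> norm ((real d * B) * indicator (punctured \<times> {0..1::real}) p)"
      by (intro AE_I2) (force intro: order_trans[OF _ abs_ge_self])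
  qed
  have pow: "has_bochner_integral lborel (\<lambda>t. real d * t ^ k * indicator {a..1} t) (1 - a ^ d)" if "a \<le> 1" for a :: real
  proof -
    have "has_bochner_integral lborel (\<lambda>t. real d * t ^ k * indicator {a..1} t) (1 ^ d - a ^ d)"
    proof (rule has_bochner_integral_FTC_Icc_real[OF that])
      fix t :: real
      show "((\<lambda>t. t ^ d) has_field_derivative real d * t ^ k) (at t)"
        using DERIV_pow[of d t] Suc by simp
    qed auto
    then show ?thesis by simp
  qed
  have inner1: "(LINT t|lborel. K x t) = indicator punctured x *\<^sub>R ((1 - complex_of_real (norm x ^ d)) * F (sgn x))" for x
  proof (cases "x \<in> punctured")
    case True
    have "(\<lambda>t. K x t) = (\<lambda>t. (real d * t ^ k * indicator {norm x..1} t) *\<^sub>R F (sgn x))"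
      using True by (auto simp: K_def indicator_def fun_eq_iff intro: order_trans[OF norm_ge_zero])
    moreover have "has_bochner_integral lborel (\<lambda>t. (real d * t ^ k * indicator {norm x..1} t) *\<^sub>R F (sgn x))
        ((1 - norm x ^ d) *\<^sub>R F (sgn x))"
      using pow[of "norm x"] True by (intro has_bochner_integral_scaleR_left) auto
    ultimately have "(LINT t|lborel. K x t) = (1 - norm x ^ d) *\<^sub>R F (sgn x)"
      by (simp only: has_bochner_integral_integral_eq)
    then show ?thesis using True by (simp add: scaleR_conv_of_real)
  qed (simp add: K_def)
  \<comment> \<open>The Jacobian raises the power to \<open>k + 3 = d + 2\<close>, whose integral
    over the unit interval yields \<open>d / (d + 3)\<close>.\<close>
  have inner2: "(LINT x|lborel. K x t) = (indicator {0..1} t * (real d * t ^ (k + 3))) *\<^sub>R ?I" for t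
  proof (cases "t \<in> {0<..1}")
    case True
    have "(\<lambda>x. K x t) = (\<lambda>x. (real d * t ^ k) *\<^sub>R (indicator (cball 0 t - {0}) x *\<^sub>R F (sgn x)))"
      using True by (auto simp: K_def indicator_def fun_eq_iff)
    then have "(LINT x|lborel. K x t) = (LINT x|lborel. (real d * t ^ k) *\<^sub>R (indicator (cball 0 t - {0}) x *\<^sub>R F (sgn x)))"
      by simp
    also have "\<dots> = (real d * t ^ k) *\<^sub>R (t ^ 3 *\<^sub>R ?I)"
      using radial_scaling[OF Fm, of t] True by (simp only: integral_scaleR_right greaterThanAtMost_iff)
    finally have "(LINT x|lborel. K x t) = (real d * t ^ k) *\<^sub>R (t ^ 3 *\<^sub>R ?I)" .
    then show ?thesis using True by (simp add: power_add)
  next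
    case False
    have "(\<lambda>x. K x t) = (\<lambda>x. 0)"
      using False by (auto simp: K_def indicator_def fun_eq_iff)
    then have "(LINT x|lborel. K x t) = 0" by simp
    then show ?thesis using False by (auto simp: indicator_def)
  qed
  have m1: "(\<lambda>x::R3. complex_of_real (norm x ^ d) * F (sgn x)) \<in> borel_measurable borel" by measurable
  have b1: "cmod (complex_of_real (norm x ^ d) * F (sgn x)) \<le> B" if "x \<in> punctured" for x
  proof -
    have "norm x ^ d \<le> 1" using that by (intro power_le_one) auto
    then have "norm x ^ d * cmod (F (sgn x)) \<le> 1 * B" using FB[of "sgn x"] by (intro mult_mono) auto
    then show ?thesis by (simp add: norm_mult norm_power)
  qed
  have "(LINT x|lborel. indicator punctured x *\<^sub>R ((1 - complex_of_real (norm x ^ d)) * F (sgn x)))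
      = (LINT x|lborel. (LINT t|lborel. K x t))" unfolding inner1 ..
  also have "\<dots> = (LINT t|lborel. (LINT x|lborel. K x t))"
    by (rule lborel_pair.Fubini_integral[OF Kint, symmetric])
  also have "\<dots> = (real d / (real d + 3)) *\<^sub>R ?I"
  proof -
    have "has_bochner_integral lborel (\<lambda>t. (real d * t ^ (k + 3)) * indicator {0..1} t)
        (real d / real (d + 3) * 1 ^ (d + 3) - real d / real (d + 3) * 0 ^ (d + 3))"
    proof (rule has_bochner_integral_FTC_Icc_real[where F = "\<lambda>t. real d / real (d + 3) * t ^ (d + 3)"])
      fix t :: real
      have "((\<lambda>t. t ^ (d + 3)) has_field_derivative real (d + 3) * t ^ (d + 3 - 1)) (at t)"
        using DERIV_pow[of "d + 3" t] by simp
      from DERIV_cmult[OF this, of "real d / real (d + 3)"]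
      show "((\<lambda>t. real d / real (d + 3) * t ^ (d + 3)) has_field_derivative real d * t ^ (k + 3)) (at t)"
        using Suc by (simp add: add.commute)
    qed auto
    then have "has_bochner_integral lborel (\<lambda>t. ((real d * t ^ (k + 3)) * indicator {0..1} t) *\<^sub>R ?I)
        ((real d / (real d + 3)) *\<^sub>R ?I)"
      by (intro has_bochner_integral_scaleR_left) (simp add: power_0_left)
    then show ?thesis
      unfolding inner2 by (simp only: has_bochner_integral_integral_eq mult.commute)
  qed
  finally have e: "(LINT x|lborel. indicator punctured x *\<^sub>R ((1 - complex_of_real (norm x ^ d)) * F (sgn x)))
      = (real d / (real d + 3)) *\<^sub>R ?I" .
  have "(LINT x|lborel. indicator punctured x *\<^sub>R ((1 - complex_of_real (norm x ^ d)) * F (sgn x)))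
      = (LINT x|lborel. indicator punctured x *\<^sub>R F (sgn x) - indicator punctured x *\<^sub>R (complex_of_real (norm x ^ d) * F (sgn x)))"
    by (simp add: left_diff_distrib scaleR_diff_right)
  also have "\<dots> = ?I - (LINT x|lborel. indicator punctured x *\<^sub>R (complex_of_real (norm x ^ d) * F (sgn x)))"
    by (intro Bochner_Integration.integral_diff indicator_punctured_integrable[OF _ FB]
        indicator_punctured_integrable[OF m1 b1]) auto
  finally have e2: "?I - (LINT x|lborel. indicator punctured x *\<^sub>R (complex_of_real (norm x ^ d) * F (sgn x)))
      = (real d / (real d + 3)) *\<^sub>R ?I" using e by (simp only:)
  have "b = a - c" if "a - b = c" for a b c :: complex using that by auto
  from this[OF e2] have "(LINT x|lborel. indicator punctured x *\<^sub>R (complex_of_real (norm x ^ d) * F (sgn x)))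
      = ?I - (real d / (real d + 3)) *\<^sub>R ?I" .
  also have "\<dots> = (1 - real d / (real d + 3)) *\<^sub>R ?I" by (simp add: scaleR_diff_left)
  also have "1 - real d / (real d + 3) = 3 / (real d + 3)" by (simp add: field_simps)
  finally show ?thesis by (simp add: scaleR_conv_of_real)
qed

section \<open>Orthogonality of spherical harmonics of different degree\<close>

text \<open>Its square is continuously differentiable on all of space and vanishes outside the ball,
  so integration by parts against it has no boundary term; the gradient of the square is
  \<open>- 4 * bump x\<close> times \<open>x\<close>, the radial field of Euler's identity.\<close>

definition bump :: "R3 \<Rightarrow> real" where
  "bump x = max 0 (1 - (norm x)\<^sup>2)"

lemma max0_sq_deriv: "((\<lambda>s. (max 0 s)\<^sup>2) has_field_derivative 2 * max 0 s) (at (s::real))"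
proof -
  consider "s > 0" | "s < 0" | "s = 0" by linarith
  then show ?thesis
  proof cases
    case 1
    have "((\<lambda>s. s\<^sup>2) has_field_derivative 2 * max 0 s) (at s)"
      using 1 by (auto intro!: derivative_eq_intros)
    moreover have "\<forall>\<^sub>F y in nhds s. y\<^sup>2 = (max 0 y)\<^sup>2"
      using 1 by (auto simp: eventually_nhds intro!: exI[of _ "{0<..}"])
    ultimately show ?thesis by (subst DERIV_cong_ev[OF refl, symmetric]) auto
  next
    case 2
    have "((\<lambda>s. 0) has_field_derivative 2 * max 0 s) (at s)" using 2 by simp
    moreover have "\<forall>\<^sub>F y in nhds s. 0 = (max 0 y)\<^sup>2"
      using 2 by (auto simp: eventually_nhds intro!: exI[of _ "{..<0}"])
    ultimately show ?thesis by (subst DERIV_cong_ev[OF refl, symmetric]) auto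
  next
    case 3
    have "((\<lambda>h::real. ((max 0 (0 + h))\<^sup>2 - (max 0 0)\<^sup>2) / h) \<longlongrightarrow> 0) (at 0)"
    proof (rule Lim_null_comparison[where g = "\<lambda>h. \<bar>h\<bar>"])
      show "\<forall>\<^sub>F h::real in at 0. norm (((max 0 (0 + h))\<^sup>2 - (max 0 0)\<^sup>2) / h) \<le> \<bar>h\<bar>"
        by (intro always_eventually allI) (auto simp: max_def power2_eq_square)
      show "((\<lambda>h::real. \<bar>h\<bar>) \<longlongrightarrow> 0) (at 0)" by (rule tendsto_rabs_zero) (rule tendsto_ident_at)
    qed
    then show ?thesis using 3 by (simp add: DERIV_def)
  qed
qed

lemma norm_axis_sq: "(norm (x + t *\<^sub>R axis i 1))\<^sup>2 = (norm x)\<^sup>2 + 2 * t * vec_nth x i + t\<^sup>2" for x :: R3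
proof -
  have "axis i (1::real) \<bullet> (axis i 1 :: R3) = 1" by (simp add: inner_axis)
  then show ?thesis
    unfolding power2_norm_eq_inner
    by (simp add: inner_add_left inner_add_right inner_axis inner_axis' power2_eq_square distrib_left)
qed

lemma bump_deriv:
  "((\<lambda>t. (bump (x + t *\<^sub>R axis i 1))\<^sup>2) has_field_derivative - 4 * vec_nth x i * bump x) (at 0)"
proof -
  have "((\<lambda>t. 1 - ((norm x)\<^sup>2 + 2 * t * vec_nth x i + t\<^sup>2)) has_field_derivative - 2 * vec_nth x i) (at 0)"
    by (auto intro!: derivative_eq_intros)
  from DERIV_chain2[OF max0_sq_deriv this]
  show ?thesis by (simp add: bump_def norm_axis_sq mult_ac)
qed

lemma continuous_bump: "continuous_on S bump"
  unfolding bump_def by (intro continuous_intros)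

lemma bump_zero: "x \<notin> cball 0 1 \<Longrightarrow> bump x = 0"
  using power_mono[of 1 "norm x" 2] by (auto simp: bump_def)

text \<open>The integrand is the partial derivative of the compactly supported function
  \<open>G\<close>. Difference quotients of \<open>G\<close> have integral \<open>0\<close> by
  translation invariance, and they converge boundedly to \<open>D\<close>.\<close>

lemma integral_by_parts_bump:
  assumes p: "p \<in> poly_space n"
  shows "(LINT x|lborel. dir_deriv (axis i 1) p x * complex_of_real ((bump x)\<^sup>2)
     + p x * complex_of_real (- 4 * vec_nth x i * bump x)) = 0"
proof -
  let ?e = "axis i 1 :: R3"
  define G where "G x = p x * complex_of_real ((bump x)\<^sup>2)" for x
  define D where "D x = dir_deriv ?e p x * complex_of_real ((bump x)\<^sup>2) + p x * complex_of_real (- 4 * vec_nth x i * bump x)" for x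
  have cG: "continuous_on UNIV G"
    unfolding G_def by (intro continuous_intros continuous_poly[OF p] continuous_bump)
  have cD: "continuous_on UNIV D"
    unfolding D_def by (intro continuous_intros continuous_poly[OF p] continuous_poly[OF poly_deriv_poly[OF p]] continuous_bump)
  have [measurable]: "G \<in> borel_measurable borel" "D \<in> borel_measurable borel"
    using cG cD by (auto intro: borel_measurable_continuous_onI)
  have G0: "G x = 0" "D x = 0" if "x \<notin> cball 0 1" for x
    using bump_zero[OF that] by (simp_all add: G_def D_def)
  have bd: "\<exists>B. \<forall>x. cmod (f x) \<le> B" if "continuous_on UNIV f" "\<And>x. x \<notin> cball 0 1 \<Longrightarrow> f x = 0" for f :: "R3 \<Rightarrow> complex"
  proof -
    have "compact (f ` cball 0 1)"
      using that by (intro compact_continuous_image) (auto intro: continuous_on_subset)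
    then obtain B where B: "\<And>x. x \<in> cball 0 1 \<Longrightarrow> cmod (f x) \<le> B"
      using compact_imp_bounded by (force simp: bounded_iff)
    have "0 \<le> B" using order_trans[OF norm_ge_zero B[of 0]] by simp
    then have "cmod (f x) \<le> B" for x using B[of x] that(2)[of x] by (cases "x \<in> cball 0 1") auto
    then show ?thesis by blast
  qed
  obtain BG where BG: "\<And>x. cmod (G x) \<le> BG" using bd[OF cG G0(1)] by blast
  obtain B where B: "\<And>x. cmod (D x) \<le> B" using bd[OF cD G0(2)] by blast
  have B0: "0 \<le> B" using B[of 0] norm_ge_zero order_trans by blast
  have d0: "((\<lambda>t. G (x + t *\<^sub>R ?e)) has_vector_derivative D x) (at 0)" for x
    unfolding G_def D_def
    using has_vector_derivative_mult[OF poly_has_deriv[OF p, of x i] has_vector_derivative_of_real[OF bump_deriv[of x i]]]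
    by (simp add: add.commute)
  have dt: "((\<lambda>t. G (x + t *\<^sub>R ?e)) has_vector_derivative D (x + t *\<^sub>R ?e)) (at t)" for x t
  proof -
    have "((\<lambda>u. u - t) has_vector_derivative 1) (at t)"
      by (auto intro!: derivative_eq_intros)
    from vector_diff_chain_at[OF this, of "\<lambda>s. G ((x + t *\<^sub>R ?e) + s *\<^sub>R ?e)" "D (x + t *\<^sub>R ?e)"] d0[of "x + t *\<^sub>R ?e"]
    show ?thesis by (simp add: o_def algebra_simps)
  qed
  have lip: "cmod (G (x + h *\<^sub>R ?e) - G x) \<le> B * h" if "h > 0" for x h
  proof -
    have "\<exists>t\<in>{0<..<h}. norm (G (x + h *\<^sub>R ?e) - G (x + 0 *\<^sub>R ?e)) \<le> norm ((h - 0) *\<^sub>R D (x + t *\<^sub>R ?e))"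
    proof (rule mvt_general[OF that])
      show "continuous_on {0..h} (\<lambda>t. G (x + t *\<^sub>R ?e))"
        by (intro continuous_on_compose2[OF cG] continuous_intros) auto
      show "((\<lambda>t. G (x + t *\<^sub>R ?e)) has_derivative (\<lambda>s. s *\<^sub>R D (x + t *\<^sub>R ?e))) (at t)" for t
        using dt[of x t] by (simp add: has_vector_derivative_def)
    qed
    then obtain t where "cmod (G (x + h *\<^sub>R ?e) - G x) \<le> h * cmod (D (x + t *\<^sub>R ?e))" using that by auto
    also have "\<dots> \<le> h * B" using B that by (intro mult_left_mono) auto
    finally show ?thesis by (simp add: mult.commute)
  qed
  define h where "h m = 1 / real (Suc m)" for m
  have h: "h m > 0" "h m \<le> 1" "h \<longlonglongrightarrow> 0" for m
    using LIMSEQ_Suc[OF lim_1_over_n] by (auto simp: h_def[abs_def])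
  have int_G: "integrable lborel G"
  proof (rule Bochner_Integration.integrable_bound)
    show "integrable lborel (\<lambda>x. BG * indicator (cball (0::R3) 1) x)"
      using emeasure_lborel_cball_finite[of "0::R3" 1]
      by (intro integrable_mult_right integrable_real_indicator) auto
    show "AE x in lborel. norm (G x) \<le> norm (BG * indicator (cball (0::R3) 1) x)"
      using BG G0(1) by (intro AE_I2) (auto simp: indicator_def intro: order_trans[OF _ abs_ge_self])
  qed simp
  have shift: "integrable lborel (\<lambda>x. G (x + c))" "(LINT x|lborel. G (x + c)) = integral\<^sup>L lborel G" for c
  proof -
    have i: "integrable (distr lborel borel ((+) c)) G" using int_G by (simp add: lborel_distr_plus)
    then show "integrable lborel (\<lambda>x. G (x + c))"
      by (subst (asm) integrable_distr_eq) (auto simp: add.commute)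
    show "(LINT x|lborel. G (x + c)) = integral\<^sup>L lborel G"
      using lborel_integral_affine[of G 1 c] by (simp add: add.commute)
  qed
  let ?Q = "\<lambda>m x. (1 / h m) *\<^sub>R (G (x + h m *\<^sub>R ?e) - G x)"
  have "(\<lambda>m. integral\<^sup>L lborel (?Q m)) \<longlonglongrightarrow> integral\<^sup>L lborel D"
  proof (rule integral_dominated_convergence)
    \<comment> \<open>Steps \<open>h m\<close> are at most \<open>1\<close>, so every difference
      quotient vanishes outside the ball of radius \<open>2\<close>.\<close>
    show "integrable lborel (\<lambda>x. B * indicator (cball (0::R3) 2) x)"
      using emeasure_lborel_cball_finite[of "0::R3" 2]
      by (intro integrable_mult_right integrable_real_indicator) auto
    show "AE x in lborel. norm (?Q m x) \<le> B * indicator (cball 0 2) x" for m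
    proof (rule AE_I2)
      fix x
      show "norm (?Q m x) \<le> B * indicator (cball 0 2) x"
      proof (cases "x \<in> cball 0 2")
        case True
        have "norm (?Q m x) \<le> B"
          using lip[OF h(1), of x m] h(1)[of m] by (simp add: pos_divide_le_eq)
        then show ?thesis using True by simp
      next
        case False
        then have n2: "norm x > 2" by simp
        have "norm x \<le> norm (x + h m *\<^sub>R ?e) + norm (h m *\<^sub>R ?e)"
          using norm_triangle_ineq4[of "x + h m *\<^sub>R ?e" "h m *\<^sub>R ?e"] by simp
        also have "norm (h m *\<^sub>R ?e) \<le> 1" using h(1)[of m] h(2)[of m] by simp
        finally have "x + h m *\<^sub>R ?e \<notin> cball 0 1" "x \<notin> cball 0 1" using n2 by auto
        then show ?thesis using G0 False by simp
      qed
    qed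
    show "AE x in lborel. (\<lambda>m. ?Q m x) \<longlonglongrightarrow> D x"
    proof (rule AE_I2)
      fix x
      have "(\<lambda>s. norm (G (x + s *\<^sub>R ?e) - G x - s *\<^sub>R D x) / norm s) \<midarrow>0\<rightarrow> 0"
        using d0[of x] by (simp add: has_vector_derivative_def has_derivative_at)
      then have "(\<lambda>m. norm (G (x + h m *\<^sub>R ?e) - G x - h m *\<^sub>R D x) / norm (h m)) \<longlonglongrightarrow> 0"
        by (rule filterlim_compose) (use h(1) h(3) in \<open>auto intro!: filterlim_atI simp: less_imp_neq[symmetric]\<close>)
      moreover have "norm (G (x + h m *\<^sub>R ?e) - G x - h m *\<^sub>R D x) / norm (h m) = norm (?Q m x - D x)" for m
      proof -
        have "?Q m x - D x = (1 / h m) *\<^sub>R (G (x + h m *\<^sub>R ?e) - G x - h m *\<^sub>R D x)"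
          using h(1)[of m] by (simp add: scaleR_diff_right)
        then show ?thesis using h(1)[of m] by simp
      qed
      ultimately have "(\<lambda>m. norm (?Q m x - D x)) \<longlonglongrightarrow> 0" by simp
      then show "(\<lambda>m. ?Q m x) \<longlonglongrightarrow> D x"
        by (simp add: tendsto_norm_zero_iff LIM_zero_iff)
    qed
  qed measurable
  moreover have "(\<lambda>m. integral\<^sup>L lborel (?Q m)) = (\<lambda>m. 0)"
  proof
    fix m
    have "(LINT x|lborel. G (x + h m *\<^sub>R ?e) - G x) = 0"
      using shift int_G by (subst Bochner_Integration.integral_diff) auto
    then show "integral\<^sup>L lborel (?Q m) = 0" by (simp only: integral_scaleR_right scaleR_zero_right)
  qed
  ultimately have "integral\<^sup>L lborel D = 0" by (simp only: LIMSEQ_const_iff)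
  then show ?thesis unfolding D_def .
qed

lemma integrable_continuous_cball:
  fixes f :: "R3 \<Rightarrow> complex"
  assumes c: "continuous_on UNIV f" and z: "\<And>x. x \<notin> cball 0 1 \<Longrightarrow> f x = 0"
  shows "integrable lborel f"
proof -
  have "compact (f ` cball 0 1)"
    using c by (intro compact_continuous_image) (auto intro: continuous_on_subset)
  then obtain B where B: "\<And>x. x \<in> cball 0 1 \<Longrightarrow> cmod (f x) \<le> B"
    using compact_imp_bounded by (force simp: bounded_iff)
  show ?thesis
  proof (rule Bochner_Integration.integrable_bound)
    show "integrable lborel (\<lambda>x. B * indicator (cball (0::R3) 1) x)"
      using emeasure_lborel_cball_finite[of "0::R3" 1]
      by (intro integrable_mult_right integrable_real_indicator) auto
    show "AE x in lborel. norm (f x) \<le> norm (B * indicator (cball (0::R3) 1) x)"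
      using B z by (intro AE_I2) (auto simp: indicator_def intro: order_trans[OF _ abs_ge_self])
    show "f \<in> borel_measurable lborel" using borel_measurable_continuous_onI[OF c] by simp
  qed
qed

text \<open>Integrate the divergence of \<open>v\<close> times the gradient of \<open>u\<close>
  times the squared bump. The Laplacian of \<open>u\<close> drops out, and the gradient of the
  weight meets that of \<open>u\<close> in the Euler field, which returns
  \<open>of_nat l * u x\<close>.\<close>

lemma green_bump:
  assumes u: "u \<in> homogeneous_space l" and v: "v \<in> poly_space n" and lap: "\<And>x. laplacian u x = 0"
  shows "(LINT x|lborel. (\<Sum>i\<in>UNIV. dir_deriv (axis i 1) u x * dir_deriv (axis i 1) v x) * complex_of_real ((bump x)\<^sup>2))
     = 4 * of_nat l * (LINT x|lborel. complex_of_real (bump x) * (u x * v x))"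
proof -
  let ?d = "\<lambda>i. dir_deriv (axis i (1::real) :: R3)"
  have up: "u \<in> poly_space l" using u homogeneous_subset_poly by blast
  have p: "(\<lambda>x. v x * ?d i u x) \<in> poly_space (n + l)" for i
    by (intro poly_mult v poly_deriv_poly[OF up])
  have dp: "?d i (\<lambda>x. v x * ?d i u x) x = v x * ?d i (?d i u) x + ?d i v x * ?d i u x" for i x
    using has_vector_derivative_mult[OF poly_has_deriv[OF v, where x = x and i = i] poly_has_deriv[OF poly_deriv_poly[OF up, of i], where x = x and i = i]]
    by (intro dir_deriv_eqI) simp
  define g where "g i x = ?d i (\<lambda>x. v x * ?d i u x) x * complex_of_real ((bump x)\<^sup>2)
     + v x * ?d i u x * complex_of_real (- 4 * vec_nth x i * bump x)" for i x
  have g0: "integral\<^sup>L lborel (g i) = 0" for i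
    using integral_by_parts_bump[OF p, of i i] by (simp only: g_def[abs_def])
  have gi: "integrable lborel (g i)" for i
  proof (rule integrable_continuous_cball)
    show "continuous_on UNIV (g i)"
      unfolding g_def by (intro continuous_intros continuous_poly[OF poly_deriv_poly[OF p]] continuous_poly[OF v]
          continuous_poly[OF poly_deriv_poly[OF up]] continuous_bump)
  qed (simp add: g_def bump_zero)
  have sum: "(\<Sum>i\<in>UNIV. g i x) = (\<Sum>i\<in>UNIV. ?d i u x * ?d i v x) * complex_of_real ((bump x)\<^sup>2)
      - 4 * of_nat l * (complex_of_real (bump x) * (u x * v x))" for x
  proof -
    have "(\<Sum>i\<in>UNIV. g i x) = (\<Sum>i\<in>UNIV. v x * complex_of_real ((bump x)\<^sup>2) * ?d i (?d i u) x
        + (?d i u x * ?d i v x) * complex_of_real ((bump x)\<^sup>2)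
        + (- 4 * complex_of_real (bump x) * v x) * (complex_of_real (vec_nth x i) * ?d i u x))"
      unfolding g_def dp by (intro sum.cong refl) (simp add: distrib_right distrib_left mult_ac)
    also have "\<dots> = v x * complex_of_real ((bump x)\<^sup>2) * (\<Sum>i\<in>UNIV. ?d i (?d i u) x)
        + (\<Sum>i\<in>UNIV. ?d i u x * ?d i v x) * complex_of_real ((bump x)\<^sup>2)
        + (- 4 * complex_of_real (bump x) * v x) * (\<Sum>i\<in>UNIV. complex_of_real (vec_nth x i) * ?d i u x)"
      by (simp only: sum.distrib sum_distrib_left sum_distrib_right)
    also have "(\<Sum>i\<in>UNIV. ?d i (?d i u) x) = 0"
      using lap[of x] by (simp add: laplacian_def sum_Basis_R3)
    also have "(\<Sum>i\<in>UNIV. complex_of_real (vec_nth x i) * ?d i u x) = of_nat l * u x"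
      by (rule euler_homogeneous[OF u])
    finally show ?thesis by (simp add: mult_ac)
  qed
  have i1: "integrable lborel (\<lambda>x. (\<Sum>i\<in>UNIV. ?d i u x * ?d i v x) * complex_of_real ((bump x)\<^sup>2))"
    by (rule integrable_continuous_cball, intro continuous_intros continuous_poly[OF poly_deriv_poly[OF up]]
        continuous_poly[OF poly_deriv_poly[OF v]] continuous_bump) (simp add: bump_zero)
  have i2: "integrable lborel (\<lambda>x. complex_of_real (bump x) * (u x * v x))"
    by (rule integrable_continuous_cball, intro continuous_intros continuous_poly[OF up]
        continuous_poly[OF v] continuous_bump) (simp add: bump_zero)
  have "(LINT x|lborel. (\<Sum>i\<in>UNIV. g i x)) = 0"
    using g0 gi by (subst Bochner_Integration.integral_sum) auto
  then have "(LINT x|lborel. (\<Sum>i\<in>UNIV. ?d i u x * ?d i v x) * complex_of_real ((bump x)\<^sup>2)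
      - 4 * of_nat l * (complex_of_real (bump x) * (u x * v x))) = 0"
    unfolding sum .
  then show ?thesis
    by (subst (asm) Bochner_Integration.integral_diff[OF i1 integrable_mult_right[OF i2]])
       (simp only: integral_mult_right_zero right_minus_eq)
qed

text \<open>The left-hand side of \<open>green_bump\<close> is symmetric in \<open>u\<close> and
  \<open>v\<close>; exchanging them shows that \<open>l\<close> and \<open>l'\<close> times the same
  integral agree.\<close>

lemma harmonic_orthogonal:
  assumes u: "u \<in> homogeneous_space l" "\<And>x. laplacian u x = 0"
    and v: "v \<in> homogeneous_space l'" "\<And>x. laplacian v x = 0" and "l \<noteq> l'"
  shows "(LINT x|lborel. complex_of_real (bump x) * (u x * v x)) = 0"
proof -
  have up: "u \<in> poly_space l" and vp: "v \<in> poly_space l'"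
    using u v homogeneous_subset_poly by blast+
  let ?J = "LINT x|lborel. complex_of_real (bump x) * (u x * v x)"
  have "4 * of_nat l * ?J = 4 * of_nat l' * (LINT x|lborel. complex_of_real (bump x) * (v x * u x))"
    unfolding green_bump[OF u(1) vp u(2), symmetric] green_bump[OF v(1) up v(2), symmetric]
    by (simp only: mult.commute)
  also have "(\<lambda>x. complex_of_real (bump x) * (v x * u x)) = (\<lambda>x. complex_of_real (bump x) * (u x * v x))"
    by (simp only: mult.commute)
  finally show ?thesis using \<open>l \<noteq> l'\<close> by simp
qed

lemma homogeneous_cnj:
  assumes "u \<in> homogeneous_space l"
  shows "(\<lambda>x. cnj (u x)) \<in> homogeneous_space l"
  using assms
proof (induction rule: homogeneous_induct)
  case (monomial a b c)
  have "(\<lambda>x. cnj (monomial3 (a, b, c) x)) = monomial3 (a, b, c)" by (simp add: monomial3_def fun_eq_iff)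
  then show ?case using monomial3_in_homogeneous[OF monomial] by simp
next
  case zero
  then show ?case using cfun.span_zero unfolding homogeneous_space_def by (simp add: zero_fun_def)
next
  case (add c p q)
  then have "(\<lambda>x. cnj c * cnj (p x)) + (\<lambda>x. cnj (q x)) \<in> homogeneous_space l"
    unfolding homogeneous_space_def by (intro cfun.span_add cfun.span_scale) auto
  then show ?case by (simp add: plus_fun_def)
qed

lemma laplacian_cnj:
  assumes "u \<in> poly_space n"
  shows "laplacian (\<lambda>x. cnj (u x)) x = cnj (laplacian u x)"
proof -
  have d: "dir_deriv (axis i 1) (\<lambda>x. cnj (f x)) = (\<lambda>x. cnj (dir_deriv (axis i 1) f x))"
    if "f \<in> poly_space n" for f i
    by (intro ext dir_deriv_eqI has_vector_derivative_cnj poly_has_deriv[OF that])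
  show ?thesis
    unfolding laplacian_def sum_Basis_R3
    by (simp add: d[OF assms] d[OF poly_deriv_poly[OF assms]] cnj_sum)
qed

text \<open>The product \<open>u x * v x\<close> is homogeneous of degree \<open>d = l + l'\<close>.
  In polar coordinates the weighted integral over the ball is
  \<open>3 / (d + 3) - 3 / (d + 5)\<close> times a multiple of the integral over the sphere, and
  this factor is not \<open>0\<close>.\<close>

theorem spherical_harmonics_orthogonal:
  assumes A: "A \<in> spherical_harmonics l" and B: "B \<in> spherical_harmonics l'" and "l \<noteq> l'"
  shows "(LINT x|sphere_measure. A x * cnj (B x)) = 0"
proof -
  obtain u where u: "u \<in> homogeneous_space l" "\<And>x. laplacian u x = 0" "\<And>x. x \<in> sphere 0 1 \<Longrightarrow> A x = u x"
    using A by (auto simp: spherical_harmonics_def)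
  obtain w where w: "w \<in> homogeneous_space l'" "\<And>x. laplacian w x = 0" "\<And>x. x \<in> sphere 0 1 \<Longrightarrow> B x = w x"
    using B by (auto simp: spherical_harmonics_def)
  define v where "v x = cnj (w x)" for x
  have v: "v \<in> homogeneous_space l'" unfolding v_def using homogeneous_cnj[OF w(1)] .
  have lv: "laplacian v x = 0" for x
    unfolding v_def using laplacian_cnj[of w l' x] w(2) homogeneous_subset_poly w(1) by auto
  have up: "u \<in> poly_space l" and vp: "v \<in> poly_space l'"
    using u v homogeneous_subset_poly by blast+
  have uv: "(\<lambda>x. u x * v x) \<in> poly_space (l + l')" by (rule poly_mult[OF up vp])
  \<comment> \<open>Cutting off outside the sphere yields a bounded function on all of space, as
    \<open>radial_integral\<close> requires; only the values at \<open>sgn x\<close> matter.\<close>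
  define F where "F x = indicator (sphere 0 1) x *\<^sub>R (u x * v x)" for x :: R3
  have "(\<lambda>x. u x * v x) \<in> borel_measurable borel"
    by (intro borel_measurable_continuous_onI continuous_poly[OF uv])
  then have Fm: "F \<in> borel_measurable borel"
    unfolding F_def by (intro borel_measurable_scaleR borel_measurable_indicator) auto
  obtain b where b: "\<And>x. x \<in> sphere 0 1 \<Longrightarrow> cmod (u x * v x) \<le> b"
    using poly_space_bounded_on[OF uv bounded_sphere] by blast
  have FB: "cmod (F x) \<le> \<bar>b\<bar>" for x
    using b[of x] by (auto simp: F_def indicator_def)
  let ?I = "LINT x|lborel. indicator punctured x *\<^sub>R F (sgn x)"
  let ?d = "l + l'"
  let ?R = "\<lambda>d x. indicator punctured x *\<^sub>R (complex_of_real (norm x ^ d) * F (sgn x))"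
  have Ri: "integrable lborel (?R d)" for d
  proof (rule indicator_punctured_integrable)
    show "(\<lambda>x. complex_of_real (norm x ^ d) * F (sgn x)) \<in> borel_measurable borel"
      using Fm by measurable
    show "cmod (complex_of_real (norm x ^ d) * F (sgn x)) \<le> \<bar>b\<bar>" if "x \<in> punctured" for x
    proof -
      have "norm x ^ d \<le> 1" using that by (intro power_le_one) auto
      then have "norm x ^ d * cmod (F (sgn x)) \<le> 1 * \<bar>b\<bar>" using FB[of "sgn x"] by (intro mult_mono) auto
      then show ?thesis by (simp add: norm_mult norm_power)
    qed
  qed
  have pt: "complex_of_real (bump x) * (u x * v x) = ?R ?d x - ?R (?d + 2) x" if "x \<noteq> 0" for x
  proof (cases "x \<in> cball 0 1")
    case True
    have x: "x = norm x *\<^sub>R sgn x" using that by (simp add: sgn_div_norm)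
    have "u x = complex_of_real (norm x) ^ l * u (sgn x)" "v x = complex_of_real (norm x) ^ l' * v (sgn x)"
      using homogeneous_scale[OF u(1), of "norm x" "sgn x"] homogeneous_scale[OF v, of "norm x" "sgn x"] x by auto
    moreover have "F (sgn x) = u (sgn x) * v (sgn x)"
      using that by (simp add: F_def norm_sgn)
    moreover have "bump x = 1 - norm x ^ 2" using True power_le_one[of "norm x" 2] by (simp add: bump_def)
    ultimately have "complex_of_real (bump x) * (u x * v x)
       = complex_of_real ((1 - norm x ^ 2) * norm x ^ ?d) * F (sgn x)"
      by (simp add: power_add mult_ac)
    also have "(1 - norm x ^ 2) * norm x ^ ?d = norm x ^ ?d - norm x ^ (?d + 2)"
      by (simp only: left_diff_distrib mult_1 power_add[of _ ?d 2] mult.commute[of "(norm x)\<^sup>2"])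
    finally show ?thesis using that True by (simp add: left_diff_distrib)
  qed (simp add: bump_zero indicator_def)
  have "0 = (LINT x|lborel. complex_of_real (bump x) * (u x * v x))"
    using harmonic_orthogonal[OF u(1,2) v lv \<open>l \<noteq> l'\<close>] by simp
  also have "\<dots> = (LINT x|lborel. ?R ?d x - ?R (?d + 2) x)"
  proof (rule integral_cong_AE)
    show "AE x in lborel. complex_of_real (bump x) * (u x * v x) = ?R ?d x - ?R (?d + 2) x"
      using AE_lborel_singleton[of "0::R3"] by eventually_elim (rule pt)
    have "continuous_on UNIV (\<lambda>x. complex_of_real (bump x) * (u x * v x))"
      by (intro continuous_intros continuous_poly[OF up] continuous_poly[OF vp] continuous_bump)
    then show "(\<lambda>x. complex_of_real (bump x) * (u x * v x)) \<in> borel_measurable lborel"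
      using borel_measurable_continuous_onI by simp
    show "(\<lambda>x. ?R ?d x - ?R (?d + 2) x) \<in> borel_measurable lborel"
      using borel_measurable_integrable[OF Ri] by (intro borel_measurable_diff)
  qed
  also have "\<dots> = integral\<^sup>L lborel (?R ?d) - integral\<^sup>L lborel (?R (?d + 2))"
    by (rule Bochner_Integration.integral_diff[OF Ri Ri])
  also have "\<dots> = (complex_of_real (3 / (real ?d + 3)) - complex_of_real (3 / (real (?d + 2) + 3))) * ?I"
    unfolding radial_integral[OF Fm FB] by (rule left_diff_distrib[symmetric])
  finally have "(complex_of_real (3 / (real ?d + 3)) - complex_of_real (3 / (real (?d + 2) + 3))) * ?I = 0" by simp
  moreover have "3 / (real ?d + 3) \<noteq> 3 / (real (?d + 2) + 3)" by (simp add: divide_simps)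
  then have "complex_of_real (3 / (real ?d + 3)) - complex_of_real (3 / (real (?d + 2) + 3)) \<noteq> 0"
    by (simp only: right_minus_eq of_real_eq_iff not_False_eq_True)
  ultimately have I0: "?I = 0" by simp
  have "(LINT x|sphere_measure. A x * cnj (B x)) = integral\<^sup>L sphere_measure F"
    by (intro Bochner_Integration.integral_cong) (auto simp: F_def u(3) w(3) v_def)
  also have "\<dots> = 0" using sphere_integral[of F] I0 Fm by (simp add: measurable_restrict_space1)
  finally show ?thesis .
qed

section \<open>Completeness of the spherical harmonics\<close>

definition harm_index :: "nat \<Rightarrow> (nat \<times> nat) set" where
  "harm_index n = Sigma {..n} (\<lambda>l. {1..2 * l + 1})"

lemma finite_harm_index [simp]: "finite (harm_index n)"
  by (simp add: harm_index_def)

lemma sum_odd: "(\<Sum>l\<le>n. 2 * l + 1) = (n + 1)\<^sup>2" for n :: nat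
  by (induction n) (simp_all add: power2_eq_square)

lemma card_harm_index: "card (harm_index n) = (n + 1)\<^sup>2"
  unfolding harm_index_def using sum_odd[of n] by (subst card_SigmaI) simp_all

lemma sum_fun_apply: "(\<Sum>i\<in>I. f i) x = (\<Sum>i\<in>I. f i x :: complex)"
  by (induction I rule: infinite_finite_induct) auto

text \<open>With the value \<open>0\<close> off the sphere, equality of functions becomes equality
  on the sphere, and the linear algebra of the full function space applies to restrictions.\<close>

definition on_sphere :: "(R3 \<Rightarrow> complex) \<Rightarrow> R3 \<Rightarrow> complex" where
  "on_sphere f x = (if x \<in> sphere 0 1 then f x else 0)"

text \<open>On the sphere the square of the third coordinate is a polynomial in the other two, so
  its exponent can be kept at most \<open>1\<close>.\<close>

definition low_degree :: "nat \<Rightarrow> (nat \<times> nat \<times> nat) set" where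
  "low_degree n = {(a, b, c). c \<le> 1 \<and> a + b + c \<le> n}"

lemma finite_low_degree: "finite (low_degree n)"
  by (rule finite_subset[OF _ finite_deg[of n]]) (auto simp: low_degree_def)

text \<open>An injection into a square of side \<open>n + 1\<close>: exponents with
  \<open>c = 0\<close> go to pairs whose first entry is at most the second, those with
  \<open>c = 1\<close> to pairs whose first entry is larger.\<close>

lemma card_low_degree: "card (low_degree n) \<le> (n + 1)\<^sup>2"
proof -
  let ?f = "\<lambda>(a, b, c::nat). if c = 0 then (a, a + b) else (a + b + 1, a)"
  have "inj_on ?f (low_degree n)"
    by (auto simp: inj_on_def low_degree_def split: if_splits)
  moreover have "?f ` low_degree n \<subseteq> {..n} \<times> {..n}"
    by (auto simp: low_degree_def split: if_splits)
  ultimately have "card (low_degree n) \<le> card ({..n} \<times> {..n})"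
    by (intro card_inj_on_le[where f = ?f]) auto
  then show ?thesis by (simp add: card_cartesian_product power2_eq_square)
qed

lemma monomial3_on_sphere:
  assumes "x \<in> sphere 0 1"
  shows "monomial3 (a, b, c + 2) x = monomial3 (a, b, c) x - monomial3 (a + 2, b, c) x - monomial3 (a, b + 2, c) x"
proof -
  have "(norm x)\<^sup>2 = vec_nth x 1 ^ 2 + vec_nth x 2 ^ 2 + vec_nth x 3 ^ 2"
    unfolding power2_norm_eq_inner inner_R3 by (simp add: sum_3 power2_eq_square)
  then have e: "vec_nth x 3 ^ 2 = 1 - vec_nth x 1 ^ 2 - vec_nth x 2 ^ 2" using assms by simp
  have "vec_nth x 1 ^ a * vec_nth x 2 ^ b * vec_nth x 3 ^ (c + 2)
      = (vec_nth x 1 ^ a * vec_nth x 2 ^ b * vec_nth x 3 ^ c) * (1 - vec_nth x 1 ^ 2 - vec_nth x 2 ^ 2)"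
    unfolding power_add e by (simp only: mult.assoc)
  also have "\<dots> = vec_nth x 1 ^ a * vec_nth x 2 ^ b * vec_nth x 3 ^ c
      - vec_nth x 1 ^ (a + 2) * vec_nth x 2 ^ b * vec_nth x 3 ^ c
      - vec_nth x 1 ^ a * vec_nth x 2 ^ (b + 2) * vec_nth x 3 ^ c"
    by (simp only: power_add right_diff_distrib mult_1_right) (simp only: mult_ac)
  finally show ?thesis unfolding monomial3_def prod.case of_real_diff[symmetric] by (rule arg_cong)
qed

text \<open>Each use of the sphere equation lowers \<open>c\<close> by \<open>2\<close> without
  raising the total degree, which keeps the bound \<open>n\<close> through the induction.\<close>

lemma on_sphere_monomial_span:
  "a + b + c \<le> n \<Longrightarrow> on_sphere (monomial3 (a, b, c)) \<in> cfun.span ((\<lambda>t. on_sphere (monomial3 t)) ` low_degree n)"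
proof (induction c arbitrary: a b rule: less_induct)
  case (less c)
  let ?T = "(\<lambda>t. on_sphere (monomial3 t)) ` low_degree n"
  show ?case
  proof (cases "c \<le> 1")
    case True
    then have "(a, b, c) \<in> low_degree n" using less.prems by (simp add: low_degree_def)
    then show ?thesis by (intro cfun.span_base) blast
  next
    case False
    define d where "d = c - 2"
    have c: "c = d + 2" using False by (simp add: d_def)
    have "on_sphere (monomial3 (a, b, c)) = on_sphere (monomial3 (a, b, d)) - on_sphere (monomial3 (a + 2, b, d))
        - on_sphere (monomial3 (a, b + 2, d))"
      unfolding c using monomial3_on_sphere[of _ a b d] by (auto simp: on_sphere_def fun_eq_iff)
    moreover have "on_sphere (monomial3 (a, b, d)) \<in> cfun.span ?T" "on_sphere (monomial3 (a + 2, b, d)) \<in> cfun.span ?T"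
        "on_sphere (monomial3 (a, b + 2, d)) \<in> cfun.span ?T"
      using less.prems c by (auto intro!: less.IH)
    ultimately show ?thesis by (metis cfun.span_diff)
  qed
qed

lemma on_sphere_poly_span:
  assumes "p \<in> poly_space n"
  shows "on_sphere p \<in> cfun.span ((\<lambda>t. on_sphere (monomial3 t)) ` low_degree n)"
  using assms
proof (induction rule: poly_induct)
  case (monomial a b c)
  then show ?case by (rule on_sphere_monomial_span)
next
  case zero
  have "on_sphere (\<lambda>_. 0) = 0" by (auto simp: on_sphere_def fun_eq_iff)
  then show ?case by (simp only: cfun.span_zero)
next
  case (add c p q)
  have "on_sphere (\<lambda>x. c * p x + q x) = (\<lambda>x. c * on_sphere p x) + on_sphere q"
    by (auto simp: on_sphere_def fun_eq_iff)
  moreover have "(\<lambda>x. c * on_sphere p x) + on_sphere q \<in> cfun.span ((\<lambda>t. on_sphere (monomial3 t)) ` low_degree n)"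
    by (intro cfun.span_add cfun.span_scale add)
  ultimately show ?case by (simp only:)
qed

context
  fixes Y :: "nat \<Rightarrow> nat \<Rightarrow> R3 \<Rightarrow> complex"
  assumes Y: "spherical_harmonic_basis Y"
begin

lemma Y_poly:
  assumes "j \<in> {1..2 * l + 1}"
  obtains p where "p \<in> poly_space l" "\<And>x. x \<in> sphere 0 1 \<Longrightarrow> Y l j x = p x"
proof -
  have "Y l j \<in> spherical_harmonics l" using Y assms by (simp add: spherical_harmonic_basis_def)
  then obtain h where "h \<in> homogeneous_space l" "\<forall>x\<in>sphere 0 1. Y l j x = h x"
    by (auto simp: spherical_harmonics_def)
  then show ?thesis using that[of h] homogeneous_subset_poly by blast
qed

lemma Y_bounded:
  assumes "j \<in> {1..2 * l + 1}"
  obtains B where "\<And>x. x \<in> sphere 0 1 \<Longrightarrow> cmod (Y l j x) \<le> B"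
proof -
  obtain p where p: "p \<in> poly_space l" "\<And>x. x \<in> sphere 0 1 \<Longrightarrow> Y l j x = p x" using Y_poly[OF assms] by blast
  then show ?thesis using poly_space_bounded_on[OF p(1) bounded_sphere[of 0 1]] that by metis
qed

lemma Y_measurable:
  assumes "j \<in> {1..2 * l + 1}"
  shows "Y l j \<in> borel_measurable sphere_measure"
proof -
  obtain p where p: "p \<in> poly_space l" "\<And>x. x \<in> sphere 0 1 \<Longrightarrow> Y l j x = p x" using Y_poly[OF assms] by blast
  have "p \<in> borel_measurable sphere_measure"
    unfolding measurable_cong_sets[OF sets_sphere_measure refl]
    by (intro measurable_restrict_space1 borel_measurable_continuous_onI continuous_poly[OF p(1)])
  then show ?thesis by (subst measurable_cong[of _ _ p]) (auto simp: p(2))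
qed

lemma Y_sqi:
  assumes "j \<in> {1..2 * l + 1}"
  shows "Y l j \<in> square_integrable sphere_measure"
proof -
  obtain B where "\<And>x. x \<in> sphere 0 1 \<Longrightarrow> cmod (Y l j x) \<le> B" using Y_bounded[OF assms] by blast
  then show ?thesis by (intro sqi_bounded[OF finite_sphere_measure Y_measurable[OF assms], of B]) auto
qed

lemma Y_orthonormal:
  assumes "i \<in> {1..2 * l + 1}" "j \<in> {1..2 * l' + 1}"
  shows "l2i sphere_measure (Y l i) (Y l' j) = of_bool ((l, i) = (l', j))"
proof (cases "l = l'")
  case True
  then show ?thesis using Y assms by (simp add: spherical_harmonic_basis_def l2i_def)
next
  case False
  have "Y l i \<in> spherical_harmonics l" "Y l' j \<in> spherical_harmonics l'"
    using Y assms by (simp_all add: spherical_harmonic_basis_def)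
  then show ?thesis using spherical_harmonics_orthogonal[OF _ _ False] False by (simp add: l2i_def)
qed

abbreviation "Yp \<equiv> \<lambda>\<alpha>. Y (fst \<alpha>) (snd \<alpha>)"

lemma harm_indexD: "\<alpha> \<in> harm_index n \<Longrightarrow> snd \<alpha> \<in> {1..2 * fst \<alpha> + 1}"
  by (auto simp: harm_index_def)

lemma Yp_orthonormal:
  assumes "\<alpha> \<in> harm_index n" "\<beta> \<in> harm_index n"
  shows "l2i sphere_measure (Yp \<alpha>) (Yp \<beta>) = of_bool (\<alpha> = \<beta>)"
  using Y_orthonormal[OF harm_indexD[OF assms(1)] harm_indexD[OF assms(2)]] by (simp add: prod_eq_iff)

text \<open>The dimension count deals with sets of functions, so distinct indices must give distinct
  restrictions.\<close>

lemma on_sphere_inj: "inj_on (\<lambda>\<alpha>. on_sphere (Yp \<alpha>)) (harm_index n)"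
proof (rule inj_onI)
  fix \<alpha> \<beta> assume a: "\<alpha> \<in> harm_index n" "\<beta> \<in> harm_index n" and e: "on_sphere (Yp \<alpha>) = on_sphere (Yp \<beta>)"
  have "Yp \<alpha> x = Yp \<beta> x" if "x \<in> sphere 0 1" for x
    using fun_cong[OF e, of x] that by (simp add: on_sphere_def)
  then have "l2i sphere_measure (Yp \<alpha>) (Yp \<beta>) = l2i sphere_measure (Yp \<alpha>) (Yp \<alpha>)"
    unfolding l2i_def by (intro Bochner_Integration.integral_cong) auto
  then show "\<alpha> = \<beta>"
    using Yp_orthonormal[OF a] Yp_orthonormal[OF a(1) a(1)] by (cases "\<alpha> = \<beta>") simp_all
qed

text \<open>Pairing a vanishing combination with one harmonic isolates its coefficient, by
  orthonormality.\<close>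

lemma on_sphere_independent: "cfun.independent ((\<lambda>\<alpha>. on_sphere (Yp \<alpha>)) ` harm_index n)"
proof -
  let ?f = "\<lambda>\<alpha>. on_sphere (Yp \<alpha>)"
  have "u v = 0" if s: "(\<Sum>v\<in>?f ` harm_index n. (\<lambda>x. u v * v x)) = 0" and v: "v \<in> ?f ` harm_index n" for u v
  proof -
    obtain \<beta> where \<beta>: "\<beta> \<in> harm_index n" "v = ?f \<beta>" using v by blast
    have "(\<Sum>\<alpha>\<in>harm_index n. u (?f \<alpha>) * Yp \<alpha> x) = 0" if "x \<in> sphere 0 1" for x
    proof -
      have "0 = (\<Sum>v\<in>?f ` harm_index n. (\<lambda>x. u v * v x)) x" using s by simp
      also have "\<dots> = (\<Sum>v\<in>?f ` harm_index n. u v * v x)" by (rule sum_fun_apply)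
      also have "\<dots> = (\<Sum>\<alpha>\<in>harm_index n. u (?f \<alpha>) * ?f \<alpha> x)"
        by (subst sum.reindex[OF on_sphere_inj]) simp
      finally show ?thesis using that by (simp add: on_sphere_def)
    qed
    then have "l2i sphere_measure (\<lambda>x. \<Sum>\<alpha>\<in>harm_index n. u (?f \<alpha>) * Yp \<alpha> x) (Yp \<beta>) = 0"
      unfolding l2i_def by (subst Bochner_Integration.integral_cong[OF refl, of _ _ "\<lambda>_. 0"]) auto
    moreover have "l2i sphere_measure (\<lambda>x. \<Sum>\<alpha>\<in>harm_index n. u (?f \<alpha>) * Yp \<alpha> x) (Yp \<beta>)
        = (\<Sum>\<alpha>\<in>harm_index n. u (?f \<alpha>) * l2i sphere_measure (Yp \<alpha>) (Yp \<beta>))"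
      by (subst l2i_sum_left, rule sqi_cmult[OF Y_sqi[OF harm_indexD]], assumption,
          rule Y_sqi[OF harm_indexD[OF \<beta>(1)]]) (simp only: l2i_cmult_left)
    moreover have "\<dots> = (\<Sum>\<alpha>\<in>harm_index n. if \<alpha> = \<beta> then u (?f \<beta>) else 0)"
      by (intro sum.cong refl) (simp add: Yp_orthonormal \<beta>(1))
    ultimately show ?thesis using \<beta> by simp
  qed
  then show ?thesis
    unfolding cfun.dependent_finite[OF finite_imageI[OF finite_harm_index]] by blast
qed

text \<open>A dimension count in place of the decomposition of polynomials into harmonic ones.
  Restrictions of polynomials of degree \<open>n\<close> lie in the span of at most
  \<open>(n + 1)\<^sup>2\<close> functions, and that span contains \<open>(n + 1)\<^sup>2\<close>
  independent harmonics; one more independent element would be too many.\<close>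

lemma poly_harmonic_expansion:
  assumes p: "p \<in> poly_space n"
  obtains c where "\<And>x. x \<in> sphere 0 1 \<Longrightarrow> p x = (\<Sum>\<alpha>\<in>harm_index n. c \<alpha> * Yp \<alpha> x)"
proof -
  let ?T = "(\<lambda>t. on_sphere (monomial3 t)) ` low_degree n"
  let ?S = "(\<lambda>\<alpha>. on_sphere (Yp \<alpha>)) ` harm_index n"
  have finT: "finite ?T" using finite_low_degree by simp
  have cardT: "card ?T \<le> (n + 1)\<^sup>2"
    using card_image_le[OF finite_low_degree] card_low_degree order_trans by blast
  have cardS: "card ?S = (n + 1)\<^sup>2" by (simp only: card_image[OF on_sphere_inj] card_harm_index)
  have ST: "?S \<subseteq> cfun.span ?T"
  proof
    fix s assume "s \<in> ?S"
    then obtain \<alpha> where \<alpha>: "\<alpha> \<in> harm_index n" "s = on_sphere (Yp \<alpha>)" by blast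
    obtain q where q: "q \<in> poly_space (fst \<alpha>)" "\<And>x. x \<in> sphere 0 1 \<Longrightarrow> Yp \<alpha> x = q x"
      using Y_poly[OF harm_indexD[OF \<alpha>(1)]] by blast
    have "fst \<alpha> \<le> n" using \<alpha> by (auto simp: harm_index_def)
    then have "q \<in> poly_space n" using q poly_space_mono by blast
    moreover have "s = on_sphere q" unfolding \<alpha>(2) by (intro ext) (simp add: on_sphere_def q(2))
    ultimately show "s \<in> cfun.span ?T" using on_sphere_poly_span by simp
  qed
  have "on_sphere p \<in> cfun.span ?S"
  proof (rule ccontr)
    assume ns: "on_sphere p \<notin> cfun.span ?S"
    then have "cfun.independent (insert (on_sphere p) ?S)"
      by (rule cfun.independent_insertI[OF _ on_sphere_independent])
    moreover have "insert (on_sphere p) ?S \<subseteq> cfun.span ?T" using ST on_sphere_poly_span[OF p] by (rule insert_subsetI[rotated])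
    ultimately have "card (insert (on_sphere p) ?S) \<le> card ?T"
      using cfun.independent_span_bound[OF finT] by blast
    moreover have "on_sphere p \<notin> ?S"
    proof
      assume "on_sphere p \<in> ?S"
      then have "on_sphere p \<in> cfun.span ?S" by (rule cfun.span_base)
      with ns show False by (rule notE)
    qed
    then have "card (insert (on_sphere p) ?S) = card ?S + 1"
      by (subst card_insert_disjoint) (simp_all only: finite_imageI finite_harm_index not_False_eq_True Suc_eq_plus1)
    ultimately show False using cardS cardT by linarith
  qed
  then have "on_sphere p \<in> range (\<lambda>u. \<Sum>v\<in>?S. (\<lambda>x. u v * v x))"
    unfolding cfun.span_finite[OF finite_imageI[OF finite_harm_index]] .
  then obtain u where u: "on_sphere p = (\<Sum>v\<in>?S. (\<lambda>x. u v * v x))"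
    by (rule imageE)
  have "p x = (\<Sum>\<alpha>\<in>harm_index n. u (on_sphere (Yp \<alpha>)) * Yp \<alpha> x)" if "x \<in> sphere 0 1" for x
  proof -
    have "p x = (\<Sum>v\<in>?S. u v * v x)"
      using fun_cong[OF u, of x] that unfolding on_sphere_def sum_fun_apply by (simp only: if_True)
    also have "\<dots> = (\<Sum>\<alpha>\<in>harm_index n. u (on_sphere (Yp \<alpha>)) * on_sphere (Yp \<alpha>) x)"
      by (subst sum.reindex[OF on_sphere_inj]) simp
    finally show ?thesis using that by (simp add: on_sphere_def)
  qed
  then show ?thesis by (rule that)
qed

lemma Y_bounded_ex: "j \<in> {1..2 * l + 1} \<Longrightarrow> \<exists>B. \<forall>x\<in>sphere 0 1. cmod (Y l j x) \<le> B"
  by (rule Y_bounded) blast+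

lemma poly_harmonic_expansion_ex:
  "p \<in> poly_space n \<Longrightarrow> \<exists>c. \<forall>x\<in>sphere 0 1. p x = (\<Sum>\<alpha>\<in>harm_index n. c \<alpha> * Yp \<alpha> x)"
  by (rule poly_harmonic_expansion, assumption) blast

end

section \<open>The product of two spheres\<close>

text \<open>Identifies the product sigma-algebra with a trace of the Borel sets, the form in which
  the density of continuous functions is available.\<close>

lemma sets_sphere2: "sets sphere2_measure = sets (restrict_space borel (sphere (0::R3) 1 \<times> sphere (0::R3) 1))"
proof
  have id: "(\<lambda>p. p) \<in> measurable sphere2_measure (borel :: (R3 \<times> R3) measure)"
  proof -
    have f: "(\<lambda>x. x) \<in> measurable sphere_measure (borel :: R3 measure)"
      unfolding measurable_cong_sets[OF sets_sphere_measure refl] by (rule measurable_restrict_space1) simp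
    have "(\<lambda>p. (fst p, snd p)) \<in> measurable sphere2_measure (borel \<Otimes>\<^sub>M borel :: (R3 \<times> R3) measure)"
      by (intro measurable_Pair measurable_compose[OF measurable_fst f] measurable_compose[OF measurable_snd f])
    then show ?thesis by (simp add: borel_prod)
  qed
  show "sets (restrict_space borel (sphere (0::R3) 1 \<times> sphere (0::R3) 1)) \<subseteq> sets sphere2_measure"
  proof
    fix A assume "A \<in> sets (restrict_space borel (sphere (0::R3) 1 \<times> sphere (0::R3) 1))"
    then obtain B :: "(R3 \<times> R3) set" where B: "B \<in> sets borel" "A = (sphere 0 1 \<times> sphere 0 1) \<inter> B"
      by (auto simp: sets_restrict_space)
    have "(\<lambda>p. p) -` B \<inter> space sphere2_measure \<in> sets sphere2_measure"
      by (rule measurable_sets[OF id B(1)])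
    then show "A \<in> sets sphere2_measure" using B(2) by (simp add: space_pair_measure Int_commute)
  qed
  show "sets sphere2_measure \<subseteq> sets (restrict_space borel (sphere (0::R3) 1 \<times> sphere (0::R3) 1))"
  proof (rule sets_pair_in_sets)
    fix a b :: "R3 set" assume "a \<in> sets sphere_measure" "b \<in> sets sphere_measure"
    then obtain a' b' where *: "a' \<in> sets borel" "a = sphere 0 1 \<inter> a'" "b' \<in> sets borel" "b = sphere 0 1 \<inter> b'"
      by (auto simp: sets_sphere_measure sets_restrict_space)
    have "a' \<times> b' \<in> sets (borel \<Otimes>\<^sub>M borel :: (R3 \<times> R3) measure)" using * by simp
    then have "a' \<times> b' \<in> sets (borel :: (R3 \<times> R3) measure)" unfolding borel_prod .
    moreover have "a \<times> b = (sphere 0 1 \<times> sphere 0 1) \<inter> (a' \<times> b')" using * by auto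
    ultimately show "a \<times> b \<in> sets (restrict_space borel (sphere (0::R3) 1 \<times> sphere (0::R3) 1))"
      unfolding sets_restrict_space by blast
  qed
qed

lemma space_sphere2 [simp]: "space sphere2_measure = sphere 0 1 \<times> sphere 0 1"
  by (simp add: space_pair_measure)

interpretation sphere: finite_measure sphere_measure
  by (rule finite_sphere_measure)

interpretation sphere2: pair_sigma_finite sphere_measure sphere_measure ..

lemma finite_sphere2: "finite_measure sphere2_measure"
  by (rule finite_measure_pair_measure[OF finite_sphere_measure finite_sphere_measure])

lemma sphere2_borel: "sphere (0::R3) 1 \<times> sphere (0::R3) 1 \<in> sets borel"
  by (intro borel_closed closed_Times) auto

lemma sphere2_integral_product:
  assumes f: "f \<in> borel_measurable sphere_measure" "\<And>x. x \<in> sphere 0 1 \<Longrightarrow> cmod (f x) \<le> B"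
    and g: "g \<in> borel_measurable sphere_measure" "\<And>x. x \<in> sphere 0 1 \<Longrightarrow> cmod (g x) \<le> C"
  shows "(LINT p|sphere2_measure. f (fst p) * g (snd p)) = integral\<^sup>L sphere_measure f * integral\<^sup>L sphere_measure g"
proof -
  have m: "(\<lambda>p. f (fst p) * g (snd p)) \<in> borel_measurable sphere2_measure"
    using f g by measurable
  have "cmod (f x * g y) \<le> B * C" if "x \<in> sphere 0 1" "y \<in> sphere 0 1" for x y
    unfolding norm_mult using f(2)[OF that(1)] g(2)[OF that(2)]
      order_trans[OF norm_ge_zero f(2)[OF that(1)]]
    by (intro mult_mono) auto
  then have i: "integrable sphere2_measure (\<lambda>p. f (fst p) * g (snd p))"
    by (intro finite_measure.integrable_const_bound[OF finite_sphere2 _ m, of "B * C"] AE_I2) auto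
  have "(LINT p|sphere2_measure. f (fst p) * g (snd p))
      = (LINT x|sphere_measure. (LINT y|sphere_measure. f (fst (x, y)) * g (snd (x, y))))"
    by (rule sphere2.integral_fst'[OF i, symmetric])
  then show ?thesis by simp
qed

section \<open>Polynomials in a pair of points\<close>

definition tensor_poly :: "nat \<Rightarrow> (R3 \<times> R3 \<Rightarrow> complex) set" where
  "tensor_poly n = cfun.span {\<lambda>p. u (fst p) * v (snd p) | u v. u \<in> poly_space n \<and> v \<in> poly_space n}"

lemma tensor_poly_mono: "m \<le> n \<Longrightarrow> tensor_poly m \<subseteq> tensor_poly n"
  unfolding tensor_poly_def using poly_space_mono by (intro cfun.span_mono) blast

lemma tensor_poly_add: "f \<in> tensor_poly n \<Longrightarrow> g \<in> tensor_poly n \<Longrightarrow> (\<lambda>p. f p + g p) \<in> tensor_poly n"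
  unfolding tensor_poly_def using cfun.span_add[of f _ g] by (simp add: plus_fun_def)

lemma tensor_poly_cmult: "f \<in> tensor_poly n \<Longrightarrow> (\<lambda>p. c * f p) \<in> tensor_poly n"
  unfolding tensor_poly_def by (rule cfun.span_scale)

lemma tensor_poly_base: "u \<in> poly_space n \<Longrightarrow> v \<in> poly_space n \<Longrightarrow> (\<lambda>p. u (fst p) * v (snd p)) \<in> tensor_poly n"
  unfolding tensor_poly_def by (rule cfun.span_base) blast

lemma tensor_poly_induct [consumes 1, case_names base zero add]:
  assumes "f \<in> tensor_poly n"
    and base: "\<And>u v. u \<in> poly_space n \<Longrightarrow> v \<in> poly_space n \<Longrightarrow> P (\<lambda>p. u (fst p) * v (snd p))"
    and zero: "P (\<lambda>_. 0)"
    and add: "\<And>c f g. P f \<Longrightarrow> P g \<Longrightarrow> P (\<lambda>x. c * f x + g x)"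
  shows "P f"
proof -
  from assms(1)[unfolded tensor_poly_def]
  have "P f"
  proof (induction rule: cfun.span_induct_alt)
    case base
    then show ?case using zero by (simp add: zero_fun_def)
  next
    case (step c p q)
    then have "P p" using base by auto
    with step add[of p q c] show ?case by (simp add: plus_fun_def)
  qed
  then show ?thesis .
qed

lemma tensor_poly_zero: "(\<lambda>_. 0) \<in> tensor_poly n"
  using tensor_poly_base[OF poly_zero poly_zero] by simp

lemma tensor_poly_mult:
  assumes "f \<in> tensor_poly m" and g: "g \<in> tensor_poly n"
  shows "(\<lambda>p. f p * g p) \<in> tensor_poly (m + n)"
  using assms(1)
proof (induction rule: tensor_poly_induct)
  case (base u v)
  from g show ?case
  proof (induction rule: tensor_poly_induct)
    case (base u' v')
    have "(\<lambda>p. (u (fst p) * u' (fst p)) * (v (snd p) * v' (snd p))) \<in> tensor_poly (m + n)"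
      using poly_mult[OF \<open>u \<in> poly_space m\<close> base(1)] poly_mult[OF \<open>v \<in> poly_space m\<close> base(2)]
      by (rule tensor_poly_base)
    then show ?case by (simp only: mult_ac)
  next
    case (add c f g)
    have "(\<lambda>p. c * (u (fst p) * v (snd p) * f p) + u (fst p) * v (snd p) * g p) \<in> tensor_poly (m + n)"
      by (intro tensor_poly_add tensor_poly_cmult add)
    then show ?case by (simp only: distrib_left mult_ac)
  qed (simp add: tensor_poly_zero)
next
  case (add c f' g')
  have "(\<lambda>p. c * (f' p * g p) + g' p * g p) \<in> tensor_poly (m + n)"
    by (intro tensor_poly_add tensor_poly_cmult add)
  then show ?case by (simp add: distrib_right mult.assoc)
qed (simp add: tensor_poly_zero)

text \<open>Links the polynomials of Stone-Weierstrass to tensor products. A linear functional of a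
  pair is a sum of inner products with fixed vectors \<open>\<xi>\<close> and \<open>\<eta>\<close>,
  and products add degrees.\<close>

lemma real_polynomial_tensor:
  assumes "real_polynomial_function r"
  shows "\<exists>n. (\<lambda>p. complex_of_real (r p)) \<in> tensor_poly n"
  using assms
proof (induction rule: real_polynomial_function.induct)
  case (linear r)
  then interpret r: bounded_linear r .
  define \<xi> where "\<xi> = (\<Sum>b\<in>Basis. r (b, 0) *\<^sub>R b)"
  define \<eta> where "\<eta> = (\<Sum>b\<in>Basis. r (0, b) *\<^sub>R b)"
  have e1: "r (x, 0) = x \<bullet> \<xi>" for x
  proof -
    have "(x, 0) = (\<Sum>b\<in>Basis. (x \<bullet> b) *\<^sub>R (b, 0 :: R3))"
      by (simp add: prod_eq_iff fst_sum snd_sum euclidean_representation)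
    then have "r (x, 0) = r (\<Sum>b\<in>Basis. (x \<bullet> b) *\<^sub>R (b, 0 :: R3))" by (rule arg_cong)
    also have "\<dots> = (\<Sum>b\<in>Basis. (x \<bullet> b) * r (b, 0))" by (simp only: r.sum r.scaleR real_scaleR_def)
    finally show ?thesis by (simp add: \<xi>_def inner_sum_right mult.commute)
  qed
  have e2: "r (0, x) = x \<bullet> \<eta>" for x
  proof -
    have "(0, x) = (\<Sum>b\<in>Basis. (x \<bullet> b) *\<^sub>R (0 :: R3, b))"
      by (simp add: prod_eq_iff fst_sum snd_sum euclidean_representation)
    then have "r (0, x) = r (\<Sum>b\<in>Basis. (x \<bullet> b) *\<^sub>R (0 :: R3, b))" by (rule arg_cong)
    also have "\<dots> = (\<Sum>b\<in>Basis. (x \<bullet> b) * r (0, b))" by (simp only: r.sum r.scaleR real_scaleR_def)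
    finally show ?thesis by (simp add: \<eta>_def inner_sum_right mult.commute)
  qed
  have "r p = fst p \<bullet> \<xi> + snd p \<bullet> \<eta>" for p
    using r.add[of "(fst p, 0)" "(0, snd p)"] by (simp add: e1 e2)
  moreover have "(\<lambda>p. complex_of_real (fst p \<bullet> \<xi>) * 1 + 1 * complex_of_real (snd p \<bullet> \<eta>)) \<in> tensor_poly 1"
    by (intro tensor_poly_add tensor_poly_base[of _ _ "\<lambda>_. 1"] tensor_poly_base[of "\<lambda>_. 1"] poly_inner poly_const)
  ultimately show ?case by (intro exI[of _ 1]) simp
next
  case (const c)
  show ?case using tensor_poly_base[OF poly_const[of "complex_of_real c" 0] poly_const[of 1 0]]
    by (intro exI[of _ 0]) simp
next
  case (add f g)
  then obtain m n where mn: "(\<lambda>p. complex_of_real (f p)) \<in> tensor_poly m" "(\<lambda>p. complex_of_real (g p)) \<in> tensor_poly n" by blast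
  have "(\<lambda>p. complex_of_real (f p)) \<in> tensor_poly (m + n)" "(\<lambda>p. complex_of_real (g p)) \<in> tensor_poly (m + n)"
    using mn tensor_poly_mono[of m "m + n"] tensor_poly_mono[of n "m + n"] by auto
  then show ?case using tensor_poly_add by (intro exI[of _ "m + n"]) simp
next
  case (mult f g)
  then obtain m n where mn: "(\<lambda>p. complex_of_real (f p)) \<in> tensor_poly m" "(\<lambda>p. complex_of_real (g p)) \<in> tensor_poly n" by blast
  then show ?case using tensor_poly_mult[OF mn] by (intro exI[of _ "m + n"]) simp
qed

section \<open>Expansion in tensor products of spherical harmonics\<close>

definition tensor_fun :: "(nat \<Rightarrow> nat \<Rightarrow> R3 \<Rightarrow> complex) \<Rightarrow> (nat \<times> nat) \<times> (nat \<times> nat) \<Rightarrow> R3 \<times> R3 \<Rightarrow> complex" where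
  "tensor_fun Y z p = Y (fst (fst z)) (snd (fst z)) (fst p) * Y (fst (snd z)) (snd (snd z)) (snd p)"

definition tensor_index :: "nat \<Rightarrow> ((nat \<times> nat) \<times> (nat \<times> nat)) set" where
  "tensor_index n = harm_index n \<times> harm_index n"

lemma finite_tensor_index [simp]: "finite (tensor_index n)"
  by (simp add: tensor_index_def)

text \<open>The factor \<open>2 * l + 1\<close> counts the harmonics of degree \<open>l\<close>;
  half of the decay rate absorbs it.\<close>

lemma summable_harmonic_weights: "\<sigma> > 0 \<Longrightarrow> summable (\<lambda>l. (2 * real l + 1) * exp (- \<sigma> * real l))"
proof -
  assume s: "\<sigma> > 0"
  show ?thesis
  proof (rule summable_comparison_test_bigo)
    show "summable (\<lambda>l. norm (exp (- (\<sigma>/2)) ^ l))" using s by (simp add: summable_geometric)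
    have "(\<lambda>l. (2 * real l + 1) * exp (- \<sigma> * real l)) \<in> O(\<lambda>l. exp (- (\<sigma>/2) * real l))"
      using s by real_asymp
    also have "(\<lambda>l. exp (- (\<sigma>/2) * real l)) = (\<lambda>l. exp (- (\<sigma>/2)) ^ l)"
      by (simp only: exp_of_nat2_mult)
    finally show "(\<lambda>l. (2 * real l + 1) * exp (- \<sigma> * real l)) \<in> O(\<lambda>l. exp (- (\<sigma>/2)) ^ l)" .
  qed
qed

context
  fixes Y :: "nat \<Rightarrow> nat \<Rightarrow> R3 \<Rightarrow> complex"
  assumes Y: "spherical_harmonic_basis Y"
begin

abbreviation "Z \<equiv> tensor_fun Y"

lemma Z_measurable:
  assumes "z \<in> tensor_index n"
  shows "Z z \<in> borel_measurable sphere2_measure"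
proof -
  have "Y (fst (fst z)) (snd (fst z)) \<in> borel_measurable sphere_measure"
       "Y (fst (snd z)) (snd (snd z)) \<in> borel_measurable sphere_measure"
    using assms by (auto intro!: Y_measurable[OF Y] simp: tensor_index_def harm_index_def)
  then show ?thesis unfolding tensor_fun_def[abs_def] by measurable
qed

lemma Z_sqi:
  assumes "z \<in> tensor_index n"
  shows "Z z \<in> square_integrable sphere2_measure"
proof -
  have i: "snd (fst z) \<in> {1..2 * fst (fst z) + 1}" "snd (snd z) \<in> {1..2 * fst (snd z) + 1}"
    using assms by (auto simp: tensor_index_def harm_index_def)
  obtain B where B: "\<And>x. x \<in> sphere 0 1 \<Longrightarrow> cmod (Y (fst (fst z)) (snd (fst z)) x) \<le> B" using Y_bounded_ex[OF Y i(1)] by blast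
  obtain C where C: "\<And>x. x \<in> sphere 0 1 \<Longrightarrow> cmod (Y (fst (snd z)) (snd (snd z)) x) \<le> C" using Y_bounded_ex[OF Y i(2)] by blast
  show ?thesis
  proof (rule sqi_bounded[OF finite_sphere2 Z_measurable[OF assms]])
    fix p assume "p \<in> space sphere2_measure"
    then have p: "fst p \<in> sphere 0 1" "snd p \<in> sphere 0 1" by auto
    show "cmod (Z z p) \<le> B * C"
      unfolding tensor_fun_def norm_mult using B[OF p(1)] C[OF p(2)] order_trans[OF norm_ge_zero B[OF p(1)]]
      by (intro mult_mono) auto
  qed
qed

lemma Z_orthonormal:
  assumes "z \<in> tensor_index n" "w \<in> tensor_index n"
  shows "l2i sphere2_measure (Z z) (Z w) = of_bool (z = w)"
proof -
  have a: "fst z \<in> harm_index n" "snd z \<in> harm_index n" "fst w \<in> harm_index n" "snd w \<in> harm_index n"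
    using assms by (auto simp: tensor_index_def)
  let ?Y = "\<lambda>\<alpha>. Y (fst \<alpha>) (snd \<alpha>)"
  have m: "(\<lambda>x. ?Y \<alpha> x * cnj (?Y \<beta> x)) \<in> borel_measurable sphere_measure"
    if "\<alpha> \<in> harm_index n" "\<beta> \<in> harm_index n" for \<alpha> \<beta>
  proof -
    note Y_measurable[OF Y harm_indexD[OF Y that(1)], measurable] Y_measurable[OF Y harm_indexD[OF Y that(2)], measurable]
    show ?thesis by measurable
  qed
  have b: "\<exists>B. \<forall>x\<in>sphere 0 1. cmod (?Y \<alpha> x * cnj (?Y \<beta> x)) \<le> B"
    if ab: "\<alpha> \<in> harm_index n" "\<beta> \<in> harm_index n" for \<alpha> \<beta>
  proof -
    obtain B where B: "\<And>x. x \<in> sphere 0 1 \<Longrightarrow> cmod (?Y \<alpha> x) \<le> B" using Y_bounded_ex[OF Y harm_indexD[OF Y ab(1)]] by blast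
    obtain C where C: "\<And>x. x \<in> sphere 0 1 \<Longrightarrow> cmod (?Y \<beta> x) \<le> C" using Y_bounded_ex[OF Y harm_indexD[OF Y ab(2)]] by blast
    have "cmod (?Y \<alpha> x * cnj (?Y \<beta> x)) \<le> B * C" if x: "x \<in> sphere 0 1" for x
      unfolding norm_mult complex_mod_cnj using B[OF x] C[OF x] order_trans[OF norm_ge_zero B[OF x]]
      by (intro mult_mono) auto
    then show ?thesis by blast
  qed
  obtain B where B: "\<And>x. x \<in> sphere 0 1 \<Longrightarrow> cmod (?Y (fst z) x * cnj (?Y (fst w) x)) \<le> B" using b[OF a(1,3)] by blast
  obtain C where C: "\<And>x. x \<in> sphere 0 1 \<Longrightarrow> cmod (?Y (snd z) x * cnj (?Y (snd w) x)) \<le> C" using b[OF a(2,4)] by blast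
  have "l2i sphere2_measure (Z z) (Z w)
      = (LINT p|sphere2_measure. (?Y (fst z) (fst p) * cnj (?Y (fst w) (fst p))) * (?Y (snd z) (snd p) * cnj (?Y (snd w) (snd p))))"
    unfolding l2i_def tensor_fun_def by (intro Bochner_Integration.integral_cong refl) (simp only: complex_cnj_mult mult_ac)
  also have "\<dots> = l2i sphere_measure (?Y (fst z)) (?Y (fst w)) * l2i sphere_measure (?Y (snd z)) (?Y (snd w))"
    unfolding l2i_def by (rule sphere2_integral_product[OF m[OF a(1,3)] B m[OF a(2,4)] C])
  also have "\<dots> = of_bool (z = w)"
    unfolding Yp_orthonormal[OF Y a(1,3)] Yp_orthonormal[OF Y a(2,4)] by (auto simp: prod_eq_iff)
  finally show ?thesis .
qed

lemma tensor_poly_expansion: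
  assumes "f \<in> tensor_poly n"
  shows "\<exists>c. \<forall>p \<in> sphere 0 1 \<times> sphere 0 1. f p = (\<Sum>z\<in>tensor_index n. c z * Z z p)"
  using assms
proof (induction rule: tensor_poly_induct)
  case (base u v)
  obtain a where a: "\<And>x. x \<in> sphere 0 1 \<Longrightarrow> u x = (\<Sum>\<alpha>\<in>harm_index n. a \<alpha> * Y (fst \<alpha>) (snd \<alpha>) x)"
    using poly_harmonic_expansion_ex[OF Y base(1)] by blast
  obtain b where b: "\<And>x. x \<in> sphere 0 1 \<Longrightarrow> v x = (\<Sum>\<alpha>\<in>harm_index n. b \<alpha> * Y (fst \<alpha>) (snd \<alpha>) x)"
    using poly_harmonic_expansion_ex[OF Y base(2)] by blast
  have "u (fst p) * v (snd p) = (\<Sum>z\<in>tensor_index n. (a (fst z) * b (snd z)) * Z z p)"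
    if p: "p \<in> sphere 0 1 \<times> sphere 0 1" for p
  proof -
    have fs: "fst p \<in> sphere 0 1" "snd p \<in> sphere 0 1" using p by auto
    have "u (fst p) * v (snd p) = (\<Sum>\<alpha>\<in>harm_index n. a \<alpha> * Y (fst \<alpha>) (snd \<alpha>) (fst p))
        * (\<Sum>\<beta>\<in>harm_index n. b \<beta> * Y (fst \<beta>) (snd \<beta>) (snd p))"
      by (simp only: a[OF fs(1)] b[OF fs(2)])
    also have "\<dots> = (\<Sum>(\<alpha>, \<beta>)\<in>harm_index n \<times> harm_index n. (a \<alpha> * Y (fst \<alpha>) (snd \<alpha>) (fst p)) * (b \<beta> * Y (fst \<beta>) (snd \<beta>) (snd p)))"
      by (simp only: sum_product sum.cartesian_product)
    also have "\<dots> = (\<Sum>z\<in>tensor_index n. (a (fst z) * b (snd z)) * Z z p)"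
      unfolding tensor_index_def tensor_fun_def by (intro sum.cong refl) (simp only: case_prod_beta mult_ac)
    finally show ?thesis .
  qed
  then show ?case by (intro exI[of _ "\<lambda>z. a (fst z) * b (snd z)"] ballI)
next
  case zero
  show ?case by (intro exI[of _ "\<lambda>_. 0"]) simp
next
  case (add k f g)
  from add(1) obtain a where a: "\<forall>p\<in>sphere 0 1 \<times> sphere 0 1. f p = (\<Sum>z\<in>tensor_index n. a z * Z z p)" by (rule exE)
  from add(2) obtain b where b: "\<forall>p\<in>sphere 0 1 \<times> sphere 0 1. g p = (\<Sum>z\<in>tensor_index n. b z * Z z p)" by (rule exE)
  have "k * f p + g p = (\<Sum>z\<in>tensor_index n. (k * a z + b z) * Z z p)" if "p \<in> sphere 0 1 \<times> sphere 0 1" for p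
    unfolding bspec[OF a that] bspec[OF b that] by (simp only: sum_distrib_left sum.distrib distrib_right mult.assoc)
  then show ?case by (intro exI[of _ "\<lambda>z. k * a z + b z"] ballI)
qed

text \<open>Approximate by a continuous function, then uniformly on the compact product by a
  polynomial, which is a finite combination of harmonics there.\<close>

lemma tensor_harmonics_dense:
  assumes g: "g \<in> square_integrable sphere2_measure" and \<eta>: "\<eta> > 0"
  obtains n c where "l2n sphere2_measure (\<lambda>p. g p - (\<Sum>z\<in>tensor_index n. c z * Z z p)) < \<eta>"
proof -
  let ?S = "sphere (0::R3) 1 \<times> sphere (0::R3) 1" and ?V = "l2n sphere2_measure (\<lambda>_. 1)"
  from \<eta> have h: "\<eta> / 2 > 0" by simp
  obtain \<phi> where \<phi>: "continuous_on UNIV \<phi>" "bounded (range \<phi>)" "l2n sphere2_measure (\<lambda>x. g x - \<phi> x) < \<eta> / 2"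
    by (rule L2_approx_continuous[OF finite_sphere2 sphere2_borel sets_sphere2 g h])
  have \<phi>s: "\<phi> \<in> square_integrable sphere2_measure"
    by (rule sqi_continuous[OF finite_sphere2 sphere2_borel sets_sphere2 \<phi>(1,2)])
  \<comment> \<open>Uniform accuracy \<open>e\<close> costs \<open>e * ?V\<close> in the
    \<open>L2\<close> norm; adding \<open>1\<close> to \<open>?V\<close> avoids division by
    zero.\<close>
  define e where "e = \<eta> / 2 / (?V + 1)"
  have V: "?V + 1 > 0" using l2n_nonneg[of sphere2_measure "\<lambda>_. 1"] by linarith
  then have e: "e > 0" using \<eta> by (simp add: e_def)
  have "compact ?S" by (intro compact_Times) auto
  moreover have "continuous_on ?S \<phi>" using \<phi>(1) continuous_on_subset by blast
  ultimately obtain P where P: "polynomial_function P" "\<And>x. x \<in> ?S \<Longrightarrow> cmod (\<phi> x - P x) < e"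
    using Stone_Weierstrass_polynomial_function[of ?S \<phi> e] e by blast
  have "real_polynomial_function (Re \<circ> P)" "real_polynomial_function (Im \<circ> P)"
    using P(1) bounded_linear_Re bounded_linear_Im unfolding polynomial_function_def by blast+
  then obtain n1 n2 where n12: "(\<lambda>p. complex_of_real (Re (P p))) \<in> tensor_poly n1"
      "(\<lambda>p. complex_of_real (Im (P p))) \<in> tensor_poly n2"
    using real_polynomial_tensor[of "Re \<circ> P"] real_polynomial_tensor[of "Im \<circ> P"] unfolding o_def by blast
  define n where "n = n1 + n2"
  have "(\<lambda>p. complex_of_real (Re (P p))) \<in> tensor_poly n" "(\<lambda>p. complex_of_real (Im (P p))) \<in> tensor_poly n"
    using n12 tensor_poly_mono[of n1 n] tensor_poly_mono[of n2 n] by (auto simp: n_def)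
  then have "(\<lambda>p. complex_of_real (Re (P p)) + \<i> * complex_of_real (Im (P p))) \<in> tensor_poly n"
    by (intro tensor_poly_add tensor_poly_cmult)
  then have "P \<in> tensor_poly n" unfolding complex_eq[symmetric] .
  then obtain c where c: "\<And>p. p \<in> ?S \<Longrightarrow> P p = (\<Sum>z\<in>tensor_index n. c z * Z z p)"
    using tensor_poly_expansion[of P n] by blast
  let ?v = "\<lambda>p. \<Sum>z\<in>tensor_index n. c z * Z z p"
  have v: "?v \<in> square_integrable sphere2_measure"
    by (intro sqi_sum sqi_cmult Z_sqi)
  have "l2n sphere2_measure (\<lambda>p. \<phi> p - ?v p) \<le> e * ?V"
  proof (rule l2n_le_const[OF finite_sphere2])
    show "(\<lambda>p. \<phi> p - ?v p) \<in> borel_measurable sphere2_measure" by (rule sqi_measurable[OF sqi_diff[OF \<phi>s v]])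
    show "cmod (\<phi> p - ?v p) \<le> e" if "p \<in> space sphere2_measure" for p
    proof -
      have p: "p \<in> ?S" using that by simp
      show ?thesis using less_imp_le[OF P(2)[OF p]] unfolding c[OF p] .
    qed
  qed (use e in simp)
  also have "\<dots> \<le> e * (?V + 1)" using e by simp
  also have "\<dots> = \<eta> / 2" 
  proof -
    have "\<eta> / 2 / x * x = \<eta> / 2" if "x > 0" for x :: real using that by simp
    then show ?thesis unfolding e_def using V by blast
  qed
  finally have "l2n sphere2_measure (\<lambda>p. g p - ?v p) < \<eta>"
    using l2n_triangle_diff[OF g \<phi>s v] \<phi>(3) by linarith
  then show ?thesis by (rule that)
qed

text \<open>Parseval with slack, without passing to an infinite sum. The approximant
  \<open>c\<close> need not be the projection of \<open>g\<close>: in each coordinate,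
  \<open>2 * Re (cnj c * g) - (cmod c)\<^sup>2 \<le> (cmod g)\<^sup>2\<close>.\<close>

lemma tensor_parseval_le:
  assumes g: "g \<in> square_integrable sphere2_measure" and \<eta>: "\<eta> > 0"
  obtains n where "(l2n sphere2_measure g)\<^sup>2 \<le> \<eta>\<^sup>2 + (\<Sum>z\<in>tensor_index n. (cmod (l2i sphere2_measure g (Z z)))\<^sup>2)"
proof -
  obtain n c where c: "l2n sphere2_measure (\<lambda>p. g p - (\<Sum>z\<in>tensor_index n. c z * Z z p)) < \<eta>"
    by (rule tensor_harmonics_dense[OF g \<eta>])
  let ?v = "\<lambda>p. \<Sum>z\<in>tensor_index n. c z * Z z p"
  let ?g = "\<lambda>z. l2i sphere2_measure g (Z z)"
  have cz: "\<And>z. z \<in> tensor_index n \<Longrightarrow> (\<lambda>p. c z * Z z p) \<in> square_integrable sphere2_measure"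
    by (intro sqi_cmult Z_sqi)
  have v: "?v \<in> square_integrable sphere2_measure" by (intro sqi_sum cz)
  have gv: "l2i sphere2_measure g ?v = (\<Sum>z\<in>tensor_index n. cnj (c z) * ?g z)"
    by (subst l2i_sum_right[OF cz g]) (simp_all only: l2i_cmult_right)
  have Zv: "l2i sphere2_measure (Z z) ?v = cnj (c z)" if z: "z \<in> tensor_index n" for z
  proof -
    have "l2i sphere2_measure (Z z) ?v = (\<Sum>w\<in>tensor_index n. cnj (c w) * l2i sphere2_measure (Z z) (Z w))"
      by (subst l2i_sum_right[OF cz Z_sqi[OF z]]) (simp_all only: l2i_cmult_right)
    also have "\<dots> = (\<Sum>w\<in>tensor_index n. if w = z then cnj (c z) else 0)"
      by (intro sum.cong refl) (auto simp: Z_orthonormal[OF z])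
    also have "\<dots> = cnj (c z)" using z by simp
    finally show ?thesis .
  qed
  have "l2i sphere2_measure ?v ?v = (\<Sum>z\<in>tensor_index n. c z * l2i sphere2_measure (Z z) ?v)"
    by (subst l2i_sum_left[OF cz v]) (simp_all only: l2i_cmult_left)
  also have "\<dots> = (\<Sum>z\<in>tensor_index n. complex_of_real ((cmod (c z))\<^sup>2))"
    by (intro sum.cong refl) (simp only: Zv complex_norm_square)
  finally have "complex_of_real ((l2n sphere2_measure ?v)\<^sup>2) = complex_of_real (\<Sum>z\<in>tensor_index n. (cmod (c z))\<^sup>2)"
    unfolding l2i_self of_real_sum .
  then have vv: "(l2n sphere2_measure ?v)\<^sup>2 = (\<Sum>z\<in>tensor_index n. (cmod (c z))\<^sup>2)"
    by (simp only: of_real_eq_iff)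
  have "(l2n sphere2_measure (\<lambda>p. g p - ?v p))\<^sup>2
     = (l2n sphere2_measure g)\<^sup>2 - 2 * Re (l2i sphere2_measure g ?v) + (l2n sphere2_measure ?v)\<^sup>2"
    by (rule l2n_diff_sq[OF g v])
  moreover have "(l2n sphere2_measure (\<lambda>p. g p - ?v p))\<^sup>2 \<le> \<eta>\<^sup>2"
    using c by (intro power_mono) auto
  ultimately have "(l2n sphere2_measure g)\<^sup>2
      \<le> \<eta>\<^sup>2 + (\<Sum>z\<in>tensor_index n. 2 * Re (cnj (c z) * ?g z) - (cmod (c z))\<^sup>2)"
    unfolding gv vv Re_sum sum_subtractf sum_distrib_left[symmetric] by linarith
  also have "\<dots> \<le> \<eta>\<^sup>2 + (\<Sum>z\<in>tensor_index n. (cmod (?g z))\<^sup>2)"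
  proof (intro add_left_mono sum_mono)
    fix z
    have "Re (cnj (c z) * ?g z) \<le> cmod (c z) * cmod (?g z)"
      using complex_Re_le_cmod[of "cnj (c z) * ?g z"] by (simp add: norm_mult)
    then show "2 * Re (cnj (c z) * ?g z) - (cmod (c z))\<^sup>2 \<le> (cmod (?g z))\<^sup>2"
      using sum_squares_bound[of "cmod (c z)" "cmod (?g z)"] by linarith
  qed
  finally show ?thesis by (rule that)
qed

text \<open>Squaring doubles the decay rate. Outside \<open>tensor_index L\<close> the two degrees
  add up to at least \<open>L\<close>, so one copy of the decay pays for
  \<open>exp (- \<sigma> * L)\<close> and the other sums to a product of two convergent
  series.\<close>

lemma tensor_tail_bound:
  assumes \<sigma>: "\<sigma> > 0" and g: "g \<in> square_integrable sphere2_measure"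
    and dec: "\<And>n z. z \<in> tensor_index n \<Longrightarrow> cmod (l2i sphere2_measure g (Z z)) \<le> D * exp (- \<sigma> * real (fst (fst z) + fst (snd z)))"
  shows "(l2n sphere2_measure g)\<^sup>2 \<le> (\<Sum>z\<in>tensor_index L. (cmod (l2i sphere2_measure g (Z z)))\<^sup>2)
    + D\<^sup>2 * exp (- \<sigma> * real L) * (\<Sum>l. (2 * real l + 1) * exp (- \<sigma> * real l))\<^sup>2"
proof -
  let ?a = "\<lambda>l. (2 * real l + 1) * exp (- \<sigma> * real l)" and ?g = "\<lambda>z. (cmod (l2i sphere2_measure g (Z z)))\<^sup>2"
  have a: "summable ?a" by (rule summable_harmonic_weights[OF \<sigma>])
  have main: "(\<Sum>z\<in>tensor_index n. ?g z) \<le> (\<Sum>z\<in>tensor_index L. ?g z) + D\<^sup>2 * exp (- \<sigma> * real L) * (\<Sum>l. ?a l)\<^sup>2" for n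
  proof -
    let ?e = "\<lambda>z. D\<^sup>2 * exp (- \<sigma> * real L) * (exp (- \<sigma> * real (fst (fst z))) * exp (- \<sigma> * real (fst (snd z))))"
    have sq: "(\<Sum>\<alpha>\<in>H. x \<alpha>)\<^sup>2 = (\<Sum>z\<in>H \<times> H. x (fst z) * x (snd z))" for H :: "(nat \<times> nat) set" and x :: "_ \<Rightarrow> real"
      by (simp only: power2_eq_square sum_product sum.cartesian_product case_prod_beta')
    \<comment> \<open>The \<open>n\<close> delivered by \<open>tensor_parseval_le\<close> may lie on
      either side of \<open>L\<close>, hence the union.\<close>
    have "(\<Sum>z\<in>tensor_index n. ?g z) \<le> (\<Sum>z\<in>tensor_index L \<union> tensor_index n. ?g z)"
      by (rule sum_mono2) auto
    also have "tensor_index L \<union> tensor_index n = tensor_index L \<union> (tensor_index n - tensor_index L)" by blast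
    also have "(\<Sum>z\<in>tensor_index L \<union> (tensor_index n - tensor_index L). ?g z)
       = (\<Sum>z\<in>tensor_index L. ?g z) + (\<Sum>z\<in>tensor_index n - tensor_index L. ?g z)"
      by (rule sum.union_disjoint) auto
    also have "(\<Sum>z\<in>tensor_index n - tensor_index L. ?g z) \<le> (\<Sum>z\<in>tensor_index n - tensor_index L. ?e z)"
    proof (rule sum_mono)
      fix z assume z: "z \<in> tensor_index n - tensor_index L"
      let ?s = "real (fst (fst z) + fst (snd z))"
      have L: "real L \<le> ?s" using z by (auto simp: tensor_index_def harm_index_def)
      have "?g z \<le> (D * exp (- \<sigma> * ?s))\<^sup>2" using dec[of z n] z by (intro power_mono) auto
      also have "\<dots> = D\<^sup>2 * (exp (- \<sigma> * ?s) * exp (- \<sigma> * ?s))" by (simp only: power2_eq_square mult_ac)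
      also have "\<dots> \<le> D\<^sup>2 * (exp (- \<sigma> * real L) * exp (- \<sigma> * ?s))"
        using L \<sigma> by (intro mult_left_mono mult_right_mono) auto
      also have "exp (- \<sigma> * ?s) = exp (- \<sigma> * real (fst (fst z))) * exp (- \<sigma> * real (fst (snd z)))"
        by (simp only: exp_add[symmetric] of_nat_add distrib_left)
      finally show "?g z \<le> ?e z" by (simp only: mult.assoc)
    qed
    also have "\<dots> \<le> (\<Sum>z\<in>tensor_index n. ?e z)" by (rule sum_mono2) auto
    also have "\<dots> = D\<^sup>2 * exp (- \<sigma> * real L) * (\<Sum>\<alpha>\<in>harm_index n. exp (- \<sigma> * real (fst \<alpha>)))\<^sup>2"
      unfolding sq tensor_index_def by (rule sum_distrib_left[symmetric])
    also have "(\<Sum>\<alpha>\<in>harm_index n. exp (- \<sigma> * real (fst \<alpha>))) = (\<Sum>l\<le>n. ?a l)"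
    proof -
      have "(\<Sum>\<alpha>\<in>harm_index n. exp (- \<sigma> * real (fst \<alpha>))) = (\<Sum>l\<le>n. \<Sum>j\<in>{1..2 * l + 1}. exp (- \<sigma> * real l))"
        unfolding harm_index_def by (subst sum.Sigma) (auto intro!: sum.cong)
      also have "\<dots> = (\<Sum>l\<le>n. ?a l)" by (intro sum.cong refl) simp
      finally show ?thesis .
    qed
    also have "D\<^sup>2 * exp (- \<sigma> * real L) * (\<Sum>l\<le>n. ?a l)\<^sup>2 \<le> D\<^sup>2 * exp (- \<sigma> * real L) * (\<Sum>l. ?a l)\<^sup>2"
      using a by (intro mult_left_mono power_mono sum_le_suminf sum_nonneg mult_nonneg_nonneg) auto
    finally show ?thesis by simp
  qed
  show ?thesis
  proof (rule field_le_epsilon)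
    fix e :: real assume e: "e > 0"
    then have "sqrt e > 0" by simp
    then obtain n where "(l2n sphere2_measure g)\<^sup>2 \<le> (sqrt e)\<^sup>2 + (\<Sum>z\<in>tensor_index n. ?g z)"
      by (rule tensor_parseval_le[OF g])
    with main[of n] e show "(l2n sphere2_measure g)\<^sup>2
      \<le> (\<Sum>z\<in>tensor_index L. ?g z) + D\<^sup>2 * exp (- \<sigma> * real L) * (\<Sum>l. ?a l)\<^sup>2 + e" by simp
  qed
qed

lemma tensor_coeff_eq:
  assumes "f \<in> L2 sphere2_measure" "z \<in> tensor_index n"
  shows "tensor_coeff Y f (fst z) (snd z) = l2i sphere2_measure (L2_rep f) (Z z)"
proof -
  have "Z z = (\<lambda>(x, \<omega>). Y (fst (fst z)) (snd (fst z)) x * Y (fst (snd z)) (snd (snd z)) \<omega>)"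
    by (simp add: tensor_fun_def fun_eq_iff)
  then show ?thesis
    using L2_inner_class_right[OF assms(1) Z_sqi[OF assms(2)]] by (simp add: tensor_coeff_def case_prod_beta)
qed

end

section \<open>The encoder\<close>

lemma harmonic_indices_Suc:
  "harmonic_indices (Suc L) = harmonic_indices L @ map (Pair (Suc L)) [1..<2 * Suc L + 2]"
  by (simp add: harmonic_indices_def)

lemma harmonic_indices_0: "harmonic_indices 0 = [(0, 1)]"
  by (simp add: harmonic_indices_def)

lemma set_harmonic_indices: "set (harmonic_indices L) = harm_index L"
  unfolding harmonic_indices_def harm_index_def by (simp only: set_concat set_map set_upt image_image) force

lemma distinct_harmonic_indices: "distinct (harmonic_indices L)"
proof (induction L)
  case (Suc L)
  then show ?case
    unfolding harmonic_indices_Suc distinct_append set_harmonic_indices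
    by (auto simp: distinct_map harm_index_def inj_on_def)
qed (simp add: harmonic_indices_0)

lemma length_harmonic_indices: "length (harmonic_indices L) = (L + 1)\<^sup>2"
  using distinct_card[OF distinct_harmonic_indices] by (simp only: set_harmonic_indices card_harm_index)

definition index_list :: "nat \<Rightarrow> ((nat \<times> nat) \<times> (nat \<times> nat)) list" where
  "index_list L = List.product (harmonic_indices L) (harmonic_indices L)"

lemma set_index_list: "set (index_list L) = tensor_index L"
  by (simp add: index_list_def set_harmonic_indices tensor_index_def)

lemma distinct_index_list: "distinct (index_list L)"
  unfolding index_list_def by (intro distinct_product distinct_harmonic_indices)

lemma length_index_list: "length (index_list L) = (L + 1) ^ 4"
  by (simp only: index_list_def length_product length_harmonic_indices power_add[symmetric]) simp

lemma m_L_eq: "m_L L = 2 * (L + 1) ^ 4"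
proof -
  have "(\<Sum>l=0..L. 2 * l + 1) = (L + 1)\<^sup>2" using sum_odd[of L] by (simp only: atMost_atLeast0)
  then show ?thesis unfolding m_L_def r_L_def by (simp only: power_mult[symmetric]) simp
qed

lemma dim_encoder: "dim_vec (encoder Y L f) = m_L L"
  by (simp add: encoder_def Let_def index_list_def[symmetric] length_index_list m_L_eq)

lemma encoder_nth:
  assumes "i < length (index_list L)"
  shows "encoder Y L f $ i = Re (tensor_coeff Y f (fst (index_list L ! i)) (snd (index_list L ! i)))"
    and "encoder Y L f $ (length (index_list L) + i) = Im (tensor_coeff Y f (fst (index_list L ! i)) (snd (index_list L ! i)))"
  using assms by (simp_all add: encoder_def Let_def index_list_def[symmetric] nth_append case_prod_beta vec_of_list_index)

lemma sum_lessThan_add: "(\<Sum>i<n + k. h i) = (\<Sum>i<n. h i) + (\<Sum>i<k. h (n + i) :: real)" for n k :: nat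
  by (induction k) auto

text \<open>Entry \<open>i\<close> of the first half and entry \<open>i\<close> of the second half
  are the real and imaginary part of one coefficient, and together give its squared modulus.\<close>

lemma encoder_dist_sq:
  "(\<Sum>i<m_L L. (encoder Y L f $ i - encoder Y L f' $ i)\<^sup>2)
    = (\<Sum>z\<in>tensor_index L. (cmod (tensor_coeff Y f (fst z) (snd z) - tensor_coeff Y f' (fst z) (snd z)))\<^sup>2)"
proof -
  let ?n = "length (index_list L)"
  let ?h = "\<lambda>i. (encoder Y L f $ i - encoder Y L f' $ i)\<^sup>2"
  let ?t = "\<lambda>z. tensor_coeff Y f (fst z) (snd z) - tensor_coeff Y f' (fst z) (snd z)"
  have m: "m_L L = ?n + ?n" by (simp add: m_L_eq length_index_list)
  have "(\<Sum>i<m_L L. ?h i) = (\<Sum>i<?n. ?h i) + (\<Sum>i<?n. ?h (?n + i))"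
    unfolding m by (rule sum_lessThan_add)
  also have "\<dots> = (\<Sum>i<?n. (cmod (?t (index_list L ! i)))\<^sup>2)"
    unfolding sum.distrib[symmetric] cmod_power2 by (intro sum.cong refl) (simp add: encoder_nth)
  also have "\<dots> = (\<Sum>z\<in>tensor_index L. (cmod (?t z))\<^sup>2)"
    by (rule sum.reindex_bij_betw[OF bij_betw_nth[OF distinct_index_list]]) (auto simp: set_index_list)
  finally show ?thesis .
qed

section \<open>ReLU networks realizing partitions of unity\<close>

lemma is_network_Cons:
  "ls \<noteq> [] \<Longrightarrow> is_network m p ((W, b) # ls) \<longleftrightarrow> dim_col W = m \<and> dim_vec b = dim_row W \<and> is_network (dim_row W) p ls"
  by (cases ls) auto

lemma realize_Cons:
  "ls \<noteq> [] \<Longrightarrow> realize ((W, b) # ls) z = realize ls (map_vec (\<lambda>t. max t 0) (W *\<^sub>v z + b))"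
  by (cases ls) auto

definition relu_layer :: "real mat \<times> real vec \<Rightarrow> real vec \<Rightarrow> real vec" where
  "relu_layer l x = map_vec (\<lambda>t. max t 0) (fst l *\<^sub>v x + snd l)"

text \<open>Writing the hidden part as a \<open>fold\<close> makes an induction on the number of
  hidden layers possible, with the state after \<open>t\<close> layers as invariant.\<close>

lemma realize_hidden:
  "realize (hs @ [(V, c)]) x = V *\<^sub>v fold relu_layer hs x + c"
proof (induction hs arbitrary: x)
  case (Cons h hs)
  then show ?case by (cases h) (simp add: realize_Cons relu_layer_def)
qed simp

lemma is_network_hidden:
  assumes "\<And>h. h \<in> set hs \<Longrightarrow> fst h \<in> carrier_mat J J \<and> snd h \<in> carrier_vec J"
    and "V \<in> carrier_mat p J" "c \<in> carrier_vec p"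
  shows "is_network J p (hs @ [(V, c)])"
  using assms(1)
proof (induction hs)
  case Nil
  then show ?case using assms(2,3) by simp
next
  case (Cons h hs)
  then have "is_network J p (hs @ [(V, c)])" "fst h \<in> carrier_mat J J" "snd h \<in> carrier_vec J" by auto
  then show ?case by (cases h) (auto simp: is_network_Cons)
qed

lemma nnz_mat_le: "nnz_mat W \<le> dim_row W * dim_col W"
proof -
  have "nnz_mat W \<le> card ({..<dim_row W} \<times> {..<dim_col W})"
    unfolding nnz_mat_def by (intro card_mono) auto
  then show ?thesis by (simp add: card_cartesian_product)
qed

lemma nnz_vec_le: "nnz_vec b \<le> dim_vec b"
proof -
  have "nnz_vec b \<le> card {..<dim_vec b}" unfolding nnz_vec_def by (intro card_mono) auto
  then show ?thesis by simp
qed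

lemma relu_layer_nth:
  assumes "i < r" "dim_vec z = c"
  shows "relu_layer (mat r c f, vec r g) z $ i = max ((\<Sum>j<c. f (i, j) * z $ j) + g i) 0"
  using assms unfolding relu_layer_def by (simp add: scalar_prod_def lessThan_atLeast0)

text \<open>The row of a layer that adds up one block of consecutive entries; it collects the
  \<open>2 * m\<close> values belonging to node \<open>j\<close>.\<close>

lemma sum_block:
  fixes g :: "nat \<Rightarrow> real"
  assumes "j < J"
  shows "(\<Sum>k<J * c. (if k div c = j then 1 else 0) * g k) = (\<Sum>r<c. g (j * c + r))"
proof -
  have le: "j * c + r < J * c" if "r < c" for r
  proof -
    have "j * c + r < (j + 1) * c" using that by simp
    also have "\<dots> \<le> J * c" using assms by (intro mult_right_mono) auto
    finally show ?thesis .
  qed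
  have "(\<Sum>k<J * c. (if k div c = j then 1 else 0) * g k) = (\<Sum>k\<in>(\<lambda>r. j * c + r) ` {..<c}. g k)"
  proof (rule sum.mono_neutral_cong_right)
    show "(\<lambda>r. j * c + r) ` {..<c} \<subseteq> {..<J * c}" using le by auto
    show "\<forall>k\<in>{..<J * c} - (\<lambda>r. j * c + r) ` {..<c}. (if k div c = j then 1 else 0) * g k = 0"
    proof
      fix k assume k: "k \<in> {..<J * c} - (\<lambda>r. j * c + r) ` {..<c}"
      have "k div c \<noteq> j"
      proof
        assume e: "k div c = j"
        have "c > 0" using k by (cases c) auto
        then have "k = j * c + k mod c" "k mod c < c" using e by auto
        then show False using k by blast
      qed
      then show "(if k div c = j then 1 else 0) * g k = 0" by simp
    qed
    show "(if k div c = j then 1 else 0) * g k = g k" if "k \<in> (\<lambda>r. j * c + r) ` {..<c}" for k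
      using that by auto
  qed auto
  also have "\<dots> = (\<Sum>r<c. g (j * c + r))" by (subst sum.reindex) (auto simp: inj_on_def)
  finally show ?thesis .
qed

text \<open>\<open>run_min e j\<close> is the minimum of \<open>1\<close> and the first \<open>j\<close> values of \<open>e\<close>; its decrements form the
  partition of unity.\<close>

primrec run_min :: "(nat \<Rightarrow> real) \<Rightarrow> nat \<Rightarrow> real" where
  "run_min e 0 = 1"
| "run_min e (Suc j) = min (run_min e j) (e j)"

definition bump_weight :: "(nat \<Rightarrow> real) \<Rightarrow> nat \<Rightarrow> real" where
  "bump_weight e j = run_min e j - run_min e (Suc j)"

lemma sum_bump_weight: "(\<Sum>j<n. bump_weight e j) = 1 - run_min e n"
  by (induction n) (auto simp: bump_weight_def)

text \<open>By telescoping, the running minimum is \<open>1\<close> minus the previous weights, so a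
  weight is the ReLU of an affine function of quantities already computed. This is why this
  partition of unity is realised exactly.\<close>

lemma bump_weight_relu: "bump_weight e j = max (1 - (\<Sum>k<j. bump_weight e k) - e j) 0"
  unfolding sum_bump_weight by (simp add: bump_weight_def)

lemma bump_weight_nonneg: "0 \<le> bump_weight e j"
  by (simp add: bump_weight_def)

lemma run_min_le_1: "run_min e j \<le> 1"
  by (induction j) auto

lemma run_min_nonneg: "(\<And>j. 0 \<le> e j) \<Longrightarrow> 0 \<le> run_min e j"
  by (induction j) auto

lemma run_min_le: "j < n \<Longrightarrow> run_min e n \<le> e j"
  by (induction n) (auto simp: less_Suc_eq min.coboundedI1)

text \<open>Locality: a node gets weight only if it lowers the running minimum, which starts at
  \<open>1\<close>.\<close>

lemma bump_weight_pos: "0 < bump_weight e j \<Longrightarrow> e j < 1"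
  using run_min_le_1[of e j] by (simp add: bump_weight_def split: if_splits)

lemma sum_bump_weight_1:
  assumes "\<And>j. 0 \<le> e j" "j < n" "e j = 0"
  shows "(\<Sum>j<n. bump_weight e j) = 1"
  using run_min_le[OF assms(2), of e] run_min_nonneg[of e n] assms(1,3) sum_bump_weight[of e n] by simp

text \<open>Layer \<open>j\<close> replaces entry \<open>j\<close>, still holding
  \<open>e j\<close>, by the weight of node \<open>j\<close>, reading the weights already stored in
  the entries before it. All other entries are nonnegative, so they pass through the ReLU
  unchanged.\<close>

definition step_layer :: "nat \<Rightarrow> nat \<Rightarrow> real mat \<times> real vec" where
  "step_layer J j = (mat J J (\<lambda>(i, k). if i = j then (if k \<le> j then - 1 else 0) else if i = k then 1 else 0),
     vec J (\<lambda>i. if i = j then 1 else 0))"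

lemma fold_step_layers:
  assumes e: "\<And>j. 0 \<le> e j" and "t \<le> J"
  shows "fold relu_layer (map (step_layer J) [0..<t]) (vec J e) = vec J (\<lambda>i. if i < t then bump_weight e i else e i)"
  using assms(2)
proof (induction t)
  case (Suc t)
  let ?x = "vec J (\<lambda>i. if i < t then bump_weight e i else e i)"
  have "relu_layer (step_layer J t) ?x = vec J (\<lambda>i. if i < Suc t then bump_weight e i else e i)"
  proof (rule eq_vecI)
    fix i assume "i < dim_vec (vec J (\<lambda>i. if i < Suc t then bump_weight e i else e i))"
    then have i: "i < J" by simp
    have "relu_layer (step_layer J t) ?x $ i =
      max ((\<Sum>k<J. (if i = t then (if k \<le> t then - 1 else 0) else if i = k then 1 else 0) * (if k < t then bump_weight e k else e k))
         + (if i = t then 1 else 0)) 0"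
      using i unfolding step_layer_def by (simp add: relu_layer_nth)
    also have "\<dots> = (if i < Suc t then bump_weight e i else e i)"
    proof (cases "i = t")
      case True
      have "(\<Sum>k<J. (if k \<le> t then - 1 else 0) * (if k < t then bump_weight e k else e k))
         = (\<Sum>k\<le>t. - (if k < t then bump_weight e k else e k))"
        using Suc.prems by (intro sum.mono_neutral_cong_right) auto
      also have "\<dots> = - (\<Sum>k<t. bump_weight e k) - e t"
        unfolding lessThan_Suc_atMost[symmetric] by (simp add: sum_negf)
      finally show ?thesis using True bump_weight_relu[of e t] by simp
    next
      case False
      have "(\<Sum>k<J. (if i = k then 1 else 0) * (if k < t then bump_weight e k else e k))
         = (\<Sum>k<J. if k = i then (if i < t then bump_weight e i else e i) else 0)"
        by (intro sum.cong) auto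
      also have "\<dots> = (if i < t then bump_weight e i else e i)" using i by simp
      finally show ?thesis using False e[of i] bump_weight_nonneg[of e i] by auto
    qed
    finally show "relu_layer (step_layer J t) ?x $ i = vec J (\<lambda>i. if i < Suc t then bump_weight e i else e i) $ i"
      using i by simp
  qed (simp add: relu_layer_def step_layer_def)
  then show ?case using Suc by simp
qed (auto intro!: eq_vecI)

text \<open>This distance is exactly computable, as an absolute value is the sum of two ReLUs, and
  it dominates the Euclidean one.\<close>

definition l1_dist :: "nat \<Rightarrow> real vec \<Rightarrow> real vec \<Rightarrow> real" where
  "l1_dist m z w = (\<Sum>i<m. \<bar>z $ i - w $ i\<bar>)"

text \<open>Layer 1 computes the positive and negative parts of all coordinate differences, and layer 2
  the quantities \<open>e j = max (l1_dist m z (\<xi> j) / d - 1) 0\<close>.\<close>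

definition diff_layer :: "nat \<Rightarrow> nat \<Rightarrow> (nat \<Rightarrow> real vec) \<Rightarrow> real mat \<times> real vec" where
  "diff_layer m J \<xi> =
    (mat (J * (2 * m)) m (\<lambda>(k, i). let r = k mod (2 * m) in if r < m then (if i = r then 1 else 0) else (if i = r - m then - 1 else 0)),
     vec (J * (2 * m)) (\<lambda>k. let r = k mod (2 * m) in if r < m then - (\<xi> (k div (2 * m)) $ r) else \<xi> (k div (2 * m)) $ (r - m)))"

definition dist_layer :: "nat \<Rightarrow> nat \<Rightarrow> real \<Rightarrow> real mat \<times> real vec" where
  "dist_layer m J d = (mat J (J * (2 * m)) (\<lambda>(j, k). (1 / d) * (if k div (2 * m) = j then 1 else 0)), vec J (\<lambda>_. - 1))"

lemma diff_layer_nth: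
  assumes z: "dim_vec z = m" and j: "j < J" and r: "r < 2 * m"
  shows "relu_layer (diff_layer m J \<xi>) z $ (j * (2 * m) + r)
    = (if r < m then max (z $ r - \<xi> j $ r) 0 else max (\<xi> j $ (r - m) - z $ (r - m)) 0)"
proof -
  let ?k = "j * (2 * m) + r"
  have kd: "?k div (2 * m) = j" using r by auto
  have km: "?k mod (2 * m) = r" using r by auto
  have k: "?k < J * (2 * m)"
  proof -
    have "?k < (j + 1) * (2 * m)" using r by simp
    also have "\<dots> \<le> J * (2 * m)" using j by (intro mult_right_mono) auto
    finally show ?thesis .
  qed
  have "relu_layer (diff_layer m J \<xi>) z $ ?k
     = max ((\<Sum>i<m. (if r < m then (if i = r then 1 else 0) else (if i = r - m then - 1 else 0)) * z $ i)
        + (if r < m then - (\<xi> j $ r) else \<xi> j $ (r - m))) 0"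
    unfolding diff_layer_def relu_layer_nth[OF k z] kd by (simp add: km Let_def del: mod_mult_self3 mod_mult_self4)
  also have "(\<Sum>i<m. (if r < m then (if i = r then 1 else 0) else (if i = r - m then - 1 else 0)) * z $ i)
     = (\<Sum>i<m. if i = (if r < m then r else r - m) then (if r < m then z $ r else - (z $ (r - m))) else 0)"
    by (intro sum.cong) auto
  also have "\<dots> = (if r < m then z $ r else - (z $ (r - m)))"
  proof -
    have "(if r < m then r else r - m) < m" using r by (cases "r < m") auto
    then show ?thesis by (subst sum.delta) auto
  qed
  finally show ?thesis by auto
qed

lemma dist_layer_eq:
  assumes z: "dim_vec z = m" and d: "d > 0"
  shows "relu_layer (dist_layer m J d) (relu_layer (diff_layer m J \<xi>) z)
    = vec J (\<lambda>j. max (l1_dist m z (\<xi> j) / d - 1) 0)"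
proof (rule eq_vecI)
  let ?x = "relu_layer (diff_layer m J \<xi>) z"
  fix j assume "j < dim_vec (vec J (\<lambda>j. max (l1_dist m z (\<xi> j) / d - 1) 0))"
  then have j: "j < J" by simp
  have x: "dim_vec ?x = J * (2 * m)" by (simp add: relu_layer_def diff_layer_def)
  have "relu_layer (dist_layer m J d) ?x $ j
     = max ((\<Sum>k<J * (2 * m). (1 / d) * (if k div (2 * m) = j then 1 else 0) * ?x $ k) - 1) 0"
    unfolding dist_layer_def relu_layer_nth[OF j x] by (simp only: prod.case diff_conv_add_uminus)
  also have "(\<Sum>k<J * (2 * m). (1 / d) * (if k div (2 * m) = j then 1 else 0) * ?x $ k)
     = (1 / d) * (\<Sum>k<J * (2 * m). (if k div (2 * m) = j then 1 else 0) * ?x $ k)"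
    by (simp only: sum_distrib_left mult.assoc)
  also have "(\<Sum>k<J * (2 * m). (if k div (2 * m) = j then 1 else 0) * ?x $ k) = (\<Sum>r<2 * m. ?x $ (j * (2 * m) + r))"
    by (rule sum_block[OF j])
  also have "\<dots> = (\<Sum>r<m + m. if r < m then max (z $ r - \<xi> j $ r) 0 else max (\<xi> j $ (r - m) - z $ (r - m)) 0)"
    unfolding mult_2 by (intro sum.cong refl) (use diff_layer_nth[OF z j, of _ \<xi>] in \<open>simp add: mult_2\<close>)
  also have "\<dots> = (\<Sum>r<m. max (z $ r - \<xi> j $ r) 0) + (\<Sum>r<m. max (\<xi> j $ r - z $ r) 0)"
    unfolding sum_lessThan_add by simp
  also have "\<dots> = l1_dist m z (\<xi> j)"
    unfolding l1_dist_def sum.distrib[symmetric] by (intro sum.cong) auto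
  finally show "relu_layer (dist_layer m J d) ?x $ j = vec J (\<lambda>j. max (l1_dist m z (\<xi> j) / d - 1) 0) $ j"
    using j by simp
qed (simp add: relu_layer_def dist_layer_def)

text \<open>Since \<open>e j = max (l1_dist m z (\<xi> j) / d - 1) 0\<close>, the value is
  \<open>0\<close> up to distance \<open>d\<close> and less than \<open>1\<close> only below
  \<open>2 * d\<close>: a point near some node gets total weight \<open>1\<close>, and no distant
  node is active. There are \<open>J\<close> successive step layers with matrices of dimension
  \<open>J\<close>, which explains the cubic size.\<close>

lemma partition_network:
  assumes J: "J \<ge> 1" and d: "d > 0" and v: "\<And>j. v j \<in> carrier_vec p"
  shows "\<exists>A. is_network m p A \<and> network_size A \<le> (2 * m * m + 4 * m + 3 + 2 * p) * J ^ 3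
    \<and> (\<forall>z\<in>carrier_vec m. \<exists>\<psi>. (\<forall>j. 0 \<le> \<psi> j) \<and> (\<forall>i<p. realize A z $ i = (\<Sum>j<J. \<psi> j * v j $ i))
        \<and> dim_vec (realize A z) = p
        \<and> (\<forall>j. 0 < \<psi> j \<longrightarrow> l1_dist m z (\<xi> j) < 2 * d)
        \<and> ((\<exists>j<J. l1_dist m z (\<xi> j) \<le> d) \<longrightarrow> (\<Sum>j<J. \<psi> j) = 1))"
proof -
  let ?V = "mat p J (\<lambda>(i, j). v j $ i)" and ?c = "0\<^sub>v p :: real vec"
  define hs where "hs = map (step_layer J) [0..<J]"
  define A where "A = diff_layer m J \<xi> # dist_layer m J d # (hs @ [(?V, ?c)])"
  have net: "is_network J p (hs @ [(?V, ?c)])"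
    by (rule is_network_hidden) (auto simp: hs_def step_layer_def)
  have A: "is_network m p A"
    unfolding A_def diff_layer_def dist_layer_def using net by (simp add: is_network_Cons)
  have sz: "network_size A \<le> (2 * m * m + 4 * m + 3 + 2 * p) * J ^ 3"
  proof -
    have layer: "nnz_mat (fst l) + nnz_vec (snd l) \<le> r * c + r"
      if "fst l \<in> carrier_mat r c" "snd l \<in> carrier_vec r" for l :: "real mat \<times> real vec" and r c
      using that nnz_mat_le[of "fst l"] nnz_vec_le[of "snd l"] by auto
    have s: "network_size ls = (\<Sum>l\<leftarrow>ls. nnz_mat (fst l) + nnz_vec (snd l))" for ls
      by (simp add: network_size_def case_prod_unfold)
    have "(\<Sum>l\<leftarrow>hs. nnz_mat (fst l) + nnz_vec (snd l)) \<le> (\<Sum>l\<leftarrow>hs. J * J + J)"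
      by (intro sum_list_mono layer) (auto simp: hs_def step_layer_def)
    also have "\<dots> = J * (J * J + J)" by (simp add: hs_def sum_list_triv)
    finally have h: "(\<Sum>l\<leftarrow>hs. nnz_mat (fst l) + nnz_vec (snd l)) \<le> J * (J * J + J)" .
    have 1: "nnz_mat (fst (diff_layer m J \<xi>)) + nnz_vec (snd (diff_layer m J \<xi>)) \<le> J * (2 * m) * m + J * (2 * m)"
      by (rule layer) (auto simp: diff_layer_def)
    have 2: "nnz_mat (fst (dist_layer m J d)) + nnz_vec (snd (dist_layer m J d)) \<le> J * (J * (2 * m)) + J"
      by (rule layer) (auto simp: dist_layer_def)
    have 3: "nnz_mat ?V + nnz_vec ?c \<le> p * J + p"
      using layer[of "(?V, ?c)" p J] by simp
    have "network_size A \<le> (J * (2 * m) * m + J * (2 * m)) + (J * (J * (2 * m)) + J) + J * (J * J + J) + (p * J + p)"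
      unfolding s A_def using h 1 2 3 by simp
    also have "\<dots> = (2 * m * m + 2 * m + 1 + p) * J + (2 * m + 1) * J ^ 2 + J ^ 3 + p * 1"
      by (simp add: algebra_simps power2_eq_square power3_eq_cube)
    also have "\<dots> \<le> (2 * m * m + 2 * m + 1 + p) * J ^ 3 + (2 * m + 1) * J ^ 3 + J ^ 3 + p * J ^ 3"
    proof -
      have "J \<le> J ^ 3" "J ^ 2 \<le> J ^ 3" "1 \<le> J ^ 3" using J power_increasing[of 1 3 J] power_increasing[of 2 3 J] by auto
      then show ?thesis by (intro add_mono mult_left_mono) auto
    qed
    also have "\<dots> = (2 * m * m + 4 * m + 3 + 2 * p) * J ^ 3" by (simp add: algebra_simps)
    finally show ?thesis .
  qed
  have part: "\<exists>\<psi>. (\<forall>j. 0 \<le> \<psi> j) \<and> (\<forall>i<p. realize A z $ i = (\<Sum>j<J. \<psi> j * v j $ i))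
        \<and> dim_vec (realize A z) = p
        \<and> (\<forall>j. 0 < \<psi> j \<longrightarrow> l1_dist m z (\<xi> j) < 2 * d)
        \<and> ((\<exists>j<J. l1_dist m z (\<xi> j) \<le> d) \<longrightarrow> (\<Sum>j<J. \<psi> j) = 1)" if z: "z \<in> carrier_vec m" for z
  proof -
    define e where "e j = max (l1_dist m z (\<xi> j) / d - 1) 0" for j
    have e0: "0 \<le> e j" for j by (simp add: e_def)
    have "realize A z = realize (hs @ [(?V, ?c)]) (relu_layer (dist_layer m J d) (relu_layer (diff_layer m J \<xi>) z))"
      unfolding A_def diff_layer_def dist_layer_def by (simp add: realize_Cons relu_layer_def)
    also have "relu_layer (dist_layer m J d) (relu_layer (diff_layer m J \<xi>) z) = vec J e"
      unfolding e_def using z by (intro dist_layer_eq d) auto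
    also have "realize (hs @ [(?V, ?c)]) (vec J e) = ?V *\<^sub>v vec J (bump_weight e) + ?c"
    proof -
      have "fold relu_layer hs (vec J e) = vec J (bump_weight e)"
        unfolding hs_def fold_step_layers[OF e0 order_refl] by (rule eq_vecI) auto
      then show ?thesis by (simp only: realize_hidden)
    qed
    finally have r: "realize A z = ?V *\<^sub>v vec J (bump_weight e) + ?c" .
    have nth: "\<forall>i<p. realize A z $ i = (\<Sum>j<J. bump_weight e j * v j $ i)"
      unfolding r by (auto simp: scalar_prod_def lessThan_atLeast0 mult.commute intro!: sum.cong)
    have pos: "l1_dist m z (\<xi> j) < 2 * d" if "0 < bump_weight e j" for j
      using bump_weight_pos[OF that] d by (simp add: e_def pos_divide_less_eq)
    have one: "(\<Sum>j<J. bump_weight e j) = 1" if "j < J" "l1_dist m z (\<xi> j) \<le> d" for j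
      using that d by (intro sum_bump_weight_1[OF e0 that(1)]) (simp add: e_def)
    show ?thesis
      using nth pos one bump_weight_nonneg by (intro exI[of _ "bump_weight e"]) (auto simp: r)
  qed
  show ?thesis by (intro exI[of _ A] conjI ballI A sz part)
qed

text \<open>Divide the box into cubes of side \<open>h\<close> and choose a point of
  \<open>K\<close> in each cube that meets \<open>K\<close>. The nodes must lie in \<open>K\<close>
  because values are prescribed only there.\<close>

lemma finite_net:
  assumes m: "m \<ge> 1" and K: "K \<noteq> {}" "\<And>z. z \<in> K \<Longrightarrow> \<forall>i<m. \<bar>z $ i\<bar> \<le> B" and h: "h > 0"
  obtains J \<xi> where "J \<ge> 1" "real J \<le> (2 * B / h + 2) ^ m" "\<And>j. \<xi> j \<in> K"
    "\<And>z. z \<in> K \<Longrightarrow> \<exists>j<J. l1_dist m z (\<xi> j) \<le> real m * h"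
proof -
  define cell where "cell z = restrict (\<lambda>i. \<lfloor>z $ i / h\<rfloor>) {..<m}" for z :: "real vec"
  let ?P = "PiE {..<m} (\<lambda>_. {\<lfloor>- B / h\<rfloor>..\<lfloor>B / h\<rfloor>})"
  have sub: "cell ` K \<subseteq> ?P"
  proof
    fix c assume "c \<in> cell ` K"
    then obtain z where z: "z \<in> K" "c = cell z" by blast
    have "\<lfloor>- B / h\<rfloor> \<le> \<lfloor>z $ i / h\<rfloor> \<and> \<lfloor>z $ i / h\<rfloor> \<le> \<lfloor>B / h\<rfloor>" if "i < m" for i
    proof -
      have "\<bar>z $ i\<bar> \<le> B" using K(2)[OF z(1)] that by blast
      then have "- B \<le> z $ i" "z $ i \<le> B" by linarith+
      then have "- B / h \<le> z $ i / h" "z $ i / h \<le> B / h" using h by (auto intro: divide_right_mono simp del: divide_minus_left)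
      then show ?thesis by (auto intro: floor_mono)
    qed
    then show "c \<in> ?P" by (auto simp: z(2) cell_def)
  qed
  have finP: "finite ?P" by (intro finite_PiE) auto
  define J where "J = card (cell ` K)"
  have fin: "finite (cell ` K)" using finite_subset[OF sub finP] .
  have J1: "J \<ge> 1" unfolding J_def using fin K(1) by (simp add: Suc_le_eq card_gt_0_iff)
  have "J \<le> card ?P" unfolding J_def by (rule card_mono[OF finP sub])
  also have "card ?P = card {\<lfloor>- B / h\<rfloor>..\<lfloor>B / h\<rfloor>} ^ m" by (simp add: card_PiE)
  finally have "real J \<le> real (card {\<lfloor>- B / h\<rfloor>..\<lfloor>B / h\<rfloor>}) ^ m" by (metis of_nat_le_iff of_nat_power)
  also have "\<dots> \<le> (2 * B / h + 2) ^ m"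
  proof (rule power_mono)
    obtain z where z: "z \<in> K" using K(1) by blast
    show "real (card {\<lfloor>- B / h\<rfloor>..\<lfloor>B / h\<rfloor>}) \<le> 2 * B / h + 2"
    proof -
      have "\<bar>z $ 0\<bar> \<le> B" using K(2)[OF z] m by auto
      then have "0 \<le> B" by linarith
      then have "- B / h \<le> B / h" using h by (intro divide_right_mono) auto
      then have "\<lfloor>- B / h\<rfloor> \<le> \<lfloor>B / h\<rfloor>" by (rule floor_mono)
      then have "real (card {\<lfloor>- B / h\<rfloor>..\<lfloor>B / h\<rfloor>}) = of_int (\<lfloor>B / h\<rfloor> - \<lfloor>- B / h\<rfloor> + 1)" by simp
      also have "\<dots> \<le> B / h - (- B / h - 1) + 1"
        using of_int_floor_le[of "B / h"] real_of_int_floor_gt_diff_one[of "- B / h"] unfolding of_int_add of_int_diff of_int_1 by linarith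
      also have "\<dots> = 2 * B / h + 2" by simp
      finally show ?thesis .
    qed
  qed auto
  finally have J2: "real J \<le> (2 * B / h + 2) ^ m" .
  obtain f where f: "bij_betw f {..<J} (cell ` K)"
    using ex_bij_betw_nat_finite[OF fin] unfolding atLeast0LessThan J_def[symmetric] by blast
  \<comment> \<open>Indices from \<open>J\<close> on get an arbitrary point, so that
    \<open>\<xi> j \<in> K\<close> holds without a bound on \<open>j\<close>.\<close>
  define \<xi> where "\<xi> j = (if j < J then SOME z. z \<in> K \<and> cell z = f j else SOME z. z \<in> K)" for j
  have \<xi>: "\<xi> j \<in> K \<and> cell (\<xi> j) = f j" if "j < J" for j
  proof -
    have "f j \<in> cell ` K" using f that by (auto simp: bij_betw_def)
    then have "\<exists>z. z \<in> K \<and> cell z = f j" by auto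
    then show ?thesis unfolding \<xi>_def using that someI_ex[of "\<lambda>z. z \<in> K \<and> cell z = f j"] by simp
  qed
  have \<xi>K: "\<xi> j \<in> K" for j
  proof (cases "j < J")
    case False
    then show ?thesis using K(1) by (auto simp: \<xi>_def intro: someI[where P = "\<lambda>z. z \<in> K"])
  qed (use \<xi> in blast)
  have "\<exists>j<J. l1_dist m z (\<xi> j) \<le> real m * h" if z: "z \<in> K" for z
  proof -
    have "cell z \<in> f ` {..<J}" using f z by (auto simp: bij_betw_def)
    then obtain j where j: "j < J" "f j = cell z" by auto
    have "\<bar>z $ i - \<xi> j $ i\<bar> \<le> h" if "i < m" for i
    proof -
      have "cell z i = cell (\<xi> j) i" using \<xi>[OF j(1)] j(2) by simp
      then have "\<lfloor>z $ i / h\<rfloor> = \<lfloor>\<xi> j $ i / h\<rfloor>" using that by (simp add: cell_def)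
      then have "\<bar>z $ i / h - \<xi> j $ i / h\<bar> < 1" by linarith
      then have "\<bar>(z $ i - \<xi> j $ i) / h\<bar> < 1" by (simp add: diff_divide_distrib)
      then show ?thesis using h by (simp add: abs_divide pos_divide_less_eq)
    qed
    then have "l1_dist m z (\<xi> j) \<le> (\<Sum>i<m. h)" unfolding l1_dist_def by (intro sum_mono) auto
    then show ?thesis using j(1) by auto
  qed
  with J1 J2 \<xi>K show ?thesis by (rule that)
qed

lemma jensen_sq:
  assumes "\<And>j. j \<in> I \<Longrightarrow> 0 \<le> w j" "(\<Sum>j\<in>I. w j) = 1"
  shows "(\<Sum>j\<in>I. w j * a j)\<^sup>2 \<le> (\<Sum>j\<in>I. w j * (a j)\<^sup>2 :: real)"
proof -
  let ?b = "\<Sum>j\<in>I. w j * a j"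
  have "0 \<le> (\<Sum>j\<in>I. w j * (a j - ?b)\<^sup>2)" using assms by (intro sum_nonneg mult_nonneg_nonneg) auto
  also have "\<dots> = (\<Sum>j\<in>I. w j * (a j)\<^sup>2 - (2 * ?b) * (w j * a j) + ?b\<^sup>2 * w j)"
    by (intro sum.cong) (auto simp: power2_eq_square algebra_simps)
  also have "\<dots> = (\<Sum>j\<in>I. w j * (a j)\<^sup>2) - 2 * ?b * ?b + ?b\<^sup>2 * 1"
    unfolding sum.distrib sum_subtractf sum_distrib_left[symmetric] assms(2) ..
  finally show ?thesis by (simp add: power2_eq_square)
qed

text \<open>Convexity of Euclidean balls, coordinate by coordinate through \<open>jensen_sq\<close>.
  Points of weight \<open>0\<close> may lie anywhere.\<close>

lemma vec_dist_convex:
  assumes w: "\<And>j. j < J \<Longrightarrow> 0 \<le> w j" "(\<Sum>j<J. w j) = 1"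
    and a: "dim_vec a = p" "\<And>i. i < p \<Longrightarrow> a $ i = (\<Sum>j<J. w j * v j $ i)"
    and c: "\<And>j. j < J \<Longrightarrow> 0 < w j \<Longrightarrow> dim_vec (v j) = p \<and> vec_dist (v j) c \<le> \<rho>" and "0 \<le> \<rho>"
  shows "vec_dist a c \<le> \<rho>"
proof -
  have "(\<Sum>i<p. (a $ i - c $ i)\<^sup>2) = (\<Sum>i<p. (\<Sum>j<J. w j * (v j $ i - c $ i))\<^sup>2)"
  proof (intro sum.cong refl)
    fix i assume "i \<in> {..<p}"
    then have "a $ i - c $ i = (\<Sum>j<J. w j * v j $ i) - (\<Sum>j<J. w j) * c $ i" using a w by simp
    also have "\<dots> = (\<Sum>j<J. w j * (v j $ i - c $ i))"
      by (simp add: sum_distrib_right sum_subtractf right_diff_distrib)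
    finally show "(a $ i - c $ i)\<^sup>2 = (\<Sum>j<J. w j * (v j $ i - c $ i))\<^sup>2" by simp
  qed
  also have "\<dots> \<le> (\<Sum>i<p. \<Sum>j<J. w j * (v j $ i - c $ i)\<^sup>2)"
    using w by (intro sum_mono jensen_sq) auto
  also have "\<dots> = (\<Sum>j<J. w j * (\<Sum>i<p. (v j $ i - c $ i)\<^sup>2))"
    by (subst sum.swap) (simp add: sum_distrib_left)
  also have "\<dots> \<le> (\<Sum>j<J. w j * \<rho>\<^sup>2)"
  proof (rule sum_mono)
    fix j assume j: "j \<in> {..<J}"
    show "w j * (\<Sum>i<p. (v j $ i - c $ i)\<^sup>2) \<le> w j * \<rho>\<^sup>2"
    proof (cases "w j = 0")
      case False
      then have "0 < w j" using w(1)[of j] j by simp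
      then have "dim_vec (v j) = p" "sqrt (\<Sum>i<p. (v j $ i - c $ i)\<^sup>2) \<le> \<rho>" using c[of j] j by (auto simp: vec_dist_def)
      then show ?thesis using w(1)[of j] j by (intro mult_left_mono) (auto dest: sqrt_le_D)
    qed simp
  qed
  also have "\<dots> = \<rho>\<^sup>2" by (simp add: sum_distrib_right[symmetric] w)
  finally show ?thesis unfolding vec_dist_def a(1) using \<open>0 \<le> \<rho>\<close> by (simp add: real_le_lsqrt)
qed

text \<open>The accuracy \<open>d\<close> is chosen so that the size bound of order \<open>d ^ (- 3 m)\<close> equals \<open>N\<close>.\<close>

lemma network_interpolation:
  assumes m: "m \<ge> 1" and B: "0 \<le> B"
  obtains c0 where "c0 > 0"
    "\<And>K v N. K \<noteq> {} \<Longrightarrow> K \<subseteq> carrier_vec m \<Longrightarrow> (\<And>z. z \<in> K \<Longrightarrow> \<forall>i<m. \<bar>z $ i\<bar> \<le> B) \<Longrightarrow>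
      (\<And>z. z \<in> K \<Longrightarrow> v z \<in> carrier_vec p) \<Longrightarrow> real N > c0 * (real p + 1) * exp (3 * real m) \<Longrightarrow>
      \<exists>A. is_network m p A \<and> network_size A \<le> N \<and>
        (\<forall>z\<in>K. dim_vec (realize A z) = p \<and> (\<forall>c \<rho>. 0 \<le> \<rho> \<longrightarrow>
          (\<forall>w\<in>K. l1_dist m z w \<le> exp (- (1 / (3 * real m) * ln (real N / (c0 * (real p + 1))))) / 2 \<longrightarrow> vec_dist (v w) c \<le> \<rho>)
          \<longrightarrow> vec_dist (realize A z) c \<le> \<rho>))"
proof -
  \<comment> \<open>\<open>ct\<close> is the coefficient of the cubic size bound, and
    \<open>\<kappa> / d\<close> bounds the number of grid cells per coordinate; both are free of
    \<open>N\<close>.\<close>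
  define ct where "ct = real (2 * m * m + 4 * m + 3 + 2 * p)"
  define \<kappa> where "\<kappa> = 8 * B * real m + 2"
  define c0 where "c0 = ct * \<kappa> ^ (3 * m)"
  have ct: "ct > 0" unfolding ct_def of_nat_0_less_iff by simp
  have k: "\<kappa> \<ge> 2" using B by (simp add: \<kappa>_def)
  have c0: "c0 > 0" using ct k by (simp add: c0_def)
  show ?thesis
  proof (rule that[OF c0])
    fix K :: "real vec set" and v :: "real vec \<Rightarrow> real vec" and N :: nat
    assume K: "K \<noteq> {}" "K \<subseteq> carrier_vec m" "\<And>z. z \<in> K \<Longrightarrow> \<forall>i<m. \<bar>z $ i\<bar> \<le> B"
      and v: "\<And>z. z \<in> K \<Longrightarrow> v z \<in> carrier_vec p"
      and N: "real N > c0 * (real p + 1) * exp (3 * real m)"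
    define x where "x = real N / (c0 * (real p + 1))"
    define d where "d = exp (- (1 / (3 * real m) * ln x))"
    have cp: "c0 * (real p + 1) > 0" using c0 by simp
    have x: "x > exp (3 * real m)" using N cp by (simp add: x_def pos_less_divide_eq mult.commute)
    then have x0: "x > 0" using exp_gt_zero[of "3 * real m"] by linarith
    have "ln x > 3 * real m" using x x0 by (metis exp_less_cancel_iff exp_ln)
    then have "ln x > 0" using m by linarith
    then have d: "d > 0" "d \<le> 1" using m by (auto simp: d_def)
    have dx: "(1 / d) ^ (3 * m) = x"
    proof -
      have "(1 / d) ^ (3 * m) = exp (real (3 * m) * (1 / (3 * real m) * ln x))"
        unfolding exp_of_nat_mult by (simp add: d_def exp_minus inverse_eq_divide)
      also have "real (3 * m) * (1 / (3 * real m) * ln x) = ln x" using m by simp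
      finally show ?thesis using x0 by simp
    qed
    \<comment> \<open>Makes \<open>m * h\<close> equal to \<open>d / 4\<close>: every point is
      within \<open>d / 4\<close> of a node, and active nodes are within
      \<open>d / 2\<close>.\<close>
    define h where "h = d / (4 * real m)"
    have h: "h > 0" using d m by (simp add: h_def)
    have mh: "real m * h = d / 4" using m by (simp add: h_def)
    obtain J \<xi> where J: "J \<ge> 1" "real J \<le> (2 * B / h + 2) ^ m" "\<And>j. \<xi> j \<in> K"
      "\<And>z. z \<in> K \<Longrightarrow> \<exists>j<J. l1_dist m z (\<xi> j) \<le> real m * h"
      using finite_net[OF m K(1,3) h] by blast
    have "2 * B / h + 2 \<le> \<kappa> * (1 / d)"
    proof -
      have "2 * B / h = 8 * B * real m * (1 / d)" using m d by (simp add: h_def)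
      moreover have "2 \<le> 2 * (1 / d)" using d by (simp add: le_divide_eq)
      ultimately show ?thesis by (simp only: \<kappa>_def distrib_right)
    qed
    then have "(2 * B / h + 2) ^ m \<le> (\<kappa> * (1 / d)) ^ m"
      using B h by (intro power_mono) auto
    with J(2) have "real J \<le> (\<kappa> * (1 / d)) ^ m" by linarith
    then have "real J ^ 3 \<le> ((\<kappa> * (1 / d)) ^ m) ^ 3" by (intro power_mono) auto
    also have "\<dots> = \<kappa> ^ (3 * m) * (1 / d) ^ (3 * m)"
      by (simp only: power_mult[symmetric] power_mult_distrib mult.commute)
    finally have J3: "real J ^ 3 \<le> \<kappa> ^ (3 * m) * x" unfolding dx .
    have "\<exists>A. is_network m p A \<and> network_size A \<le> (2 * m * m + 4 * m + 3 + 2 * p) * J ^ 3 \<and>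
      (\<forall>z\<in>carrier_vec m. (\<exists>\<psi>. (\<forall>j. 0 \<le> \<psi> j) \<and> (\<forall>i<p. realize A z $ i = (\<Sum>j<J. \<psi> j * v (\<xi> j) $ i))
        \<and> dim_vec (realize A z) = p
        \<and> (\<forall>j. 0 < \<psi> j \<longrightarrow> l1_dist m z (\<xi> j) < 2 * (d / 4))
        \<and> ((\<exists>j<J. l1_dist m z (\<xi> j) \<le> d / 4) \<longrightarrow> (\<Sum>j<J. \<psi> j) = 1)))"
      by (rule partition_network[OF J(1)]) (use d v J(3) in auto)
    then obtain A where A: "is_network m p A" "network_size A \<le> (2 * m * m + 4 * m + 3 + 2 * p) * J ^ 3"
      "\<forall>z\<in>carrier_vec m. (\<exists>\<psi>. (\<forall>j. 0 \<le> \<psi> j) \<and> (\<forall>i<p. realize A z $ i = (\<Sum>j<J. \<psi> j * v (\<xi> j) $ i))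
        \<and> dim_vec (realize A z) = p
        \<and> (\<forall>j. 0 < \<psi> j \<longrightarrow> l1_dist m z (\<xi> j) < 2 * (d / 4))
        \<and> ((\<exists>j<J. l1_dist m z (\<xi> j) \<le> d / 4) \<longrightarrow> (\<Sum>j<J. \<psi> j) = 1))" by (elim exE conjE)
    have "real (network_size A) \<le> ct * real J ^ 3"
      using A(2) unfolding ct_def by (metis of_nat_le_iff of_nat_mult of_nat_power)
    also have "\<dots> \<le> ct * (\<kappa> ^ (3 * m) * x)" using J3 ct by simp
    also have "\<dots> = c0 * x" by (simp add: c0_def)
    also have "\<dots> \<le> c0 * (real p + 1) * x" using c0 x0 by simp
    also have "\<dots> = real N"
    proof -
      have "y * (a / y) = a" if "y > 0" for y a :: real using that by simp
      then show ?thesis unfolding x_def using cp by blast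
    qed
    finally have size: "network_size A \<le> N" by simp
    have "dim_vec (realize A z) = p \<and> (\<forall>c \<rho>. 0 \<le> \<rho> \<longrightarrow>
        (\<forall>w\<in>K. l1_dist m z w \<le> d / 2 \<longrightarrow> vec_dist (v w) c \<le> \<rho>) \<longrightarrow> vec_dist (realize A z) c \<le> \<rho>)"
      if z: "z \<in> K" for z
    proof -
      from z K(2) have "z \<in> carrier_vec m" by blast
      from bspec[OF A(3) this] obtain \<psi> where \<psi>: "\<forall>j. 0 \<le> \<psi> j" "\<forall>i<p. realize A z $ i = (\<Sum>j<J. \<psi> j * v (\<xi> j) $ i)"
        "dim_vec (realize A z) = p" "\<forall>j. 0 < \<psi> j \<longrightarrow> l1_dist m z (\<xi> j) < 2 * (d / 4)"
        "(\<exists>j<J. l1_dist m z (\<xi> j) \<le> d / 4) \<longrightarrow> (\<Sum>j<J. \<psi> j) = 1" by (elim exE conjE)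
      have one: "(\<Sum>j<J. \<psi> j) = 1" using \<psi>(5) J(4)[OF z] unfolding mh by blast
      have "vec_dist (realize A z) c \<le> \<rho>"
        if "0 \<le> \<rho>" "\<forall>w\<in>K. l1_dist m z w \<le> d / 2 \<longrightarrow> vec_dist (v w) c \<le> \<rho>" for c \<rho>
      proof (rule vec_dist_convex[where w = \<psi> and v = "\<lambda>j. v (\<xi> j)" and J = J and p = p])
        show "dim_vec (v (\<xi> j)) = p \<and> vec_dist (v (\<xi> j)) c \<le> \<rho>" if j: "0 < \<psi> j" for j
        proof -
          have "l1_dist m z (\<xi> j) \<le> d / 2" using \<psi>(4) j by (simp add: less_imp_le)
          then show ?thesis using \<open>\<forall>w\<in>K. l1_dist m z w \<le> d / 2 \<longrightarrow> vec_dist (v w) c \<le> \<rho>\<close> J(3)[of j] v[OF J(3)[of j]] by auto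
        qed
      qed (use \<psi> one that in auto)
      with \<psi>(3) show ?thesis by blast
    qed
    then show "\<exists>A. is_network m p A \<and> network_size A \<le> N \<and>
        (\<forall>z\<in>K. dim_vec (realize A z) = p \<and> (\<forall>c \<rho>. 0 \<le> \<rho> \<longrightarrow>
          (\<forall>w\<in>K. l1_dist m z w \<le> exp (- (1 / (3 * real m) * ln (real N / (c0 * (real p + 1))))) / 2 \<longrightarrow> vec_dist (v w) c \<le> \<rho>)
          \<longrightarrow> vec_dist (realize A z) c \<le> \<rho>))"
      using A(1) size unfolding d_def x_def by (intro exI[of _ A] conjI ballI) auto
  qed
qed

section \<open>Projector and reconstructor\<close>

context
  fixes \<phi> :: "nat \<Rightarrow> R3 \<Rightarrow> real" and n :: nat
  assumes basis: "polynomial_basis \<phi>"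
begin

abbreviation "\<Phi> \<equiv> \<lambda>k x. complex_of_real (\<phi> k x)"

lemma basis_span: "cfun.span (\<Phi> ` {1..poly_dim n}) = poly_space n"
  using basis by (simp add: polynomial_basis_def)

lemma basis_poly: "k \<in> {1..poly_dim n} \<Longrightarrow> \<Phi> k \<in> poly_space n"
  unfolding basis_span[symmetric] by (intro cfun.span_base imageI)

lemma basis_sqi: "k \<in> {1..poly_dim n} \<Longrightarrow> \<Phi> k \<in> square_integrable ball_measure"
  by (rule sqi_poly_ball[OF basis_poly])

lemma basis_orthonormal:
  assumes "i \<in> {1..poly_dim n}" "j \<in> {1..poly_dim n}"
  shows "l2i ball_measure (\<Phi> i) (\<Phi> j) = of_bool (i = j)"
proof -
  have "l2i ball_measure (\<Phi> i) (\<Phi> j) = (LINT x|ball_measure. complex_of_real (\<phi> i x * \<phi> j x))"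
    unfolding l2i_def by simp
  also have "\<dots> = complex_of_real (LINT x|ball_measure. \<phi> i x * \<phi> j x)"
    by (rule integral_complex_of_real)
  also have "(LINT x|ball_measure. \<phi> i x * \<phi> j x) = of_bool (i = j)"
    using basis assms unfolding polynomial_basis_def by simp
  finally show ?thesis by simp
qed

text \<open>Keeps the base of the negative power in the third error term positive and provides a
  unit vector for the lower bound on the Lipschitz constant.\<close>

lemma poly_dim_pos: "poly_dim n \<ge> 1"
proof (rule ccontr)
  assume "\<not> poly_dim n \<ge> 1"
  then have "{1..poly_dim n} = {}" by simp
  then have "poly_space n = {0}" using basis_span by simp
  moreover have "(\<lambda>_. 1) \<in> poly_space n" by (rule poly_const)
  ultimately have "(\<lambda>_. 1 :: complex) = (0 :: R3 \<Rightarrow> complex)" by blast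
  from fun_cong[OF this, of 0] show False by simp
qed

definition basis_sum :: "(nat \<Rightarrow> complex) \<Rightarrow> R3 \<Rightarrow> complex" where
  "basis_sum a x = (\<Sum>k=1..poly_dim n. a k * \<Phi> k x)"

lemma basis_term_sqi: "k \<in> {1..poly_dim n} \<Longrightarrow> (\<lambda>x. a k * \<Phi> k x) \<in> square_integrable ball_measure"
  by (rule sqi_cmult[OF basis_sqi])

lemma basis_sum_sqi: "basis_sum a \<in> square_integrable ball_measure"
  unfolding basis_sum_def by (intro sqi_sum basis_term_sqi)

lemma l2i_basis_sum:
  assumes "f \<in> square_integrable ball_measure"
  shows "l2i ball_measure f (basis_sum a) = (\<Sum>k=1..poly_dim n. cnj (a k) * l2i ball_measure f (\<Phi> k))"
  unfolding basis_sum_def by (subst l2i_sum_right[OF basis_term_sqi assms]) (simp_all only: l2i_cmult_right)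

lemma l2i_basis_sum_basis:
  assumes "j \<in> {1..poly_dim n}"
  shows "l2i ball_measure (basis_sum a) (\<Phi> j) = a j"
proof -
  have "l2i ball_measure (basis_sum a) (\<Phi> j) = (\<Sum>k=1..poly_dim n. a k * l2i ball_measure (\<Phi> k) (\<Phi> j))"
    unfolding basis_sum_def by (subst l2i_sum_left[OF basis_term_sqi basis_sqi[OF assms]]) (simp_all only: l2i_cmult_left)
  also have "\<dots> = (\<Sum>k=1..poly_dim n. if k = j then a j else 0)"
    by (intro sum.cong refl) (simp only: basis_orthonormal assms of_bool_def if_distrib[of "\<lambda>x. _ * x"] mult_1_right mult_zero_right, simp)
  also have "\<dots> = a j" using assms by simp
  finally show ?thesis .
qed

lemma l2n_basis_sum: "(l2n ball_measure (basis_sum a))\<^sup>2 = (\<Sum>k=1..poly_dim n. (cmod (a k))\<^sup>2)"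
proof -
  have "complex_of_real ((l2n ball_measure (basis_sum a))\<^sup>2) = (\<Sum>k=1..poly_dim n. cnj (a k) * l2i ball_measure (basis_sum a) (\<Phi> k))"
    unfolding l2i_self[symmetric] by (rule l2i_basis_sum[OF basis_sum_sqi])
  also have "\<dots> = (\<Sum>k=1..poly_dim n. complex_of_real ((cmod (a k))\<^sup>2))"
    by (intro sum.cong refl) (simp only: l2i_basis_sum_basis complex_norm_square mult.commute)
  finally show ?thesis by (simp only: of_real_sum[symmetric] of_real_eq_iff)
qed

lemma basis_sum_diff: "basis_sum a x - basis_sum b x = basis_sum (\<lambda>k. a k - b k) x"
  unfolding basis_sum_def by (simp only: left_diff_distrib sum_subtractf)

lemma basis_bessel:
  assumes f: "f \<in> square_integrable ball_measure"
  shows "(\<Sum>k=1..poly_dim n. (cmod (l2i ball_measure f (\<Phi> k)))\<^sup>2) \<le> (l2n ball_measure f)\<^sup>2"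
proof -
  define a where "a k = l2i ball_measure f (\<Phi> k)" for k
  have "l2i ball_measure f (basis_sum a) = (\<Sum>k=1..poly_dim n. complex_of_real ((cmod (a k))\<^sup>2))"
    unfolding l2i_basis_sum[OF f] a_def[symmetric] by (simp only: complex_norm_square mult.commute)
  then have "Re (l2i ball_measure f (basis_sum a)) = (\<Sum>k=1..poly_dim n. (cmod (a k))\<^sup>2)"
    by (simp only: of_real_sum[symmetric] Re_complex_of_real)
  moreover have "0 \<le> (l2n ball_measure (\<lambda>x. f x - basis_sum a x))\<^sup>2" by simp
  ultimately show ?thesis
    unfolding l2n_diff_sq[OF f basis_sum_sqi] l2n_basis_sum a_def[symmetric] by linarith
qed

definition pcoeff :: "R3 l2 \<Rightarrow> nat \<Rightarrow> complex" where
  "pcoeff q k = l2i ball_measure (L2_rep q) (\<Phi> k)"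

lemma L2_inner_pcoeff:
  "q \<in> L2 ball_measure \<Longrightarrow> k \<in> {1..poly_dim n} \<Longrightarrow> L2_inner ball_measure q (L2_class ball_measure (\<Phi> k)) = pcoeff q k"
  unfolding pcoeff_def by (rule L2_inner_class_right[OF _ basis_sqi])

lemma projector_carrier: "projector \<phi> n q \<in> carrier_vec (2 * poly_dim n)"
  by (simp add: projector_def Let_def)

lemma projector_nth:
  assumes "q \<in> L2 ball_measure" "i < poly_dim n"
  shows "projector \<phi> n q $ i = Re (pcoeff q (i + 1))" "projector \<phi> n q $ (poly_dim n + i) = Im (pcoeff q (i + 1))"
  using assms L2_inner_pcoeff[OF assms(1), of "i + 1"] by (simp_all add: projector_def Let_def)

text \<open>Basis functions are counted from \<open>1\<close> and vector entries from
  \<open>0\<close>, hence the shifts by one.\<close>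

definition vcoeff :: "real vec \<Rightarrow> nat \<Rightarrow> complex" where
  "vcoeff v k = Complex (v $ (k - 1)) (v $ (poly_dim n + k - 1))"

lemma reconstructor_eq: "reconstructor \<phi> n v = L2_class ball_measure (basis_sum (vcoeff v))"
  by (simp add: reconstructor_def Let_def basis_sum_def[abs_def] vcoeff_def)

lemma reconstructor_L2: "reconstructor \<phi> n v \<in> L2 ball_measure"
  unfolding reconstructor_eq by (intro L2_class_in basis_sum_sqi)

lemma vcoeff_projector:
  assumes "q \<in> L2 ball_measure" "k \<in> {1..poly_dim n}"
  shows "vcoeff (projector \<phi> n q) k = pcoeff q k"
proof -
  have "k - 1 < poly_dim n" "poly_dim n + (k - 1) = poly_dim n + k - 1" "k - 1 + 1 = k" using assms(2) by auto
  then show ?thesis using projector_nth[OF assms(1), of "k - 1"] by (simp add: vcoeff_def complex_eq_iff)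
qed

lemma vec_dist_vcoeff:
  assumes "v \<in> carrier_vec (2 * poly_dim n)"
  shows "(vec_dist v w)\<^sup>2 = (\<Sum>k=1..poly_dim n. (cmod (vcoeff v k - vcoeff w k))\<^sup>2)"
proof -
  have "(vec_dist v w)\<^sup>2 = (\<Sum>i<poly_dim n + poly_dim n. (v $ i - w $ i)\<^sup>2)"
    using assms unfolding vec_dist_def by (simp add: sum_nonneg mult_2)
  also have "\<dots> = (\<Sum>i<poly_dim n. (v $ i - w $ i)\<^sup>2 + (v $ (poly_dim n + i) - w $ (poly_dim n + i))\<^sup>2)"
    unfolding sum_lessThan_add sum.distrib ..
  also have "\<dots> = (\<Sum>i<poly_dim n. (cmod (vcoeff v (i + 1) - vcoeff w (i + 1)))\<^sup>2)"
    by (intro sum.cong refl) (simp add: cmod_power2 vcoeff_def)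
  also have "\<dots> = (\<Sum>k=1..poly_dim n. (cmod (vcoeff v k - vcoeff w k))\<^sup>2)"
    by (rule sum.reindex_bij_witness[of _ "\<lambda>k. k - 1" "\<lambda>i. i + 1"]) auto
  finally show ?thesis .
qed

text \<open>Orthonormality turns the \<open>L2\<close> distance into the distance of coefficients.
  \<open>vec_dist\<close> takes its dimension from its first argument, so only that one needs a
  carrier condition.\<close>

lemma reconstructor_isometry:
  assumes "v \<in> carrier_vec (2 * poly_dim n)"
  shows "L2_dist ball_measure (reconstructor \<phi> n v) (reconstructor \<phi> n w) = vec_dist v w"
proof -
  have "(L2_dist ball_measure (reconstructor \<phi> n v) (reconstructor \<phi> n w))\<^sup>2 = (vec_dist v w)\<^sup>2"
    unfolding reconstructor_eq L2_dist_class[OF basis_sum_sqi basis_sum_sqi] basis_sum_diff l2n_basis_sum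
      vec_dist_vcoeff[OF assms] ..
  then show ?thesis by (rule power2_eq_imp_eq) (auto simp: vec_dist_def sum_nonneg)
qed

text \<open>Bessel's inequality for the difference of the two functions.\<close>

lemma projector_contraction:
  assumes "q \<in> L2 ball_measure" "q' \<in> L2 ball_measure"
  shows "vec_dist (projector \<phi> n q) (projector \<phi> n q') \<le> L2_dist ball_measure q q'"
proof -
  have "(vec_dist (projector \<phi> n q) (projector \<phi> n q'))\<^sup>2
      = (\<Sum>k=1..poly_dim n. (cmod (l2i ball_measure (\<lambda>x. L2_rep q x - L2_rep q' x) (\<Phi> k)))\<^sup>2)"
    unfolding vec_dist_vcoeff[OF projector_carrier]
    by (intro sum.cong refl arg_cong[where f = "\<lambda>x. (cmod x)\<^sup>2"])
       (simp only: vcoeff_projector assms pcoeff_def l2i_diff_left[OF L2_rep_sqi[OF assms(1)] L2_rep_sqi[OF assms(2)] basis_sqi])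
  also have "\<dots> \<le> (L2_dist ball_measure q q')\<^sup>2"
    unfolding L2_dist_eq by (intro basis_bessel sqi_diff L2_rep_sqi assms)
  finally show ?thesis by (rule power2_le_imp_le) simp
qed

lemma residual_orthogonal:
  assumes q: "q \<in> L2 ball_measure" and p: "p \<in> poly_space n"
  shows "l2i ball_measure (\<lambda>x. L2_rep q x - basis_sum (pcoeff q) x) p = 0"
proof -
  let ?\<rho> = "\<lambda>x. L2_rep q x - basis_sum (pcoeff q) x"
  have \<rho>: "?\<rho> \<in> square_integrable ball_measure" by (intro sqi_diff L2_rep_sqi q basis_sum_sqi)
  have b: "l2i ball_measure ?\<rho> (\<Phi> k) = 0" if "k \<in> {1..poly_dim n}" for k
    unfolding l2i_diff_left[OF L2_rep_sqi[OF q] basis_sum_sqi basis_sqi[OF that]] l2i_basis_sum_basis[OF that] pcoeff_def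
    by simp
  have "p \<in> square_integrable ball_measure \<and> l2i ball_measure ?\<rho> p = 0"
    using p[folded basis_span]
  proof (induction rule: cfun.span_induct_alt)
    case base
    then show ?case by (simp add: zero_fun_def sqi_zero)
  next
    case (step c x y)
    then obtain k where k: "k \<in> {1..poly_dim n}" "x = \<Phi> k" by blast
    have x: "(\<lambda>t. c * x t) \<in> square_integrable ball_measure" unfolding k(2) by (rule sqi_cmult[OF basis_sqi[OF k(1)]])
    have e: "(\<lambda>t. c * x t) + y = (\<lambda>t. c * x t + y t)" by (simp add: plus_fun_def)
    have "l2i ball_measure ?\<rho> (\<lambda>t. c * x t + y t) = 0"
      using step b[OF k(1)] unfolding k(2)[symmetric]
      by (simp only: l2i_add_right[OF x _ \<rho>] l2i_cmult_right mult_zero_right add_0)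
    moreover have "(\<lambda>t. c * x t + y t) \<in> square_integrable ball_measure"
      using step by (intro sqi_add x) blast
    ultimately show ?case unfolding e by blast
  qed
  then show ?thesis by blast
qed

lemma reconstruct_project:
  assumes "q \<in> L2 ball_measure"
  shows "reconstructor \<phi> n (projector \<phi> n q) = L2_class ball_measure (basis_sum (pcoeff q))"
proof -
  have "basis_sum (vcoeff (projector \<phi> n q)) = basis_sum (pcoeff q)"
    unfolding basis_sum_def using vcoeff_projector[OF assms] by (intro ext sum.cong) auto
  then show ?thesis by (simp only: reconstructor_eq)
qed

lemma projection_error_le:
  assumes q: "q \<in> L2 ball_measure" and r: "0 \<le> \<epsilon>"
    and pair: "\<And>r. r \<in> square_integrable ball_measure \<Longrightarrow> (\<And>p. p \<in> poly_space n \<Longrightarrow> l2i ball_measure r p = 0) \<Longrightarrow>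
       cmod (l2i ball_measure (L2_rep q) r) \<le> \<epsilon> * l2n ball_measure r"
  shows "L2_dist ball_measure q (reconstructor \<phi> n (projector \<phi> n q)) \<le> \<epsilon>"
proof -
  let ?\<rho> = "\<lambda>x. L2_rep q x - basis_sum (pcoeff q) x"
  have \<rho>: "?\<rho> \<in> square_integrable ball_measure" by (intro sqi_diff L2_rep_sqi q basis_sum_sqi)
  have "L2_dist ball_measure q (reconstructor \<phi> n (projector \<phi> n q)) = l2n ball_measure ?\<rho>"
    unfolding reconstruct_project[OF q]
    using L2_dist_class[OF L2_rep_sqi[OF q] basis_sum_sqi, of "pcoeff q"] q by simp
  moreover have "l2n ball_measure ?\<rho> \<le> \<epsilon>"
  proof -
    have bp: "basis_sum (pcoeff q) \<in> poly_space n"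
      unfolding basis_sum_def[abs_def] by (intro poly_sum poly_cmult basis_poly)
    have "complex_of_real ((l2n ball_measure ?\<rho>)\<^sup>2)
        = l2i ball_measure (L2_rep q) ?\<rho> - l2i ball_measure (basis_sum (pcoeff q)) ?\<rho>"
      unfolding l2i_self[symmetric] by (rule l2i_diff_left[OF L2_rep_sqi[OF q] basis_sum_sqi \<rho>])
    also have "l2i ball_measure (basis_sum (pcoeff q)) ?\<rho> = 0"
      using residual_orthogonal[OF q bp] l2i_commute[of ball_measure "basis_sum (pcoeff q)" ?\<rho>] by (simp only: complex_cnj_zero)
    finally have "cmod (complex_of_real ((l2n ball_measure ?\<rho>)\<^sup>2)) = cmod (l2i ball_measure (L2_rep q) ?\<rho>)" by (simp only: diff_zero)
    also have "\<dots> \<le> \<epsilon> * l2n ball_measure ?\<rho>"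
      by (intro pair \<rho> residual_orthogonal q)
    finally have "l2n ball_measure ?\<rho> * l2n ball_measure ?\<rho> \<le> \<epsilon> * l2n ball_measure ?\<rho>"
      unfolding norm_of_real power2_eq_square by (simp only: abs_mult abs_of_nonneg[OF l2n_nonneg])
    then show ?thesis using r l2n_nonneg[of ball_measure ?\<rho>]
      by (cases "l2n ball_measure ?\<rho> = 0") (auto simp: mult_le_cancel_right)
  qed
  ultimately show ?thesis by simp
qed

text \<open>Allows the factor \<open>Lip_R\<close> to be inserted into an error bound for free. The
  greatest lower bound is only meaningful for a nonempty set of constants, and \<open>1\<close>
  belongs to it by the isometry.\<close>

lemma Lip_reconstructor_ge_1:
  "1 \<le> Lip_const (carrier_vec (2 * poly_dim n)) vec_dist (L2_dist ball_measure) (reconstructor \<phi> n)"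
  unfolding Lip_const_def
proof (rule cInf_greatest)
  show "{C. 0 \<le> C \<and> (\<forall>x\<in>carrier_vec (2 * poly_dim n). \<forall>y\<in>carrier_vec (2 * poly_dim n).
      L2_dist ball_measure (reconstructor \<phi> n x) (reconstructor \<phi> n y) \<le> C * vec_dist x y)} \<noteq> {}"
    using reconstructor_isometry by (auto intro!: exI[of _ 1])
  fix C assume C: "C \<in> {C. 0 \<le> C \<and> (\<forall>x\<in>carrier_vec (2 * poly_dim n). \<forall>y\<in>carrier_vec (2 * poly_dim n).
      L2_dist ball_measure (reconstructor \<phi> n x) (reconstructor \<phi> n y) \<le> C * vec_dist x y)}"
  let ?v = "unit_vec (2 * poly_dim n) 0 :: real vec" and ?w = "0\<^sub>v (2 * poly_dim n) :: real vec"
  have "vec_dist ?v ?w = sqrt (\<Sum>i<2 * poly_dim n. if i = 0 then 1 else 0)"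
    unfolding vec_dist_def by (intro arg_cong[where f = sqrt] sum.cong) auto
  also have "\<dots> = 1" using poly_dim_pos by simp
  finally have "vec_dist ?v ?w = 1" .
  moreover have "L2_dist ball_measure (reconstructor \<phi> n ?v) (reconstructor \<phi> n ?w) \<le> C * vec_dist ?v ?w"
    using C by simp
  ultimately show "1 \<le> C" using reconstructor_isometry[of ?v ?w] by simp
qed

text \<open>Nonnegativity of the infimum also needs an admissible constant, which the contraction
  property supplies.\<close>

lemma Lip_reconstruct_project_nonneg:
  "0 \<le> Lip_const (L2 ball_measure) (L2_dist ball_measure) (L2_dist ball_measure) (reconstructor \<phi> n \<circ> projector \<phi> n)"
  unfolding Lip_const_def
proof (rule cInf_greatest)
  have "L2_dist ball_measure ((reconstructor \<phi> n \<circ> projector \<phi> n) x) ((reconstructor \<phi> n \<circ> projector \<phi> n) y)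
      \<le> 1 * L2_dist ball_measure x y" if "x \<in> L2 ball_measure" "y \<in> L2 ball_measure" for x y
    using projector_contraction[OF that] reconstructor_isometry[OF projector_carrier] by simp
  then show "{C. 0 \<le> C \<and> (\<forall>x\<in>L2 ball_measure. \<forall>y\<in>L2 ball_measure.
      L2_dist ball_measure ((reconstructor \<phi> n \<circ> projector \<phi> n) x) ((reconstructor \<phi> n \<circ> projector \<phi> n) y)
      \<le> C * L2_dist ball_measure x y)} \<noteq> {}"
    using zero_le_one by blast
qed auto

end

text \<open>Re-expresses the rate through \<open>p = 2 * poly_dim n\<close>, which is at most
  \<open>2 * (n + 1) ^ 3\<close>; the factor \<open>2\<close> accounts for the constant
  \<open>2 powr (s / 3)\<close>.\<close>

lemma jackson_admissible:
  assumes s: "s > 0" and Cq: "Cq > 0" and basis: "polynomial_basis \<phi>"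
  obtains C where "C > 0"
    "\<And>n q. q \<in> admissible s Cq \<Longrightarrow> to_ball q \<in> L2 ball_measure \<Longrightarrow>
      L2_dist ball_measure (to_ball q) (reconstructor \<phi> n (projector \<phi> n (to_ball q)))
        \<le> C * real (2 * poly_dim n) powr (- s / 3)"
proof -
  obtain C where C: "C > 0"
    "\<And>n q r. q \<in> admissible s Cq \<Longrightarrow> r \<in> square_integrable ball_measure \<Longrightarrow>
       (\<And>p. p \<in> poly_space n \<Longrightarrow> l2i ball_measure r p = 0) \<Longrightarrow>
       cmod (l2i ball_measure (L2_rep q) r) \<le> C * real (n + 1) powr (- s) * l2n ball_measure r"
    using jackson_pairing[OF s Cq] by blast
  define C' where "C' = C * 2 powr (s / 3)"
  have bound: "L2_dist ball_measure (to_ball q) (reconstructor \<phi> n (projector \<phi> n (to_ball q)))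
        \<le> C' * real (2 * poly_dim n) powr (- s / 3)"
    if q: "q \<in> admissible s Cq" and tb: "to_ball q \<in> L2 ball_measure" for n q
  proof -
    have g: "L2_rep q \<in> square_integrable ball_measure"
      by (rule sqi_lborel_ball[OF admissible_rep_sqi[OF q]])
    have "L2_dist ball_measure (to_ball q) (reconstructor \<phi> n (projector \<phi> n (to_ball q))) \<le> C * real (n + 1) powr (- s)"
    proof (rule projection_error_le[OF basis tb])
      show "0 \<le> C * real (n + 1) powr (- s)" using C(1) by simp
      fix r assume r: "r \<in> square_integrable ball_measure" "\<And>p. p \<in> poly_space n \<Longrightarrow> l2i ball_measure r p = 0"
      have "l2i ball_measure (L2_rep (to_ball q)) r = l2i ball_measure (L2_rep q) r"
        by (intro l2i_cong_AE sqi_measurable[OF L2_rep_sqi[OF tb]] sqi_measurable[OF g] sqi_measurable[OF r(1)])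
           (use L2_rep_class[OF g] in \<open>auto simp: to_ball_def\<close>)
      then show "cmod (l2i ball_measure (L2_rep (to_ball q)) r) \<le> C * real (n + 1) powr (- s) * l2n ball_measure r"
        using C(2)[OF q r] by (simp only:)
    qed
    also have "real (n + 1) powr (- s) \<le> 2 powr (s / 3) * real (2 * poly_dim n) powr (- s / 3)"
    proof -
      have p0: "0 < real (2 * poly_dim n)" using poly_dim_pos[OF basis, of n] by simp
      have "real (poly_dim n) \<le> real ((n + 1) ^ 3)" using poly_dim_le of_nat_le_iff by blast
      then have le: "real (2 * poly_dim n) \<le> 2 * real (n + 1) ^ 3" by simp
      have "real (n + 1) powr (- s) = (real (n + 1) powr 3) powr (- s / 3)" by (simp only: powr_powr) simp
      also have "real (n + 1) powr 3 = real (n + 1) ^ 3" using powr_realpow[of "real (n + 1)" 3] by simp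
      also have "(real (n + 1) ^ 3) powr (- s / 3) = 2 powr (s / 3) * (2 * real (n + 1) ^ 3) powr (- s / 3)"
        by (simp add: powr_mult powr_add[symmetric] mult.assoc[symmetric] del: of_nat_Suc)
      also have "\<dots> \<le> 2 powr (s / 3) * real (2 * poly_dim n) powr (- s / 3)"
        using powr_mono2'[OF _ p0 le, of "- s / 3"] s by (intro mult_left_mono) auto
      finally show ?thesis .
    qed
    finally show ?thesis using C(1) by (simp add: C'_def mult_left_mono mult.assoc)
  qed
  show ?thesis
  proof (rule that)
    show "C' > 0" using C(1) by (simp add: C'_def)
  qed (rule bound)
qed

section \<open>Borel sets and supports\<close>

lemma space_borel_of [simp]: "space (borel_of T) = topspace T"
  unfolding borel_of_def by (rule space_measure_of) (auto dest: openin_subset)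

lemma openin_sets_borel_of: "openin T U \<Longrightarrow> U \<in> sets (borel_of T)"
  unfolding borel_of_def by (subst sets_measure_of) (auto dest: openin_subset)

lemma measurable_borel_of:
  assumes "\<And>U. openin T U \<Longrightarrow> f -` U \<inter> space M \<in> sets M" "f \<in> space M \<rightarrow> topspace T"
  shows "f \<in> measurable M (borel_of T)"
  unfolding borel_of_def by (rule measurable_measure_of) (use assms in \<open>auto dest: openin_subset\<close>)

lemma continuous_map_measurable:
  assumes c: "continuous_map S T f" and M: "sets M = sets (borel_of S)"
  shows "f \<in> measurable M (borel_of T)"
proof (rule measurable_borel_of)
  have sp: "space M = topspace S" using sets_eq_imp_space_eq[OF M] by simp
  show "f \<in> space M \<rightarrow> topspace T" using c unfolding sp by (rule continuous_map_funspace)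
  fix U assume "openin T U"
  then have "openin S {x \<in> topspace S. f x \<in> U}" using c openin_continuous_map_preimage by blast
  then have "{x \<in> topspace S. f x \<in> U} \<in> sets M" unfolding M by (rule openin_sets_borel_of)
  moreover have "f -` U \<inter> space M = {x \<in> topspace S. f x \<in> U}" unfolding sp by auto
  ultimately show "f -` U \<inter> space M \<in> sets M" by simp
qed

text \<open>The complement of the support is covered by null balls with centres in a countable dense
  set and radii \<open>1 / Suc n\<close>, hence by countably many null sets.\<close>

lemma AE_measure_support:
  assumes met: "metrizable_space T" and sep: "separable_space T" and sets: "sets M = sets (borel_of T)"
  shows "AE x in M. x \<in> measure_support T M"
proof -
  have sp: "space M = topspace T" using sets_eq_imp_space_eq[OF sets] by simp
  obtain S d where Sd: "Metric_space S d" "T = Metric_space.mtopology S d"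
    using met by (auto simp: metrizable_space_def)
  interpret Metric_space S d by fact
  have top: "topspace T = S" using Sd by simp
  obtain C where C: "countable C" "C \<subseteq> S" "T closure_of C = S"
    using sep unfolding separable_space_def top by blast
  define \<B> where "\<B> = {B. (\<exists>c\<in>C. \<exists>n::nat. B = mball c (1 / real (Suc n))) \<and> emeasure M B = 0}"
  have "\<B> \<subseteq> (\<lambda>(c, n). mball c (1 / real (Suc n))) ` (C \<times> (UNIV :: nat set))" by (auto simp: \<B>_def)
  moreover have "countable (C \<times> (UNIV :: nat set))" by (rule countable_SIGMA[OF C(1)]) simp
  ultimately have cB: "countable \<B>" by (rule countable_subset[OF _ countable_image])
  have opB: "openin T B" if "B \<in> \<B>" for B using that Sd(2) openin_mball by (auto simp: \<B>_def)
  have "(\<Union>B\<in>\<B>. B) \<in> null_sets M"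
  proof (rule null_sets_UN'[OF cB])
    fix B assume B: "B \<in> \<B>"
    then have "B \<in> sets M" unfolding sets by (intro openin_sets_borel_of opB)
    then show "B \<in> null_sets M" using B by (auto simp: \<B>_def)
  qed
  then have ae: "AE x in M. x \<notin> (\<Union>B\<in>\<B>. B)" by (rule AE_not_in)
  have "x \<in> measure_support T M" if x: "x \<in> space M" "x \<notin> (\<Union>B\<in>\<B>. B)" for x
  proof -
    have xS: "x \<in> S" using x(1) sp top by simp
    have "emeasure M U > 0" if U: "openin T U" "x \<in> U" for U
    proof (rule ccontr)
      assume "\<not> emeasure M U > 0"
      then have U0: "emeasure M U = 0" by simp
      obtain r where r: "r > 0" "mball x r \<subseteq> U" using U unfolding Sd(2) openin_mtopology by blast
      obtain n :: nat where n: "2 / r < real n" using reals_Archimedean2 by blast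
      \<comment> \<open>As \<open>2 * e < r\<close>, a ball of radius \<open>e\<close> around a
        centre that is \<open>e\<close>-close to \<open>x\<close> contains \<open>x\<close> and
        stays inside the null set \<open>U\<close>.\<close>
      define e where "e = 1 / real (Suc n)"
      have e: "e > 0" "2 * e < r"
      proof -
        have "2 / r < real (Suc n)" using n by simp
        then show "2 * e < r" using r(1) by (simp add: e_def field_simps)
      qed (simp add: e_def)
      have "x \<in> T closure_of C" using C xS by simp
      then have "\<forall>r>0. \<exists>c\<in>C. c \<in> mball x r"
        unfolding Sd(2) metric_closure_of by (simp only: mem_Collect_eq, elim conjE)
      then obtain c where c: "c \<in> C" "c \<in> mball x e" using e(1) by blast
      have xc: "x \<in> mball c e" using c C(2) xS by (auto simp: commute)
      have "mball c e \<subseteq> mball x r"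
      proof
        fix y assume y: "y \<in> mball c e"
        then have "d x y \<le> d x c + d c y" using xS c C(2) by (intro triangle) auto
        then show "y \<in> mball x r" using y c xS e(2) by auto
      qed
      then have sub: "mball c e \<subseteq> U" using r(2) by blast
      have "U \<in> sets M" unfolding sets by (rule openin_sets_borel_of[OF U(1)])
      from emeasure_mono[OF sub this] have "emeasure M (mball c e) = 0" using U0 by simp
      then have "mball c e \<in> \<B>"
        unfolding \<B>_def by (intro CollectI conjI bexI[OF _ c(1)] exI[of _ n]) (simp_all only: e_def)
      then show False using x(2) xc by blast
    qed
    then show ?thesis using xS top unfolding measure_support_def by blast
  qed
  then show ?thesis by (intro AE_mp[OF ae AE_I2] impI)
qed

text \<open>Preimages of open sets are open. Working with \<open>\<bar>C\<bar> + 1\<close> avoids a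
  case distinction on the sign of \<open>C\<close>.\<close>

lemma L2_lipschitz_measurable:
  fixes h :: "'a l2 \<Rightarrow> 'b::metric_space"
  assumes lip: "\<And>F G. F \<in> L2 M \<Longrightarrow> G \<in> L2 M \<Longrightarrow> dist (h F) (h G) \<le> C * L2_dist M F G"
  shows "h \<in> borel_measurable (borel_of (L2_topology M))"
proof (rule borel_measurableI)
  interpret Metric_space "L2 M" "L2_dist M" by (rule Metric_space_L2)
  fix U :: "'b set" assume U: "open U"
  have "openin (L2_topology M) (h -` U \<inter> L2 M)"
    unfolding L2_topology_def openin_mtopology
  proof (intro conjI ballI allI impI)
    fix F assume F: "F \<in> h -` U \<inter> L2 M"
    then obtain e where e: "e > 0" "\<And>y. dist y (h F) < e \<Longrightarrow> y \<in> U" using U by (auto simp: open_dist)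
    have C: "\<bar>C\<bar> + 1 > 0" by linarith
    show "\<exists>r>0. mball F r \<subseteq> h -` U \<inter> L2 M"
    proof (intro exI[of _ "e / (\<bar>C\<bar> + 1)"] conjI subsetI)
      show "e / (\<bar>C\<bar> + 1) > 0" using e C by simp
      fix G assume G: "G \<in> mball F (e / (\<bar>C\<bar> + 1))"
      then have GL: "G \<in> L2 M" and d: "L2_dist M F G < e / (\<bar>C\<bar> + 1)" by auto
      have "dist (h G) (h F) \<le> C * L2_dist M G F" using lip GL F by auto
      also have "\<dots> \<le> (\<bar>C\<bar> + 1) * L2_dist M F G"
        unfolding L2_dist_commute[of M G F] by (intro mult_right_mono) auto
      also have "\<dots> < e" using d C by (simp add: pos_less_divide_eq mult.commute)
      finally show "G \<in> h -` U \<inter> L2 M" using e(2) GL by blast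
    qed
  qed auto
  then show "h -` U \<inter> space (borel_of (L2_topology M)) \<in> sets (borel_of (L2_topology M))"
    by (simp add: openin_sets_borel_of)
qed

lemma L2_inner_measurable:
  assumes g: "g \<in> square_integrable M"
  shows "(\<lambda>F. l2i M (L2_rep F) g) \<in> borel_measurable (borel_of (L2_topology M))"
proof (rule L2_lipschitz_measurable[where C = "l2n M g"])
  fix F G assume FG: "F \<in> L2 M" "G \<in> L2 M"
  have "dist (l2i M (L2_rep F) g) (l2i M (L2_rep G) g) = cmod (l2i M (\<lambda>x. L2_rep F x - L2_rep G x) g)"
    unfolding dist_norm l2i_diff_left[OF L2_rep_sqi[OF FG(1)] L2_rep_sqi[OF FG(2)] g] ..
  also have "\<dots> \<le> l2n M (\<lambda>x. L2_rep F x - L2_rep G x) * l2n M g"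
    by (intro cmod_l2i_le sqi_diff L2_rep_sqi FG g)
  finally show "dist (l2i M (L2_rep F) g) (l2i M (L2_rep G) g) \<le> l2n M g * L2_dist M F G"
    by (simp only: L2_dist_eq mult.commute)
qed

lemma L2_norm_measurable: "(\<lambda>F. l2n M (L2_rep F)) \<in> borel_measurable (borel_of (L2_topology M))"
proof (rule L2_lipschitz_measurable[where C = 1])
  fix F G assume FG: "F \<in> L2 M" "G \<in> L2 M"
  note s = L2_rep_sqi[OF FG(1)] L2_rep_sqi[OF FG(2)]
  have "l2n M (L2_rep F) \<le> l2n M (\<lambda>x. L2_rep F x - L2_rep G x) + l2n M (L2_rep G)"
    using l2n_triangle_diff[OF s sqi_zero] by simp
  moreover have "l2n M (L2_rep G) \<le> l2n M (\<lambda>x. L2_rep G x - L2_rep F x) + l2n M (L2_rep F)"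
    using l2n_triangle_diff[OF s(2) s(1) sqi_zero] by simp
  ultimately show "dist (l2n M (L2_rep F)) (l2n M (L2_rep G)) \<le> 1 * L2_dist M F G"
    unfolding L2_dist_eq dist_real_def l2n_minus_commute[of M "L2_rep G"] by linarith
qed

text \<open>Stated coordinatewise, so that no sigma-algebra on vectors of varying dimension is
  involved; the induction generalises the inner map \<open>g\<close>, which absorbs one layer at a
  time.\<close>

lemma realize_measurable:
  assumes "is_network m p A" "\<And>f. dim_vec (g f) = m" "\<And>i. i < m \<Longrightarrow> (\<lambda>f. g f $ i) \<in> borel_measurable M"
  shows "i < p \<Longrightarrow> (\<lambda>f. realize A (g f) $ i) \<in> borel_measurable M"
  using assms
proof (induction A arbitrary: m g)
  case Nil
  then show ?case by simp
next
  case (Cons l ls)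
  obtain W b where l: "l = (W, b)" by (cases l)
  have comp: "(\<lambda>f. (W *\<^sub>v g f + b) $ j) \<in> borel_measurable M"
    if "dim_col W = m" "dim_vec b = dim_row W" "j < dim_row W" for j
  proof -
    have "(\<lambda>f. (W *\<^sub>v g f + b) $ j) = (\<lambda>f. (\<Sum>k<m. W $$ (j, k) * g f $ k) + b $ j)"
      using that Cons.prems(3) by (intro ext) (simp add: scalar_prod_def lessThan_atLeast0)
    then show ?thesis using Cons.prems(4) by simp
  qed
  show ?case
  proof (cases "ls = []")
    case True
    then show ?thesis using Cons.prems l comp by auto
  next
    case False
    note net = Cons.prems(2)[unfolded l is_network_Cons[OF False]]
    have "(\<lambda>f. realize ls (map_vec (\<lambda>t. max t 0) (W *\<^sub>v g f + b)) $ i) \<in> borel_measurable M"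
    proof (rule Cons.IH[OF Cons.prems(1)])
      show "is_network (dim_row W) p ls" using net by blast
      show "dim_vec (map_vec (\<lambda>t. max t 0) (W *\<^sub>v g f + b)) = dim_row W" for f using net by simp
      show "(\<lambda>f. map_vec (\<lambda>t. max t 0) (W *\<^sub>v g f + b) $ j) \<in> borel_measurable M" if "j < dim_row W" for j
      proof -
        have "(\<lambda>f. map_vec (\<lambda>t. max t 0) (W *\<^sub>v g f + b) $ j) = (\<lambda>f. max ((W *\<^sub>v g f + b) $ j) 0)"
          using net that by (intro ext) simp
        moreover have "(\<lambda>f. max ((W *\<^sub>v g f + b) $ j) 0) \<in> borel_measurable M"
          using comp[of j] net that by (intro borel_measurable_max) auto
        ultimately show ?thesis by (simp only:)
      qed
    qed
    then show ?thesis unfolding l by (simp only: realize_Cons[OF False])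
  qed
qed

text \<open>Expanding the squared distance leaves finitely many norms, inner products and
  coefficients, each measurable in \<open>f\<close>; joint measurability of the metric is thus
  avoided.\<close>

lemma reconstruction_error_measurable:
  assumes basis: "polynomial_basis \<phi>"
    and G: "G \<in> measurable N (borel_of (L2_topology ball_measure))"
    and a: "\<And>i. i < 2 * poly_dim n \<Longrightarrow> (\<lambda>f. a f $ i) \<in> borel_measurable N"
  shows "(\<lambda>f. (L2_dist ball_measure (G f) (reconstructor \<phi> n (a f)))\<^sup>2) \<in> borel_measurable N"
proof -
  let ?r = "poly_dim n"
  let ?c = "\<lambda>f k. vcoeff n (a f) k" and ?\<Phi> = "\<lambda>k x. complex_of_real (\<phi> k x)"
  have GL: "G f \<in> L2 ball_measure" if "f \<in> space N" for f
    using measurable_space[OF G that] by simp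
  have eq: "(L2_dist ball_measure (G f) (reconstructor \<phi> n (a f)))\<^sup>2
    = (l2n ball_measure (L2_rep (G f)))\<^sup>2
      - 2 * Re (\<Sum>k=1..?r. cnj (?c f k) * l2i ball_measure (L2_rep (G f)) (?\<Phi> k)) + (\<Sum>k=1..?r. (cmod (?c f k))\<^sup>2)"
    if f: "f \<in> space N" for f
  proof -
    note s = L2_rep_sqi[OF GL[OF f]] and b = basis_sum_sqi[OF basis, of n "vcoeff n (a f)"]
    have "L2_dist ball_measure (G f) (reconstructor \<phi> n (a f)) = l2n ball_measure (\<lambda>x. L2_rep (G f) x - basis_sum \<phi> n (vcoeff n (a f)) x)"
      unfolding reconstructor_eq[OF basis] using L2_dist_class[OF s b] GL[OF f] by simp
    then show ?thesis
      by (simp only: l2n_diff_sq[OF s b] l2n_basis_sum[OF basis] l2i_basis_sum[OF basis s])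
  qed
  have cm: "(\<lambda>f. ?c f k) \<in> borel_measurable N" if k: "k \<in> {1..?r}" for k
  proof -
    have m: "(\<lambda>f. a f $ (k - 1)) \<in> borel_measurable N" "(\<lambda>f. a f $ (?r + k - 1)) \<in> borel_measurable N"
      using k by (auto intro!: a)
    have "(\<lambda>f. ?c f k) = (\<lambda>f. complex_of_real (a f $ (k - 1)) + \<i> * complex_of_real (a f $ (?r + k - 1)))"
      by (intro ext) (simp add: vcoeff_def[OF basis] complex_eq_iff)
    then show ?thesis using m by simp
  qed
  have im: "(\<lambda>f. l2i ball_measure (L2_rep (G f)) (?\<Phi> k)) \<in> borel_measurable N" if "k \<in> {1..?r}" for k
    by (rule measurable_compose[OF G L2_inner_measurable[OF basis_sqi[OF basis that]]])
  have nm: "(\<lambda>f. l2n ball_measure (L2_rep (G f))) \<in> borel_measurable N"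
    by (rule measurable_compose[OF G L2_norm_measurable])
  have cc: "(\<lambda>f. cnj (?c f k)) \<in> borel_measurable N" if "k \<in> {1..?r}" for k
    by (rule measurable_compose[OF cm[OF that] cnj_measurable])
  have cn: "(\<lambda>f. cmod (?c f k)) \<in> borel_measurable N" if "k \<in> {1..?r}" for k
    using cm[OF that] by simp
  have "(\<lambda>f. (l2n ball_measure (L2_rep (G f)))\<^sup>2
      - 2 * Re (\<Sum>k=1..?r. cnj (?c f k) * l2i ball_measure (L2_rep (G f)) (?\<Phi> k)) + (\<Sum>k=1..?r. (cmod (?c f k))\<^sup>2))
      \<in> borel_measurable N"
    by (intro borel_measurable_add borel_measurable_diff borel_measurable_power nm borel_measurable_times
        borel_measurable_const borel_measurable_sum cn
        measurable_compose[OF _ borel_measurable_Re] cc im)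
  then show ?thesis by (subst measurable_cong[OF eq])
qed

section \<open>The logarithmic modulus\<close>

lemma ln_minus_le: "ln_minus t \<le> - 1" if "t > 0"
proof -
  have "ln t \<le> - 1" if "t \<le> exp (- 1)"
    using \<open>t > 0\<close> that ln_le_cancel_iff[of t "exp (- 1)"] by simp
  then show ?thesis by (simp add: ln_minus_def)
qed

lemma ln_minus_mono: "ln_minus t \<le> ln_minus u" if "0 < t" "t \<le> u"
  using that ln_minus_le[of t] by (auto simp: ln_minus_def)

lemma log_modulus_mono:
  assumes "0 \<le> \<alpha>" "0 \<le> t" "t \<le> u"
  shows "log_modulus \<alpha> t \<le> log_modulus \<alpha> u"
proof (cases "t = 0")
  case False
  then have "0 < t" "0 < u" using assms by auto
  then show ?thesis
    using assms ln_minus_mono[of t u] ln_minus_le[of u] by (simp add: log_modulus_def powr_mono2')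
qed (simp add: log_modulus_def)

lemma log_modulus_nonneg: "0 \<le> log_modulus \<alpha> t"
  by (simp add: log_modulus_def)

lemma log_modulus_exp:
  assumes "x \<ge> 1" shows "log_modulus \<alpha> (exp (- x)) = x powr (- \<alpha>)"
  using assms by (simp add: log_modulus_def ln_minus_def)

text \<open>A sum is at most twice its larger term. Writing the first term as
  \<open>exp (- x) / 2\<close> makes its double \<open>exp (- x)\<close>, where the modulus is
  explicit; the second term is doubled in the conclusion.\<close>

lemma log_modulus_add:
  assumes \<alpha>: "0 \<le> \<alpha>" and x: "x \<ge> 1" and t: "0 \<le> t" "t \<le> exp (- x) / 2 + \<tau>" and \<tau>: "0 \<le> \<tau>"
  shows "log_modulus \<alpha> t \<le> x powr (- \<alpha>) + log_modulus \<alpha> (2 * \<tau>)"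
proof (cases "\<tau> \<le> exp (- x) / 2")
  case True
  then have "log_modulus \<alpha> t \<le> log_modulus \<alpha> (exp (- x))" using t by (intro log_modulus_mono \<alpha>) auto
  then show ?thesis using log_modulus_nonneg[of \<alpha> "2 * \<tau>"] by (simp add: log_modulus_exp[OF x])
next
  case False
  then have "log_modulus \<alpha> t \<le> log_modulus \<alpha> (2 * \<tau>)" using t by (intro log_modulus_mono \<alpha>) auto
  then show ?thesis using powr_ge_zero[of x "- \<alpha>"] by linarith
qed

text \<open>For large \<open>L\<close> the negative logarithm grows like \<open>b * L\<close>; for
  small \<open>L\<close> the argument may be large and the modulus saturates at \<open>1\<close>.
  One linear lower bound has to serve both regimes.\<close>

lemma log_modulus_exponential:
  assumes \<alpha>: "0 \<le> \<alpha>" and a: "0 \<le> a" and b: "0 < b"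
  obtains C where "C > 0" "\<And>L. log_modulus \<alpha> (a * exp (- b * real L)) \<le> C * real (L + 1) powr (- \<alpha>)"
proof -
  \<comment> \<open>Adding \<open>?M \<ge> b * L - ln a\<close> and
    \<open>(\<bar>ln a\<bar> + b) * ?M \<ge> \<bar>ln a\<bar> + b\<close> gives
    \<open>(1 + \<bar>ln a\<bar> + b) * ?M \<ge> b * (L + 1)\<close>.\<close>
  define \<kappa> where "\<kappa> = b / (1 + \<bar>ln a\<bar> + b)"
  have den: "1 + \<bar>ln a\<bar> + b > 0" using b by simp
  have k: "\<kappa> > 0" using b den by (simp add: \<kappa>_def)
  have bound: "log_modulus \<alpha> (a * exp (- b * real L)) \<le> \<kappa> powr (- \<alpha>) * real (L + 1) powr (- \<alpha>)" for L
  proof (cases "a = 0")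
    case False
    let ?M = "- ln_minus (a * exp (- b * real L))"
    have pos: "a * exp (- b * real L) > 0" using False a by simp
    have M1: "?M \<ge> 1" using ln_minus_le[OF pos] by simp
    have lnt: "ln (a * exp (- b * real L)) = ln a - b * real L" using False a by (simp add: ln_mult)
    have "?M \<ge> b * real L - ln a"
    proof (cases "a * exp (- b * real L) \<le> exp (- 1)")
      case True
      then show ?thesis using lnt by (simp add: ln_minus_def)
    next
      case F: False
      then have "ln (exp (- 1)) \<le> ln (a * exp (- b * real L))" using pos by (subst ln_le_cancel_iff) auto
      then show ?thesis using F lnt by (simp add: ln_minus_def)
    qed
    moreover have "(\<bar>ln a\<bar> + b) * 1 \<le> (\<bar>ln a\<bar> + b) * ?M" using M1 b by (intro mult_left_mono) auto
    ultimately have "b * (real L + 1) \<le> (1 + \<bar>ln a\<bar> + b) * ?M" by (simp add: algebra_simps)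
    then have "\<kappa> * real (L + 1) \<le> ?M"
      unfolding \<kappa>_def using den by (simp add: pos_divide_le_eq mult.commute add.commute)
    then have "?M powr (- \<alpha>) \<le> (\<kappa> * real (L + 1)) powr (- \<alpha>)"
      using \<alpha> k by (intro powr_mono2') auto
    also have "\<dots> = \<kappa> powr (- \<alpha>) * real (L + 1) powr (- \<alpha>)" using k by (intro powr_mult)
    finally show ?thesis using pos unfolding log_modulus_def by simp
  qed (simp add: log_modulus_def)
  show ?thesis by (rule that[OF _ bound]) (use k in simp)
qed

section \<open>Stability of the encoder\<close>

lemma encoder_bound:
  assumes "\<And>z. z \<in> tensor_index L \<Longrightarrow> cmod (tensor_coeff Y f (fst z) (snd z)) \<le> B"
    and i: "i < m_L L"
  shows "\<bar>encoder Y L f $ i\<bar> \<le> B"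
proof -
  let ?n = "length (index_list L)"
  have c: "cmod (tensor_coeff Y f (fst (index_list L ! j)) (snd (index_list L ! j))) \<le> B" if "j < ?n" for j
    using assms(1) nth_mem[OF that] by (simp add: set_index_list)
  have m: "m_L L = ?n + ?n" by (simp add: m_L_eq length_index_list)
  show ?thesis
  proof (cases "i < ?n")
    case True
    show ?thesis unfolding encoder_nth(1)[OF True] by (rule order_trans[OF abs_Re_le_cmod c[OF True]])
  next
    case False
    then have j: "i - ?n < ?n" and eq: "i = ?n + (i - ?n)" using i m by linarith+
    have "encoder Y L f $ i = Im (tensor_coeff Y f (fst (index_list L ! (i - ?n))) (snd (index_list L ! (i - ?n))))"
      by (subst eq) (rule encoder_nth(2)[OF j])
    then show ?thesis using order_trans[OF abs_Im_le_cmod c[OF j]] by (simp only:)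
  qed
qed

lemma encoder_measurable:
  assumes Y: "spherical_harmonic_basis Y" and i: "i < m_L L"
  shows "(\<lambda>f. encoder Y L f $ i) \<in> borel_measurable (borel_of (L2_topology sphere2_measure))"
proof -
  let ?n = "length (index_list L)" and ?B = "borel_of (L2_topology sphere2_measure)"
  have m: "m_L L = ?n + ?n" by (simp add: m_L_eq length_index_list)
  have c: "(\<lambda>f. tensor_coeff Y f (fst (index_list L ! j)) (snd (index_list L ! j))) \<in> borel_measurable ?B"
    if "j < ?n" for j
  proof -
    have z: "index_list L ! j \<in> tensor_index L" using nth_mem[OF that] by (simp add: set_index_list)
    show ?thesis
      using L2_inner_measurable[OF Z_sqi[OF Y z]]
      by (subst measurable_cong[OF tensor_coeff_eq[OF Y _ z]]) simp_all
  qed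
  show ?thesis
  proof (cases "i < ?n")
    case True
    then show ?thesis
      using measurable_compose[OF c[OF True] borel_measurable_Re] by (simp only: encoder_nth)
  next
    case False
    then have j: "i - ?n < ?n" and eq: "i = ?n + (i - ?n)" using i m by linarith+
    show ?thesis
      using measurable_compose[OF c[OF j] borel_measurable_Im] by (subst eq) (simp only: encoder_nth[OF j])
  qed
qed

lemma sum_squares_le_l1_dist: "(\<Sum>i<m. (z $ i - w $ i)\<^sup>2) \<le> (l1_dist m z w)\<^sup>2"
proof -
  have "L2_set (\<lambda>i. z $ i - w $ i) {..<m} \<le> l1_dist m z w"
    unfolding l1_dist_def by (rule L2_set_le_sum_abs)
  from power_mono[OF this L2_set_nonneg, of 2] show ?thesis
    by (simp add: L2_set_def sum_nonneg)
qed

text \<open>Coefficients up to degree \<open>L\<close> are compared through the encoder, those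
  beyond through the decay of both functions, whence \<open>2 * D\<close>. Taking the root of the
  squared tail halves the exponent \<open>\<sigma>\<close>.\<close>

lemma encoder_stability:
  assumes Y: "spherical_harmonic_basis Y" and \<sigma>: "\<sigma> > 0" and D: "D \<ge> 0"
    and f: "f \<in> L2 sphere2_measure" and f': "f' \<in> L2 sphere2_measure"
    and cf: "\<And>n z. z \<in> tensor_index n \<Longrightarrow>
      cmod (tensor_coeff Y f (fst z) (snd z)) \<le> D * exp (- \<sigma> * real (fst (fst z) + fst (snd z)))"
    and cf': "\<And>n z. z \<in> tensor_index n \<Longrightarrow>
      cmod (tensor_coeff Y f' (fst z) (snd z)) \<le> D * exp (- \<sigma> * real (fst (fst z) + fst (snd z)))"
  shows "L2_dist sphere2_measure f f' \<le> l1_dist (m_L L) (encoder Y L f) (encoder Y L f')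
    + 2 * D * (\<Sum>l. (2 * real l + 1) * exp (- \<sigma> * real l)) * exp (- (\<sigma> / 2) * real L)"
proof -
  let ?g = "\<lambda>x. L2_rep f x - L2_rep f' x" and ?S = "\<Sum>l. (2 * real l + 1) * exp (- \<sigma> * real l)"
  let ?t = "\<lambda>z. tensor_coeff Y f (fst z) (snd z) - tensor_coeff Y f' (fst z) (snd z)"
  let ?l = "l1_dist (m_L L) (encoder Y L f) (encoder Y L f')"
  note s = L2_rep_sqi[OF f] L2_rep_sqi[OF f']
  have S: "?S \<ge> 0" by (rule suminf_nonneg[OF summable_harmonic_weights[OF \<sigma>]]) simp
  have t: "l2i sphere2_measure ?g (tensor_fun Y z) = ?t z" if "z \<in> tensor_index n" for n z
    unfolding l2i_diff_left[OF s Z_sqi[OF Y that]] tensor_coeff_eq[OF Y f that] tensor_coeff_eq[OF Y f' that] ..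
  have "(l2n sphere2_measure ?g)\<^sup>2 \<le> (\<Sum>z\<in>tensor_index L. (cmod (l2i sphere2_measure ?g (tensor_fun Y z)))\<^sup>2)
      + (2 * D)\<^sup>2 * exp (- \<sigma> * real L) * ?S\<^sup>2"
  proof (rule tensor_tail_bound[OF Y \<sigma> sqi_diff[OF s]])
    fix n z assume z: "z \<in> tensor_index n"
    show "cmod (l2i sphere2_measure ?g (tensor_fun Y z)) \<le> 2 * D * exp (- \<sigma> * real (fst (fst z) + fst (snd z)))"
      using norm_triangle_ineq4[of "tensor_coeff Y f (fst z) (snd z)" "tensor_coeff Y f' (fst z) (snd z)"]
        cf[OF z] cf'[OF z] unfolding t[OF z] by linarith
  qed
  also have "(\<Sum>z\<in>tensor_index L. (cmod (l2i sphere2_measure ?g (tensor_fun Y z)))\<^sup>2) = (\<Sum>z\<in>tensor_index L. (cmod (?t z))\<^sup>2)"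
    by (intro sum.cong refl) (simp only: t)
  also have "\<dots> = (\<Sum>i<m_L L. (encoder Y L f $ i - encoder Y L f' $ i)\<^sup>2)" by (rule encoder_dist_sq[symmetric])
  also have "\<dots> \<le> ?l\<^sup>2" by (rule sum_squares_le_l1_dist)
  also have "exp (- \<sigma> * real L) = (exp (- (\<sigma> / 2) * real L))\<^sup>2"
    by (simp add: power2_eq_square exp_add[symmetric])
  also have "?l\<^sup>2 + (2 * D)\<^sup>2 * (exp (- (\<sigma> / 2) * real L))\<^sup>2 * ?S\<^sup>2
      = ?l\<^sup>2 + (2 * D * ?S * exp (- (\<sigma> / 2) * real L))\<^sup>2"
    by (simp add: power_mult_distrib mult_ac)
  also have "\<dots> \<le> (?l + 2 * D * ?S * exp (- (\<sigma> / 2) * real L))\<^sup>2"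
    using D S by (simp add: power2_sum l1_dist_def sum_nonneg)
  finally have "(l2n sphere2_measure ?g)\<^sup>2 \<le> (?l + 2 * D * ?S * exp (- (\<sigma> / 2) * real L))\<^sup>2" by simp
  then show ?thesis
    unfolding L2_dist_eq by (rule power2_le_imp_le) (use D S in \<open>simp add: l1_dist_def sum_nonneg\<close>)
qed

section \<open>The approximation theorem\<close>

lemma vec_dist_commute: "dim_vec v = dim_vec w \<Longrightarrow> vec_dist v w = vec_dist w v"
  by (simp add: vec_dist_def power2_commute)

text \<open>A bound \<open>M\<close> replaces the norm so that one constant serves the whole prior;
  \<open>max 0 M\<close> keeps it nonnegative whatever the sign of \<open>M\<close>.\<close>

lemma analytic_class_coeff:
  assumes X: "analytic_class Y X nrm"
  obtains C \<sigma> where "C > 0" "\<sigma> > 0"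
    "\<And>f M n z. f \<in> X \<Longrightarrow> nrm f \<le> M \<Longrightarrow> z \<in> tensor_index n \<Longrightarrow>
      cmod (tensor_coeff Y f (fst z) (snd z)) \<le> C * max 0 M * exp (- \<sigma> * real (fst (fst z) + fst (snd z)))"
proof -
  obtain C \<sigma> where C: "C > 0" "\<sigma> > 0" and bd: "\<forall>f\<in>X. \<forall>l1 l2. \<forall>m1\<in>{1..2*l1+1}. \<forall>m2\<in>{1..2*l2+1}.
        cmod (tensor_coeff Y f (l1, m1) (l2, m2)) \<le> C * nrm f * exp (- \<sigma> * real (l1 + l2))"
    using X unfolding analytic_class_def by blast
  show ?thesis
  proof (rule that[OF C])
    fix f M n z assume f: "f \<in> X" "nrm f \<le> M" and z: "z \<in> tensor_index n"
    let ?e = "exp (- \<sigma> * real (fst (fst z) + fst (snd z)))"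
    have "snd (fst z) \<in> {1..2 * fst (fst z) + 1}" "snd (snd z) \<in> {1..2 * fst (snd z) + 1}"
      using z by (auto simp: tensor_index_def harm_index_def)
    from bd[rule_format, OF f(1) this]
    have "cmod (tensor_coeff Y f (fst z) (snd z)) \<le> C * nrm f * ?e" by (simp only: prod.collapse)
    also have "\<dots> \<le> C * max 0 M * ?e"
      using f(2) C(1) by (intro mult_right_mono mult_left_mono) auto
    finally show "cmod (tensor_coeff Y f (fst z) (snd z)) \<le> C * max 0 M * ?e" .
  qed
qed

text \<open>Integrability is part of the claim because the integral of a non-integrable function is
  \<open>0\<close> by convention, and the bound alone would be void.\<close>

lemma (in prob_space) integrable_square_le:
  assumes ms: "(\<lambda>x. (g x)\<^sup>2) \<in> borel_measurable M"
    and bd: "AE x in M. (g x)\<^sup>2 \<le> E\<^sup>2" and E: "0 \<le> (E::real)"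
  shows "integrable M (\<lambda>x. (g x)\<^sup>2)" "sqrt (LINT x|M. (g x)\<^sup>2) \<le> E"
proof -
  show int: "integrable M (\<lambda>x. (g x)\<^sup>2)"
    by (rule integrable_const_bound[OF _ ms]) (use bd in simp)
  have "(LINT x|M. (g x)\<^sup>2) \<le> E\<^sup>2" by (rule integral_le_const[OF int bd])
  then show "sqrt (LINT x|M. (g x)\<^sup>2) \<le> E" using E by (intro real_le_lsqrt) auto
qed

theorem theorem4p5:
  fixes s Cq k \<epsilon> s_hat M_pr :: real
    and Qad Qpr :: "(R3) l2 set"
    and \<Psi> :: "(R3) l2 \<Rightarrow> (R3 \<times> R3) l2"
    and T :: "(R3) l2 topology"
    and \<nu> :: "(R3) l2 measure"
    and \<mu> :: "(R3 \<times> R3) l2 measure"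
    and G_ext :: "(R3 \<times> R3) l2 \<Rightarrow> (R3) l2"
    and X_an :: "(R3 \<times> R3) l2 set"
    and norm_X :: "(R3 \<times> R3) l2 \<Rightarrow> real"
    and Y :: "nat \<Rightarrow> nat \<Rightarrow> R3 \<Rightarrow> complex"
    and \<phi> :: "nat \<Rightarrow> R3 \<Rightarrow> real"
    and sel :: "nat \<Rightarrow> real vec \<Rightarrow> (R3) l2"
    and K :: "nat \<Rightarrow> real vec set"
    and \<epsilon>_ad :: "nat \<Rightarrow> ereal"
  assumes parameters: "s > 3/2" "Cq > 0" "k > 0" "0 < \<epsilon>" "\<epsilon> < s / (s + 3)"
    and s_hat: "s_hat = s / (s + 3) - \<epsilon>"
    and Qad: "Qad = admissible s Cq"
    and Psi: "\<Psi> = forward_map k"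
    and stability: "log_stability k Qad s_hat"
    \<comment> \<open>the prior\<close>
    and topology: "topspace T = Qad" "metrizable_space T" "separable_space T"
    and inclusion_continuous: "continuous_map T (L2_topology ball_measure) to_ball"
    and Psi_continuous: "continuous_map T (L2_topology sphere2_measure) \<Psi>"
    and prior: "prob_space \<nu>" "sets \<nu> = sets (borel_of T)"
    and Qpr: "Qpr = measure_support T \<nu>" "compactin T Qpr"
    and mu: "\<mu> = distr \<nu> (borel_of (L2_topology sphere2_measure)) \<Psi>"
    and G_measurable:
      "G_ext \<in> measurable (borel_of (L2_topology sphere2_measure)) (borel_of (L2_topology ball_measure))"
    and G_extends: "\<forall>f\<in>\<Psi> ` Qpr. G_ext f = inverse_map k Qad f"
    \<comment> \<open>the analytic class and the uniform analytic bound\<close>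
    and harmonics: "spherical_harmonic_basis Y"
    and X_an: "analytic_class Y X_an norm_X"
    and analytic_bound: "\<forall>q\<in>Qpr. \<Psi> q \<in> X_an \<and> norm_X (\<Psi> q) \<le> M_pr"
    \<comment> \<open>the admissible decoders \<open>\<Psi> \<circ> sel L\<close> and the reconstruction basis\<close>
    and K: "\<forall>L. K L = (encoder Y L \<circ> \<Psi>) ` Qpr"
    and selector_measurable:
      "\<forall>L. sel L \<in> measurable (restrict_space (borel_of (vec_topology (m_L L))) (K L))
                              (restrict_space (borel_of T) Qpr)"
    and selector: "\<forall>L. \<forall>z\<in>K L. encoder Y L (\<Psi> (sel L z)) = z"
    and eps_ad: "\<forall>L. \<epsilon>_ad L = esssup (restrict_space \<mu> (\<Psi> ` Qpr))
                   (\<lambda>f. ereal (L2_dist sphere2_measure (\<Psi> (sel L (encoder Y L f))) f))"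
    and basis: "polynomial_basis \<phi>"
  shows "\<exists>C1>0. \<exists>C2>0. \<exists>C3>0. \<forall>L n. \<epsilon>_ad L \<le> ereal (exp (- 1)) \<longrightarrow>
    (let m = m_L L;
         p = 2 * poly_dim n;
         Enc = encoder Y L;
         P = projector \<phi> n;
         R = reconstructor \<phi> n;
         Lip_R = Lip_const (carrier_vec p) vec_dist (L2_dist ball_measure) R;
         Lip_RP = Lip_const (L2 ball_measure) (L2_dist ball_measure) (L2_dist ball_measure) (R \<circ> P)
     in \<exists>c0>0. \<exists>c1>0. \<forall>N::nat. real N > c0 * (real p + 1) * exp (c1 * real m) \<longrightarrow>
          (\<exists>A. is_network m p A \<and> network_size A \<le> N \<and>
             (let err = (\<lambda>f. L2_dist ball_measure (G_ext f) ((R \<circ> realize A \<circ> Enc) f))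
              in integrable \<mu> (\<lambda>f. (err f)\<^sup>2) \<and>
                 sqrt (LINT f|\<mu>. (err f)\<^sup>2)
                   \<le> C1 * Lip_R *
                        (1 / (c1 * real m) * ln (real N / (c0 * (real p + 1)))) powr (- s_hat)
                     + C2 * (Lip_R + Lip_RP) * real m powr (- s_hat / 4)
                     + C3 * real p powr (- s / 3))))"
proof -
  let ?S2 = "sphere2_measure"
  let ?\<Sigma> = "borel_of (L2_topology ?S2)"
  have spos: "s > 0" using parameters(1) by simp
  have a0: "0 \<le> s_hat" using parameters s_hat by simp
  have top: "Qpr \<subseteq> Qad" using topology(1) unfolding Qpr(1) measure_support_def by blast
  have PsiL2: "\<Psi> q \<in> L2 ?S2" if "q \<in> Qad" for q
    using continuous_map_funspace[OF Psi_continuous] that topology(1) by auto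
  have tbL2: "to_ball q \<in> L2 ball_measure" if "q \<in> Qad" for q
    using continuous_map_funspace[OF inclusion_continuous] that topology(1) by auto
  \<comment> \<open>The error is controlled only on the support, so the support must carry the full
    measure.\<close>
  have AEpr: "AE q in \<nu>. q \<in> Qpr"
    unfolding Qpr(1) by (rule AE_measure_support[OF topology(2,3) prior(2)])
  interpret \<nu>: prob_space \<nu> by (rule prior(1))
  \<comment> \<open>The net needs at least one node; a probability measure concentrated on its
    support cannot have empty support.\<close>
  have ne: "Qpr \<noteq> {}"
  proof
    assume "Qpr = {}"
    with AEpr have "AE q in \<nu>. False" by simp
    then show False using \<nu>.AE_const[of False] by simp
  qed
  have Psi_meas: "\<Psi> \<in> measurable \<nu> ?\<Sigma>" by (rule continuous_map_measurable[OF Psi_continuous prior(2)])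
  have sets_mu: "sets \<mu> = sets ?\<Sigma>" by (simp add: mu)
  interpret \<mu>: prob_space \<mu> unfolding mu by (rule \<nu>.prob_space_distr[OF Psi_meas])

  obtain Cst where Cst: "Cst > 0" and st: "\<And>q q'. q \<in> Qad \<Longrightarrow> q' \<in> Qad \<Longrightarrow>
      L2_dist ball_measure (to_ball q) (to_ball q') \<le> Cst * log_modulus s_hat (L2_dist ?S2 (\<Psi> q) (\<Psi> q'))"
    using stability unfolding log_stability_def Psi by blast
  obtain Ca \<sigma> where Ca: "Ca > 0" and \<sigma>: "\<sigma> > 0"
    and coeff0: "\<And>f M n z. f \<in> X_an \<Longrightarrow> norm_X f \<le> M \<Longrightarrow> z \<in> tensor_index n \<Longrightarrow>
      cmod (tensor_coeff Y f (fst z) (snd z)) \<le> Ca * max 0 M * exp (- \<sigma> * real (fst (fst z) + fst (snd z)))"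
    using analytic_class_coeff[OF X_an] by blast
  define D where "D = Ca * max 0 M_pr"
  have D: "0 \<le> D" using Ca by (simp add: D_def)
  have coeff: "cmod (tensor_coeff Y (\<Psi> q) (fst z) (snd z)) \<le> D * exp (- \<sigma> * real (fst (fst z) + fst (snd z)))"
    if "q \<in> Qpr" "z \<in> tensor_index n" for q z n
    unfolding D_def using analytic_bound that by (intro coeff0) auto
  define S where "S = (\<Sum>l. (2 * real l + 1) * exp (- \<sigma> * real l))"
  have S: "0 \<le> S" unfolding S_def by (rule suminf_nonneg[OF summable_harmonic_weights[OF \<sigma>]]) simp
  \<comment> \<open>The inner \<open>2\<close> comes from comparing two functions in
    \<open>encoder_stability\<close>, the outer one from the doubling in
    \<open>log_modulus_add\<close>.\<close>
  have "0 \<le> 2 * (2 * D * S)" "0 < \<sigma> / 2" using D S \<sigma> by simp_all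
  then obtain Ct where Ct: "Ct > 0" and ct: "\<And>L. log_modulus s_hat (2 * (2 * D * S) * exp (- (\<sigma> / 2) * real L))
      \<le> Ct * real (L + 1) powr (- s_hat)"
    using log_modulus_exponential[OF a0] by blast
  obtain C3 where C3: "C3 > 0" and jackson: "\<And>n q. q \<in> admissible s Cq \<Longrightarrow> to_ball q \<in> L2 ball_measure \<Longrightarrow>
      L2_dist ball_measure (to_ball q) (reconstructor \<phi> n (projector \<phi> n (to_ball q)))
        \<le> C3 * real (2 * poly_dim n) powr (- s / 3)"
    using jackson_admissible[OF spos parameters(2) basis] by blast

  have close: "L2_dist ball_measure (to_ball q) (to_ball q') \<le> Cst * (x powr (- s_hat) + Ct * real (L + 1) powr (- s_hat))"
    if q: "q \<in> Qpr" "q' \<in> Qpr" and x: "x \<ge> 1"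
      and l: "l1_dist (m_L L) (encoder Y L (\<Psi> q)) (encoder Y L (\<Psi> q')) \<le> exp (- x) / 2" for q q' x L
  proof -
    let ?\<tau> = "2 * D * S * exp (- (\<sigma> / 2) * real L)"
    have Q: "q \<in> Qad" "q' \<in> Qad" using q top by auto
    have "L2_dist ?S2 (\<Psi> q) (\<Psi> q') \<le> exp (- x) / 2 + ?\<tau>"
    proof -
      have "L2_dist ?S2 (\<Psi> q) (\<Psi> q') \<le> l1_dist (m_L L) (encoder Y L (\<Psi> q)) (encoder Y L (\<Psi> q')) + ?\<tau>"
        unfolding S_def
        by (rule encoder_stability[OF harmonics \<sigma> D PsiL2[OF Q(1)] PsiL2[OF Q(2)]]) (rule coeff, rule q, assumption)+
      then show ?thesis using l by linarith
    qed
    from log_modulus_add[OF a0 x L2_dist_nonneg this]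
    have "log_modulus s_hat (L2_dist ?S2 (\<Psi> q) (\<Psi> q')) \<le> x powr (- s_hat) + log_modulus s_hat (2 * ?\<tau>)"
      using D S by simp
    also have "2 * ?\<tau> = 2 * (2 * D * S) * exp (- (\<sigma> / 2) * real L)" by (simp only: mult.assoc)
    also have "x powr (- s_hat) + log_modulus s_hat \<dots> \<le> x powr (- s_hat) + Ct * real (L + 1) powr (- s_hat)"
      using ct by simp
    finally show ?thesis using st[OF Q] mult_left_mono[OF _ less_imp_le[OF Cst]] order_trans by blast
  qed

  \<comment> \<open>\<open>c0\<close> is fixed before \<open>N\<close>, while \<open>Cst\<close>,
    \<open>Ct\<close> and \<open>C3\<close> are already fixed before \<open>L\<close> and
    \<open>n\<close>: this is the required dependence of the constants.\<close>
  have approx: "\<exists>c0>0. \<forall>N::nat. real N > c0 * (real (2 * poly_dim n) + 1) * exp (3 * real (m_L L)) \<longrightarrow>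
      (\<exists>A. is_network (m_L L) (2 * poly_dim n) A \<and> network_size A \<le> N \<and>
         (\<forall>q\<in>Qpr. L2_dist ball_measure (G_ext (\<Psi> q)) (reconstructor \<phi> n (realize A (encoder Y L (\<Psi> q))))
            \<le> Cst * (1 / (3 * real (m_L L)) * ln (real N / (c0 * (real (2 * poly_dim n) + 1)))) powr (- s_hat)
              + Cst * Ct * real (L + 1) powr (- s_hat) + C3 * real (2 * poly_dim n) powr (- s / 3)))"
    for L n
  proof -
    let ?m = "m_L L" and ?p = "2 * poly_dim n" and ?Enc = "\<lambda>q. encoder Y L (\<Psi> q)"
    let ?P = "projector \<phi> n" and ?R = "reconstructor \<phi> n"
    have m1: "?m \<ge> 1" by (simp add: m_L_eq)
    obtain c0 where c0: "c0 > 0" and net: "\<And>K v N. K \<noteq> {} \<Longrightarrow> K \<subseteq> carrier_vec ?m \<Longrightarrow> (\<And>z. z \<in> K \<Longrightarrow> \<forall>i<?m. \<bar>z $ i\<bar> \<le> D) \<Longrightarrow>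
      (\<And>z. z \<in> K \<Longrightarrow> v z \<in> carrier_vec ?p) \<Longrightarrow> real N > c0 * (real ?p + 1) * exp (3 * real ?m) \<Longrightarrow>
      \<exists>A. is_network ?m ?p A \<and> network_size A \<le> N \<and>
        (\<forall>z\<in>K. dim_vec (realize A z) = ?p \<and> (\<forall>c \<rho>. 0 \<le> \<rho> \<longrightarrow>
          (\<forall>w\<in>K. l1_dist ?m z w \<le> exp (- (1 / (3 * real ?m) * ln (real N / (c0 * (real ?p + 1))))) / 2 \<longrightarrow> vec_dist (v w) c \<le> \<rho>)
          \<longrightarrow> vec_dist (realize A z) c \<le> \<rho>))"
      using network_interpolation[OF m1 D, of ?p] by blast
    let ?K = "?Enc ` Qpr"
    \<comment> \<open>Any contrast with the given encoding will do, since \<open>close\<close>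
      bounds the distance of all contrasts of the prior with nearby encodings.\<close>
    define pick where "pick = inv_into Qpr ?Enc"
    have pick: "pick w \<in> Qpr" "?Enc (pick w) = w" if "w \<in> ?K" for w
      unfolding pick_def using that by (rule inv_into_into, rule f_inv_into_f)
    define v where "v w = ?P (to_ball (pick w))" for w
    show ?thesis
    proof (intro exI[of _ c0] conjI allI impI)
      show "c0 > 0" by (rule c0)
      fix N :: nat assume N: "real N > c0 * (real ?p + 1) * exp (3 * real ?m)"
      define x where "x = 1 / (3 * real ?m) * ln (real N / (c0 * (real ?p + 1)))"
      \<comment> \<open>The threshold on \<open>N\<close> says just this, up to strictness; it
        places \<open>exp (- x)\<close> in the range where the logarithmic modulus is
        \<open>x powr (- s_hat)\<close>.\<close>
      have x1: "x \<ge> 1"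
      proof -
        have pos: "c0 * (real ?p + 1) > 0" using c0 by simp
        then have lt: "exp (3 * real ?m) \<le> real N / (c0 * (real ?p + 1))"
          using N by (simp add: pos_le_divide_eq mult.commute)
        then have "0 < real N / (c0 * (real ?p + 1))" by (rule less_le_trans[OF exp_gt_zero])
        then have "3 * real ?m \<le> ln (real N / (c0 * (real ?p + 1)))" using lt by (simp only: ln_ge_iff)
        then show ?thesis using m1 by (simp add: x_def pos_le_divide_eq)
      qed
      define \<rho> where "\<rho> = Cst * (x powr (- s_hat) + Ct * real (L + 1) powr (- s_hat))"
      have \<rho>: "0 \<le> \<rho>" using Cst Ct by (simp add: \<rho>_def)
      have Kne: "?K \<noteq> {}" using ne by simp
      have Kc: "?K \<subseteq> carrier_vec ?m" by (rule image_subsetI) (rule carrier_vecI[OF dim_encoder])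
      have Kb: "\<forall>i<?m. \<bar>z $ i\<bar> \<le> D" if z: "z \<in> ?K" for z
      proof (intro allI impI)
        fix i assume i: "i < ?m"
        obtain q where q: "q \<in> Qpr" "z = ?Enc q" using z by blast
        show "\<bar>z $ i\<bar> \<le> D" unfolding q(2)
        proof (rule encoder_bound[OF _ i])
          fix z' assume z': "z' \<in> tensor_index L"
          have "D * exp (- \<sigma> * real (fst (fst z') + fst (snd z'))) \<le> D * 1"
            using \<sigma> by (intro mult_left_mono D) simp
          then show "cmod (tensor_coeff Y (\<Psi> q) (fst z') (snd z')) \<le> D"
            using coeff[OF q(1) z'] by linarith
        qed
      qed
      have vc: "v z \<in> carrier_vec ?p" for z unfolding v_def by (rule projector_carrier[OF basis])
      from net[of ?K v N, OF Kne Kc Kb vc N] obtain A where A: "is_network ?m ?p A" "network_size A \<le> N"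
        and Ap: "\<And>z. z \<in> ?K \<Longrightarrow> dim_vec (realize A z) = ?p \<and> (\<forall>c \<rho>. 0 \<le> \<rho> \<longrightarrow>
          (\<forall>w\<in>?K. l1_dist ?m z w \<le> exp (- x) / 2 \<longrightarrow> vec_dist (v w) c \<le> \<rho>) \<longrightarrow> vec_dist (realize A z) c \<le> \<rho>)"
        unfolding x_def by blast
      have err: "L2_dist ball_measure (G_ext (\<Psi> q)) (?R (realize A (?Enc q)))
          \<le> Cst * x powr (- s_hat) + Cst * Ct * real (L + 1) powr (- s_hat) + C3 * real ?p powr (- s / 3)"
        if q: "q \<in> Qpr" for q
      proof -
        let ?t = "to_ball q" and ?a = "realize A (?Enc q)"
        have Q: "q \<in> Qad" using q top by auto
        have tL: "?t \<in> L2 ball_measure" by (rule tbL2[OF Q])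
        have z: "?Enc q \<in> ?K" using q by (rule imageI)
        \<comment> \<open>The inverse map returns some preimage of the datum, not necessarily
          \<open>q\<close>. Stability at data distance \<open>0\<close>, where the modulus is
          \<open>0\<close> by convention, shows that both agree in \<open>L2(B_1)\<close>.\<close>
        define q' where "q' = inv_into Qad \<Psi> (\<Psi> q)"
        have q': "q' \<in> Qad" "\<Psi> q' = \<Psi> q"
          unfolding q'_def using Q by (simp_all add: inv_into_into f_inv_into_f)
        have G: "G_ext (\<Psi> q) = to_ball q'"
          using G_extends q unfolding q'_def inverse_map_def Psi by simp
        have GL: "G_ext (\<Psi> q) \<in> L2 ball_measure" unfolding G by (rule tbL2[OF q'(1)])
        have "L2_dist ball_measure (to_ball q') ?t \<le> 0"
          using st[OF q'(1) Q] by (simp add: q'(2) L2_dist_def log_modulus_def)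
        then have e1: "L2_dist ball_measure (G_ext (\<Psi> q)) ?t \<le> 0" by (simp only: G)
        have e2: "L2_dist ball_measure ?t (?R (?P ?t)) \<le> C3 * real ?p powr (- s / 3)"
          by (rule jackson) (use Q tL Qad in auto)
        have "vec_dist ?a (?P ?t) \<le> \<rho>"
        proof (rule conjunct2[OF Ap[OF z], rule_format, OF \<rho>])
          fix w assume w: "w \<in> ?K" "l1_dist ?m (?Enc q) w \<le> exp (- x) / 2"
          have "vec_dist (v w) (?P ?t) \<le> L2_dist ball_measure (to_ball (pick w)) ?t"
            unfolding v_def using pick(1)[OF w(1)] top tL
            by (intro projector_contraction[OF basis]) (auto intro: tbL2)
          also have "\<dots> = L2_dist ball_measure ?t (to_ball (pick w))" by (rule L2_dist_commute)
          also have "\<dots> \<le> \<rho>"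
            unfolding \<rho>_def by (rule close[OF q pick(1)[OF w(1)] x1]) (simp only: pick(2)[OF w(1)] w(2))
          finally show "vec_dist (v w) (?P ?t) \<le> \<rho>" .
        qed
        also have "vec_dist ?a (?P ?t) = vec_dist (?P ?t) ?a"
          using Ap[OF z] projector_carrier[OF basis, of n ?t] by (intro vec_dist_commute) auto
        also have "\<dots> = L2_dist ball_measure (?R (?P ?t)) (?R ?a)"
          by (rule reconstructor_isometry[OF basis projector_carrier[OF basis], symmetric])
        finally have e3: "L2_dist ball_measure (?R (?P ?t)) (?R ?a) \<le> \<rho>" .
        have "L2_dist ball_measure (G_ext (\<Psi> q)) (?R ?a)
            \<le> L2_dist ball_measure (G_ext (\<Psi> q)) ?t + L2_dist ball_measure ?t (?R ?a)"
          by (intro L2_dist_triangle GL tL reconstructor_L2[OF basis])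
        moreover have "L2_dist ball_measure ?t (?R ?a)
            \<le> L2_dist ball_measure ?t (?R (?P ?t)) + L2_dist ball_measure (?R (?P ?t)) (?R ?a)"
          by (intro L2_dist_triangle tL reconstructor_L2[OF basis])
        ultimately show ?thesis using e1 e2 e3 unfolding \<rho>_def by (simp add: distrib_left)
      qed
      then show "\<exists>A. is_network ?m ?p A \<and> network_size A \<le> N \<and>
         (\<forall>q\<in>Qpr. L2_dist ball_measure (G_ext (\<Psi> q)) (?R (realize A (?Enc q)))
            \<le> Cst * (1 / (3 * real ?m) * ln (real N / (c0 * (real ?p + 1)))) powr (- s_hat)
              + Cst * Ct * real (L + 1) powr (- s_hat) + C3 * real ?p powr (- s / 3))"
        unfolding x_def using A by blast
    qed
  qed

  \<comment> \<open>Compensates the factor \<open>2\<close> in \<open>m = 2 * (L + 1) ^ 4\<close>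
    after taking the power \<open>- s_hat / 4\<close>.\<close>
  define C2 where "C2 = Cst * Ct * 2 powr (s_hat / 4)"
  have C2: "C2 > 0" using Cst Ct by (simp add: C2_def)
  have final: "let m = m_L L; p = 2 * poly_dim n; Enc = encoder Y L; P = projector \<phi> n; R = reconstructor \<phi> n;
         Lip_R = Lip_const (carrier_vec p) vec_dist (L2_dist ball_measure) R;
         Lip_RP = Lip_const (L2 ball_measure) (L2_dist ball_measure) (L2_dist ball_measure) (R \<circ> P)
     in \<exists>c0>0. \<exists>c1>0. \<forall>N::nat. real N > c0 * (real p + 1) * exp (c1 * real m) \<longrightarrow>
          (\<exists>A. is_network m p A \<and> network_size A \<le> N \<and>
             (let err = (\<lambda>f. L2_dist ball_measure (G_ext f) ((R \<circ> realize A \<circ> Enc) f))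
              in integrable \<mu> (\<lambda>f. (err f)\<^sup>2) \<and>
                 sqrt (LINT f|\<mu>. (err f)\<^sup>2)
                   \<le> Cst * Lip_R * (1 / (c1 * real m) * ln (real N / (c0 * (real p + 1)))) powr (- s_hat)
                     + C2 * (Lip_R + Lip_RP) * real m powr (- s_hat / 4)
                     + C3 * real p powr (- s / 3)))" for L n
    unfolding Let_def
  proof -
    let ?m = "m_L L" and ?p = "2 * poly_dim n"
    let ?LR = "Lip_const (carrier_vec ?p) vec_dist (L2_dist ball_measure) (reconstructor \<phi> n)"
    let ?LRP = "Lip_const (L2 ball_measure) (L2_dist ball_measure) (L2_dist ball_measure) (reconstructor \<phi> n \<circ> projector \<phi> n)"
    have LR: "1 \<le> ?LR" by (rule Lip_reconstructor_ge_1[OF basis])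
    have LRP: "0 \<le> ?LRP" by (rule Lip_reconstruct_project_nonneg[OF basis])
    obtain c0 where c0: "c0 > 0" and ap: "\<And>N::nat. real N > c0 * (real ?p + 1) * exp (3 * real ?m) \<Longrightarrow>
      (\<exists>A. is_network ?m ?p A \<and> network_size A \<le> N \<and>
         (\<forall>q\<in>Qpr. L2_dist ball_measure (G_ext (\<Psi> q)) (reconstructor \<phi> n (realize A (encoder Y L (\<Psi> q))))
            \<le> Cst * (1 / (3 * real ?m) * ln (real N / (c0 * (real ?p + 1)))) powr (- s_hat)
              + Cst * Ct * real (L + 1) powr (- s_hat) + C3 * real ?p powr (- s / 3)))"
      using approx by blast
    show "\<exists>c0>0. \<exists>c1>0. \<forall>N::nat. real N > c0 * (real ?p + 1) * exp (c1 * real ?m) \<longrightarrow>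
          (\<exists>A. is_network ?m ?p A \<and> network_size A \<le> N \<and>
             (integrable \<mu> (\<lambda>f. (L2_dist ball_measure (G_ext f) ((reconstructor \<phi> n \<circ> realize A \<circ> encoder Y L) f))\<^sup>2) \<and>
                 sqrt (LINT f|\<mu>. (L2_dist ball_measure (G_ext f) ((reconstructor \<phi> n \<circ> realize A \<circ> encoder Y L) f))\<^sup>2)
                   \<le> Cst * ?LR * (1 / (c1 * real ?m) * ln (real N / (c0 * (real ?p + 1)))) powr (- s_hat)
                     + C2 * (?LR + ?LRP) * real ?m powr (- s_hat / 4)
                     + C3 * real ?p powr (- s / 3)))"
    proof (rule exI[of _ c0], rule conjI[OF c0], rule exI[of _ 3], rule conjI, simp, intro allI impI)
      fix N :: nat assume N: "real N > c0 * (real ?p + 1) * exp (3 * real ?m)"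
      let ?x = "(1 / (3 * real ?m) * ln (real N / (c0 * (real ?p + 1)))) powr (- s_hat)"
      let ?E = "Cst * ?x + Cst * Ct * real (L + 1) powr (- s_hat) + C3 * real ?p powr (- s / 3)"
      from ap[OF N] obtain A where A: "is_network ?m ?p A" "network_size A \<le> N"
        and err: "\<And>q. q \<in> Qpr \<Longrightarrow> L2_dist ball_measure (G_ext (\<Psi> q)) (reconstructor \<phi> n (realize A (encoder Y L (\<Psi> q)))) \<le> ?E"
        by blast
      let ?err = "\<lambda>f. L2_dist ball_measure (G_ext f) (reconstructor \<phi> n (realize A (encoder Y L f)))"
      have E0: "0 \<le> ?E" using Cst Ct C3 by simp
      have meas: "(\<lambda>f. (?err f)\<^sup>2) \<in> borel_measurable ?\<Sigma>"
      proof (rule reconstruction_error_measurable[OF basis G_measurable])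
        fix i assume i: "i < ?p"
        show "(\<lambda>f. realize A (encoder Y L f) $ i) \<in> borel_measurable ?\<Sigma>"
          by (rule realize_measurable[OF A(1) dim_encoder encoder_measurable[OF harmonics] i])
      qed
      have ae: "AE f in \<mu>. (?err f)\<^sup>2 \<le> ?E\<^sup>2"
        \<comment> \<open>The bound is known for data \<open>\<Psi> q\<close> with \<open>q\<close>
          in the support; pulling back along \<open>\<Psi>\<close> turns it into a statement almost
          everywhere for \<open>\<mu>\<close>.\<close>
        unfolding mu
      proof (subst AE_distr_iff[OF Psi_meas])
        show "{f \<in> space ?\<Sigma>. (?err f)\<^sup>2 \<le> ?E\<^sup>2} \<in> sets ?\<Sigma>"
          by (rule borel_measurable_le[OF meas borel_measurable_const])
        show "AE q in \<nu>. (?err (\<Psi> q))\<^sup>2 \<le> ?E\<^sup>2"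
          using AEpr by eventually_elim (intro power_mono err L2_dist_nonneg)
      qed
      have meas': "(\<lambda>f. (?err f)\<^sup>2) \<in> borel_measurable \<mu>"
        using meas by (simp only: measurable_cong_sets[OF sets_mu refl])
      note int = \<mu>.integrable_square_le[OF meas' ae E0]
      have "real ?m powr (- s_hat / 4) = 2 powr (- s_hat / 4) * real (L + 1) powr (- s_hat)"
      proof -
        have "real ?m = 2 * real (L + 1) powr 4" using powr_realpow[of "real (L + 1)" 4] by (simp add: m_L_eq)
        then have "real ?m powr (- s_hat / 4) = 2 powr (- s_hat / 4) * (real (L + 1) powr 4) powr (- s_hat / 4)"
          by (simp only: powr_mult)
        then show ?thesis by (simp only: powr_powr) simp
      qed
      then have "C2 * real ?m powr (- s_hat / 4) = Cst * Ct * (2 powr (s_hat / 4) * 2 powr (- s_hat / 4)) * real (L + 1) powr (- s_hat)"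
        by (simp only: C2_def mult_ac)
      also have "2 powr (s_hat / 4) * 2 powr (- s_hat / 4) = (1::real)" by (simp add: powr_add[symmetric])
      finally have t2: "C2 * real ?m powr (- s_hat / 4) = Cst * Ct * real (L + 1) powr (- s_hat)" by simp
      \<comment> \<open>The first two terms may be multiplied by the Lipschitz factors because
        \<open>?LR\<close> is at least \<open>1\<close> and \<open>?LRP\<close> is
        nonnegative.\<close>
      have "Cst * ?x * 1 \<le> Cst * ?x * ?LR" using LR Cst by (intro mult_left_mono) auto
      moreover have "C2 * real ?m powr (- s_hat / 4) * 1 \<le> C2 * real ?m powr (- s_hat / 4) * (?LR + ?LRP)"
        using LR LRP C2 by (intro mult_left_mono) auto
      ultimately have "?E \<le> Cst * ?LR * ?x + C2 * (?LR + ?LRP) * real ?m powr (- s_hat / 4) + C3 * real ?p powr (- s / 3)"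
        unfolding t2[symmetric] by (simp only: mult_ac mult_1_right)
      with int A show "\<exists>A. is_network ?m ?p A \<and> network_size A \<le> N \<and>
             (integrable \<mu> (\<lambda>f. (L2_dist ball_measure (G_ext f) ((reconstructor \<phi> n \<circ> realize A \<circ> encoder Y L) f))\<^sup>2) \<and>
                 sqrt (LINT f|\<mu>. (L2_dist ball_measure (G_ext f) ((reconstructor \<phi> n \<circ> realize A \<circ> encoder Y L) f))\<^sup>2)
                   \<le> Cst * ?LR * ?x + C2 * (?LR + ?LRP) * real ?m powr (- s_hat / 4)
                     + C3 * real ?p powr (- s / 3))"
        unfolding o_apply by (intro exI[of _ A] conjI) (auto intro: order_trans)
    qed
  qed
  show ?thesis
    by (intro exI[of _ Cst] exI[of _ C2] exI[of _ C3] conjI Cst C2 C3 allI impI final)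
qed

end
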